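(* Let $D$ be an integral domain and $A$ a $D$-algebra. Suppose that $\mathfrak{p}D_\mathfrak{p}$ is principal and has finite height for every $t$-maximal ideal $\mathfrak{p}$ of $D$ of finite norm. Then $A$ is locally WPC if and only if, for every $t$-maximal ideal $\mathfrak{p}$ of $D$ of finite norm $q=N(\mathfrak{p})$, any of the following equivalent conditions holds. (1) $a^{N(\mathfrak{p})}\equiv a\pmod{\mathfrak{p}A}$ for all $a\in A$. (2) The endomorphism $a\mapsto a^q$ of $A/\mathfrak{p}A$ is the identity. (3) $A/\mathfrak{p}A$ is locally isomorphic to $D/\mathfrak{p}$ as a $D$-algebra. (4) $A/\mathfrak{p}A$ is reduced, and every residue field of $A/\mathfrak{p}A$ is isomorphic to $D/\mathfrak{p}$ as a $D$-algebra. (5) $A/\mathfrak{p}A$ is isomorphic to a subring of $\mathbb{F}_q^Y$ for some set $Y$. (6) For every maximal ideal $\mathfrak{M}$ of $A$ lying over $\mathfrak{p}$, one has $\mathfrak{p}A_\mathfrak{M}=\mathfrak{M}A_\mathfrak{M}$ and $A/\mathfrak{M}\cong D/\mathfrak{p}$ as $D$-algebras. (7) For every prime ideal $\mathfrak{P}$ of $A$ lying over $\mathfrak{p}$, one has $\mathfrak{p}A_\mathfrak{P}=\mathfrak{P}A_\mathfrak{P}$ and $A/\mathfrak{P}\cong D/\mathfrak{p}$ as $D$-algebras. Moreover, if $A/\mathfrak{p}A$ is semi-local or Noetherian, then each of conditions (1) through (7) is equivalent to the following. (8) $\mathfrak{p}A=\mathfrak{M}_1\mathfrak{M}_2\cdots\mathfrak{M}_r$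 for distinct maximal ideals $\mathfrak{M}_i$ of $A$ such that $A/\mathfrak{M}_i\cong D/\mathfrak{p}$.
   Context: All rings and algebras are commutative with identity. Let $D$ be an integral domain with quotient field $K$. $\operatorname{Int}(D)=\{f\in K[X]: f(D)\subseteq D\}$. A $D$-algebra $A$ is weakly polynomially complete (WPC) if for every $a\in A$ there is a $D$-algebra homomorphism $\operatorname{Int}(D)\to A$ sending $X$ to $a$. A $D$-algebra $A$ is locally WPC if $A_\mathfrak{p}=A\otimes_D D_\mathfrak{p}$ is a WPC $D_\mathfrak{p}$-algebra for every prime ideal $\mathfrak{p}$ of $D$. For a nonzero fractional ideal $I$ of $D$, $I^{-1}=\{x\in K: xI\subseteq D\}$, $I_v=(I^{-1})^{-1}$, and $I_t=\bigcup J_v$ over the nonzero finitely generated $J\subseteq I$; $I$ is a $t$-ideal if $I_t=I$. A $t$-maximal ideal of $D$ is an ideal maximal among the nonzero proper ideals of $D$ that are $t$-ideals. The norm of an ideal $\mathfrak{a}$ is $N(\mathfrak{a})=|D/\mathfrak{a}|$. "$A/\mathfrak{p}A$ is locally isomorphic to $D/\mathfrak{p}$ as a $D$-algebra" means that the localization of $A/\mathfrak{p}A$ at each of its prime ideals is isomorphic to $D/\mathfrak{p}$ as a $D$-algebra. A ring is semi-local if it has only finitely many maximal ideals. Empty products ($r=0$) and $Y=\emptyset$ are allowed (the case $\mathfrak{p}A=A$). *)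

theory Defs
  imports "HOL-Library.Extended_Nat" "HOL-Algebra.Algebra"
begin

text \<open>
  A commutative \<open>D\<close>-algebra is a commutative ring \<open>A\<close> together with a structure homomorphism
  \<open>\<phi>\<close> from \<open>D\<close> to \<open>A\<close>, that is, \<^term>\<open>ring_hom_cring D A \<phi>\<close>.  The zero ring is allowed.
\<close>

section \<open>Algebras given by structure maps\<close>

definition alg_hom ::
  "('r, 'k) ring_scheme \<Rightarrow> ('a, 'm) ring_scheme \<Rightarrow> ('r \<Rightarrow> 'a) \<Rightarrow> ('b, 'n) ring_scheme \<Rightarrow> ('r \<Rightarrow> 'b)
    \<Rightarrow> ('a \<Rightarrow> 'b) set"
  where "alg_hom R A \<alpha> B \<beta> = {h \<in> ring_hom A B. \<forall>r\<in>carrier R. h (\<alpha> r) = \<beta> r}"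

definition alg_isomorphic ::
  "('r, 'k) ring_scheme \<Rightarrow> ('a, 'm) ring_scheme \<Rightarrow> ('r \<Rightarrow> 'a) \<Rightarrow> ('b, 'n) ring_scheme \<Rightarrow> ('r \<Rightarrow> 'b)
    \<Rightarrow> bool"
  where "alg_isomorphic R A \<alpha> B \<beta> \<longleftrightarrow> (\<exists>h \<in> ring_iso A B. h \<in> alg_hom R A \<alpha> B \<beta>)"

definition quot_map :: "('a, 'm) ring_scheme \<Rightarrow> 'a set \<Rightarrow> 'a \<Rightarrow> 'a set"
  where "quot_map R I a = I +>\<^bsub>R\<^esub> a"

definition extended_ideal :: "('b, 'm) ring_scheme \<Rightarrow> ('a \<Rightarrow> 'b) \<Rightarrow> 'a set \<Rightarrow> 'b set"
  where "extended_ideal A \<phi> I = Idl\<^bsub>A\<^esub> (\<phi> ` I)"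

definition lies_over ::
  "('a, 'k) ring_scheme \<Rightarrow> ('a \<Rightarrow> 'b) \<Rightarrow> 'b set \<Rightarrow> 'a set \<Rightarrow> bool"
  where "lies_over D \<phi> P p \<longleftrightarrow> {d \<in> carrier D. \<phi> d \<in> P} = p"

section \<open>Localization\<close>

definition loc_rel :: "('a, 'm) ring_scheme \<Rightarrow> 'a set \<Rightarrow> (('a \<times> 'a) \<times> ('a \<times> 'a)) set"
  where "loc_rel R S = {((a, s), (b, t)) | a s b t.
     a \<in> carrier R \<and> s \<in> S \<and> b \<in> carrier R \<and> t \<in> S \<and>
     (\<exists>u\<in>S. u \<otimes>\<^bsub>R\<^esub> ((t \<otimes>\<^bsub>R\<^esub> a) \<ominus>\<^bsub>R\<^esub> (s \<otimes>\<^bsub>R\<^esub> b)) = \<zero>\<^bsub>R\<^esub>)}"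

definition loc_frac :: "('a, 'm) ring_scheme \<Rightarrow> 'a set \<Rightarrow> 'a \<Rightarrow> 'a \<Rightarrow> ('a \<times> 'a) set"
  where "loc_frac R S a s = loc_rel R S `` {(a, s)}"

definition loc :: "('a, 'm) ring_scheme \<Rightarrow> 'a set \<Rightarrow> ('a \<times> 'a) set ring"
  where "loc R S = \<lparr>
     carrier = (carrier R \<times> S) // loc_rel R S,
     monoid.mult = (\<lambda>U V. \<Union>(a, s)\<in>U. \<Union>(b, t)\<in>V. loc_frac R S (a \<otimes>\<^bsub>R\<^esub> b) (s \<otimes>\<^bsub>R\<^esub> t)),
     one = loc_frac R S \<one>\<^bsub>R\<^esub> \<one>\<^bsub>R\<^esub>,
     ring.zero = loc_frac R S \<zero>\<^bsub>R\<^esub> \<one>\<^bsub>R\<^esub>,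
     add = (\<lambda>U V. \<Union>(a, s)\<in>U. \<Union>(b, t)\<in>V.
       loc_frac R S ((t \<otimes>\<^bsub>R\<^esub> a) \<oplus>\<^bsub>R\<^esub> (s \<otimes>\<^bsub>R\<^esub> b)) (s \<otimes>\<^bsub>R\<^esub> t))\<rparr>"

definition loc_at :: "('a, 'm) ring_scheme \<Rightarrow> 'a set \<Rightarrow> ('a \<times> 'a) set ring"
  where "loc_at R P = loc R (carrier R - P)"

definition loc_map :: "('a, 'm) ring_scheme \<Rightarrow> 'a set \<Rightarrow> 'a \<Rightarrow> ('a \<times> 'a) set"
  where "loc_map R P a = loc_frac R (carrier R - P) a \<one>\<^bsub>R\<^esub>"

definition residue_field :: "('a, 'm) ring_scheme \<Rightarrow> 'a set \<Rightarrow> ('a \<times> 'a) set set ring"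
  where "residue_field R P = loc_at R P Quot extended_ideal (loc_at R P) (loc_map R P) P"

definition residue_map :: "('a, 'm) ring_scheme \<Rightarrow> 'a set \<Rightarrow> 'a \<Rightarrow> ('a \<times> 'a) set set"
  where "residue_map R P =
     quot_map (loc_at R P) (extended_ideal (loc_at R P) (loc_map R P) P) \<circ> loc_map R P"

section \<open>Tensor products of algebras\<close>

text \<open>
  A multiset of pairs \<open>(a, b)\<close> stands for the formal sum of the symbols \<open>a \<otimes> b\<close>; the tensor product
  consists of these formal sums modulo the congruence generated by bilinearity and balancedness.
  Negatives need not be adjoined, since \<open>(- a) \<otimes> b\<close> becomes the negative of \<open>a \<otimes> b\<close>.
\<close>

inductive tensor_eq ::
  "('r, 'k) ring_scheme \<Rightarrow> ('a, 'm) ring_scheme \<Rightarrow> ('r \<Rightarrow> 'a) \<Rightarrow> ('b, 'n) ring_scheme \<Rightarrow> ('r \<Rightarrow> 'b)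
    \<Rightarrow> ('a \<times> 'b) multiset \<Rightarrow> ('a \<times> 'b) multiset \<Rightarrow> bool"
  for R A \<alpha> B \<beta>
  where
    refl: "set_mset M \<subseteq> carrier A \<times> carrier B \<Longrightarrow> tensor_eq R A \<alpha> B \<beta> M M"
  | sym: "tensor_eq R A \<alpha> B \<beta> M N \<Longrightarrow> tensor_eq R A \<alpha> B \<beta> N M"
  | trans: "tensor_eq R A \<alpha> B \<beta> L M \<Longrightarrow> tensor_eq R A \<alpha> B \<beta> M N \<Longrightarrow> tensor_eq R A \<alpha> B \<beta> L N"
  | plus: "tensor_eq R A \<alpha> B \<beta> M M' \<Longrightarrow> tensor_eq R A \<alpha> B \<beta> N N' \<Longrightarrow>
      tensor_eq R A \<alpha> B \<beta> (M + N) (M' + N')"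
  | zero: "b \<in> carrier B \<Longrightarrow> tensor_eq R A \<alpha> B \<beta> {#(\<zero>\<^bsub>A\<^esub>, b)#} {#}"
  | add_left: "a \<in> carrier A \<Longrightarrow> a' \<in> carrier A \<Longrightarrow> b \<in> carrier B \<Longrightarrow>
      tensor_eq R A \<alpha> B \<beta> {#(a \<oplus>\<^bsub>A\<^esub> a', b)#} {#(a, b), (a', b)#}"
  | add_right: "a \<in> carrier A \<Longrightarrow> b \<in> carrier B \<Longrightarrow> b' \<in> carrier B \<Longrightarrow>
      tensor_eq R A \<alpha> B \<beta> {#(a, b \<oplus>\<^bsub>B\<^esub> b')#} {#(a, b), (a, b')#}"
  | balanced: "r \<in> carrier R \<Longrightarrow> a \<in> carrier A \<Longrightarrow> b \<in> carrier B \<Longrightarrow>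
      tensor_eq R A \<alpha> B \<beta> {#(\<alpha> r \<otimes>\<^bsub>A\<^esub> a, b)#} {#(a, \<beta> r \<otimes>\<^bsub>B\<^esub> b)#}"

definition tensor_class ::
  "('r, 'k) ring_scheme \<Rightarrow> ('a, 'm) ring_scheme \<Rightarrow> ('r \<Rightarrow> 'a) \<Rightarrow> ('b, 'n) ring_scheme \<Rightarrow> ('r \<Rightarrow> 'b)
    \<Rightarrow> ('a \<times> 'b) multiset \<Rightarrow> ('a \<times> 'b) multiset set"
  where "tensor_class R A \<alpha> B \<beta> M = {N. tensor_eq R A \<alpha> B \<beta> M N}"

definition formal_mult ::
  "('a, 'm) ring_scheme \<Rightarrow> ('b, 'n) ring_scheme
    \<Rightarrow> ('a \<times> 'b) multiset \<Rightarrow> ('a \<times> 'b) multiset \<Rightarrow> ('a \<times> 'b) multiset"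
  where "formal_mult A B M N =
     (\<Sum>x\<in>#M. image_mset (\<lambda>y. (fst x \<otimes>\<^bsub>A\<^esub> fst y, snd x \<otimes>\<^bsub>B\<^esub> snd y)) N)"

definition tensor_alg ::
  "('r, 'k) ring_scheme \<Rightarrow> ('a, 'm) ring_scheme \<Rightarrow> ('r \<Rightarrow> 'a) \<Rightarrow> ('b, 'n) ring_scheme \<Rightarrow> ('r \<Rightarrow> 'b)
    \<Rightarrow> ('a \<times> 'b) multiset set ring"
  where "tensor_alg R A \<alpha> B \<beta> = \<lparr>
     carrier = tensor_class R A \<alpha> B \<beta> ` {M. set_mset M \<subseteq> carrier A \<times> carrier B},
     monoid.mult = (\<lambda>U V. \<Union>M\<in>U. \<Union>N\<in>V. tensor_class R A \<alpha> B \<beta> (formal_mult A B M N)),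
     one = tensor_class R A \<alpha> B \<beta> {#(\<one>\<^bsub>A\<^esub>, \<one>\<^bsub>B\<^esub>)#},
     ring.zero = tensor_class R A \<alpha> B \<beta> {#},
     add = (\<lambda>U V. \<Union>M\<in>U. \<Union>N\<in>V. tensor_class R A \<alpha> B \<beta> (M + N))\<rparr>"

definition tensor_right ::
  "('r, 'k) ring_scheme \<Rightarrow> ('a, 'm) ring_scheme \<Rightarrow> ('r \<Rightarrow> 'a) \<Rightarrow> ('b, 'n) ring_scheme \<Rightarrow> ('r \<Rightarrow> 'b)
    \<Rightarrow> 'b \<Rightarrow> ('a \<times> 'b) multiset set"
  where "tensor_right R A \<alpha> B \<beta> b = tensor_class R A \<alpha> B \<beta> {#(\<one>\<^bsub>A\<^esub>, b)#}"

section \<open>Integer-valued polynomials and weak polynomial completeness\<close>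

definition quot_field :: "('a, 'm) ring_scheme \<Rightarrow> ('a \<times> 'a) set ring"
  where "quot_field D = loc_at D {\<zero>\<^bsub>D\<^esub>}"

definition quot_field_map :: "('a, 'm) ring_scheme \<Rightarrow> 'a \<Rightarrow> ('a \<times> 'a) set"
  where "quot_field_map D = loc_map D {\<zero>\<^bsub>D\<^esub>}"

definition int_poly ::
  "('a, 'm) ring_scheme \<Rightarrow> (('a \<times> 'a) set, nat \<Rightarrow> ('a \<times> 'a) set) up_ring"
  where "int_poly D = (UP (quot_field D)) \<lparr> carrier :=
     {f \<in> carrier (UP (quot_field D)). \<forall>d\<in>carrier D.
        UnivPoly.eval (quot_field D) (quot_field D) (\<lambda>x. x) (quot_field_map D d) f
          \<in> quot_field_map D ` carrier D} \<rparr>"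

definition int_poly_const :: "('a, 'm) ring_scheme \<Rightarrow> 'a \<Rightarrow> nat \<Rightarrow> ('a \<times> 'a) set"
  where "int_poly_const D d = monom (UP (quot_field D)) (quot_field_map D d) 0"

definition int_poly_X :: "('a, 'm) ring_scheme \<Rightarrow> nat \<Rightarrow> ('a \<times> 'a) set"
  where "int_poly_X D = monom (UP (quot_field D)) \<one>\<^bsub>quot_field D\<^esub> 1"

definition WPC :: "('a, 'm) ring_scheme \<Rightarrow> ('b, 'n) ring_scheme \<Rightarrow> ('a \<Rightarrow> 'b) \<Rightarrow> bool"
  where "WPC D A \<phi> \<longleftrightarrow>
     (\<forall>a\<in>carrier A. \<exists>h \<in> alg_hom D (int_poly D) (int_poly_const D) A \<phi>. h (int_poly_X D) = a)"

definition locally_WPC :: "('a, 'm) ring_scheme \<Rightarrow> ('b, 'n) ring_scheme \<Rightarrow> ('a \<Rightarrow> 'b) \<Rightarrow> bool"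
  where "locally_WPC D A \<phi> \<longleftrightarrow> (\<forall>p. primeideal p D \<longrightarrow>
     WPC (loc_at D p)
       (tensor_alg D A \<phi> (loc_at D p) (loc_map D p))
       (tensor_right D A \<phi> (loc_at D p) (loc_map D p)))"

section \<open>Fractional ideals and \<open>t\<close>-ideals\<close>

definition frac_submodule :: "('a, 'm) ring_scheme \<Rightarrow> ('a \<times> 'a) set set \<Rightarrow> bool"
  where "frac_submodule D I \<longleftrightarrow> additive_subgroup I (quot_field D) \<and>
     (\<forall>d\<in>carrier D. \<forall>x\<in>I. quot_field_map D d \<otimes>\<^bsub>quot_field D\<^esub> x \<in> I)"

definition nonzero_fractional_ideal :: "('a, 'm) ring_scheme \<Rightarrow> ('a \<times> 'a) set set \<Rightarrow> bool"
  where "nonzero_fractional_ideal D I \<longleftrightarrow> frac_submodule D I \<and> I \<noteq> {\<zero>\<^bsub>quot_field D\<^esub>} \<and>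
     (\<exists>d\<in>carrier D - {\<zero>\<^bsub>D\<^esub>}. \<forall>x\<in>I.
        quot_field_map D d \<otimes>\<^bsub>quot_field D\<^esub> x \<in> quot_field_map D ` carrier D)"

definition frac_inverse :: "('a, 'm) ring_scheme \<Rightarrow> ('a \<times> 'a) set set \<Rightarrow> ('a \<times> 'a) set set"
  where "frac_inverse D I = {x \<in> carrier (quot_field D).
     \<forall>y\<in>I. x \<otimes>\<^bsub>quot_field D\<^esub> y \<in> quot_field_map D ` carrier D}"

definition v_closure :: "('a, 'm) ring_scheme \<Rightarrow> ('a \<times> 'a) set set \<Rightarrow> ('a \<times> 'a) set set"
  where "v_closure D I = frac_inverse D (frac_inverse D I)"

definition frac_span :: "('a, 'm) ring_scheme \<Rightarrow> ('a \<times> 'a) set set \<Rightarrow> ('a \<times> 'a) set set"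
  where "frac_span D S = \<Inter>{M. frac_submodule D M \<and> S \<subseteq> M}"

definition fin_gen :: "('a, 'm) ring_scheme \<Rightarrow> ('a \<times> 'a) set set \<Rightarrow> bool"
  where "fin_gen D J \<longleftrightarrow> (\<exists>S. finite S \<and> S \<subseteq> carrier (quot_field D) \<and> J = frac_span D S)"

definition t_closure :: "('a, 'm) ring_scheme \<Rightarrow> ('a \<times> 'a) set set \<Rightarrow> ('a \<times> 'a) set set"
  where "t_closure D I =
     \<Union>{v_closure D J | J. nonzero_fractional_ideal D J \<and> fin_gen D J \<and> J \<subseteq> I}"

definition proper_t_ideal :: "('a, 'm) ring_scheme \<Rightarrow> 'a set \<Rightarrow> bool"
  where "proper_t_ideal D p \<longleftrightarrow> ideal p D \<and> p \<noteq> {\<zero>\<^bsub>D\<^esub>} \<and> p \<noteq> carrier D \<and>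
     t_closure D (quot_field_map D ` p) = quot_field_map D ` p"

definition t_maximal :: "('a, 'm) ring_scheme \<Rightarrow> 'a set \<Rightarrow> bool"
  where "t_maximal D p \<longleftrightarrow> proper_t_ideal D p \<and> (\<forall>I. proper_t_ideal D I \<and> p \<subseteq> I \<longrightarrow> I = p)"

section \<open>Norm, height and the remaining ring-theoretic notions\<close>

definition finite_norm :: "('a, 'm) ring_scheme \<Rightarrow> 'a set \<Rightarrow> bool"
  where "finite_norm D I \<longleftrightarrow> finite (carrier (D Quot I))"

definition ideal_norm :: "('a, 'm) ring_scheme \<Rightarrow> 'a set \<Rightarrow> nat"
  where "ideal_norm D I = card (carrier (D Quot I))"

definition height :: "('a, 'm) ring_scheme \<Rightarrow> 'a set \<Rightarrow> enat"
  where "height R P = Sup {enat n | n. \<exists>c :: nat \<Rightarrow> 'a set.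
     (\<forall>i\<le>n. primeideal (c i) R) \<and> (\<forall>i<n. c i \<subset> c (Suc i)) \<and> c n = P}"

definition reduced_ring :: "('a, 'm) ring_scheme \<Rightarrow> bool"
  where "reduced_ring R \<longleftrightarrow> (\<forall>x\<in>carrier R. \<forall>n::nat. x [^]\<^bsub>R\<^esub> n = \<zero>\<^bsub>R\<^esub> \<longrightarrow> x = \<zero>\<^bsub>R\<^esub>)"

definition semi_local :: "('a, 'm) ring_scheme \<Rightarrow> bool"
  where "semi_local R \<longleftrightarrow> finite {M. maximalideal M R}"

definition power_ring :: "('f, 'm) ring_scheme \<Rightarrow> 'y set \<Rightarrow> ('y \<Rightarrow> 'f) ring"
  where "power_ring F Y = \<lparr>
     carrier = Y \<rightarrow>\<^sub>E carrier F,
     monoid.mult = (\<lambda>f g. \<lambda>y\<in>Y. f y \<otimes>\<^bsub>F\<^esub> g y),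
     one = (\<lambda>y\<in>Y. \<one>\<^bsub>F\<^esub>),
     ring.zero = (\<lambda>y\<in>Y. \<zero>\<^bsub>F\<^esub>),
     add = (\<lambda>f g. \<lambda>y\<in>Y. f y \<oplus>\<^bsub>F\<^esub> g y)\<rparr>"

text \<open>
  \<open>F\<close> is a model of the finite field with \<open>q\<close> elements.  In HOL an existential quantifier over
  \<open>F\<close> and \<open>Y\<close> has to fix their types; those used in the theorem are large enough, and the
  theorem also says that an embedding over any other types yields the same conclusion.
\<close>
definition subring_of_Fq_power ::
  "nat \<Rightarrow> ('c, 'm) ring_scheme \<Rightarrow> 'f ring \<Rightarrow> 'y set \<Rightarrow> bool"
  where "subring_of_Fq_power q R F Y \<longleftrightarrow> field F \<and> finite (carrier F) \<and> card (carrier F) = q \<and>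
     (\<exists>S. subring S (power_ring F Y) \<and> R \<simeq> (power_ring F Y)\<lparr>carrier := S\<rparr>)"

definition power_congruence ::
  "('a, 'k) ring_scheme \<Rightarrow> 'a set \<Rightarrow> ('b, 'm) ring_scheme \<Rightarrow> ('a \<Rightarrow> 'b) \<Rightarrow> bool"
  where "power_congruence D p A \<phi> \<longleftrightarrow>
     (\<forall>a\<in>carrier A. (a [^]\<^bsub>A\<^esub> ideal_norm D p) \<ominus>\<^bsub>A\<^esub> a \<in> extended_ideal A \<phi> p)"

definition locally_isomorphic_to_residue ::
  "('a, 'k) ring_scheme \<Rightarrow> 'a set \<Rightarrow> ('b, 'm) ring_scheme \<Rightarrow> ('a \<Rightarrow> 'b) \<Rightarrow> bool"
  where "locally_isomorphic_to_residue D p B \<beta> \<longleftrightarrow> (\<forall>P. primeideal P B \<longrightarrow>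
     alg_isomorphic D (loc_at B P) (loc_map B P \<circ> \<beta>) (D Quot p) (quot_map D p))"

definition unramified_with_residue ::
  "('a, 'k) ring_scheme \<Rightarrow> 'a set \<Rightarrow> ('b, 'm) ring_scheme \<Rightarrow> ('a \<Rightarrow> 'b) \<Rightarrow> 'b set \<Rightarrow> bool"
  where "unramified_with_residue D p A \<phi> P \<longleftrightarrow>
     extended_ideal (loc_at A P) (loc_map A P \<circ> \<phi>) p = extended_ideal (loc_at A P) (loc_map A P) P \<and>
     alg_isomorphic D (A Quot P) (quot_map A P \<circ> \<phi>) (D Quot p) (quot_map D p)"

abbreviation reduction :: "('b, 'm) ring_scheme \<Rightarrow> ('a \<Rightarrow> 'b) \<Rightarrow> 'a set \<Rightarrow> 'b set ring"
  where "reduction A \<phi> p \<equiv> A Quot extended_ideal A \<phi> p"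

abbreviation reduction_map :: "('b, 'm) ring_scheme \<Rightarrow> ('a \<Rightarrow> 'b) \<Rightarrow> 'a set \<Rightarrow> 'a \<Rightarrow> 'b set"
  where "reduction_map A \<phi> p \<equiv> quot_map A (extended_ideal A \<phi> p) \<circ> \<phi>"

definition ideal_product :: "('b, 'm) ring_scheme \<Rightarrow> 'b set list \<Rightarrow> 'b set"
  where "ideal_product A Ms = foldr (ideal_prod A) Ms (carrier A)"

end

theory Submission
  imports Defs
begin

text \<open>
  Let \<open>V = D\<^sub>p\<close> for a prime ideal \<open>p\<close>. If every integer-valued polynomial on \<open>V\<close> has coefficients
  in \<open>V\<close>, then evaluation at \<open>a\<close> is the required homomorphism. Otherwise \<open>p\<close> turns out to be \<open>t\<close>-maximal of
  finite norm \<open>q\<close>, so \<open>p V = \<pi> V\<close> for some \<open>\<pi>\<close>. As \<open>(X\<^sup>q - X) / \<pi>\<close> is integer-valued, weak polynomial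
  completeness forces \<open>a\<^sup>q \<equiv> a\<close> modulo \<open>\<pi> A\<^sub>p\<close>, and this descends to \<open>A\<close> because the elements outside \<open>p\<close> are
  invertible modulo \<open>p\<close>.

  Conversely, start from \<open>f\<^sub>0 = X\<close>, \<open>a\<^sub>0 = a\<close> and choose \<open>f\<^sub>k\<^sub>+\<^sub>1\<close>, \<open>a\<^sub>k\<^sub>+\<^sub>1\<close> with
  \<open>f\<^sub>k\<^sup>q = f\<^sub>k + \<pi> f\<^sub>k\<^sub>+\<^sub>1\<close> and \<open>a\<^sub>k\<^sup>q = a\<^sub>k + \<pi> a\<^sub>k\<^sub>+\<^sub>1\<close>. By these relations the \<open>V\<close>-combinations of monomials
  with exponents below \<open>q\<close> in the pairs \<open>(f\<^sub>k, a\<^sub>k)\<close> form a subring of \<open>K[X] \<times> A\<^sub>p\<close>, and since \<open>f\<^sub>k\<close> has degree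
  \<open>q\<^sup>k\<close>, this subring is the graph of a function. The function is defined on every integer-valued
  polynomial \<open>f\<close>: some \<open>\<pi>\<^sup>N f\<close> has coefficients in \<open>V\<close> and thus lies in the domain, and a combination all of whose
  values are divisible by \<open>\<pi>\<close> has coefficients divisible by \<open>\<pi>\<close>, because the iterates of
  \<open>x \<mapsto> (x\<^sup>q - x) / \<pi>\<close> can be prescribed modulo \<open>\<pi>\<close>.

  For the list of conditions, \<open>x\<^sup>q = x\<close> in \<open>A / p A\<close> makes every \<open>x\<^sup>q\<^sup>-\<^sup>1\<close> idempotent. Hence the localizations at
  primes are fields whose elements are roots of \<open>X\<^sup>q - X\<close>, and no element other than \<open>0\<close> lies in all
  primes.
\<close>

section \<open>Localization\<close>

text \<open>Since \<open>\<pi>\<close> may be a zero divisor in \<open>A_p\<close>, the element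
  \<open>a_(k+1)\<close> is not determined by \<open>a_k\<close>, and nothing can be divided by
  \<open>\<pi>\<close> there. This is why the map is built through its graph: every division happens
  in \<open>K[X]\<close> or among the coefficients of a normal form, and the second component merely
  follows. Arbitrary choices of \<open>a_(k+1)\<close> do no harm: distinct monomials have distinct
  degrees, by uniqueness of base \<open>q\<close> digits, so the polynomial alone determines the
  coefficients.

  Denominators are controlled by interpolation, in place of a valuation. At the nodes
  \<open>1, r, r^2, ...\<close> with \<open>r\<close> in \<open>p\<close> all differences are units
  times powers of \<open>r\<close>, so a power of \<open>r\<close> clears an integer-valued
  polynomial up to a unit. For \<open>r = \<pi>\<close> this gives the exponent \<open>N\<close>.
  For arbitrary \<open>r\<close> it shows that a coefficient outside \<open>V\<close> is brought
  into \<open>V\<close> by powers of every element of \<open>p\<close>, which makes \<open>p\<close>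
  a \<open>t\<close>-ideal.

  Prescribing the iterates modulo \<open>\<pi>\<close> is a Hensel argument to finite precision: the
  derivative of \<open>x^q - x\<close> is \<open>-1\<close> modulo \<open>\<pi>\<close>.\<close>

locale localization = cring R for R (structure) +
  fixes S
  assumes S_subset: "S \<subseteq> carrier R"
    and S_one: "\<one> \<in> S"
    and S_mult: "s \<in> S \<Longrightarrow> t \<in> S \<Longrightarrow> s \<otimes> t \<in> S"
begin

lemma S_closed [simp]: "s \<in> S \<Longrightarrow> s \<in> carrier R"
  using S_subset by blast

text \<open>Trading the difference for an equation leaves only products, so that later steps are
  commutative rearrangements.\<close>

lemma loc_rel_iff:
  "((a, s), (b, t)) \<in> loc_rel R S \<longleftrightarrow>
    a \<in> carrier R \<and> s \<in> S \<and> b \<in> carrier R \<and> t \<in> S \<and> (\<exists>u\<in>S. u \<otimes> (t \<otimes> a) = u \<otimes> (s \<otimes> b))"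
proof -
  have "u \<otimes> ((t \<otimes> a) \<ominus> (s \<otimes> b)) = \<zero> \<longleftrightarrow> u \<otimes> (t \<otimes> a) = u \<otimes> (s \<otimes> b)"
    if c: "a \<in> carrier R" "s \<in> S" "b \<in> carrier R" "t \<in> S" "u \<in> S" for u
  proof -
    have "u \<otimes> ((t \<otimes> a) \<ominus> (s \<otimes> b)) = u \<otimes> (t \<otimes> a) \<ominus> u \<otimes> (s \<otimes> b)"
      using c(1,3) c(2,4,5)[THEN S_closed] by algebra
    then show ?thesis using c by (simp add: r_right_minus_eq)
  qed
  then show ?thesis unfolding loc_rel_def by blast
qed

lemma loc_rel_equiv: "equiv (carrier R \<times> S) (loc_rel R S)"
proof (rule equivI)
  show "loc_rel R S \<subseteq> (carrier R \<times> S) \<times> (carrier R \<times> S)"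
    unfolding loc_rel_def by blast
  show "refl_on (carrier R \<times> S) (loc_rel R S)"
    unfolding refl_on_def by (auto simp: loc_rel_iff S_one intro!: bexI[OF _ S_one])
  show "sym (loc_rel R S)"
    unfolding sym_def by (auto simp: loc_rel_iff) (metis)+
  show "trans (loc_rel R S)"
  proof (rule transI, clarify)
    fix a s b t c r
    assume "((a, s), (b, t)) \<in> loc_rel R S" "((b, t), (c, r)) \<in> loc_rel R S"
    then obtain u v where *: "a \<in> carrier R" "s \<in> S" "b \<in> carrier R" "t \<in> S" "c \<in> carrier R" "r \<in> S"
      "u \<in> S" "v \<in> S" and u: "u \<otimes> (t \<otimes> a) = u \<otimes> (s \<otimes> b)" and v: "v \<otimes> (r \<otimes> b) = v \<otimes> (t \<otimes> c)"
      by (auto simp: loc_rel_iff)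
    \<comment> \<open>The middle denominator \<open>t\<close> cannot be cancelled, so it is absorbed
      into the multiplier \<open>u v t\<close>, which lies in \<open>S\<close>.\<close>
    have "(u \<otimes> (v \<otimes> t)) \<otimes> (r \<otimes> a) = (v \<otimes> r) \<otimes> (u \<otimes> (t \<otimes> a))"
      using * by (simp add: m_ac)
    also have "\<dots> = (u \<otimes> s) \<otimes> (v \<otimes> (r \<otimes> b))"
      unfolding u using * by (simp add: m_ac)
    also have "\<dots> = (u \<otimes> (v \<otimes> t)) \<otimes> (s \<otimes> c)"
      unfolding v using * by (simp add: m_ac)
    finally show "((a, s), (c, r)) \<in> loc_rel R S"
      using * by (auto simp: loc_rel_iff intro!: bexI[of _ "u \<otimes> (v \<otimes> t)"] S_mult)
  qed
qed

lemma frac_eq_iff: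
  assumes "a \<in> carrier R" "s \<in> S" "b \<in> carrier R" "t \<in> S"
  shows "loc_frac R S a s = loc_frac R S b t \<longleftrightarrow> (\<exists>u\<in>S. u \<otimes> (t \<otimes> a) = u \<otimes> (s \<otimes> b))"
  unfolding loc_frac_def
  using eq_equiv_class_iff[OF loc_rel_equiv, of "(a, s)" "(b, t)"] assms by (simp add: loc_rel_iff)

lemma frac_eqI:
  assumes "a \<in> carrier R" "s \<in> S" "b \<in> carrier R" "t \<in> S" "t \<otimes> a = s \<otimes> b"
  shows "loc_frac R S a s = loc_frac R S b t"
  using assms S_one by (subst frac_eq_iff) auto

lemma mem_frac_iff:
  "(b, t) \<in> loc_frac R S a s \<longleftrightarrow>
    a \<in> carrier R \<and> s \<in> S \<and> b \<in> carrier R \<and> t \<in> S \<and> loc_frac R S b t = loc_frac R S a s"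
proof -
  have "(b, t) \<in> loc_frac R S a s \<longleftrightarrow> ((a, s), (b, t)) \<in> loc_rel R S"
    by (simp add: loc_frac_def)
  also have "\<dots> \<longleftrightarrow> a \<in> carrier R \<and> s \<in> S \<and> b \<in> carrier R \<and> t \<in> S \<and> loc_frac R S b t = loc_frac R S a s"
    using frac_eq_iff[of a s b t] unfolding loc_rel_iff by metis
  finally show ?thesis .
qed

lemma carrier_loc: "carrier (loc R S) = {loc_frac R S a s | a s. a \<in> carrier R \<and> s \<in> S}"
  unfolding loc_def loc_frac_def quotient_def by auto

lemma frac_closed [simp]: "a \<in> carrier R \<Longrightarrow> s \<in> S \<Longrightarrow> loc_frac R S a s \<in> carrier (loc R S)"
  unfolding carrier_loc by blast

lemma loc_cases:
  assumes "x \<in> carrier (loc R S)"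
  obtains a s where "a \<in> carrier R" "s \<in> S" "x = loc_frac R S a s"
  using assms unfolding carrier_loc by blast

text \<open>The operations of \<open>loc\<close> are unions over all representatives; once the body
  agrees on all of them, the union collapses to a single term.\<close>

lemma UN_frac:
  assumes "a \<in> carrier R" "s \<in> S"
    and "\<And>b t. b \<in> carrier R \<Longrightarrow> t \<in> S \<Longrightarrow> loc_frac R S b t = loc_frac R S a s \<Longrightarrow> f b t = f a s"
  shows "(\<Union>(b, t)\<in>loc_frac R S a s. f b t) = f a s"
proof (rule SUP_eq_const)
  show "loc_frac R S a s \<noteq> {}" using mem_frac_iff[of a s a s] assms(1,2) by blast
  fix x assume "x \<in> loc_frac R S a s"
  then have "(fst x, snd x) \<in> loc_frac R S a s" by simp
  then have "f (fst x) (snd x) = f a s"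
    unfolding mem_frac_iff by (intro assms(3)) blast+
  then show "(case x of (b, t) \<Rightarrow> f b t) = f a s" by (simp only: case_prod_unfold)
qed

lemma frac_mult:
  assumes "a \<in> carrier R" "s \<in> S" "b \<in> carrier R" "t \<in> S"
  shows "loc_frac R S a s \<otimes>\<^bsub>loc R S\<^esub> loc_frac R S b t = loc_frac R S (a \<otimes> b) (s \<otimes> t)"
proof -
  \<comment> \<open>Independence of both representatives at once; the nested unions are then
    collapsed one variable at a time, each time with reflexivity in the other variable.\<close>
  have *: "loc_frac R S (a' \<otimes> b') (s' \<otimes> t') = loc_frac R S (a'' \<otimes> b'') (s'' \<otimes> t'')"
    if h: "loc_frac R S a' s' = loc_frac R S a'' s''" "loc_frac R S b' t' = loc_frac R S b'' t''"
      and c: "a' \<in> carrier R" "s' \<in> S" "b' \<in> carrier R" "t' \<in> S"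
       "a'' \<in> carrier R" "s'' \<in> S" "b'' \<in> carrier R" "t'' \<in> S" for a' s' b' t' a'' s'' b'' t''
  proof -
    obtain u v where uv: "u \<in> S" "v \<in> S"
      and u: "u \<otimes> (s'' \<otimes> a') = u \<otimes> (s' \<otimes> a'')" and v: "v \<otimes> (t'' \<otimes> b') = v \<otimes> (t' \<otimes> b'')"
      using h c by (auto simp: frac_eq_iff)
    have "(u \<otimes> v) \<otimes> ((s'' \<otimes> t'') \<otimes> (a' \<otimes> b')) = (u \<otimes> (s'' \<otimes> a')) \<otimes> (v \<otimes> (t'' \<otimes> b'))"
      using c uv by (simp add: m_ac)
    also have "\<dots> = (u \<otimes> v) \<otimes> ((s' \<otimes> t') \<otimes> (a'' \<otimes> b''))"
      unfolding u v using c uv by (simp add: m_ac)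
    finally show ?thesis
      using c uv by (auto simp: frac_eq_iff S_mult intro!: bexI[of _ "u \<otimes> v"])
  qed
  have "loc_frac R S a s \<otimes>\<^bsub>loc R S\<^esub> loc_frac R S b t =
    (\<Union>(a', s')\<in>loc_frac R S a s. \<Union>(b', t')\<in>loc_frac R S b t. loc_frac R S (a' \<otimes> b') (s' \<otimes> t'))"
    (is "_ = (\<Union>(a', s')\<in>_. \<Union>(b', t')\<in>_. ?f a' s' b' t')")
    unfolding loc_def by simp
  also have "\<dots> = (\<Union>(a', s')\<in>loc_frac R S a s. loc_frac R S (a' \<otimes> b) (s' \<otimes> t))"
    proof (intro SUP_cong HOL.refl, clarify)
    fix a' s' assume "(a', s') \<in> loc_frac R S a s"
    then have "a' \<in> carrier R" "s' \<in> S" unfolding mem_frac_iff by blast+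
    then show "(\<Union>(b', t')\<in>loc_frac R S b t. ?f a' s' b' t') = ?f a' s' b t"
      by (intro UN_frac[OF assms(3,4)] *[OF HOL.refl]) (use assms in blast)+
  qed
  also have "\<dots> = loc_frac R S (a \<otimes> b) (s \<otimes> t)"
    by (intro UN_frac[OF assms(1,2)] *[OF _ HOL.refl]) (use assms in blast)+
  finally show ?thesis .
qed

lemma frac_add:
  assumes "a \<in> carrier R" "s \<in> S" "b \<in> carrier R" "t \<in> S"
  shows "loc_frac R S a s \<oplus>\<^bsub>loc R S\<^esub> loc_frac R S b t = loc_frac R S ((t \<otimes> a) \<oplus> (s \<otimes> b)) (s \<otimes> t)"
proof -
  have *: "loc_frac R S ((t' \<otimes> a') \<oplus> (s' \<otimes> b')) (s' \<otimes> t') = loc_frac R S ((t'' \<otimes> a'') \<oplus> (s'' \<otimes> b'')) (s'' \<otimes> t'')"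
    if h: "loc_frac R S a' s' = loc_frac R S a'' s''" "loc_frac R S b' t' = loc_frac R S b'' t''"
      and c: "a' \<in> carrier R" "s' \<in> S" "b' \<in> carrier R" "t' \<in> S"
       "a'' \<in> carrier R" "s'' \<in> S" "b'' \<in> carrier R" "t'' \<in> S" for a' s' b' t' a'' s'' b'' t''
  proof -
    obtain u v where uv: "u \<in> S" "v \<in> S"
      and u: "u \<otimes> (s'' \<otimes> a') = u \<otimes> (s' \<otimes> a'')" and v: "v \<otimes> (t'' \<otimes> b') = v \<otimes> (t' \<otimes> b'')"
      using h c by (auto simp: frac_eq_iff)
    have "(u \<otimes> v) \<otimes> ((s'' \<otimes> t'') \<otimes> ((t' \<otimes> a') \<oplus> (s' \<otimes> b')))
        = (v \<otimes> t' \<otimes> t'') \<otimes> (u \<otimes> (s'' \<otimes> a')) \<oplus> (u \<otimes> s' \<otimes> s'') \<otimes> (v \<otimes> (t'' \<otimes> b'))"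
      using c(1,3,5,7) c(2,4,6,8)[THEN S_closed] uv[THEN S_closed] by algebra
    also have "\<dots> = (u \<otimes> v) \<otimes> ((s' \<otimes> t') \<otimes> ((t'' \<otimes> a'') \<oplus> (s'' \<otimes> b'')))"
      unfolding u v using c(1,3,5,7) c(2,4,6,8)[THEN S_closed] uv[THEN S_closed] by algebra
    finally show ?thesis
      using c uv by (auto simp: frac_eq_iff S_mult intro!: bexI[of _ "u \<otimes> v"])
  qed
  have "loc_frac R S a s \<oplus>\<^bsub>loc R S\<^esub> loc_frac R S b t =
    (\<Union>(a', s')\<in>loc_frac R S a s. \<Union>(b', t')\<in>loc_frac R S b t. loc_frac R S ((t' \<otimes> a') \<oplus> (s' \<otimes> b')) (s' \<otimes> t'))"
    (is "_ = (\<Union>(a', s')\<in>_. \<Union>(b', t')\<in>_. ?f a' s' b' t')")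
    unfolding loc_def by simp
  also have "\<dots> = (\<Union>(a', s')\<in>loc_frac R S a s. loc_frac R S ((t \<otimes> a') \<oplus> (s' \<otimes> b)) (s' \<otimes> t))"
    proof (intro SUP_cong HOL.refl, clarify)
    fix a' s' assume "(a', s') \<in> loc_frac R S a s"
    then have "a' \<in> carrier R" "s' \<in> S" unfolding mem_frac_iff by blast+
    then show "(\<Union>(b', t')\<in>loc_frac R S b t. ?f a' s' b' t') = ?f a' s' b t"
      by (intro UN_frac[OF assms(3,4)] *[OF HOL.refl]) (use assms in blast)+
  qed
  also have "\<dots> = loc_frac R S ((t \<otimes> a) \<oplus> (s \<otimes> b)) (s \<otimes> t)"
    by (intro UN_frac[OF assms(1,2)] *[OF _ HOL.refl]) (use assms in blast)+
  finally show ?thesis .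
qed

lemma loc_one: "\<one>\<^bsub>loc R S\<^esub> = loc_frac R S \<one> \<one>"
  and loc_zero: "\<zero>\<^bsub>loc R S\<^esub> = loc_frac R S \<zero> \<one>"
  unfolding loc_def by simp_all

lemma frac_zero: "s \<in> S \<Longrightarrow> loc_frac R S \<zero> s = \<zero>\<^bsub>loc R S\<^esub>"
  unfolding loc_zero by (rule frac_eqI) (auto simp: S_one)

lemma frac_eq_zero_iff:
  assumes "a \<in> carrier R" "s \<in> S"
  shows "loc_frac R S a s = \<zero>\<^bsub>loc R S\<^esub> \<longleftrightarrow> (\<exists>u\<in>S. u \<otimes> a = \<zero>)"
  using assms by (simp add: loc_zero frac_eq_iff S_one)

lemma frac_same_denom_add:
  assumes "a \<in> carrier R" "s \<in> S" "b \<in> carrier R"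
  shows "loc_frac R S a s \<oplus>\<^bsub>loc R S\<^esub> loc_frac R S b s = loc_frac R S (a \<oplus> b) s"
proof -
  have "s \<otimes> (s \<otimes> a \<oplus> s \<otimes> b) = s \<otimes> s \<otimes> (a \<oplus> b)"
    using assms(1,3) S_closed[OF assms(2)] by algebra
  then show ?thesis
    unfolding frac_add[OF assms(1,2,3,2)] by (intro frac_eqI) (use assms in \<open>auto simp: S_mult\<close>)
qed

lemma frac_cancel:
  assumes "a \<in> carrier R" "s \<in> S" "t \<in> S"
  shows "loc_frac R S (t \<otimes> a) (t \<otimes> s) = loc_frac R S a s"
  by (rule frac_eqI) (use assms in \<open>auto simp: S_mult m_ac\<close>)

text \<open>With one denominator for both fractions the additive laws reduce to those of the
  numerators.\<close>

lemma common_denominator: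
  assumes "x \<in> carrier (loc R S)" "y \<in> carrier (loc R S)"
  obtains a b s where "a \<in> carrier R" "b \<in> carrier R" "s \<in> S" "x = loc_frac R S a s" "y = loc_frac R S b s"
proof -
  obtain a s b t where *: "a \<in> carrier R" "s \<in> S" "x = loc_frac R S a s"
    "b \<in> carrier R" "t \<in> S" "y = loc_frac R S b t"
    using assms by (meson loc_cases)
  show ?thesis
    by (rule that[of "t \<otimes> a" "s \<otimes> b" "t \<otimes> s"])
      (use * frac_cancel[of a s t] frac_cancel[of b t s] in \<open>auto simp: S_mult m_comm\<close>)
qed

lemma loc_cring: "cring (loc R S)"
proof (rule cringI)
  show "abelian_group (loc R S)"
  proof (rule abelian_groupI)
    fix x y assume "x \<in> carrier (loc R S)" "y \<in> carrier (loc R S)"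
    then obtain a b s where *: "a \<in> carrier R" "b \<in> carrier R" "s \<in> S"
      "x = loc_frac R S a s" "y = loc_frac R S b s" by (rule common_denominator)
    then show "x \<oplus>\<^bsub>loc R S\<^esub> y \<in> carrier (loc R S)" "x \<oplus>\<^bsub>loc R S\<^esub> y = y \<oplus>\<^bsub>loc R S\<^esub> x"
      by (auto simp: frac_same_denom_add a_comm)
  next
    show "\<zero>\<^bsub>loc R S\<^esub> \<in> carrier (loc R S)" by (simp add: loc_zero S_one)
  next
    fix x y z assume *: "x \<in> carrier (loc R S)" "y \<in> carrier (loc R S)" "z \<in> carrier (loc R S)"
    obtain a b s where 1: "a \<in> carrier R" "b \<in> carrier R" "s \<in> S"
      "x = loc_frac R S a s" "y = loc_frac R S b s" using *(1,2) by (rule common_denominator)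
    obtain c t where 2: "c \<in> carrier R" "t \<in> S" "z = loc_frac R S c t" using *(3) by (rule loc_cases)
    have "x = loc_frac R S (t \<otimes> a) (t \<otimes> s)" "y = loc_frac R S (t \<otimes> b) (t \<otimes> s)"
        "z = loc_frac R S (s \<otimes> c) (t \<otimes> s)"
      using 1 2 frac_cancel[of a s t] frac_cancel[of b s t] frac_cancel[of c t s]
      by (auto simp: m_comm)
    then show "x \<oplus>\<^bsub>loc R S\<^esub> y \<oplus>\<^bsub>loc R S\<^esub> z = x \<oplus>\<^bsub>loc R S\<^esub> (y \<oplus>\<^bsub>loc R S\<^esub> z)"
      using 1 2 by (auto simp: frac_same_denom_add S_mult a_assoc)
  next
    fix x assume "x \<in> carrier (loc R S)"
    then obtain a s where *: "a \<in> carrier R" "s \<in> S" "x = loc_frac R S a s" by (rule loc_cases)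
    then show "\<zero>\<^bsub>loc R S\<^esub> \<oplus>\<^bsub>loc R S\<^esub> x = x"
      unfolding frac_zero[OF *(2), symmetric] by (simp add: frac_same_denom_add)
    show "\<exists>y\<in>carrier (loc R S). y \<oplus>\<^bsub>loc R S\<^esub> x = \<zero>\<^bsub>loc R S\<^esub>"
      by (rule bexI[of _ "loc_frac R S (\<ominus> a) s"]) (use * in \<open>auto simp: frac_same_denom_add l_neg frac_zero\<close>)
  qed
  show "comm_monoid (loc R S)"
  proof (rule comm_monoidI)
    fix x y assume "x \<in> carrier (loc R S)" "y \<in> carrier (loc R S)"
    then obtain a b s where *: "a \<in> carrier R" "b \<in> carrier R" "s \<in> S"
      "x = loc_frac R S a s" "y = loc_frac R S b s" by (rule common_denominator)
    then show "x \<otimes>\<^bsub>loc R S\<^esub> y \<in> carrier (loc R S)" "x \<otimes>\<^bsub>loc R S\<^esub> y = y \<otimes>\<^bsub>loc R S\<^esub> x"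
      by (auto simp: frac_mult m_comm S_mult)
  next
    show "\<one>\<^bsub>loc R S\<^esub> \<in> carrier (loc R S)" by (simp add: loc_one S_one)
  next
    fix x y z assume *: "x \<in> carrier (loc R S)" "y \<in> carrier (loc R S)" "z \<in> carrier (loc R S)"
    then show "x \<otimes>\<^bsub>loc R S\<^esub> y \<otimes>\<^bsub>loc R S\<^esub> z = x \<otimes>\<^bsub>loc R S\<^esub> (y \<otimes>\<^bsub>loc R S\<^esub> z)"
      by (elim loc_cases) (simp add: frac_mult S_mult m_assoc)
  next
    fix x assume "x \<in> carrier (loc R S)"
    then show "\<one>\<^bsub>loc R S\<^esub> \<otimes>\<^bsub>loc R S\<^esub> x = x"
      by (elim loc_cases) (simp add: frac_mult S_one loc_one)
  qed
  fix x y z assume *: "x \<in> carrier (loc R S)" "y \<in> carrier (loc R S)" "z \<in> carrier (loc R S)"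
  obtain a b s where 1: "a \<in> carrier R" "b \<in> carrier R" "s \<in> S"
    "x = loc_frac R S a s" "y = loc_frac R S b s" using *(1,2) by (rule common_denominator)
  obtain c t where 2: "c \<in> carrier R" "t \<in> S" "z = loc_frac R S c t" using *(3) by (rule loc_cases)
  show "(x \<oplus>\<^bsub>loc R S\<^esub> y) \<otimes>\<^bsub>loc R S\<^esub> z = x \<otimes>\<^bsub>loc R S\<^esub> z \<oplus>\<^bsub>loc R S\<^esub> y \<otimes>\<^bsub>loc R S\<^esub> z"
    using 1 2 by (auto simp: frac_same_denom_add frac_mult S_mult l_distr)
qed

lemma frac_hom: "ring_hom_cring R (loc R S) (\<lambda>a. loc_frac R S a \<one>)"
  by (rule ring_hom_cringI)
    (auto simp: loc_cring cring_axioms S_one frac_mult frac_same_denom_add loc_one intro!: ring_hom_memI)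

lemma frac_split:
  assumes "a \<in> carrier R" "s \<in> S"
  shows "loc_frac R S a s = loc_frac R S \<one> s \<otimes>\<^bsub>loc R S\<^esub> loc_frac R S a \<one>"
  using assms by (simp add: frac_mult S_one)

lemma frac_inverse:
  assumes "s \<in> S"
  shows "loc_frac R S \<one> s \<otimes>\<^bsub>loc R S\<^esub> loc_frac R S s \<one> = \<one>\<^bsub>loc R S\<^esub>"
  unfolding loc_one using assms by (simp add: frac_mult S_one) (rule frac_eqI; simp add: S_one)

lemma frac_Units: "s \<in> S \<Longrightarrow> loc_frac R S s \<one> \<in> Units (loc R S)"
proof -
  assume s: "s \<in> S"
  interpret L: cring "loc R S" by (rule loc_cring)
  have c: "loc_frac R S \<one> s \<in> carrier (loc R S)" "loc_frac R S s \<one> \<in> carrier (loc R S)"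
    using s S_one by simp_all
  show ?thesis
    unfolding Units_def using frac_inverse[OF s] L.m_comm[OF c] c by auto
qed

text \<open>The fractions with numerator in \<open>Idl T\<close> form an ideal that contains the
  generators, which gives one inclusion. For the other, the elements of \<open>R\<close> sent into
  the generated ideal form an ideal above \<open>T\<close>, and \<open>1 / s\<close> is only a
  scalar.\<close>

lemma genideal_frac:
  assumes T: "T \<subseteq> carrier R"
  shows "Idl\<^bsub>loc R S\<^esub> ((\<lambda>a. loc_frac R S a \<one>) ` T) = {loc_frac R S a s | a s. a \<in> Idl T \<and> s \<in> S}"
proof -
  interpret L: cring "loc R S" by (rule loc_cring)
  interpret h: ring_hom_cring R "loc R S" "\<lambda>a. loc_frac R S a \<one>" by (rule frac_hom)
  interpret I: ideal "Idl T" R by (rule genideal_ideal[OF T])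
  let ?J = "Idl\<^bsub>loc R S\<^esub> ((\<lambda>a. loc_frac R S a \<one>) ` T)"
  have im: "(\<lambda>a. loc_frac R S a \<one>) ` T \<subseteq> carrier (loc R S)" using T by auto
  interpret J: ideal ?J "loc R S" by (rule L.genideal_ideal[OF im])
  show ?thesis
  proof
    have ID: "ideal {loc_frac R S a s | a s. a \<in> Idl T \<and> s \<in> S} (loc R S)"
    proof (rule idealI[OF L.ring_axioms])
      show "subgroup {loc_frac R S a s | a s. a \<in> Idl T \<and> s \<in> S} (add_monoid (loc R S))"
      proof (rule L.add.subgroupI)
        show "{loc_frac R S a s | a s. a \<in> Idl T \<and> s \<in> S} \<noteq> {}" using S_one I.zero_closed by blast
      next
        fix x assume "x \<in> {loc_frac R S a s | a s. a \<in> Idl T \<and> s \<in> S}"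
        then obtain a s where *: "a \<in> Idl T" "s \<in> S" "x = loc_frac R S a s" by blast
        have "x \<oplus>\<^bsub>loc R S\<^esub> loc_frac R S (\<ominus> a) s = \<zero>\<^bsub>loc R S\<^esub>"
          using * I.a_Hcarr[of a] by (simp add: frac_same_denom_add r_neg frac_zero)
        then have "\<ominus>\<^bsub>loc R S\<^esub> x = loc_frac R S (\<ominus> a) s"
          using * I.a_Hcarr[of a] by (intro L.minus_equality) (auto simp: L.a_comm)
        then show "\<ominus>\<^bsub>loc R S\<^esub> x \<in> {loc_frac R S a s | a s. a \<in> Idl T \<and> s \<in> S}"
          using * I.a_inv_closed by blast
      next
        fix x y assume "x \<in> {loc_frac R S a s | a s. a \<in> Idl T \<and> s \<in> S}"
          "y \<in> {loc_frac R S a s | a s. a \<in> Idl T \<and> s \<in> S}"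
        then obtain a s b t where *: "a \<in> Idl T" "s \<in> S" "x = loc_frac R S a s"
          "b \<in> Idl T" "t \<in> S" "y = loc_frac R S b t" by blast
        have "x \<oplus>\<^bsub>loc R S\<^esub> y = loc_frac R S ((t \<otimes> a) \<oplus> (s \<otimes> b)) (s \<otimes> t)"
          using * I.a_Hcarr by (simp add: frac_add)
        moreover have "(t \<otimes> a) \<oplus> (s \<otimes> b) \<in> Idl T" using * by (auto intro!: I.a_closed I.I_l_closed)
        ultimately show "x \<oplus>\<^bsub>loc R S\<^esub> y \<in> {loc_frac R S a s | a s. a \<in> Idl T \<and> s \<in> S}"
          using * S_mult by blast
      qed (use I.a_Hcarr in \<open>auto\<close>)
    next
      fix x y assume "x \<in> {loc_frac R S a s | a s. a \<in> Idl T \<and> s \<in> S}" "y \<in> carrier (loc R S)"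
      then obtain a s b t where *: "a \<in> Idl T" "s \<in> S" "x = loc_frac R S a s"
          "b \<in> carrier R" "t \<in> S" "y = loc_frac R S b t" by (auto elim: loc_cases)
      have "y \<otimes>\<^bsub>loc R S\<^esub> x = loc_frac R S (b \<otimes> a) (t \<otimes> s)"
        using * I.a_Hcarr by (simp add: frac_mult)
      then show "y \<otimes>\<^bsub>loc R S\<^esub> x \<in> {loc_frac R S a s | a s. a \<in> Idl T \<and> s \<in> S}"
        using * S_mult I.I_l_closed by blast
      then show "x \<otimes>\<^bsub>loc R S\<^esub> y \<in> {loc_frac R S a s | a s. a \<in> Idl T \<and> s \<in> S}"
        using L.m_comm[of x y] * I.a_Hcarr by auto
    qed
    show "?J \<subseteq> {loc_frac R S a s | a s. a \<in> Idl T \<and> s \<in> S}"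
      by (rule L.genideal_minimal[OF ID]) (use genideal_self[OF T] S_one in auto)
    show "{loc_frac R S a s | a s. a \<in> Idl T \<and> s \<in> S} \<subseteq> ?J"
    proof clarify
      fix a s assume a: "a \<in> Idl T" and s: "s \<in> S"
      have "ideal {r \<in> carrier R. loc_frac R S r \<one> \<in> ?J} R"
        by (rule h.ring.ideal_vimage[OF J.is_ideal])
      moreover have "T \<subseteq> {r \<in> carrier R. loc_frac R S r \<one> \<in> ?J}"
        using T L.genideal_self[OF im] by auto
      ultimately have "Idl T \<subseteq> {r \<in> carrier R. loc_frac R S r \<one> \<in> ?J}" by (rule genideal_minimal)
      then have "loc_frac R S a \<one> \<in> ?J" using a by auto
      then have "loc_frac R S \<one> s \<otimes>\<^bsub>loc R S\<^esub> loc_frac R S a \<one> \<in> ?J"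
        by (rule J.I_l_closed) (use s in simp)
      then show "loc_frac R S a s \<in> ?J" using frac_split[of a s] a s I.a_Hcarr by simp
    qed
  qed
qed

text \<open>A fraction of the extended ideal may be written with a numerator outside
  \<open>Idl T\<close>; hence the factor \<open>u\<close>, which expresses saturation with respect
  to \<open>S\<close>.\<close>

lemma frac_in_genideal_iff:
  assumes T: "T \<subseteq> carrier R" and a: "a \<in> carrier R" and s: "s \<in> S"
  shows "loc_frac R S a s \<in> Idl\<^bsub>loc R S\<^esub> ((\<lambda>a. loc_frac R S a \<one>) ` T) \<longleftrightarrow> (\<exists>u\<in>S. u \<otimes> a \<in> Idl T)"
proof -
  interpret I: ideal "Idl T" R by (rule genideal_ideal[OF T])
  show ?thesis unfolding genideal_frac[OF T]
  proof
    assume "loc_frac R S a s \<in> {loc_frac R S a s | a s. a \<in> Idl T \<and> s \<in> S}"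
    then obtain b t where b: "b \<in> Idl T" "t \<in> S" "loc_frac R S a s = loc_frac R S b t" by blast
    then obtain u where u: "u \<in> S" "u \<otimes> (t \<otimes> a) = u \<otimes> (s \<otimes> b)"
      using frac_eq_iff[OF a s _ b(2)] I.a_Hcarr by blast
    have "(u \<otimes> t) \<otimes> a = (u \<otimes> s) \<otimes> b" using u a b s I.a_Hcarr[OF b(1)] by (simp add: m_assoc)
    also have "\<dots> \<in> Idl T" using b u s by (intro I.I_l_closed) auto
    finally show "\<exists>u\<in>S. u \<otimes> a \<in> Idl T" using u b S_mult by blast
  next
    assume "\<exists>u\<in>S. u \<otimes> a \<in> Idl T"
    then obtain u where u: "u \<in> S" "u \<otimes> a \<in> Idl T" by blast
    then show "loc_frac R S a s \<in> {loc_frac R S a s | a s. a \<in> Idl T \<and> s \<in> S}"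
      using frac_cancel[OF a s u(1)] S_mult[OF u(1) s] by auto
  qed
qed

text \<open>For \<open>S = carrier R - P\<close> this rule makes the simplifier loop.\<close>
declare S_closed [simp del]

end

section \<open>Maps between localizations, and localizations of domains\<close>

definition loc_lift ::
  "('a, 'm) ring_scheme \<Rightarrow> 'a set \<Rightarrow> ('b, 'n) ring_scheme \<Rightarrow> 'b set \<Rightarrow> ('a \<Rightarrow> 'b) \<Rightarrow> ('a \<times> 'a) set \<Rightarrow> ('b \<times> 'b) set"
  where "loc_lift R S A T \<phi> U = (\<Union>(a, s)\<in>U. loc_frac A T (\<phi> a) (\<phi> s))"

lemma loc_lift_frac:
  assumes "localization R S" "localization A T" "ring_hom_cring R A \<phi>" "\<phi> ` S \<subseteq> T"
    and as: "a \<in> carrier R" "s \<in> S"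
  shows "loc_lift R S A T \<phi> (loc_frac R S a s) = loc_frac A T (\<phi> a) (\<phi> s)"
proof -
  interpret R: localization R S by fact
  interpret A: localization A T by fact
  interpret h: ring_hom_cring R A \<phi> by fact
  show ?thesis unfolding loc_lift_def
  proof (rule R.UN_frac[OF as])
    fix b t assume bt: "b \<in> carrier R" "t \<in> S" "loc_frac R S b t = loc_frac R S a s"
    then obtain u where u: "u \<in> S" "u \<otimes>\<^bsub>R\<^esub> (s \<otimes>\<^bsub>R\<^esub> b) = u \<otimes>\<^bsub>R\<^esub> (t \<otimes>\<^bsub>R\<^esub> a)"
      using R.frac_eq_iff as by auto
    have "\<phi> u \<otimes>\<^bsub>A\<^esub> (\<phi> s \<otimes>\<^bsub>A\<^esub> \<phi> b) = \<phi> u \<otimes>\<^bsub>A\<^esub> (\<phi> t \<otimes>\<^bsub>A\<^esub> \<phi> a)"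
      using arg_cong[OF u(2), of \<phi>] u(1) bt(1,2) as R.S_closed by simp
    then show "loc_frac A T (\<phi> b) (\<phi> t) = loc_frac A T (\<phi> a) (\<phi> s)"
      using assms bt u as by (subst A.frac_eq_iff) (auto simp: image_subset_iff)
  qed
qed

lemma loc_lift_hom:
  assumes "localization R S" "localization A T" "ring_hom_cring R A \<phi>" "\<phi> ` S \<subseteq> T"
  shows "ring_hom_cring (loc R S) (loc A T) (loc_lift R S A T \<phi>)"
proof (rule ring_hom_cringI)
  interpret R: localization R S by fact
  interpret A: localization A T by fact
  interpret h: ring_hom_cring R A \<phi> by fact
  note lift = loc_lift_frac[OF assms]
  have sT: "\<And>s. s \<in> S \<Longrightarrow> \<phi> s \<in> T" using assms(4) by auto
  show "cring (loc R S)" by (rule R.loc_cring)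
  show "cring (loc A T)" by (rule A.loc_cring)
  show "loc_lift R S A T \<phi> \<in> ring_hom (loc R S) (loc A T)"
  proof (rule ring_hom_memI)
    fix x assume "x \<in> carrier (loc R S)"
    then show "loc_lift R S A T \<phi> x \<in> carrier (loc A T)"
      by (elim R.loc_cases) (simp add: lift sT)
  next
    fix x y assume "x \<in> carrier (loc R S)" "y \<in> carrier (loc R S)"
    then obtain a b s where *: "a \<in> carrier R" "b \<in> carrier R" "s \<in> S"
      "x = loc_frac R S a s" "y = loc_frac R S b s" by (rule R.common_denominator)
    show "loc_lift R S A T \<phi> (x \<otimes>\<^bsub>loc R S\<^esub> y) = loc_lift R S A T \<phi> x \<otimes>\<^bsub>loc A T\<^esub> loc_lift R S A T \<phi> y"
      using * by (simp add: R.S_closed R.frac_mult lift R.S_mult A.frac_mult sT)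
    show "loc_lift R S A T \<phi> (x \<oplus>\<^bsub>loc R S\<^esub> y) = loc_lift R S A T \<phi> x \<oplus>\<^bsub>loc A T\<^esub> loc_lift R S A T \<phi> y"
      using * by (simp add: R.frac_same_denom_add lift A.frac_same_denom_add sT)
  next
    show "loc_lift R S A T \<phi> \<one>\<^bsub>loc R S\<^esub> = \<one>\<^bsub>loc A T\<^esub>"
      by (simp add: R.loc_one A.loc_one lift R.S_one)
  qed
qed

lemma (in cring) localization_primeI:
  assumes "primeideal P R"
  shows "localization R (carrier R - P)"
proof -
  interpret P: primeideal P R by fact
  have "\<one> \<notin> P" using P.I_notcarr P.one_imp_carrier by blast
  then show ?thesis
    by unfold_locales (auto dest: P.I_prime)
qed

lemma (in domain) localization_nonzero: "localization R (carrier R - {\<zero>})"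
  by unfold_locales (auto simp: integral_iff)

text \<open>Elements of \<open>S\<close> are nonzero and can be cancelled, so the multiplier
  \<open>u\<close> disappears from equality and a fraction vanishes only with its numerator.\<close>

lemma (in domain) loc_domain:
  assumes "localization R S" "\<zero> \<notin> S"
  shows "domain (loc R S)" and "inj_on (\<lambda>a. loc_frac R S a \<one>) (carrier R)"
proof -
  interpret L: localization R S by fact
  interpret LL: cring "loc R S" by (rule L.loc_cring)
  have z: "loc_frac R S a s = \<zero>\<^bsub>loc R S\<^esub> \<longleftrightarrow> a = \<zero>" if "a \<in> carrier R" "s \<in> S" for a s
    using that L.frac_eq_zero_iff[of a s] assms(2) L.S_one by (auto simp: integral_iff L.S_closed)
  show "domain (loc R S)"
  proof (rule domain.intro[OF L.loc_cring], rule domain_axioms.intro)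
    show "\<one>\<^bsub>loc R S\<^esub> \<noteq> \<zero>\<^bsub>loc R S\<^esub>" unfolding L.loc_one using z[OF one_closed L.S_one] by simp
    fix x y assume "x \<otimes>\<^bsub>loc R S\<^esub> y = \<zero>\<^bsub>loc R S\<^esub>" "x \<in> carrier (loc R S)" "y \<in> carrier (loc R S)"
    then show "x = \<zero>\<^bsub>loc R S\<^esub> \<or> y = \<zero>\<^bsub>loc R S\<^esub>"
      by (elim L.loc_cases) (auto simp: L.frac_mult z L.S_mult integral_iff)
  qed
  show "inj_on (\<lambda>a. loc_frac R S a \<one>) (carrier R)"
  proof (rule inj_onI)
    fix a b assume ab: "a \<in> carrier R" "b \<in> carrier R" "loc_frac R S a \<one> = loc_frac R S b \<one>"
    then obtain u where "u \<in> S" "u \<otimes> (\<one> \<otimes> a) = u \<otimes> (\<one> \<otimes> b)"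
      using L.frac_eq_iff[of a \<one> b \<one>] L.S_one by auto
    then show "a = b" using ab assms(2) by (metis L.S_closed l_one m_lcancel)
  qed
qed

lemma (in domain) quot_field_field: "field (quot_field R)"
proof -
  interpret L: localization R "carrier R - {\<zero>}" by (rule localization_nonzero)
  interpret LL: domain "loc R (carrier R - {\<zero>})" by (rule loc_domain) (auto intro: L.localization_axioms)
  have "Units (loc R (carrier R - {\<zero>})) = carrier (loc R (carrier R - {\<zero>})) - {\<zero>\<^bsub>loc R (carrier R - {\<zero>})\<^esub>}"
  proof (intro equalityI subsetI)
    fix x assume "x \<in> carrier (loc R (carrier R - {\<zero>})) - {\<zero>\<^bsub>loc R (carrier R - {\<zero>})\<^esub>}"
    then obtain a s where as: "a \<in> carrier R" "s \<in> carrier R - {\<zero>}" "x = loc_frac R (carrier R - {\<zero>}) a s"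
      and x: "x \<noteq> \<zero>\<^bsub>loc R (carrier R - {\<zero>})\<^esub>"
      by (metis DiffD1 DiffD2 L.loc_cases singletonI)
    then have a: "a \<in> carrier R - {\<zero>}" using L.frac_zero[OF as(2)] by auto
    have "loc_frac R (carrier R - {\<zero>}) (s \<otimes> a) (a \<otimes> s) = loc_frac R (carrier R - {\<zero>}) \<one> \<one>"
      by (rule L.frac_eqI) (use as(1,2) a in \<open>auto simp: m_comm L.S_mult integral_iff\<close>)
    then have "loc_frac R (carrier R - {\<zero>}) s a \<otimes>\<^bsub>loc R (carrier R - {\<zero>})\<^esub> x = \<one>\<^bsub>loc R (carrier R - {\<zero>})\<^esub>"
      unfolding as(3) L.loc_one using as(1,2) a
      by (simp add: L.frac_mult)
    moreover have "loc_frac R (carrier R - {\<zero>}) s a \<in> carrier (loc R (carrier R - {\<zero>}))"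
      "x \<in> carrier (loc R (carrier R - {\<zero>}))"
      using as a by simp_all
    ultimately show "x \<in> Units (loc R (carrier R - {\<zero>}))"
      unfolding Units_def using LL.m_comm by blast
  next
    fix x assume "x \<in> Units (loc R (carrier R - {\<zero>}))"
    then show "x \<in> carrier (loc R (carrier R - {\<zero>})) - {\<zero>\<^bsub>loc R (carrier R - {\<zero>})\<^esub>}"
      using LL.one_not_zero LL.l_null by (auto simp: Units_def)
  qed
  then show ?thesis
    unfolding quot_field_def loc_at_def using LL.domain_axioms by (simp add: field_def field_axioms_def)
qed

section \<open>Horner evaluation and Vandermonde elimination\<close>

text \<open>Coefficient lists, constant term first. Lists keep the elimination below independent of
  polynomial rings and let the coefficients themselves be values of further Horner sums.\<close>

primrec horner :: "('a, 'm) ring_scheme \<Rightarrow> 'a list \<Rightarrow> 'a \<Rightarrow> 'a"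
  where
    "horner R [] x = \<zero>\<^bsub>R\<^esub>"
  | "horner R (c # cs) x = c \<oplus>\<^bsub>R\<^esub> (x \<otimes>\<^bsub>R\<^esub> horner R cs x)"

text \<open>Synthetic division by \<open>X - x\<close>: the entries are the partial Horner values at
  \<open>x\<close>, and the remainder would be \<open>horner R cs x\<close>.\<close>

primrec horner_quotient :: "('a, 'm) ring_scheme \<Rightarrow> 'a \<Rightarrow> 'a list \<Rightarrow> 'a list"
  where
    "horner_quotient R x [] = []"
  | "horner_quotient R x (c # cs) = (if cs = [] then [] else horner R cs x # horner_quotient R x cs)"

context cring
begin

lemma horner_closed [simp]: "set cs \<subseteq> carrier R \<Longrightarrow> x \<in> carrier R \<Longrightarrow> horner R cs x \<in> carrier R"
  by (induction cs) auto

lemma horner_replicate: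
  "c \<in> carrier R \<Longrightarrow> x \<in> carrier R \<Longrightarrow> horner R (replicate n \<zero> @ [c]) x = x [^] n \<otimes> c"
  by (induction n) (auto simp: m_assoc[symmetric] nat_pow_Suc2 m_comm)

lemma horner_quotient_closed:
  "set cs \<subseteq> carrier R \<Longrightarrow> x \<in> carrier R \<Longrightarrow> set (horner_quotient R x cs) \<subseteq> carrier R"
  by (induction cs) auto

lemma length_horner_quotient: "length (horner_quotient R x cs) = length cs - 1"
  by (induction cs) auto

lemma horner_minus_horner:
  assumes "set cs \<subseteq> carrier R" "x \<in> carrier R" "y \<in> carrier R"
  shows "horner R cs y \<ominus> horner R cs x = (y \<ominus> x) \<otimes> horner R (horner_quotient R x cs) y"
  using assms
proof (induction cs)
  case (Cons c cs)
  show ?case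
  proof (cases "cs = []")
    case True
    then show ?thesis using Cons.prems by (simp add: minus_eq r_neg)
  next
    case False
    let ?q = "horner R (horner_quotient R x cs) y"
    have c: "c \<in> carrier R" "horner R cs x \<in> carrier R" "horner R cs y \<in> carrier R" "?q \<in> carrier R"
      using Cons.prems horner_quotient_closed[of cs x] by auto
    have IH: "horner R cs y \<ominus> horner R cs x = (y \<ominus> x) \<otimes> ?q"
      using Cons by auto
    have "horner R (c # cs) y \<ominus> horner R (c # cs) x
        = y \<otimes> (horner R cs y \<ominus> horner R cs x) \<oplus> (y \<ominus> x) \<otimes> horner R cs x"
      using c Cons.prems(2,3) unfolding horner.simps by algebra
    also have "\<dots> = (y \<ominus> x) \<otimes> (horner R cs x \<oplus> y \<otimes> ?q)"
      unfolding IH using c Cons.prems(2,3) by algebra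
    finally show ?thesis using False by simp
  qed
qed (simp add: minus_eq)

text \<open>For a list \<open>c # cs\<close> with nonempty tail the quotient starts with
  \<open>horner R cs x\<close>, so \<open>c\<close> is recovered as the value at \<open>x\<close>
  minus \<open>x\<close> times that entry; the factor \<open>t\<close> is carried along.\<close>

lemma horner_coeffs_mem:
  assumes I: "additive_subgroup I R" and mult: "\<And>i. i \<in> I \<Longrightarrow> x \<otimes> i \<in> I"
    and "x \<in> carrier R" "t \<in> carrier R" "set cs \<subseteq> carrier R" "t \<otimes> horner R cs x \<in> I"
    and "\<forall>g\<in>set (horner_quotient R x cs). t \<otimes> g \<in> I"
  shows "\<forall>c\<in>set cs. t \<otimes> c \<in> I"
  using assms(3-)
proof (induction cs)
  case (Cons c cs)
  interpret I: additive_subgroup I R by fact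
  show ?case
  proof (cases "cs = []")
    case True
    then show ?thesis using Cons.prems by auto
  next
    case False
    then have 1: "t \<otimes> horner R cs x \<in> I" using Cons.prems by auto
    have 2: "\<forall>c\<in>set cs. t \<otimes> c \<in> I" using Cons False by auto
    have cl: "c \<in> carrier R" "horner R cs x \<in> carrier R" using Cons.prems by auto
    have "t \<otimes> c = t \<otimes> horner R (c # cs) x \<ominus> x \<otimes> (t \<otimes> horner R cs x)"
      unfolding horner.simps using Cons.prems(1,2) cl by algebra
    also have "\<dots> \<in> I"
      unfolding minus_eq using 1 Cons.prems(4) mult by (intro I.a_closed I.a_inv_closed) auto
    finally show ?thesis using 2 by auto
  qed
qed simp

text \<open>One node is eliminated at a time: \<open>p(y) - p(x) = (y - x) g(y)\<close>, so after
  multiplication by a product of differences the quotient \<open>g\<close> takes values in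
  \<open>I\<close> at the remaining nodes. \<open>I\<close> is an additive subgroup stable under
  \<open>T\<close> and the nodes, and not an ideal, because one application takes the image of a
  ring in its quotient field.\<close>

lemma vandermonde:
  assumes I: "additive_subgroup I R"
    and T: "T \<subseteq> carrier R" "\<one> \<in> T" "\<And>s t. s \<in> T \<Longrightarrow> t \<in> T \<Longrightarrow> s \<otimes> t \<in> T"
    and TI: "\<And>t i. t \<in> T \<Longrightarrow> i \<in> I \<Longrightarrow> t \<otimes> i \<in> I"
    and xI: "\<And>x i. x \<in> set xs \<Longrightarrow> i \<in> I \<Longrightarrow> x \<otimes> i \<in> I"
    and "set xs \<subseteq> carrier R" "sorted_wrt (\<lambda>x y. y \<ominus> x \<in> T) xs"
    and "set cs \<subseteq> carrier R" "length cs = length xs" "\<forall>x\<in>set xs. horner R cs x \<in> I"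
  shows "\<exists>t\<in>T. \<forall>c\<in>set cs. t \<otimes> c \<in> I"
  using xI assms(7-)
proof (induction xs arbitrary: cs)
  case Nil
  then show ?case using T by auto
next
  case (Cons x xs)
  interpret I: additive_subgroup I R by fact
  have x: "x \<in> carrier R" and xs: "set xs \<subseteq> carrier R" using Cons.prems by auto
  \<comment> \<open>A single multiplier that every difference \<open>y - x\<close> divides with
    cofactor in \<open>T\<close>; it replaces division by \<open>y - x\<close>.\<close>
  have "\<exists>t\<in>T. \<forall>y\<in>set xs. \<exists>s\<in>T. t = s \<otimes> (y \<ominus> x)"
    using Cons.prems(3) xs
  proof (induction xs)
    case Nil
    then show ?case using T by auto
  next
    case (Cons z zs)
    then obtain t where t: "t \<in> T" "\<forall>y\<in>set zs. \<exists>s\<in>T. t = s \<otimes> (y \<ominus> x)" by auto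
    have z: "z \<ominus> x \<in> T" using Cons.prems by auto
    have "\<exists>s\<in>T. t \<otimes> (z \<ominus> x) = s \<otimes> (y \<ominus> x)" if y: "y \<in> set zs" for y
    proof -
      obtain s where s: "s \<in> T" "t = s \<otimes> (y \<ominus> x)" using t y by blast
      have cl: "s \<in> carrier R" "z \<in> carrier R" "y \<in> carrier R" using s T Cons.prems y by auto
      have "t \<otimes> (z \<ominus> x) = (s \<otimes> (z \<ominus> x)) \<otimes> (y \<ominus> x)" unfolding s(2) using cl x by algebra
      then show ?thesis using s z T by blast
    qed
    then show ?case using t z T by (intro bexI[of _ "t \<otimes> (z \<ominus> x)"]) auto
  qed
  then obtain t where t: "t \<in> T" "\<And>y. y \<in> set xs \<Longrightarrow> \<exists>s\<in>T. t = s \<otimes> (y \<ominus> x)" by blast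
  have tc: "t \<in> carrier R" using t T by auto
  \<comment> \<open>The quotient is multiplied by \<open>t\<close> in advance, so that its values at
    the other nodes lie in \<open>I\<close> as the induction hypothesis requires.\<close>
  define gs where "gs = map ((\<otimes>) t) (horner_quotient R x cs)"
  have hq: "set (horner_quotient R x cs) \<subseteq> carrier R"
    using horner_quotient_closed[OF Cons.prems(4) x] .
  have hm: "horner R (map ((\<otimes>) t) ds) y = t \<otimes> horner R ds y"
    if "set ds \<subseteq> carrier R" "y \<in> carrier R" for ds y
    using that(1)
  proof (induction ds)
    case (Cons d ds)
    then have "d \<in> carrier R" "horner R ds y \<in> carrier R" using that by auto
    moreover have "horner R (map ((\<otimes>) t) ds) y = t \<otimes> horner R ds y" using Cons by auto
    ultimately show ?case using tc that(2) by (simp add: r_distr m_lcomm)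
  qed (use tc in simp)
  have "horner R gs y \<in> I" if y: "y \<in> set xs" for y
  proof -
    obtain s where s: "s \<in> T" "t = s \<otimes> (y \<ominus> x)" using t y by blast
    have cl: "s \<in> carrier R" "y \<in> carrier R" using s T xs y by auto
    have hy: "horner R (horner_quotient R x cs) y \<in> carrier R" using cl hq by simp
    have "horner R gs y = t \<otimes> horner R (horner_quotient R x cs) y"
      unfolding gs_def using hm[OF hq] xs y by auto
    also have "\<dots> = s \<otimes> ((y \<ominus> x) \<otimes> horner R (horner_quotient R x cs) y)"
      unfolding s(2) using cl hy x by (simp add: m_assoc)
    also have "\<dots> = s \<otimes> (horner R cs y \<ominus> horner R cs x)"
      using horner_minus_horner[OF Cons.prems(4) x cl(2)] by simp
    also have "\<dots> \<in> I"
      unfolding minus_eq using Cons.prems(6) y s by (intro TI I.a_closed I.a_inv_closed) auto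
    finally show ?thesis .
  qed
  moreover have "length gs = length xs" "set gs \<subseteq> carrier R"
    unfolding gs_def using Cons.prems hq tc by (auto simp: length_horner_quotient)
  ultimately obtain t' where t': "t' \<in> T" "\<forall>g\<in>set gs. t' \<otimes> g \<in> I"
    using Cons.IH[of gs] Cons.prems by auto
  have t'c: "t' \<in> carrier R" using t' T by auto
  show ?case
  proof (rule bexI[of _ "t' \<otimes> t"])
    show "t' \<otimes> t \<in> T" using t t' T by auto
    show "\<forall>c\<in>set cs. (t' \<otimes> t) \<otimes> c \<in> I"
    proof (rule horner_coeffs_mem[OF I])
      show "\<And>i. i \<in> I \<Longrightarrow> x \<otimes> i \<in> I" using Cons.prems by auto
      show "(t' \<otimes> t) \<otimes> horner R cs x \<in> I" using Cons.prems TI t t' T by auto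
      show "\<forall>g\<in>set (horner_quotient R x cs). (t' \<otimes> t) \<otimes> g \<in> I"
        using t'(2) hq tc t'c unfolding gs_def by (auto simp: m_assoc subset_eq)
    qed (use Cons.prems tc t'c x in auto)
  qed
qed

end

text \<open>Elimination with \<open>I = {0}\<close> at \<open>n + 1\<close> roots of
  \<open>X^n - X\<close> would produce a nonzero multiple of the leading coefficient 1 that
  vanishes.\<close>

lemma (in domain) card_roots_frobenius_le:
  assumes "n \<ge> 2" "distinct xs" "set xs \<subseteq> carrier R" "\<forall>x\<in>set xs. x [^] n = x"
  shows "length xs \<le> n"
proof (rule ccontr)
  assume len: "\<not> length xs \<le> n"
  define ys where "ys = take (Suc n) xs"
  have ys: "distinct ys" "length ys = Suc n" "set ys \<subseteq> set xs"
    using assms len by (auto simp: ys_def dest: in_set_takeD)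
  \<comment> \<open>The polynomial \<open>X^n - X\<close>, constant term first;
    \<open>n \<ge> 2\<close> keeps the entry \<open>-1\<close> apart from the leading 1.\<close>
  define cs where "cs = \<zero> # (\<ominus> \<one>) # (replicate (n - 2) \<zero> @ [\<one>])"
  have lcs: "length cs = length ys" using assms(1) ys by (simp add: cs_def)
  have h: "horner R cs x = x [^] n \<ominus> x" if x: "x \<in> carrier R" for x
  proof -
    have "horner R cs x = x \<otimes> (\<ominus> \<one> \<oplus> x \<otimes> x [^] (n - 2))"
      unfolding cs_def horner.simps using x by (simp add: horner_replicate)
    also have "\<dots> = x \<otimes> x \<otimes> x [^] (n - 2) \<ominus> x" using x nat_pow_closed[OF x, of "n - 2"] by algebra
    also have "x \<otimes> x \<otimes> x [^] (n - 2) = x [^] (Suc (Suc (n - 2)))"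
      using x by (simp add: m_ac)
    also have "Suc (Suc (n - 2)) = n" using assms(1) by arith
    finally show ?thesis .
  qed
  have sw: "sorted_wrt (\<lambda>x y. y \<ominus> x \<in> carrier R - {\<zero>}) ys"
    using ys(1,3) assms(3) unfolding distinct_conv_nth sorted_wrt_iff_nth_less
    by (auto simp: subset_eq r_right_minus_eq dest!: nth_mem)
  have "\<exists>t\<in>carrier R - {\<zero>}. \<forall>c\<in>set cs. t \<otimes> c \<in> {\<zero>}"
  proof (rule vandermonde[where xs = ys])
    show "additive_subgroup {\<zero>} R" by (rule ideal.axioms[OF zeroideal])
    show "\<forall>x\<in>set ys. horner R cs x \<in> {\<zero>}"
      using h ys(3) assms(3,4) by (auto simp: subset_eq minus_eq r_neg)
    show "set cs \<subseteq> carrier R" unfolding cs_def by auto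
  qed (use sw lcs ys assms in \<open>auto simp: integral_iff subset_eq\<close>)
  moreover have "\<one> \<in> set cs" unfolding cs_def by simp
  ultimately show False by auto
qed

section \<open>Maximal ideals, nilpotents, finite fields\<close>

text \<open>Zorn's lemma for the ideals above \<open>I\<close> that miss 1, a condition that
  survives unions of chains.\<close>

lemma (in ring) proper_ideal_le_maximal:
  assumes "ideal I R" "I \<noteq> carrier R"
  shows "\<exists>M. maximalideal M R \<and> I \<subseteq> M"
proof -
  let ?A = "{J. ideal J R \<and> I \<subseteq> J \<and> \<one> \<notin> J}"
  have "\<one> \<notin> I" using assms ideal.one_imp_carrier by blast
  then have "?A \<noteq> {}" using assms by blast
  moreover have "\<Union>\<C> \<in> ?A" if "\<C> \<noteq> {}" "subset.chain ?A \<C>" for \<C>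
  proof -
    have ch: "subset.chain {J. ideal J R} \<C>" and sub: "\<C> \<subseteq> ?A"
      using that unfolding pred_on.chain_def by auto
    have "ideal (\<Union>\<C>) R" using chain_Union_is_ideal[OF ch] that(1) by simp
    then show ?thesis using sub that(1) by auto
  qed
  ultimately obtain M where M: "M \<in> ?A" "\<forall>N\<in>?A. M \<subseteq> N \<longrightarrow> N = M"
    using subset_Zorn_nonempty[of ?A] by auto
  have "maximalideal M R"
  proof (rule maximalidealI)
    show "ideal M R" using M by auto
    show "carrier R \<noteq> M" using M by auto
    fix J assume J: "ideal J R" "M \<subseteq> J" "J \<subseteq> carrier R"
    show "J = M \<or> J = carrier R"
    proof (cases "\<one> \<in> J")
      case True
      then show ?thesis using J ideal.one_imp_carrier by blast
    next
      case False
      then show ?thesis using M J by auto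
    qed
  qed
  then show ?thesis using M by auto
qed

lemma (in ring_hom_cring) primeideal_vimage:
  assumes "primeideal P S"
  shows "primeideal {r \<in> carrier R. h r \<in> P} R"
proof -
  interpret P: primeideal P S by fact
  show ?thesis
  proof (rule primeidealI[OF ring.ideal_vimage[OF P.is_ideal] R.is_cring])
    have "h \<one> \<notin> P" using P.I_notcarr P.one_imp_carrier hom_one by metis
    then show "carrier R \<noteq> {r \<in> carrier R. h r \<in> P}"
      using R.one_closed by blast
    fix a b assume "a \<in> carrier R" "b \<in> carrier R" "a \<otimes> b \<in> {r \<in> carrier R. h r \<in> P}"
    then show "a \<in> {r \<in> carrier R. h r \<in> P} \<or> b \<in> {r \<in> carrier R. h r \<in> P}"
      using P.I_prime[of "h a" "h b"] by auto
  qed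
qed

text \<open>If no power of \<open>z\<close> vanishes, inverting \<open>z\<close> gives a nonzero
  ring; a maximal ideal of it contracts to a prime ideal that misses \<open>z\<close>.\<close>

lemma (in cring) nilpotent_if_in_all_primes:
  assumes z: "z \<in> carrier R" and P: "\<And>P. primeideal P R \<Longrightarrow> z \<in> P"
  shows "\<exists>n::nat. z [^] n = \<zero>"
proof (rule ccontr)
  assume nz: "\<nexists>n::nat. z [^] n = \<zero>"
  define S where "S = range (\<lambda>n::nat. z [^] n)"
  interpret L: localization R S
  proof unfold_locales
    show "S \<subseteq> carrier R" using z unfolding S_def by auto
    show "\<one> \<in> S" unfolding S_def using nat_pow_0[of z] by (metis rangeI)
    fix s t assume "s \<in> S" "t \<in> S"
    then show "s \<otimes> t \<in> S" unfolding S_def using z by (auto simp: nat_pow_mult)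
  qed
  interpret LL: cring "loc R S" by (rule L.loc_cring)
  interpret h: ring_hom_cring R "loc R S" "\<lambda>a. loc_frac R S a \<one>" by (rule L.frac_hom)
  have "\<one>\<^bsub>loc R S\<^esub> \<noteq> \<zero>\<^bsub>loc R S\<^esub>"
    unfolding L.loc_one using L.frac_eq_zero_iff[OF one_closed L.S_one] nz z
    by (auto simp: S_def)
  then have "{\<zero>\<^bsub>loc R S\<^esub>} \<noteq> carrier (loc R S)" by auto
  then obtain M where M: "maximalideal M (loc R S)"
    using LL.proper_ideal_le_maximal[OF LL.zeroideal] by blast
  interpret M: primeideal M "loc R S" by (rule LL.maximalideal_prime[OF M])
  have "primeideal {r \<in> carrier R. loc_frac R S r \<one> \<in> M} R"
    by (rule h.primeideal_vimage) (rule M.primeideal)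
  then have "loc_frac R S z \<one> \<in> M" using P by blast
  moreover have zS: "z \<in> S" unfolding S_def using z nat_pow_eone by (metis rangeI)
  ultimately have "loc_frac R S \<one> z \<otimes>\<^bsub>loc R S\<^esub> loc_frac R S z \<one> \<in> M"
    by (intro M.I_l_closed) auto
  then show False using L.frac_inverse[OF zS] M.I_notcarr M.one_imp_carrier by auto
qed

text \<open>Lagrange's theorem in the unit group, whose order is one less than the number of
  elements; zero is treated apart.\<close>

lemma (in field) finite_field_pow_card:
  assumes "finite (carrier R)" "x \<in> carrier R"
  shows "x [^] card (carrier R) = x"
proof (cases "x = \<zero>")
  case True
  have "card (carrier R) \<noteq> 0" using assms by auto
  then show ?thesis unfolding True by (rule nat_pow_zero)
next
  case False
  have "card (Units R) = card (carrier R) - 1"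
    unfolding field_Units using assms by simp
  moreover have "card (carrier R) > 0" using assms by (auto simp: card_gt_0_iff)
  ultimately have c: "Suc (card (Units R)) = card (carrier R)" by simp
  have "x [^] card (Units R) = \<one>"
    by (rule units_power_order_eq_one) (use assms False in \<open>auto simp: field_Units\<close>)
  then have "x [^] Suc (card (Units R)) = x" using assms by simp
  then show ?thesis unfolding c .
qed

section \<open>Residue algebras\<close>

lemma (in ideal) rcos_eq_iff:
  "a \<in> carrier R \<Longrightarrow> b \<in> carrier R \<Longrightarrow> I +> a = I +> b \<longleftrightarrow> a \<ominus> b \<in> I"
  using quotient_eq_iff_same_a_r_cos[OF is_ideal] by simp

lemma (in ideal) rcos_eq_self_iff: "a \<in> carrier R \<Longrightarrow> I +> a = I \<longleftrightarrow> a \<in> I"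
  using rcos_const_imp_mem a_rcos_zero[OF is_ideal] by blast

lemma (in ideal) Quot_cases:
  assumes "x \<in> carrier (R Quot I)"
  obtains a where "a \<in> carrier R" "x = I +> a"
  using assms unfolding FactRing_simps by auto

lemma (in ideal) minus_mem: "a \<in> I \<Longrightarrow> b \<in> I \<Longrightarrow> a \<ominus> b \<in> I"
  unfolding minus_eq
  by (intro additive_subgroup.a_closed[OF is_additive_subgroup] additive_subgroup.a_inv_closed[OF is_additive_subgroup])

lemma Quot_zero: "\<zero>\<^bsub>R Quot I\<^esub> = I"
  by (simp add: FactRing_def)

text \<open>An algebra isomorphism is forced on the image of the structure map, so only surjectivity
  and kernel of \<open>\<beta>\<close> matter. Every condition about \<open>D\<close>-algebra
  isomorphisms is handled through this criterion.\<close>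

lemma alg_isomorphic_Quot_iff:
  assumes "ring_hom_cring D B \<beta>" and p: "ideal p D"
  shows "alg_isomorphic D B \<beta> (D Quot p) (quot_map D p) \<longleftrightarrow>
    \<beta> ` carrier D = carrier B \<and> {d \<in> carrier D. \<beta> d = \<zero>\<^bsub>B\<^esub>} = p"
proof -
  interpret h: ring_hom_cring D B \<beta> by fact
  interpret p: ideal p D by fact
  interpret Q: ring "D Quot p" by (rule p.quotient_is_ring)
  show ?thesis
  proof
    assume "alg_isomorphic D B \<beta> (D Quot p) (quot_map D p)"
    then obtain f where f: "f \<in> ring_iso B (D Quot p)" and fd: "\<And>d. d \<in> carrier D \<Longrightarrow> f (\<beta> d) = p +>\<^bsub>D\<^esub> d"
      unfolding alg_isomorphic_def alg_hom_def quot_map_def by auto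
    have inj: "inj_on f (carrier B)" and fB: "f ` carrier B = carrier (D Quot p)" and fh: "f \<in> ring_hom B (D Quot p)"
      using f unfolding ring_iso_def bij_betw_def by auto
    interpret f: ring_hom_ring B "D Quot p" f
      by (rule ring_hom_ringI2[OF h.S.ring_axioms Q.ring_axioms fh])
    have "\<beta> ` carrier D = carrier B"
    proof (intro equalityI subsetI)
      fix b assume b: "b \<in> carrier B"
      then have "f b \<in> carrier (D Quot p)" using fB by blast
      then obtain d where d: "d \<in> carrier D" "f b = p +>\<^bsub>D\<^esub> d" by (rule p.Quot_cases)
      then have "f b = f (\<beta> d)" using fd by simp
      then have "b = \<beta> d" using inj_onD[OF inj] b h.hom_closed[OF d(1)] by blast
      then show "b \<in> \<beta> ` carrier D" using d(1) by blast
    qed auto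
    moreover have "\<beta> d = \<zero>\<^bsub>B\<^esub> \<longleftrightarrow> d \<in> p" if d: "d \<in> carrier D" for d
    proof -
      have "\<beta> d = \<zero>\<^bsub>B\<^esub> \<longleftrightarrow> f (\<beta> d) = f \<zero>\<^bsub>B\<^esub>"
        using inj_on_eq_iff[OF inj h.hom_closed[OF d] h.S.zero_closed] by blast
      also have "\<dots> \<longleftrightarrow> p +>\<^bsub>D\<^esub> d = p" using fd[OF d] f.hom_zero by (simp add: Quot_zero)
      also have "\<dots> \<longleftrightarrow> d \<in> p" by (rule p.rcos_eq_self_iff[OF d])
      finally show ?thesis .
    qed
    ultimately show "\<beta> ` carrier D = carrier B \<and> {d \<in> carrier D. \<beta> d = \<zero>\<^bsub>B\<^esub>} = p"
      using p.a_Hcarr by blast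
  next
    assume *: "\<beta> ` carrier D = carrier B \<and> {d \<in> carrier D. \<beta> d = \<zero>\<^bsub>B\<^esub>} = p"
    then have ker: "a_kernel D B \<beta> = p" unfolding a_kernel_def' by blast
    define g where "g = (\<lambda>N. the_elem (\<beta> ` N))"
    have g: "g \<in> ring_iso (D Quot p) B"
      using h.ring.FactRing_iso_set * unfolding ker g_def by blast
    have gd: "g (p +>\<^bsub>D\<^esub> d) = \<beta> d" if "d \<in> carrier D" for d
      using h.ring.the_elem_simp[OF that] unfolding ker g_def .
    have "inv_into (carrier (D Quot p)) g \<in> ring_iso B (D Quot p)"
      by (rule ring_iso_set_sym[OF Q.ring_axioms g])
    moreover have "inv_into (carrier (D Quot p)) g (\<beta> d) = p +>\<^bsub>D\<^esub> d" if d: "d \<in> carrier D" for d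
    proof -
      have "p +>\<^bsub>D\<^esub> d \<in> carrier (D Quot p)" using ring_hom_closed[OF p.rcos_ring_hom d] .
      then show ?thesis
        using g gd[OF d] inv_into_f_f[of g "carrier (D Quot p)" "p +>\<^bsub>D\<^esub> d"]
        unfolding ring_iso_def bij_betw_def by auto
    qed
    ultimately show "alg_isomorphic D B \<beta> (D Quot p) (quot_map D p)"
      unfolding alg_isomorphic_def alg_hom_def quot_map_def ring_iso_def by auto
  qed
qed

text \<open>Maximality is assumed outright; \<open>finite_prime_imp_maximal\<close> supplies it for
  primes of finite norm.\<close>

locale finite_residue = ring_hom_cring D A \<phi> + p: maximalideal p D
  for D (structure) and A (structure) and \<phi> p +
  assumes fin: "finite_norm D p"
begin

abbreviation "q \<equiv> ideal_norm D p"
abbreviation "J \<equiv> extended_ideal A \<phi> p"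

lemma phi_p_subset: "\<phi> ` p \<subseteq> carrier A"
  using p.a_subset by auto

sublocale J: ideal J A
  unfolding extended_ideal_def by (rule S.genideal_ideal[OF phi_p_subset])

lemma phi_mem_J: "d \<in> p \<Longrightarrow> \<phi> d \<in> J"
  unfolding extended_ideal_def using S.genideal_self[OF phi_p_subset] by auto

lemma J_subset_iff: "ideal I A \<Longrightarrow> J \<subseteq> I \<longleftrightarrow> \<phi> ` p \<subseteq> I"
  using phi_mem_J S.genideal_minimal[of I "\<phi> ` p"] unfolding extended_ideal_def by blast

sublocale k: field "D Quot p"
  by (rule p.quotient_is_field[OF R.is_cring])

lemma fin_k: "finite (carrier (D Quot p))" "card (carrier (D Quot p)) = q"
  using fin unfolding finite_norm_def ideal_norm_def by auto

lemma q_ge_2: "q \<ge> 2"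
proof -
  have "card {\<zero>\<^bsub>D Quot p\<^esub>, \<one>\<^bsub>D Quot p\<^esub>} \<le> q"
    unfolding fin_k(2)[symmetric] by (rule card_mono[OF fin_k(1)]) auto
  then show ?thesis using k.one_not_zero by simp
qed

lemma frobenius_D: "d \<in> carrier D \<Longrightarrow> (d [^]\<^bsub>D\<^esub> q) \<ominus>\<^bsub>D\<^esub> d \<in> p"
proof -
  assume d: "d \<in> carrier D"
  interpret h: ring_hom_ring D "D Quot p" "(+>\<^bsub>D\<^esub>) p" by (rule p.rcos_ring_hom_ring)
  have "(p +>\<^bsub>D\<^esub> d) [^]\<^bsub>D Quot p\<^esub> q = p +>\<^bsub>D\<^esub> d"
    using k.finite_field_pow_card[OF fin_k(1)] h.hom_closed[OF d] unfolding fin_k(2) by blast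
  then have "p +>\<^bsub>D\<^esub> (d [^]\<^bsub>D\<^esub> q) = p +>\<^bsub>D\<^esub> d" using h.hom_nat_pow[OF d] by simp
  then show ?thesis using p.rcos_eq_iff d by simp
qed

lemma inverse_mod_p:
  assumes "d \<in> carrier D" "d \<notin> p"
  shows "\<exists>e\<in>carrier D. e \<otimes>\<^bsub>D\<^esub> d \<ominus>\<^bsub>D\<^esub> \<one>\<^bsub>D\<^esub> \<in> p"
proof -
  interpret h: ring_hom_ring D "D Quot p" "(+>\<^bsub>D\<^esub>) p" by (rule p.rcos_ring_hom_ring)
  have "p +>\<^bsub>D\<^esub> d \<in> carrier (D Quot p) - {\<zero>\<^bsub>D Quot p\<^esub>}"
    using assms h.hom_closed by (simp add: Quot_zero p.rcos_eq_self_iff)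
  then have "p +>\<^bsub>D\<^esub> d \<in> Units (D Quot p)" using k.field_Units by simp
  then obtain y where "y \<in> carrier (D Quot p)" "y \<otimes>\<^bsub>D Quot p\<^esub> (p +>\<^bsub>D\<^esub> d) = \<one>\<^bsub>D Quot p\<^esub>"
    unfolding Units_def by blast
  then obtain e where e: "e \<in> carrier D" "(p +>\<^bsub>D\<^esub> e) \<otimes>\<^bsub>D Quot p\<^esub> (p +>\<^bsub>D\<^esub> d) = \<one>\<^bsub>D Quot p\<^esub>"
    by (metis p.Quot_cases)
  then have "p +>\<^bsub>D\<^esub> (e \<otimes>\<^bsub>D\<^esub> d) = p +>\<^bsub>D\<^esub> \<one>\<^bsub>D\<^esub>"
    using assms(1) h.hom_mult[of e d] h.hom_one by simp
  then have "e \<otimes>\<^bsub>D\<^esub> d \<ominus>\<^bsub>D\<^esub> \<one>\<^bsub>D\<^esub> \<in> p" using p.rcos_eq_iff[of "e \<otimes>\<^bsub>D\<^esub> d" "\<one>\<^bsub>D\<^esub>"] e(1) assms(1) by simp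
  then show ?thesis using e(1) by blast
qed

text \<open>The preimage is a proper ideal that contains the maximal ideal \<open>p\<close>. This
  turns lying over \<open>p\<close> into the containment \<open>J \<subseteq> I\<close>.\<close>

lemma comap_eq_p:
  assumes "ideal I A" "I \<noteq> carrier A" "J \<subseteq> I"
  shows "{d \<in> carrier D. \<phi> d \<in> I} = p"
proof -
  interpret I: ideal I A by fact
  have id: "ideal {d \<in> carrier D. \<phi> d \<in> I} D" by (rule ring.ideal_vimage[OF assms(1)])
  have "\<one>\<^bsub>A\<^esub> \<notin> I" using assms I.one_imp_carrier by blast
  then have "{d \<in> carrier D. \<phi> d \<in> I} \<noteq> carrier D"
    using hom_one R.one_closed mem_Collect_eq by metis
  moreover have "p \<subseteq> {d \<in> carrier D. \<phi> d \<in> I}" using phi_mem_J assms(3) p.a_subset by auto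
  ultimately show ?thesis using p.I_maximal[OF id] by auto
qed

lemma lies_over_iff: "ideal I A \<Longrightarrow> I \<noteq> carrier A \<Longrightarrow> lies_over D \<phi> I p \<longleftrightarrow> J \<subseteq> I"
  using comap_eq_p J_subset_iff unfolding lies_over_def by blast

text \<open>Modulo \<open>I\<close> the element \<open>x\<close> is the image of \<open>d\<close>,
  and the \<open>q\<close>-th power map fixes \<open>d\<close> modulo \<open>p\<close>.\<close>

lemma frobenius_mem:
  assumes I: "ideal I A" "J \<subseteq> I" and x: "x \<in> carrier A" and d: "d \<in> carrier D" and xd: "x \<ominus>\<^bsub>A\<^esub> \<phi> d \<in> I"
  shows "(x [^]\<^bsub>A\<^esub> q) \<ominus>\<^bsub>A\<^esub> x \<in> I"
proof -
  interpret I: ideal I A by fact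
  interpret h: ring_hom_ring A "A Quot I" "(+>\<^bsub>A\<^esub>) I" by (rule I.rcos_ring_hom_ring)
  have "I +>\<^bsub>A\<^esub> (\<phi> d [^]\<^bsub>A\<^esub> q) = I +>\<^bsub>A\<^esub> \<phi> d"
  proof (subst I.rcos_eq_iff)
    have "\<phi> ((d [^]\<^bsub>D\<^esub> q) \<ominus>\<^bsub>D\<^esub> d) \<in> I" using phi_mem_J[OF frobenius_D[OF d]] I(2) by blast
    then show "\<phi> d [^]\<^bsub>A\<^esub> q \<ominus>\<^bsub>A\<^esub> \<phi> d \<in> I" using d by (simp add: R.minus_eq S.minus_eq)
  qed (use d in auto)
  moreover have e: "I +>\<^bsub>A\<^esub> x = I +>\<^bsub>A\<^esub> \<phi> d" using I.rcos_eq_iff x d xd by simp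
  ultimately have "I +>\<^bsub>A\<^esub> (x [^]\<^bsub>A\<^esub> q) = I +>\<^bsub>A\<^esub> x"
    using h.hom_nat_pow x d by simp
  then show ?thesis using I.rcos_eq_iff x by simp
qed

text \<open>Every element of the domain \<open>A / P\<close> is a root of \<open>X^q - X\<close>,
  which has at most \<open>q\<close> roots there; the images of the \<open>q\<close> classes of
  \<open>D / p\<close> already exhaust them.\<close>

lemma residue_if_power_congruence:
  assumes pc: "power_congruence D p A \<phi>" and P: "primeideal P A" "J \<subseteq> P" and x: "x \<in> carrier A"
  shows "\<exists>d\<in>carrier D. x \<ominus>\<^bsub>A\<^esub> \<phi> d \<in> P"
proof -
  interpret P: primeideal P A by fact
  interpret E: domain "A Quot P" by (rule P.quotient_is_domain)
  interpret h: ring_hom_ring A "A Quot P" "(+>\<^bsub>A\<^esub>) P" by (rule P.rcos_ring_hom_ring)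
  \<comment> \<open>The map from \<open>D / p\<close> to \<open>A / P\<close>, through chosen
    representatives. It only has to be injective, so as to yield \<open>q\<close> distinct
    elements.\<close>
  define f where "f = (\<lambda>K. P +>\<^bsub>A\<^esub> \<phi> (SOME d. d \<in> carrier D \<and> K = p +>\<^bsub>D\<^esub> d))"
  have some: "\<exists>d. d \<in> carrier D \<and> K = p +>\<^bsub>D\<^esub> d \<and> f K = P +>\<^bsub>A\<^esub> \<phi> d"
    if K: "K \<in> carrier (D Quot p)" for K
  proof -
    have "\<exists>d. d \<in> carrier D \<and> K = p +>\<^bsub>D\<^esub> d" by (rule p.Quot_cases[OF K]) blast
    then show ?thesis unfolding f_def by (rule someI2_ex) blast
  qed
  have "inj_on f (carrier (D Quot p))"
  proof (rule inj_onI)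
    fix K L assume KL: "K \<in> carrier (D Quot p)" "L \<in> carrier (D Quot p)" "f K = f L"
    obtain d e where de: "d \<in> carrier D" "K = p +>\<^bsub>D\<^esub> d" "f K = P +>\<^bsub>A\<^esub> \<phi> d"
      "e \<in> carrier D" "L = p +>\<^bsub>D\<^esub> e" "f L = P +>\<^bsub>A\<^esub> \<phi> e"
      using some KL by meson
    have "P +>\<^bsub>A\<^esub> \<phi> d = P +>\<^bsub>A\<^esub> \<phi> e" using KL(3) de by simp
    then have "\<phi> d \<ominus>\<^bsub>A\<^esub> \<phi> e \<in> P" using P.rcos_eq_iff de by simp
    then have "\<phi> (d \<ominus>\<^bsub>D\<^esub> e) \<in> P" using de by (simp add: R.minus_eq S.minus_eq)
    then have "d \<ominus>\<^bsub>D\<^esub> e \<in> p" using comap_eq_p[OF P.is_ideal _ P(2)] P.I_notcarr de(1,4) R.minus_closed by blast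
    then show "K = L" using p.rcos_eq_iff de by simp
  qed
  then have card: "card (f ` carrier (D Quot p)) = q" using card_image fin_k by metis
  have fin: "finite (f ` carrier (D Quot p))" using fin_k by simp
  then obtain ys where ys: "set ys = f ` carrier (D Quot p)" "distinct ys" using finite_distinct_list by blast
  have len: "length ys = q" using distinct_card[OF ys(2)] card ys by simp
  have cl: "set ys \<subseteq> carrier (A Quot P)"
  proof
    fix y assume "y \<in> set ys"
    then obtain K where "K \<in> carrier (D Quot p)" "y = f K" using ys by auto
    then obtain d where "d \<in> carrier D" "y = P +>\<^bsub>A\<^esub> \<phi> d" using some by metis
    then show "y \<in> carrier (A Quot P)" using h.hom_closed by simp
  qed
  have fr: "y [^]\<^bsub>A Quot P\<^esub> q = y" if y: "y \<in> carrier (A Quot P)" for y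
  proof -
    obtain a where a: "a \<in> carrier A" "y = P +>\<^bsub>A\<^esub> a" using y by (rule P.Quot_cases)
    have "(a [^]\<^bsub>A\<^esub> q) \<ominus>\<^bsub>A\<^esub> a \<in> P" using pc a P(2) unfolding power_congruence_def by blast
    then show ?thesis using a P.rcos_eq_iff[of "a [^]\<^bsub>A\<^esub> q" a] h.hom_nat_pow[of a q] by simp
  qed
  have "P +>\<^bsub>A\<^esub> x \<in> set ys"
  proof (rule ccontr)
    assume "P +>\<^bsub>A\<^esub> x \<notin> set ys"
    then have "distinct ((P +>\<^bsub>A\<^esub> x) # ys)" using ys by simp
    moreover have "set ((P +>\<^bsub>A\<^esub> x) # ys) \<subseteq> carrier (A Quot P)" using cl h.hom_closed[OF x] by simp
    ultimately have "length ((P +>\<^bsub>A\<^esub> x) # ys) \<le> q"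
      using fr by (intro E.card_roots_frobenius_le[OF q_ge_2]) auto
    then show False using len by simp
  qed
  then obtain K where "K \<in> carrier (D Quot p)" "P +>\<^bsub>A\<^esub> x = f K" using ys by auto
  then obtain d where "d \<in> carrier D" "P +>\<^bsub>A\<^esub> x = P +>\<^bsub>A\<^esub> \<phi> d" using some by metis
  then show ?thesis using P.rcos_eq_iff x by auto
qed

text \<open>The multiplier is \<open>u = 1 - x^(q-1)\<close>: it lies outside \<open>P\<close>
  because \<open>x\<close> is in \<open>P\<close> and \<open>q \<ge> 2\<close>, and
  \<open>u x = x - x^q\<close>.\<close>

lemma annihilator_if_power_congruence:
  assumes pc: "power_congruence D p A \<phi>" and P: "primeideal P A" and x: "x \<in> P"
  shows "\<exists>u\<in>carrier A - P. u \<otimes>\<^bsub>A\<^esub> x \<in> J"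
proof -
  interpret P: primeideal P A by fact
  have xc: "x \<in> carrier A" using x P.a_Hcarr by blast
  obtain m where m: "q = Suc (Suc m)" using q_ge_2 using that[of "q - 2"] by simp
  let ?e = "x [^]\<^bsub>A\<^esub> Suc m"
  have ec: "?e \<in> carrier A" using xc by blast
  have "?e \<in> P" unfolding S.nat_pow_Suc using x xc by (intro P.I_l_closed) auto
  then have "\<one>\<^bsub>A\<^esub> \<ominus>\<^bsub>A\<^esub> ?e \<notin> P"
  proof -
    assume e: "?e \<in> P"
    have "\<one>\<^bsub>A\<^esub> = (\<one>\<^bsub>A\<^esub> \<ominus>\<^bsub>A\<^esub> ?e) \<oplus>\<^bsub>A\<^esub> ?e" using ec by algebra
    then show ?thesis using e P.a_closed[of "\<one>\<^bsub>A\<^esub> \<ominus>\<^bsub>A\<^esub> ?e" ?e] P.one_imp_carrier P.I_notcarr by auto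
  qed
  moreover have "(\<one>\<^bsub>A\<^esub> \<ominus>\<^bsub>A\<^esub> ?e) \<otimes>\<^bsub>A\<^esub> x \<in> J"
  proof -
    have "\<ominus>\<^bsub>A\<^esub> ((x [^]\<^bsub>A\<^esub> q) \<ominus>\<^bsub>A\<^esub> x) \<in> J"
      using pc xc unfolding power_congruence_def by (intro J.a_inv_closed) blast
    also have "\<ominus>\<^bsub>A\<^esub> ((x [^]\<^bsub>A\<^esub> q) \<ominus>\<^bsub>A\<^esub> x) = (\<one>\<^bsub>A\<^esub> \<ominus>\<^bsub>A\<^esub> ?e) \<otimes>\<^bsub>A\<^esub> x"
      unfolding m S.nat_pow_Suc[of x "Suc m"] using ec xc by algebra
    finally show ?thesis .
  qed
  ultimately show ?thesis using ec by blast
qed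

text \<open>Surjectivity becomes the existence of residues \<open>d\<close>; the kernel condition
  becomes \<open>J \<subseteq> I\<close>, since a proper ideal above \<open>J\<close> contracts
  exactly to \<open>p\<close>.\<close>

lemma alg_isomorphic_Quot_prime_iff:
  assumes I: "ideal I A" "I \<noteq> carrier A"
  shows "alg_isomorphic D (A Quot I) (quot_map A I \<circ> \<phi>) (D Quot p) (quot_map D p) \<longleftrightarrow>
    J \<subseteq> I \<and> (\<forall>x\<in>carrier A. \<exists>d\<in>carrier D. x \<ominus>\<^bsub>A\<^esub> \<phi> d \<in> I)"
proof -
  interpret I: ideal I A by fact
  interpret h: ring_hom_cring A "A Quot I" "(+>\<^bsub>A\<^esub>) I"
    by (rule I.rcos_ring_hom_cring[OF S.is_cring])
  have hc: "ring_hom_cring D (A Quot I) (quot_map A I \<circ> \<phi>)"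
    by (rule ring_hom_cringI[OF R.is_cring h.S.is_cring])
      (auto intro!: ring_hom_memI simp: quot_map_def)
  have 1: "{d \<in> carrier D. (quot_map A I \<circ> \<phi>) d = \<zero>\<^bsub>A Quot I\<^esub>} = {d \<in> carrier D. \<phi> d \<in> I}"
    using I.rcos_eq_self_iff[OF hom_closed] unfolding quot_map_def Quot_zero comp_def by blast
  have 2: "(quot_map A I \<circ> \<phi>) ` carrier D = carrier (A Quot I) \<longleftrightarrow>
      (\<forall>x\<in>carrier A. \<exists>d\<in>carrier D. x \<ominus>\<^bsub>A\<^esub> \<phi> d \<in> I)"
  proof
    assume *: "(quot_map A I \<circ> \<phi>) ` carrier D = carrier (A Quot I)"
    show "\<forall>x\<in>carrier A. \<exists>d\<in>carrier D. x \<ominus>\<^bsub>A\<^esub> \<phi> d \<in> I"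
    proof
      fix x assume x: "x \<in> carrier A"
      then have "I +>\<^bsub>A\<^esub> x \<in> (quot_map A I \<circ> \<phi>) ` carrier D" using * h.hom_closed by blast
      then show "\<exists>d\<in>carrier D. x \<ominus>\<^bsub>A\<^esub> \<phi> d \<in> I" using x by (auto simp: quot_map_def I.rcos_eq_iff)
    qed
  next
    assume *: "\<forall>x\<in>carrier A. \<exists>d\<in>carrier D. x \<ominus>\<^bsub>A\<^esub> \<phi> d \<in> I"
    show "(quot_map A I \<circ> \<phi>) ` carrier D = carrier (A Quot I)"
    proof (intro equalityI subsetI)
      fix y assume "y \<in> carrier (A Quot I)"
      then obtain x where x: "x \<in> carrier A" "y = I +>\<^bsub>A\<^esub> x" by (rule I.Quot_cases)
      then obtain d where d: "d \<in> carrier D" "x \<ominus>\<^bsub>A\<^esub> \<phi> d \<in> I" using * by blast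
      then have "y = (quot_map A I \<circ> \<phi>) d"
        using x I.rcos_eq_iff[of x "\<phi> d"] by (simp add: quot_map_def)
      then show "y \<in> (quot_map A I \<circ> \<phi>) ` carrier D" using d(1) by blast
    qed (auto simp: quot_map_def)
  qed
  have 3: "{d \<in> carrier D. \<phi> d \<in> I} = p \<longleftrightarrow> J \<subseteq> I"
    using comap_eq_p[OF I] J_subset_iff[OF I(1)] by blast
  show ?thesis
    unfolding alg_isomorphic_Quot_iff[OF hc p.is_ideal] 1 2 3 by blast
qed

text \<open>Equality of the two extended ideals means that each element of \<open>P\<close> enters
  \<open>J\<close> after multiplication by an element outside \<open>P\<close>. This removes the
  localization from the conditions at ideals of \<open>A\<close>.\<close>

lemma unramified_iff:
  assumes P: "primeideal P A"
  shows "unramified_with_residue D p A \<phi> P \<longleftrightarrow>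
    J \<subseteq> P \<and> (\<forall>x\<in>P. \<exists>u\<in>carrier A - P. u \<otimes>\<^bsub>A\<^esub> x \<in> J) \<and> (\<forall>x\<in>carrier A. \<exists>d\<in>carrier D. x \<ominus>\<^bsub>A\<^esub> \<phi> d \<in> P)"
proof -
  interpret P: primeideal P A by fact
  interpret L: localization A "carrier A - P" by (rule S.localization_primeI[OF P])
  have lm: "loc_map A P = (\<lambda>a. loc_frac A (carrier A - P) a \<one>\<^bsub>A\<^esub>)" unfolding loc_map_def by auto
  have PP: "Idl\<^bsub>A\<^esub> P = P" using S.genideal_minimal[OF P.is_ideal] S.genideal_self[of P] P.a_subset by blast
  have e1: "extended_ideal (loc_at A P) (loc_map A P \<circ> \<phi>) p
      = {loc_frac A (carrier A - P) a s | a s. a \<in> J \<and> s \<in> carrier A - P}"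
    unfolding extended_ideal_def loc_at_def lm image_comp[symmetric] by (rule L.genideal_frac[OF phi_p_subset])
  have e2: "extended_ideal (loc_at A P) (loc_map A P) P
      = {loc_frac A (carrier A - P) a s | a s. a \<in> P \<and> s \<in> carrier A - P}"
    unfolding extended_ideal_def loc_at_def lm using L.genideal_frac[OF P.a_subset] unfolding PP .
  have e1_iff: "loc_frac A (carrier A - P) a s \<in> extended_ideal (loc_at A P) (loc_map A P \<circ> \<phi>) p
      \<longleftrightarrow> (\<exists>u\<in>carrier A - P. u \<otimes>\<^bsub>A\<^esub> a \<in> J)" if "a \<in> carrier A" "s \<in> carrier A - P" for a s
    unfolding extended_ideal_def loc_at_def lm image_comp[symmetric]
    by (rule L.frac_in_genideal_iff[OF phi_p_subset that])
  have "extended_ideal (loc_at A P) (loc_map A P \<circ> \<phi>) p = extended_ideal (loc_at A P) (loc_map A P) P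
      \<longleftrightarrow> (\<forall>x\<in>P. \<exists>u\<in>carrier A - P. u \<otimes>\<^bsub>A\<^esub> x \<in> J)" if JP: "J \<subseteq> P"
  proof
    assume eq: "extended_ideal (loc_at A P) (loc_map A P \<circ> \<phi>) p = extended_ideal (loc_at A P) (loc_map A P) P"
    show "\<forall>x\<in>P. \<exists>u\<in>carrier A - P. u \<otimes>\<^bsub>A\<^esub> x \<in> J"
    proof
      fix x assume x: "x \<in> P"
      then have "loc_frac A (carrier A - P) x \<one>\<^bsub>A\<^esub> \<in> extended_ideal (loc_at A P) (loc_map A P \<circ> \<phi>) p"
        unfolding eq e2 using L.S_one by blast
      then show "\<exists>u\<in>carrier A - P. u \<otimes>\<^bsub>A\<^esub> x \<in> J" using e1_iff x P.a_Hcarr L.S_one by blast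
    qed
  next
    assume *: "\<forall>x\<in>P. \<exists>u\<in>carrier A - P. u \<otimes>\<^bsub>A\<^esub> x \<in> J"
    show "extended_ideal (loc_at A P) (loc_map A P \<circ> \<phi>) p = extended_ideal (loc_at A P) (loc_map A P) P"
    proof (intro equalityI subsetI)
      fix y assume "y \<in> extended_ideal (loc_at A P) (loc_map A P \<circ> \<phi>) p"
      then show "y \<in> extended_ideal (loc_at A P) (loc_map A P) P" unfolding e1 e2 using JP by blast
    next
      fix y assume "y \<in> extended_ideal (loc_at A P) (loc_map A P) P"
      then obtain a s where as: "a \<in> P" "s \<in> carrier A - P" "y = loc_frac A (carrier A - P) a s"
        unfolding e2 by blast
      show "y \<in> extended_ideal (loc_at A P) (loc_map A P \<circ> \<phi>) p"
        unfolding as(3) e1_iff[OF P.a_Hcarr[OF as(1)] as(2)] using * as(1) by blast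
    qed
  qed
  then show ?thesis
    unfolding unramified_with_residue_def
      alg_isomorphic_Quot_prime_iff[OF P.is_ideal P.I_notcarr[symmetric]] by blast
qed

text \<open>Local-global argument for \<open>z = x^q - x\<close>: a proper \<open>(J : z)\<close>
  would lie in a maximal ideal \<open>M\<close> above \<open>J\<close>. The residue condition puts
  \<open>z\<close> into \<open>M\<close>, and then \<open>p A_M = M A_M\<close> produces an element
  of \<open>(J : z)\<close> outside \<open>M\<close>. As only maximal ideals are used, this is the
  way back from the conditions on maximal and on prime ideals alike.\<close>

lemma power_congruence_if_unramified:
  assumes "\<And>M. maximalideal M A \<Longrightarrow> lies_over D \<phi> M p \<Longrightarrow> unramified_with_residue D p A \<phi> M"
  shows "power_congruence D p A \<phi>"
  unfolding power_congruence_def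
proof (intro ballI, rule ccontr)
  fix x let ?z = "(x [^]\<^bsub>A\<^esub> q) \<ominus>\<^bsub>A\<^esub> x"
  assume x: "x \<in> carrier A" and z: "?z \<notin> J"
  have zc: "?z \<in> carrier A" using x by simp
  let ?I = "{r \<in> carrier A. r \<otimes>\<^bsub>A\<^esub> ?z \<in> J}"
  have I: "ideal ?I A"
  proof (rule idealI[OF S.ring_axioms])
    show "subgroup ?I (add_monoid A)"
      by (rule S.add.subgroupI)
        (use zc J.zero_closed in \<open>auto simp: S.l_minus S.l_distr intro: J.a_closed J.a_inv_closed\<close>)
    fix a r assume ar: "a \<in> ?I" "r \<in> carrier A"
    then show "r \<otimes>\<^bsub>A\<^esub> a \<in> ?I" using zc by (auto simp: S.m_assoc intro: J.I_l_closed)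
    then show "a \<otimes>\<^bsub>A\<^esub> r \<in> ?I" using ar by (simp add: S.m_comm)
  qed
  have "\<one>\<^bsub>A\<^esub> \<notin> ?I" using z zc by simp
  then have "?I \<noteq> carrier A" by blast
  then obtain M where M: "maximalideal M A" "?I \<subseteq> M" using S.proper_ideal_le_maximal[OF I] by blast
  interpret M: maximalideal M A by fact
  have "J \<subseteq> ?I" using J.I_r_closed zc J.a_Hcarr by blast
  then have JM: "J \<subseteq> M" using M by blast
  then have u: "unramified_with_residue D p A \<phi> M"
    using assms[OF M(1)] lies_over_iff[OF M.is_ideal] M.I_notcarr by blast
  then obtain d where "d \<in> carrier D" "x \<ominus>\<^bsub>A\<^esub> \<phi> d \<in> M"
    using unramified_iff[OF S.maximalideal_prime[OF M(1)]] x by blast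
  then have "?z \<in> M" using frobenius_mem[OF M.is_ideal JM x] by blast
  then obtain v where "v \<in> carrier A - M" "v \<otimes>\<^bsub>A\<^esub> ?z \<in> J"
    using u unramified_iff[OF S.maximalideal_prime[OF M(1)]] by blast
  then show False using M(2) by blast
qed

lemma unramified_if_power_congruence:
  assumes "power_congruence D p A \<phi>" "primeideal P A" "lies_over D \<phi> P p"
  shows "unramified_with_residue D p A \<phi> P"
proof -
  interpret P: primeideal P A by fact
  have "J \<subseteq> P" using lies_over_iff[OF P.is_ideal] P.I_notcarr assms(3) by blast
  then show ?thesis
    using unramified_iff[OF assms(2)] residue_if_power_congruence[OF assms(1,2)]
      annihilator_if_power_congruence[OF assms(1,2)] by blast
qed

end

section \<open>Colon ideals, intersections, and products of maximal ideals\<close>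

lemma (in cring) m_minus_distr:
  "a \<in> carrier R \<Longrightarrow> b \<in> carrier R \<Longrightarrow> c \<in> carrier R \<Longrightarrow> a \<otimes> (b \<ominus> c) = a \<otimes> b \<ominus> a \<otimes> c"
  by algebra

lemma (in cring) minus_add_cancel:
  "a \<in> carrier R \<Longrightarrow> b \<in> carrier R \<Longrightarrow> a \<ominus> b \<oplus> b = a"
  by algebra

lemma (in cring) add_minus_cancel:
  "a \<in> carrier R \<Longrightarrow> b \<in> carrier R \<Longrightarrow> a \<oplus> b \<ominus> b = a"
  by algebra

lemma (in cring) colon_ideal:
  assumes "ideal I R" "z \<in> carrier R"
  shows "ideal {r \<in> carrier R. r \<otimes> z \<in> I} R"
proof -
  interpret I: ideal I R by fact
  show ?thesis
  proof (rule idealI[OF ring_axioms])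
    show "subgroup {r \<in> carrier R. r \<otimes> z \<in> I} (add_monoid R)"
      by (rule add.subgroupI)
        (use assms I.zero_closed in \<open>auto simp: l_minus l_distr intro: I.a_closed I.a_inv_closed\<close>)
    fix a r assume ar: "a \<in> {r \<in> carrier R. r \<otimes> z \<in> I}" "r \<in> carrier R"
    then show "r \<otimes> a \<in> {r \<in> carrier R. r \<otimes> z \<in> I}"
      using assms by (auto simp: m_assoc intro: I.I_l_closed)
    then show "a \<otimes> r \<in> {r \<in> carrier R. r \<otimes> z \<in> I}" using ar by (simp add: m_comm)
  qed
qed

lemma (in ring) Inter_ideals:
  assumes "\<forall>N\<in>\<N>. ideal N R"
  shows "ideal {x \<in> carrier R. \<forall>N\<in>\<N>. x \<in> N} R"
proof -
  have c: "\<And>N. N \<in> \<N> \<Longrightarrow> additive_subgroup N R" using assms ideal.axioms(1) by blast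
  show ?thesis
  proof (rule idealI[OF ring_axioms])
    show "subgroup {x \<in> carrier R. \<forall>N\<in>\<N>. x \<in> N} (add_monoid R)"
    proof (rule add.subgroupI)
      have "\<zero> \<in> {x \<in> carrier R. \<forall>N\<in>\<N>. x \<in> N}" using additive_subgroup.zero_closed[OF c] by blast
      then show "{x \<in> carrier R. \<forall>N\<in>\<N>. x \<in> N} \<noteq> {}" by blast
    qed (use additive_subgroup.a_closed[OF c] additive_subgroup.a_inv_closed[OF c] in auto)
    fix a x assume ax: "a \<in> {x \<in> carrier R. \<forall>N\<in>\<N>. x \<in> N}" "x \<in> carrier R"
    have "x \<otimes> a \<in> N \<and> a \<otimes> x \<in> N" if N: "N \<in> \<N>" for N
      using ideal.I_l_closed[of N R a x] ideal.I_r_closed[of N R a x] assms N ax by simp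
    then show "x \<otimes> a \<in> {x \<in> carrier R. \<forall>N\<in>\<N>. x \<in> N}" "a \<otimes> x \<in> {x \<in> carrier R. \<forall>N\<in>\<N>. x \<in> N}"
      using ax by simp_all
  qed
qed

text \<open>Inductively, \<open>M\<close> is comaximal with the intersection of the remaining
  ideals, and comaximal ideals have their intersection as product.\<close>

lemma (in cring) ideal_product_distinct_maximals:
  assumes "distinct Ms" "\<forall>M\<in>set Ms. maximalideal M R"
  shows "ideal_product R Ms = {x \<in> carrier R. \<forall>M\<in>set Ms. x \<in> M}"
  using assms
proof (induction Ms)
  case Nil
  then show ?case by (simp add: ideal_product_def)
next
  case (Cons M Ms)
  let ?K = "{x \<in> carrier R. \<forall>N\<in>set Ms. x \<in> N}"
  interpret M: maximalideal M R using Cons by simp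
  interpret MP: primeideal M R by (rule maximalideal_prime[OF M.is_maximalideal])
  have K: "ideal ?K R" by (rule Inter_ideals) (use Cons.prems maximalideal.axioms(1) in auto)
  \<comment> \<open>A product of elements, one from each remaining ideal, all outside
    \<open>M\<close>: distinct maximal ideals are incomparable, and \<open>M\<close> is
    prime.\<close>
  have "\<exists>k\<in>?K. k \<notin> M"
    using Cons.prems
  proof (induction Ms)
    case Nil
    then show ?case using M.one_imp_carrier M.I_notcarr by auto
  next
    case (Cons N Ns)
    then obtain k where k: "k \<in> carrier R" "\<forall>N\<in>set Ns. k \<in> N" "k \<notin> M" by auto
    interpret N: maximalideal N R using Cons.prems by simp
    have "\<not> N \<subseteq> M" using N.I_maximal[OF M.is_ideal] M.a_subset M.I_notcarr Cons.prems(1) by auto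
    then obtain x where x: "x \<in> N" "x \<notin> M" by blast
    then have xc: "x \<in> carrier R" using N.a_Hcarr by blast
    have "x \<otimes> k \<notin> M" using MP.I_prime[OF xc k(1)] x k by blast
    moreover have "x \<otimes> k \<in> N" using x k by (intro N.I_r_closed)
    moreover have "x \<otimes> k \<in> N'" if "N' \<in> set Ns" for N'
      using ideal.I_l_closed[OF maximalideal.axioms(1), of N' R k x] Cons.prems that k xc by auto
    ultimately show ?case using xc k(1) by (intro bexI[of _ "x \<otimes> k"]) auto
  qed
  then obtain k where k: "k \<in> ?K" "k \<notin> M" by blast
  have MK: "ideal (M <+> ?K) R" by (rule add_ideals[OF M.is_ideal K])
  have z: "\<zero> \<in> ?K" "\<zero> \<in> M" using additive_subgroup.zero_closed[OF ideal.axioms(1)[OF K]] M.zero_closed by blast+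
  have sub: "M \<subseteq> M <+> ?K"
  proof
    fix x assume "x \<in> M"
    then have "x \<oplus> \<zero> \<in> M <+> ?K" using z(1) unfolding set_add_def' by blast
    then show "x \<in> M <+> ?K" using M.a_Hcarr[OF \<open>x \<in> M\<close>] by simp
  qed
  have "\<zero> \<oplus> k \<in> M <+> ?K" using z(2) k(1) unfolding set_add_def' by blast
  then have "k \<in> M <+> ?K" using k(1) by simp
  then have "M <+> ?K = carrier R"
    using M.I_maximal[OF MK sub] k(2) additive_subgroup.a_subset[OF ideal.axioms(1)[OF MK]] by blast
  then have "ideal_prod R M ?K = M \<inter> ?K" by (rule ideal_prod_eq_inter[OF M.is_ideal K])
  then show ?case using Cons M.a_subset unfolding ideal_product_def by auto
qed

section \<open>Powers of a ring, and elements with \<open>x^q = x\<close>\<close>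

context ring
begin

lemma power_ring_ring: "ring (power_ring R Y)"
proof (rule ringI)
  show "abelian_group (power_ring R Y)"
  proof (rule abelian_groupI)
    fix f assume f: "f \<in> carrier (power_ring R Y)"
    show "\<exists>g\<in>carrier (power_ring R Y). g \<oplus>\<^bsub>power_ring R Y\<^esub> f = \<zero>\<^bsub>power_ring R Y\<^esub>"
      by (rule bexI[of _ "\<lambda>y\<in>Y. \<ominus> f y"])
        (use f in \<open>auto simp: power_ring_def PiE_iff l_neg intro!: restrict_ext\<close>)
  next
    fix f assume "f \<in> carrier (power_ring R Y)"
    then show "\<zero>\<^bsub>power_ring R Y\<^esub> \<oplus>\<^bsub>power_ring R Y\<^esub> f = f"
      by (auto simp: power_ring_def PiE_iff intro!: extensionalityI[of _ Y])
  qed (auto simp: power_ring_def PiE_iff a_ac intro!: restrict_ext)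
  show "monoid (power_ring R Y)"
  proof (rule monoidI)
    fix f assume "f \<in> carrier (power_ring R Y)"
    then show "\<one>\<^bsub>power_ring R Y\<^esub> \<otimes>\<^bsub>power_ring R Y\<^esub> f = f" "f \<otimes>\<^bsub>power_ring R Y\<^esub> \<one>\<^bsub>power_ring R Y\<^esub> = f"
      by (auto simp: power_ring_def PiE_iff intro!: extensionalityI[of _ Y])
  qed (auto simp: power_ring_def PiE_iff m_assoc intro!: restrict_ext)
qed (auto simp: power_ring_def PiE_iff l_distr r_distr intro!: restrict_ext)

text \<open>Iteration gives \<open>x = x^(q^k)\<close> for every \<open>k\<close>, and
  \<open>q^n \<ge> n\<close> reaches the exponent that kills \<open>x\<close>.\<close>

lemma nilpotent_frobenius_fixed:
  assumes "x \<in> carrier R" "x [^] (q::nat) = x" "q \<ge> 2" "x [^] (n::nat) = \<zero>"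
  shows "x = \<zero>"
proof -
  have "x [^] (q ^ k) = x" for k
    using assms(1,2) by (induction k) (auto simp: nat_pow_pow[symmetric] mult.commute)
  moreover have "n \<le> q ^ n" using assms(3) by (meson less_exp less_imp_le order_trans power_mono zero_le)
  then have "x [^] (q ^ n) = x [^] n \<otimes> x [^] (q ^ n - n)" using assms(1) by (simp add: nat_pow_mult)
  ultimately show ?thesis using assms by simp
qed

end

text \<open>The identity holds in every coordinate, because a field with \<open>q\<close> elements
  satisfies it, and it is pulled back along the injective embedding.\<close>

lemma power_congruence_if_subring_of_Fq_power:
  assumes "ring C" "subring_of_Fq_power q C F Y"
  shows "\<forall>x\<in>carrier C. x [^]\<^bsub>C\<^esub> q = x"
proof
  interpret C: ring C by fact
  fix x assume x: "x \<in> carrier C"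
  from assms(2) obtain S h where F: "field F" "finite (carrier F)" "card (carrier F) = q"
    and S: "subring S (power_ring F Y)" and h: "h \<in> ring_iso C ((power_ring F Y)\<lparr>carrier := S\<rparr>)"
    unfolding subring_of_Fq_power_def is_ring_iso_def by auto
  interpret F: field F by fact
  note hm = ring_iso_memE[OF h]
  have S_sub: "S \<subseteq> Y \<rightarrow>\<^sub>E carrier F" using subringE(1)[OF S] by (simp add: power_ring_def)
  have hx: "h x \<in> Y \<rightarrow>\<^sub>E carrier F" using hm(1)[OF x] S_sub by auto
  have hp: "h (x [^]\<^bsub>C\<^esub> n) = (\<lambda>y\<in>Y. h x y [^]\<^bsub>F\<^esub> n)" for n :: nat
  proof (induction n)
    case 0
    then show ?case using hm(4) by (simp add: power_ring_def)
  next
    case (Suc n)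
    have "h (x [^]\<^bsub>C\<^esub> Suc n) = h (x [^]\<^bsub>C\<^esub> n) \<otimes>\<^bsub>power_ring F Y\<^esub> h x"
      using hm(2)[of "x [^]\<^bsub>C\<^esub> n" x] x by simp
    then show ?case unfolding Suc by (simp add: power_ring_def cong: restrict_cong)
  qed
  have "h (x [^]\<^bsub>C\<^esub> q) = (\<lambda>y\<in>Y. h x y)"
    unfolding hp using hx F.finite_field_pow_card[OF F(2)] unfolding F(3) by (intro restrict_ext) auto
  also have "\<dots> = h x" using hx by (simp add: PiE_restrict)
  finally show "x [^]\<^bsub>C\<^esub> q = x"
    using hm(5) x unfolding bij_betw_def by (meson C.nat_pow_closed inj_onD)
qed

section \<open>The equivalent conditions on the reduction modulo \<open>p A\<close>\<close>

context finite_residue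
begin

lemma reduction_hom: "ring_hom_cring A (A Quot J) (\<lambda>a. J +>\<^bsub>A\<^esub> a)"
  by (rule J.rcos_ring_hom_cring[OF S.is_cring])

text \<open>\<open>A / J\<close> is an algebra of the same kind whose own extended ideal is zero.
  Conditions that only involve the reduction can therefore be proved for \<open>J = {0}\<close> and
  then applied to \<open>A / J\<close>.\<close>

lemma reduction_finite_residue: "finite_residue D (A Quot J) (reduction_map A \<phi> p) p"
proof -
  interpret r: ring_hom_cring A "A Quot J" "\<lambda>a. J +>\<^bsub>A\<^esub> a" by (rule reduction_hom)
  have "ring_hom_cring D (A Quot J) (reduction_map A \<phi> p)"
    by (rule ring_hom_cringI[OF R.is_cring r.S.is_cring])
      (auto intro!: ring_hom_memI simp: quot_map_def)
  then show ?thesis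
    using p.is_maximalideal fin by (intro finite_residue.intro finite_residue_axioms.intro)
qed

lemma reduction_extended_ideal:
  "extended_ideal (A Quot J) (reduction_map A \<phi> p) p = {\<zero>\<^bsub>A Quot J\<^esub>}"
proof -
  interpret Q: ring "A Quot J" by (rule J.quotient_is_ring)
  have "reduction_map A \<phi> p d = \<zero>\<^bsub>A Quot J\<^esub>" if "d \<in> p" for d
    using J.rcos_eq_self_iff[OF J.a_Hcarr] phi_mem_J[OF that] by (simp add: quot_map_def Quot_zero)
  then have "reduction_map A \<phi> p ` p = {\<zero>\<^bsub>A Quot J\<^esub>}" using p.zero_closed by blast
  then show ?thesis by (simp only: extended_ideal_def[of "A Quot J"] Q.genideal_zero)
qed

lemma power_congruence_iff_reduction:
  "power_congruence D p A \<phi> \<longleftrightarrow> (\<forall>x\<in>carrier (A Quot J). x [^]\<^bsub>A Quot J\<^esub> q = x)"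
proof -
  interpret r: ring_hom_cring A "A Quot J" "\<lambda>a. J +>\<^bsub>A\<^esub> a" by (rule reduction_hom)
  have e: "(J +>\<^bsub>A\<^esub> a) [^]\<^bsub>A Quot J\<^esub> q = J +>\<^bsub>A\<^esub> a \<longleftrightarrow> (a [^]\<^bsub>A\<^esub> q) \<ominus>\<^bsub>A\<^esub> a \<in> J" if "a \<in> carrier A" for a
    using J.rcos_eq_iff[of "a [^]\<^bsub>A\<^esub> q" a] r.hom_pow[of a q] that by simp
  show ?thesis unfolding power_congruence_def
    using e r.hom_closed J.Quot_cases by metis
qed

lemma power_congruence_iff_zero:
  assumes "J = {\<zero>\<^bsub>A\<^esub>}"
  shows "power_congruence D p A \<phi> \<longleftrightarrow> (\<forall>x\<in>carrier A. x [^]\<^bsub>A\<^esub> q = x)"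
  unfolding power_congruence_def assms by (simp add: S.r_right_minus_eq)

text \<open>Division in the residue ring: if \<open>x\<close> and \<open>s\<close> have residues
  \<open>d\<close> and \<open>e\<close>, and \<open>f\<close> is inverse to \<open>e\<close> modulo
  \<open>p\<close>, then the quotient has residue \<open>f d\<close>.\<close>

lemma residue_of_fraction:
  assumes pc: "power_congruence D p A \<phi>" and P: "primeideal P A" and JP: "J \<subseteq> P"
    and x: "x \<in> carrier A" and s: "s \<in> carrier A - P"
  shows "\<exists>d\<in>carrier D. x \<ominus>\<^bsub>A\<^esub> s \<otimes>\<^bsub>A\<^esub> \<phi> d \<in> P"
proof -
  interpret P: primeideal P A by fact
  obtain d where d: "d \<in> carrier D" "x \<ominus>\<^bsub>A\<^esub> \<phi> d \<in> P"
    using residue_if_power_congruence[OF pc P JP x] by blast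
  obtain e where e: "e \<in> carrier D" "s \<ominus>\<^bsub>A\<^esub> \<phi> e \<in> P"
    using residue_if_power_congruence[OF pc P JP, of s] s by blast
  have c: "\<phi> d \<in> carrier A" "\<phi> e \<in> carrier A" "s \<in> carrier A" using d e s by auto
  have "e \<notin> p"
  proof
    assume "e \<in> p"
    then have "\<phi> e \<in> P" using phi_mem_J JP by blast
    with e(2) have "(s \<ominus>\<^bsub>A\<^esub> \<phi> e) \<oplus>\<^bsub>A\<^esub> \<phi> e \<in> P" by (rule P.a_closed)
    then show False using s S.minus_add_cancel[OF c(3,2)] by simp
  qed
  then obtain f where f: "f \<in> carrier D" "f \<otimes>\<^bsub>D\<^esub> e \<ominus>\<^bsub>D\<^esub> \<one>\<^bsub>D\<^esub> \<in> p" using inverse_mod_p e by blast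
  have fe: "\<phi> f \<otimes>\<^bsub>A\<^esub> \<phi> e \<ominus>\<^bsub>A\<^esub> \<one>\<^bsub>A\<^esub> \<in> P"
    using phi_mem_J[OF f(2)] JP f(1) e(1) by (auto simp: R.minus_eq S.minus_eq)
  have cf: "\<phi> f \<in> carrier A" using f by auto
  \<comment> \<open>Each of the three terms on the right is a multiple of one of the differences
    already known to lie in \<open>P\<close>.\<close>
  have "x \<ominus>\<^bsub>A\<^esub> s \<otimes>\<^bsub>A\<^esub> \<phi> (f \<otimes>\<^bsub>D\<^esub> d) = ((x \<ominus>\<^bsub>A\<^esub> \<phi> d) \<ominus>\<^bsub>A\<^esub> (\<phi> f \<otimes>\<^bsub>A\<^esub> \<phi> d) \<otimes>\<^bsub>A\<^esub> (s \<ominus>\<^bsub>A\<^esub> \<phi> e)) \<ominus>\<^bsub>A\<^esub> \<phi> d \<otimes>\<^bsub>A\<^esub> (\<phi> f \<otimes>\<^bsub>A\<^esub> \<phi> e \<ominus>\<^bsub>A\<^esub> \<one>\<^bsub>A\<^esub>)"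
    unfolding hom_mult[OF f(1) d(1)] using c cf x by algebra
  also have "\<dots> \<in> P"
    by (intro P.minus_mem d(2) P.I_l_closed[OF e(2)] P.I_l_closed[OF fe]) (use c cf in auto)
  finally show ?thesis using f(1) d(1) R.m_closed by blast
qed

text \<open>Forwards, \<open>x - s d\<close> lies in \<open>P\<close> and is annihilated by an
  element outside \<open>P\<close>, so \<open>x / s\<close> equals \<open>d\<close> already in the
  localization, not just in the residue field. Backwards, each element agrees with some
  \<open>d\<close> at each maximal ideal, so \<open>x^q - x\<close> has annihilators outside every
  maximal ideal and must be zero.\<close>

lemma locally_isomorphic_iff:
  assumes J0: "J = {\<zero>\<^bsub>A\<^esub>}"
  shows "power_congruence D p A \<phi> \<longleftrightarrow> locally_isomorphic_to_residue D p A \<phi>"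
proof
  assume pc: "power_congruence D p A \<phi>"
  show "locally_isomorphic_to_residue D p A \<phi>"
    unfolding locally_isomorphic_to_residue_def
  proof (intro allI impI)
    fix P assume P: "primeideal P A"
    interpret P: primeideal P A by fact
    interpret L: localization A "carrier A - P" by (rule S.localization_primeI[OF P])
    interpret l: ring_hom_cring A "loc A (carrier A - P)" "\<lambda>a. loc_frac A (carrier A - P) a \<one>\<^bsub>A\<^esub>" by (rule L.frac_hom)
    have JP: "J \<subseteq> P" using J0 P.zero_closed by simp
    have hc: "ring_hom_cring D (loc_at A P) (loc_map A P \<circ> \<phi>)"
      by (rule ring_hom_cringI[OF R.is_cring])
        (auto intro!: ring_hom_memI simp: loc_at_def loc_map_def L.loc_cring)
    have comap: "{d \<in> carrier D. \<phi> d \<in> P} = p" using comap_eq_p[OF P.is_ideal _ JP] P.I_notcarr by simp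
    have p0: "\<phi> d = \<zero>\<^bsub>A\<^esub>" if "d \<in> p" for d using phi_mem_J[OF that] J0 by simp
    have "(loc_map A P \<circ> \<phi>) ` carrier D = carrier (loc_at A P)"
    proof (intro equalityI subsetI)
      fix y assume "y \<in> carrier (loc_at A P)"
      then obtain x s where xs: "x \<in> carrier A" "s \<in> carrier A - P" "y = loc_frac A (carrier A - P) x s"
        unfolding loc_at_def by (rule L.loc_cases)
      obtain d where d: "d \<in> carrier D" "x \<ominus>\<^bsub>A\<^esub> s \<otimes>\<^bsub>A\<^esub> \<phi> d \<in> P"
        using residue_of_fraction[OF pc P JP xs(1,2)] by blast
      then obtain u where u: "u \<in> carrier A - P" "u \<otimes>\<^bsub>A\<^esub> (x \<ominus>\<^bsub>A\<^esub> s \<otimes>\<^bsub>A\<^esub> \<phi> d) = \<zero>\<^bsub>A\<^esub>"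
        using annihilator_if_power_congruence[OF pc P] J0 by blast
      have c: "u \<in> carrier A" "s \<otimes>\<^bsub>A\<^esub> \<phi> d \<in> carrier A" using u xs(2) d(1) by auto
      have "u \<otimes>\<^bsub>A\<^esub> x = u \<otimes>\<^bsub>A\<^esub> (s \<otimes>\<^bsub>A\<^esub> \<phi> d)"
        using u(2) c xs(1) by (simp add: S.m_minus_distr S.r_right_minus_eq)
      then have "u \<otimes>\<^bsub>A\<^esub> (\<one>\<^bsub>A\<^esub> \<otimes>\<^bsub>A\<^esub> x) = u \<otimes>\<^bsub>A\<^esub> (s \<otimes>\<^bsub>A\<^esub> \<phi> d)" using xs(1) by simp
      then have "y = loc_frac A (carrier A - P) (\<phi> d) \<one>\<^bsub>A\<^esub>"
        unfolding xs(3) L.frac_eq_iff[OF xs(1,2) hom_closed[OF d(1)] L.S_one] using u(1) by blast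
      then have "y = (loc_map A P \<circ> \<phi>) d" by (simp add: loc_map_def)
      then show "y \<in> (loc_map A P \<circ> \<phi>) ` carrier D" using d(1) by blast
    qed (auto simp: loc_map_def loc_at_def L.S_one)
    moreover have "(loc_map A P \<circ> \<phi>) d = \<zero>\<^bsub>loc_at A P\<^esub> \<longleftrightarrow> d \<in> p" if d: "d \<in> carrier D" for d
    proof -
      have "(loc_map A P \<circ> \<phi>) d = \<zero>\<^bsub>loc_at A P\<^esub> \<longleftrightarrow> (\<exists>u\<in>carrier A - P. u \<otimes>\<^bsub>A\<^esub> \<phi> d = \<zero>\<^bsub>A\<^esub>)"
        unfolding loc_map_def loc_at_def comp_def by (rule L.frac_eq_zero_iff[OF hom_closed[OF d] L.S_one])
      also have "\<dots> \<longleftrightarrow> d \<in> p"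
      proof
        assume "\<exists>u\<in>carrier A - P. u \<otimes>\<^bsub>A\<^esub> \<phi> d = \<zero>\<^bsub>A\<^esub>"
        then have "\<phi> d \<in> P" using P.I_prime hom_closed[OF d] P.zero_closed by (metis DiffE)
        then show "d \<in> p" using comap d by blast
      qed (use p0 L.S_one in auto)
      finally show ?thesis .
    qed
    ultimately show "alg_isomorphic D (loc_at A P) (loc_map A P \<circ> \<phi>) (D Quot p) (quot_map D p)"
      unfolding alg_isomorphic_Quot_iff[OF hc p.is_ideal] using p.a_Hcarr by blast
  qed
next
  assume li: "locally_isomorphic_to_residue D p A \<phi>"
  show "power_congruence D p A \<phi>"
    unfolding power_congruence_def J0
  proof (intro ballI, rule ccontr)
    fix x assume x: "x \<in> carrier A" and "(x [^]\<^bsub>A\<^esub> q) \<ominus>\<^bsub>A\<^esub> x \<notin> {\<zero>\<^bsub>A\<^esub>}"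
    let ?z = "(x [^]\<^bsub>A\<^esub> q) \<ominus>\<^bsub>A\<^esub> x" let ?I = "{r \<in> carrier A. r \<otimes>\<^bsub>A\<^esub> ?z \<in> {\<zero>\<^bsub>A\<^esub>}}"
    have zc: "?z \<in> carrier A" and z: "?z \<noteq> \<zero>\<^bsub>A\<^esub>" using x \<open>?z \<notin> _\<close> by auto
    have I: "ideal ?I A" by (rule S.colon_ideal[OF S.zeroideal zc])
    have "\<one>\<^bsub>A\<^esub> \<notin> ?I" using z zc by simp
    then have "?I \<noteq> carrier A" by blast
    then obtain M where M: "maximalideal M A" "?I \<subseteq> M" using S.proper_ideal_le_maximal[OF I] by blast
    have P: "primeideal M A" by (rule S.maximalideal_prime[OF M(1)])
    interpret P: primeideal M A by fact
    interpret L: localization A "carrier A - M" by (rule S.localization_primeI[OF P])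
    interpret l: ring_hom_cring A "loc A (carrier A - M)" "\<lambda>a. loc_frac A (carrier A - M) a \<one>\<^bsub>A\<^esub>" by (rule L.frac_hom)
    have hc: "ring_hom_cring D (loc_at A M) (loc_map A M \<circ> \<phi>)"
      by (rule ring_hom_cringI[OF R.is_cring])
        (auto intro!: ring_hom_memI simp: loc_at_def loc_map_def L.loc_cring)
    have "(loc_map A M \<circ> \<phi>) ` carrier D = carrier (loc_at A M)"
      using alg_isomorphic_Quot_iff[OF hc p.is_ideal] li P unfolding locally_isomorphic_to_residue_def by blast
    moreover have "loc_frac A (carrier A - M) x \<one>\<^bsub>A\<^esub> \<in> carrier (loc_at A M)"
      unfolding loc_at_def using l.hom_closed[OF x] .
    ultimately have "loc_frac A (carrier A - M) x \<one>\<^bsub>A\<^esub> \<in> (loc_map A M \<circ> \<phi>) ` carrier D" by blast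
    then obtain d where d: "d \<in> carrier D" "loc_frac A (carrier A - M) x \<one>\<^bsub>A\<^esub> = loc_frac A (carrier A - M) (\<phi> d) \<one>\<^bsub>A\<^esub>"
      unfolding loc_map_def comp_def by (rule imageE)
    have z0: "(\<phi> d [^]\<^bsub>A\<^esub> q) \<ominus>\<^bsub>A\<^esub> \<phi> d = \<zero>\<^bsub>A\<^esub>"
      using phi_mem_J[OF frobenius_D[OF d(1)]] d(1) unfolding J0 by (simp add: R.minus_eq S.minus_eq)
    have "loc_frac A (carrier A - M) ?z \<one>\<^bsub>A\<^esub> = loc_frac A (carrier A - M) ((\<phi> d [^]\<^bsub>A\<^esub> q) \<ominus>\<^bsub>A\<^esub> \<phi> d) \<one>\<^bsub>A\<^esub>"
      using x d by (simp add: S.minus_eq)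
    then have "\<exists>u\<in>carrier A - M. u \<otimes>\<^bsub>A\<^esub> ?z = \<zero>\<^bsub>A\<^esub>"
      unfolding z0 using L.frac_eq_zero_iff[OF zc L.S_one] L.frac_zero[OF L.S_one] by simp
    then show False using M(2) by blast
  qed
qed

text \<open>With \<open>J = {0}\<close> every prime ideal contracts to \<open>p\<close>, so the
  kernel is right automatically and only surjectivity on fractions \<open>x / s\<close>
  remains.\<close>

lemma residue_field_iff:
  assumes J0: "J = {\<zero>\<^bsub>A\<^esub>}" and P: "primeideal P A"
  shows "alg_isomorphic D (residue_field A P) (residue_map A P \<circ> \<phi>) (D Quot p) (quot_map D p) \<longleftrightarrow>
    (\<forall>x\<in>carrier A. \<forall>s\<in>carrier A - P. \<exists>d\<in>carrier D. x \<ominus>\<^bsub>A\<^esub> s \<otimes>\<^bsub>A\<^esub> \<phi> d \<in> P)"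
proof -
  interpret P: primeideal P A by fact
  interpret L: localization A "carrier A - P" by (rule S.localization_primeI[OF P])
  interpret l: ring_hom_cring A "loc A (carrier A - P)" "\<lambda>a. loc_frac A (carrier A - P) a \<one>\<^bsub>A\<^esub>" by (rule L.frac_hom)
  let ?B = "loc A (carrier A - P)"
  let ?E = "extended_ideal (loc_at A P) (loc_map A P) P"
  have lm: "loc_map A P = (\<lambda>a. loc_frac A (carrier A - P) a \<one>\<^bsub>A\<^esub>)" unfolding loc_map_def by auto
  have PP: "Idl\<^bsub>A\<^esub> P = P" using S.genideal_minimal[OF P.is_ideal] S.genideal_self[of P] P.a_subset by blast
  have imP: "loc_map A P ` P \<subseteq> carrier ?B" unfolding lm using P.a_Hcarr L.S_one by auto
  have EB: "ideal ?E ?B" unfolding extended_ideal_def loc_at_def by (rule l.S.genideal_ideal[OF imP])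
  interpret E: ideal ?E ?B by (rule EB)
  interpret e: ring_hom_cring ?B "?B Quot ?E" "\<lambda>y. ?E +>\<^bsub>?B\<^esub> y" by (rule E.rcos_ring_hom_cring[OF L.loc_cring])
  have memE: "loc_frac A (carrier A - P) a s \<in> ?E \<longleftrightarrow> a \<in> P" if as: "a \<in> carrier A" "s \<in> carrier A - P" for a s
  proof -
    have "loc_frac A (carrier A - P) a s \<in> ?E \<longleftrightarrow> (\<exists>u\<in>carrier A - P. u \<otimes>\<^bsub>A\<^esub> a \<in> P)"
      using L.frac_in_genideal_iff[OF P.a_subset as] unfolding extended_ideal_def loc_at_def lm PP .
    also have "\<dots> \<longleftrightarrow> a \<in> P"
      using P.I_prime[OF _ as(1)] P.I_l_closed[OF _ L.S_closed[OF L.S_one], of a] L.S_one as(1) by force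
    finally show ?thesis .
  qed
  have rf: "residue_field A P = ?B Quot ?E" unfolding residue_field_def loc_at_def by simp
  have rm: "(residue_map A P \<circ> \<phi>) d = ?E +>\<^bsub>?B\<^esub> loc_frac A (carrier A - P) (\<phi> d) \<one>\<^bsub>A\<^esub>" for d
    unfolding residue_map_def quot_map_def loc_at_def lm by simp
  have hc: "ring_hom_cring D (residue_field A P) (residue_map A P \<circ> \<phi>)"
    by (rule ring_hom_cringI[OF R.is_cring])
      (use e.S.is_cring in \<open>auto intro!: ring_hom_memI simp only: rm rf hom_mult hom_add hom_one l.hom_mult l.hom_add l.hom_one
         e.hom_mult e.hom_add e.hom_one e.hom_closed l.hom_closed hom_closed\<close>)
  have JP: "J \<subseteq> P" using J0 P.zero_closed by simp
  have "(residue_map A P \<circ> \<phi>) d = \<zero>\<^bsub>residue_field A P\<^esub> \<longleftrightarrow> \<phi> d \<in> P" if "d \<in> carrier D" for d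
    unfolding rm unfolding rf Quot_zero using E.rcos_eq_self_iff[OF l.hom_closed[OF hom_closed[OF that]]]
      memE[OF hom_closed[OF that] L.S_one] by simp
  then have ker: "{d \<in> carrier D. (residue_map A P \<circ> \<phi>) d = \<zero>\<^bsub>residue_field A P\<^esub>} = p"
    using comap_eq_p[OF P.is_ideal _ JP] P.I_notcarr by blast
  have frac_eq: "?E +>\<^bsub>?B\<^esub> loc_frac A (carrier A - P) x s = (residue_map A P \<circ> \<phi>) d
      \<longleftrightarrow> x \<ominus>\<^bsub>A\<^esub> s \<otimes>\<^bsub>A\<^esub> \<phi> d \<in> P"
    if xs: "x \<in> carrier A" "s \<in> carrier A - P" and d: "d \<in> carrier D" for x s d
  proof -
    have c: "loc_frac A (carrier A - P) x s \<in> carrier ?B" "loc_frac A (carrier A - P) (\<phi> d) \<one>\<^bsub>A\<^esub> \<in> carrier ?B"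
       "loc_frac A (carrier A - P) (s \<otimes>\<^bsub>A\<^esub> \<phi> d) s \<in> carrier ?B"
      using xs d L.S_one by auto
    have 1: "loc_frac A (carrier A - P) (\<phi> d) \<one>\<^bsub>A\<^esub> = loc_frac A (carrier A - P) (s \<otimes>\<^bsub>A\<^esub> \<phi> d) s"
      using L.frac_cancel[OF hom_closed[OF d] L.S_one xs(2)] xs(2) by simp
    have sd: "s \<otimes>\<^bsub>A\<^esub> \<phi> d \<in> carrier A" using xs d by auto
    have z: "x \<ominus>\<^bsub>A\<^esub> s \<otimes>\<^bsub>A\<^esub> \<phi> d \<in> carrier A" using xs(1) sd by simp
    have "loc_frac A (carrier A - P) (x \<ominus>\<^bsub>A\<^esub> s \<otimes>\<^bsub>A\<^esub> \<phi> d) s \<oplus>\<^bsub>?B\<^esub> loc_frac A (carrier A - P) (s \<otimes>\<^bsub>A\<^esub> \<phi> d) s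
        = loc_frac A (carrier A - P) x s"
      unfolding L.frac_same_denom_add[OF z xs(2) sd] S.minus_add_cancel[OF xs(1) sd] ..
    then have 2: "loc_frac A (carrier A - P) x s \<ominus>\<^bsub>?B\<^esub> loc_frac A (carrier A - P) (s \<otimes>\<^bsub>A\<^esub> \<phi> d) s
        = loc_frac A (carrier A - P) (x \<ominus>\<^bsub>A\<^esub> s \<otimes>\<^bsub>A\<^esub> \<phi> d) s"
      using l.S.add_minus_cancel[OF L.frac_closed[OF z xs(2)] c(3)] by simp
    show ?thesis
      unfolding rm E.rcos_eq_iff[OF c(1,2)] unfolding 1 2 by (rule memE[OF z xs(2)])
  qed
  have "(residue_map A P \<circ> \<phi>) ` carrier D = carrier (residue_field A P) \<longleftrightarrow>
     (\<forall>x\<in>carrier A. \<forall>s\<in>carrier A - P. \<exists>d\<in>carrier D. x \<ominus>\<^bsub>A\<^esub> s \<otimes>\<^bsub>A\<^esub> \<phi> d \<in> P)"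
  proof
    assume *: "(residue_map A P \<circ> \<phi>) ` carrier D = carrier (residue_field A P)"
    show "\<forall>x\<in>carrier A. \<forall>s\<in>carrier A - P. \<exists>d\<in>carrier D. x \<ominus>\<^bsub>A\<^esub> s \<otimes>\<^bsub>A\<^esub> \<phi> d \<in> P"
    proof (intro ballI)
      fix x s assume xs: "x \<in> carrier A" "s \<in> carrier A - P"
      have "?E +>\<^bsub>?B\<^esub> loc_frac A (carrier A - P) x s \<in> carrier (residue_field A P)"
        unfolding rf using e.hom_closed xs by simp
      then obtain d where "d \<in> carrier D" "?E +>\<^bsub>?B\<^esub> loc_frac A (carrier A - P) x s = (residue_map A P \<circ> \<phi>) d"
        unfolding *[symmetric] by blast
      then show "\<exists>d\<in>carrier D. x \<ominus>\<^bsub>A\<^esub> s \<otimes>\<^bsub>A\<^esub> \<phi> d \<in> P" using frac_eq[OF xs] by blast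
    qed
  next
    assume *: "\<forall>x\<in>carrier A. \<forall>s\<in>carrier A - P. \<exists>d\<in>carrier D. x \<ominus>\<^bsub>A\<^esub> s \<otimes>\<^bsub>A\<^esub> \<phi> d \<in> P"
    interpret r: ring_hom_cring D "residue_field A P" "residue_map A P \<circ> \<phi>" by (rule hc)
    show "(residue_map A P \<circ> \<phi>) ` carrier D = carrier (residue_field A P)"
    proof (intro equalityI subsetI)
      fix y assume "y \<in> carrier (residue_field A P)"
      then obtain b where b: "b \<in> carrier ?B" "y = ?E +>\<^bsub>?B\<^esub> b" unfolding rf by (rule E.Quot_cases)
      obtain x s where xs: "x \<in> carrier A" "s \<in> carrier A - P" "b = loc_frac A (carrier A - P) x s"
        using b(1) by (rule L.loc_cases)
      then obtain d where "d \<in> carrier D" "x \<ominus>\<^bsub>A\<^esub> s \<otimes>\<^bsub>A\<^esub> \<phi> d \<in> P" using * by blast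
      then show "y \<in> (residue_map A P \<circ> \<phi>) ` carrier D" using frac_eq[OF xs(1,2)] unfolding b(2) xs(3) by blast
    next
      fix y assume "y \<in> (residue_map A P \<circ> \<phi>) ` carrier D"
      then show "y \<in> carrier (residue_field A P)" using r.hom_closed by blast
    qed
  qed
  then show ?thesis unfolding alg_isomorphic_Quot_iff[OF hc p.is_ideal] ker by simp
qed

text \<open>Backwards, the residue fields put \<open>x^q - x\<close> into every prime ideal; hence
  it is nilpotent, and reducedness makes it zero.\<close>

lemma reduced_residue_iff:
  assumes J0: "J = {\<zero>\<^bsub>A\<^esub>}"
  shows "power_congruence D p A \<phi> \<longleftrightarrow> reduced_ring A \<and>
    (\<forall>P. primeideal P A \<longrightarrow>
      alg_isomorphic D (residue_field A P) (residue_map A P \<circ> \<phi>) (D Quot p) (quot_map D p))"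
proof (intro iffI conjI allI impI)
  assume pc: "power_congruence D p A \<phi>"
  then have "\<forall>x\<in>carrier A. x [^]\<^bsub>A\<^esub> q = x" using power_congruence_iff_zero[OF J0] by simp
  then show "reduced_ring A"
    unfolding reduced_ring_def using S.nilpotent_frobenius_fixed[OF _ _ q_ge_2] by blast
  fix P assume P: "primeideal P A"
  interpret P: primeideal P A by fact
  interpret L: localization A "carrier A - P" by (rule S.localization_primeI[OF P])
  have JP: "J \<subseteq> P" using J0 P.zero_closed by simp
  show "alg_isomorphic D (residue_field A P) (residue_map A P \<circ> \<phi>) (D Quot p) (quot_map D p)"
    unfolding residue_field_iff[OF J0 P]
    using residue_of_fraction[OF pc P JP] by blast
next
  assume *: "reduced_ring A \<and> (\<forall>P. primeideal P A \<longrightarrow>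
      alg_isomorphic D (residue_field A P) (residue_map A P \<circ> \<phi>) (D Quot p) (quot_map D p))"
  show "power_congruence D p A \<phi>"
    unfolding power_congruence_def
  proof
    fix x assume x: "x \<in> carrier A"
    let ?z = "(x [^]\<^bsub>A\<^esub> q) \<ominus>\<^bsub>A\<^esub> x"
    have "?z \<in> P" if P: "primeideal P A" for P
    proof -
      interpret P: primeideal P A by fact
      interpret L: localization A "carrier A - P" by (rule S.localization_primeI[OF P])
      have JP: "J \<subseteq> P" using J0 P.zero_closed by simp
      obtain d where d: "d \<in> carrier D" "x \<ominus>\<^bsub>A\<^esub> \<one>\<^bsub>A\<^esub> \<otimes>\<^bsub>A\<^esub> \<phi> d \<in> P"
        using * P x L.S_one unfolding residue_field_iff[OF J0 P, symmetric]
        using residue_field_iff[OF J0 P] by blast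
      then have "x \<ominus>\<^bsub>A\<^esub> \<phi> d \<in> P" by simp
      then show ?thesis by (rule frobenius_mem[OF P.is_ideal JP x d(1)])
    qed
    then obtain n :: nat where "?z [^]\<^bsub>A\<^esub> n = \<zero>\<^bsub>A\<^esub>"
      using S.nilpotent_if_in_all_primes[of ?z] x by blast
    then have "?z = \<zero>\<^bsub>A\<^esub>" using * x unfolding reduced_ring_def by blast
    then show "?z \<in> J" using J0 by simp
  qed
qed

text \<open>A maximal ideal above \<open>(J : x)\<close> would contain \<open>x\<close>, and then
  the element \<open>1 - x^(q-1)\<close> of \<open>(J : x)\<close> would lie outside it. Thus
  \<open>J\<close> is the intersection of the maximal ideals above it.\<close>

lemma Inter_primes_if_power_congruence:
  assumes pc: "power_congruence D p A \<phi>" and x: "x \<in> carrier A"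
    and xM: "\<And>M. maximalideal M A \<Longrightarrow> J \<subseteq> M \<Longrightarrow> x \<in> M"
  shows "x \<in> J"
proof (rule ccontr)
  assume "x \<notin> J"
  let ?I = "{r \<in> carrier A. r \<otimes>\<^bsub>A\<^esub> x \<in> J}"
  have I: "ideal ?I A" by (rule S.colon_ideal[OF J.is_ideal x])
  have "\<one>\<^bsub>A\<^esub> \<notin> ?I" using \<open>x \<notin> J\<close> x by simp
  then have "?I \<noteq> carrier A" by blast
  then obtain M where M: "maximalideal M A" "?I \<subseteq> M" using S.proper_ideal_le_maximal[OF I] by blast
  have "J \<subseteq> ?I" using J.I_r_closed x J.a_Hcarr by blast
  then have "x \<in> M" using xM M by blast
  then obtain u where "u \<in> carrier A - M" "u \<otimes>\<^bsub>A\<^esub> x \<in> J"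
    using annihilator_if_power_congruence[OF pc S.maximalideal_prime[OF M(1)]] by blast
  then show False using M(2) by blast
qed

text \<open>The coordinates are the primes \<open>P\<close> above \<open>J\<close>, and each
  \<open>A / P\<close> is a copy of the field \<open>D / p\<close>. The kernel of the map to the
  product is the intersection of these primes, which is \<open>J\<close>.\<close>

lemma subring_of_Fq_power_if_power_congruence:
  assumes pc: "power_congruence D p A \<phi>"
  shows "subring_of_Fq_power q (A Quot J) (D Quot p) {P. primeideal P A \<and> J \<subseteq> P}"
proof -
  let ?Y = "{P. primeideal P A \<and> J \<subseteq> P}"
  let ?W = "power_ring (D Quot p) ?Y"
  interpret W: ring ?W by (rule k.power_ring_ring)
  have "\<exists>g. g \<in> ring_hom A (D Quot p) \<and> (\<forall>x\<in>carrier A. g x = \<zero>\<^bsub>D Quot p\<^esub> \<longleftrightarrow> x \<in> P)" if "P \<in> ?Y" for P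
  proof -
    have P: "primeideal P A" "J \<subseteq> P" using that by auto
    interpret P: primeideal P A by fact
    interpret h: ring_hom_cring A "A Quot P" "(+>\<^bsub>A\<^esub>) P"
      by (rule P.rcos_ring_hom_cring)
    have "alg_isomorphic D (A Quot P) (quot_map A P \<circ> \<phi>) (D Quot p) (quot_map D p)"
      using alg_isomorphic_Quot_prime_iff[OF P.is_ideal P.I_notcarr[symmetric]] P(2)
        residue_if_power_congruence[OF pc P] by blast
    then obtain f where f: "f \<in> ring_iso (A Quot P) (D Quot p)"
      unfolding alg_isomorphic_def by blast
    then have fh: "f \<in> ring_hom (A Quot P) (D Quot p)" and inj: "inj_on f (carrier (A Quot P))"
      unfolding ring_iso_def bij_betw_def by auto
    interpret f: ring_hom_ring "A Quot P" "D Quot p" f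
      by (rule ring_hom_ringI2[OF h.S.ring_axioms k.ring_axioms fh])
    have "f (P +>\<^bsub>A\<^esub> x) = \<zero>\<^bsub>D Quot p\<^esub> \<longleftrightarrow> x \<in> P" if x: "x \<in> carrier A" for x
    proof -
      have "f (P +>\<^bsub>A\<^esub> x) = \<zero>\<^bsub>D Quot p\<^esub> \<longleftrightarrow> f (P +>\<^bsub>A\<^esub> x) = f \<zero>\<^bsub>A Quot P\<^esub>" by simp
      also have "\<dots> \<longleftrightarrow> P +>\<^bsub>A\<^esub> x = \<zero>\<^bsub>A Quot P\<^esub>"
        using inj_on_eq_iff[OF inj h.hom_closed[OF x] h.S.zero_closed] .
      also have "\<dots> \<longleftrightarrow> x \<in> P" unfolding Quot_zero by (rule P.rcos_eq_self_iff[OF x])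
      finally show ?thesis .
    qed
    moreover have "(\<lambda>x. f (P +>\<^bsub>A\<^esub> x)) \<in> ring_hom A (D Quot p)"
      by (rule ring_hom_memI) auto
    ultimately show ?thesis by blast
  qed
  then have "\<forall>P\<in>?Y. \<exists>g. g \<in> ring_hom A (D Quot p) \<and> (\<forall>x\<in>carrier A. g x = \<zero>\<^bsub>D Quot p\<^esub> \<longleftrightarrow> x \<in> P)"
    by (rule ballI)
  from bchoice[OF this] obtain g where gg: "\<forall>P\<in>?Y. g P \<in> ring_hom A (D Quot p) \<and> (\<forall>x\<in>carrier A. g P x = \<zero>\<^bsub>D Quot p\<^esub> \<longleftrightarrow> x \<in> P)"
    by (rule exE)
  have g: "\<And>P. P \<in> ?Y \<Longrightarrow> g P \<in> ring_hom A (D Quot p)"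
    and g0: "\<And>P x. P \<in> ?Y \<Longrightarrow> x \<in> carrier A \<Longrightarrow> g P x = \<zero>\<^bsub>D Quot p\<^esub> \<longleftrightarrow> x \<in> P"
    using gg by blast+
  define \<theta> where "\<theta> x = (\<lambda>P\<in>?Y. g P x)" for x
  have th: "\<theta> \<in> ring_hom A ?W"
  proof (rule ring_hom_memI)
    fix x assume "x \<in> carrier A"
    then show "\<theta> x \<in> carrier ?W" using ring_hom_closed[OF g] by (simp add: \<theta>_def power_ring_def)
  next
    fix x y assume "x \<in> carrier A" "y \<in> carrier A"
    then show "\<theta> (x \<otimes>\<^bsub>A\<^esub> y) = \<theta> x \<otimes>\<^bsub>?W\<^esub> \<theta> y" "\<theta> (x \<oplus>\<^bsub>A\<^esub> y) = \<theta> x \<oplus>\<^bsub>?W\<^esub> \<theta> y"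
      using ring_hom_mult[OF g] ring_hom_add[OF g]
      by (auto simp: \<theta>_def power_ring_def intro!: restrict_ext)
  next
    show "\<theta> \<one>\<^bsub>A\<^esub> = \<one>\<^bsub>?W\<^esub>"
      using ring_hom_one[OF g] by (auto simp: \<theta>_def power_ring_def intro!: restrict_ext)
  qed
  interpret th: ring_hom_ring A ?W \<theta> by (rule ring_hom_ringI2[OF S.ring_axioms W.ring_axioms th])
  have "a_kernel A ?W \<theta> = J"
    unfolding a_kernel_def'
  proof (intro equalityI subsetI)
    fix x assume x: "x \<in> {x \<in> carrier A. \<theta> x = \<zero>\<^bsub>?W\<^esub>}"
    have "x \<in> M" if M: "maximalideal M A" "J \<subseteq> M" for M
    proof -
      have Y: "M \<in> ?Y" using S.maximalideal_prime[OF M(1)] M(2) by blast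
      have "\<theta> x M = \<zero>\<^bsub>?W\<^esub> M" using x by simp
      then have "g M x = \<zero>\<^bsub>D Quot p\<^esub>" using Y by (simp add: \<theta>_def power_ring_def)
      then show "x \<in> M" using g0[OF Y] x by blast
    qed
    then show "x \<in> J" using Inter_primes_if_power_congruence[OF pc] x by blast
  next
    fix x assume x: "x \<in> J"
    then have xc: "x \<in> carrier A" by (rule J.a_Hcarr)
    have "g P x = \<zero>\<^bsub>D Quot p\<^esub>" if "P \<in> ?Y" for P
      unfolding g0[OF that xc] using that x by blast
    then have "\<theta> x = (\<lambda>P\<in>?Y. \<zero>\<^bsub>D Quot p\<^esub>)"
      unfolding \<theta>_def by (rule restrict_ext)
    then have "\<theta> x = \<zero>\<^bsub>?W\<^esub>" by (simp only: power_ring_def ring.simps)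
    then show "x \<in> {x \<in> carrier A. \<theta> x = \<zero>\<^bsub>?W\<^esub>}" using xc by simp
  qed
  then have "A Quot J \<simeq> ?W\<lparr>carrier := \<theta> ` carrier A\<rparr>"
    using th.FactRing_iso_set_aux unfolding is_ring_iso_def by auto
  moreover have "subring (\<theta> ` carrier A) ?W"
    by (rule th.img_is_subring[OF S.carrier_is_subring])
  ultimately have "\<exists>S. subring S ?W \<and> A Quot J \<simeq> ?W\<lparr>carrier := S\<rparr>" by (intro exI conjI)
  then show ?thesis
    unfolding subring_of_Fq_power_def using fin_k k.field_axioms by simp
qed

text \<open>\<open>A / P\<close> is a copy of the field \<open>D / p\<close>. Concretely, a larger
  proper ideal would contain the residue \<open>\<phi> d\<close> of each of its elements, which puts
  \<open>d\<close> into \<open>p\<close>.\<close>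

lemma prime_imp_maximal:
  assumes pc: "power_congruence D p A \<phi>" and P: "primeideal P A" "J \<subseteq> P"
  shows "maximalideal P A"
proof -
  interpret P: primeideal P A by fact
  show ?thesis
  proof (rule maximalidealI[OF P.is_ideal P.I_notcarr])
    fix K assume K: "ideal K A" "P \<subseteq> K" "K \<subseteq> carrier A"
    interpret K: ideal K A by fact
    show "K = P \<or> K = carrier A"
    proof (cases "K = carrier A")
      case False
      have "x \<in> P" if x: "x \<in> K" for x
      proof -
        have xc: "x \<in> carrier A" using x K by blast
        obtain d where d: "d \<in> carrier D" "x \<ominus>\<^bsub>A\<^esub> \<phi> d \<in> P"
          using residue_if_power_congruence[OF pc P xc] by blast
        have c: "\<phi> d \<in> carrier A" using d by simp
        have "x \<ominus>\<^bsub>A\<^esub> (x \<ominus>\<^bsub>A\<^esub> \<phi> d) \<in> K" by (intro K.minus_mem[OF x] subsetD[OF K(2) d(2)])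
        also have "x \<ominus>\<^bsub>A\<^esub> (x \<ominus>\<^bsub>A\<^esub> \<phi> d) = \<phi> d" using xc c by algebra
        finally have "d \<in> p" using comap_eq_p[OF K(1) False] P(2) K(2) d by blast
        then have "\<phi> d \<in> P" using phi_mem_J P(2) by blast
        with d(2) have "(x \<ominus>\<^bsub>A\<^esub> \<phi> d) \<oplus>\<^bsub>A\<^esub> \<phi> d \<in> P" by (rule P.a_closed)
        then show "x \<in> P" using S.minus_add_cancel[OF xc c] by simp
      qed
      then show ?thesis using K by blast
    qed simp
  qed
qed

text \<open>Noetherian induction: a largest ideal that is not a finite intersection of maximal
  ideals would be split by an idempotent, and \<open>x^(q-1)\<close> is idempotent for every
  \<open>x\<close>.\<close>

lemma noetherian_zero_Inter_maximals:
  assumes pc: "power_congruence D p A \<phi>" and J0: "J = {\<zero>\<^bsub>A\<^esub>}" and noeth: "noetherian_ring A"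
  shows "\<exists>\<N>. finite \<N> \<and> (\<forall>N\<in>\<N>. maximalideal N A) \<and> {x \<in> carrier A. \<forall>N\<in>\<N>. x \<in> N} = {\<zero>\<^bsub>A\<^esub>}"
proof (rule ccontr)
  let ?good = "\<lambda>I. \<exists>\<N>. finite \<N> \<and> (\<forall>N\<in>\<N>. maximalideal N A) \<and> {x \<in> carrier A. \<forall>N\<in>\<N>. x \<in> N} = I"
  let ?B = "{I. ideal I A \<and> \<not> ?good I}"
  assume "\<not> ?good {\<zero>\<^bsub>A\<^esub>}"
  then have "?B \<noteq> {}" using S.zeroideal by blast
  \<comment> \<open>In a Noetherian ring a nonempty chain of ideals contains its union, so Zorn's
    lemma yields a maximal counterexample.\<close>
  moreover have "\<Union>\<C> \<in> ?B" if "\<C> \<noteq> {}" "subset.chain ?B \<C>" for \<C>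
  proof -
    have "subset.chain {I. ideal I A} \<C>" "\<C> \<subseteq> ?B" using that(2) unfolding pred_on.chain_def by auto
    then show ?thesis using noetherian_ring.ideal_chain_is_trivial[OF noeth that(1)] by blast
  qed
  ultimately obtain I where "I \<in> ?B" and max: "\<forall>K\<in>?B. I \<subseteq> K \<longrightarrow> K = I"
    using subset_Zorn_nonempty[of ?B] by auto
  then have I: "ideal I A" "\<not> ?good I" by auto
  interpret I: ideal I A by (rule I)
  have good_larger: "?good K" if "ideal K A" "I \<subseteq> K" "K \<noteq> I" for K using max that by blast
  have "?good (carrier A)" by (rule exI[of _ "{}"]) simp
  then have "I \<noteq> carrier A" using I(2) by blast
  then obtain M where M: "maximalideal M A" "I \<subseteq> M" using S.proper_ideal_le_maximal[OF I(1)] by blast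
  interpret M: maximalideal M A by fact
  have "?good M" by (rule exI[of _ "{M}"]) (use M M.a_subset in auto)
  then have "I \<noteq> M" using I(2) by blast
  then obtain x where x: "x \<in> M" "x \<notin> I" using M(2) by blast
  have xc: "x \<in> carrier A" using x M.a_Hcarr by blast
  obtain m where m: "q = Suc (Suc m)" using q_ge_2 that[of "q - 2"] by simp
  \<comment> \<open>\<open>e\<close> is idempotent with \<open>e x = x\<close>, so like
    \<open>x\<close> it lies in \<open>M\<close> but not in \<open>I\<close>; then
    \<open>1 - e\<close> is outside \<open>M\<close>, hence outside \<open>I\<close>.\<close>
  define e where "e = x [^]\<^bsub>A\<^esub> Suc m"
  have ec: "e \<in> carrier A" using xc unfolding e_def by blast
  have ex: "e \<otimes>\<^bsub>A\<^esub> x = x"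
    using pc xc unfolding power_congruence_iff_zero[OF J0] m e_def by simp
  have ee: "e \<otimes>\<^bsub>A\<^esub> e = e"
  proof -
    have "e \<otimes>\<^bsub>A\<^esub> e = x [^]\<^bsub>A\<^esub> m \<otimes>\<^bsub>A\<^esub> (e \<otimes>\<^bsub>A\<^esub> x)"
      using xc ec unfolding e_def by (simp add: S.m_ac)
    then show ?thesis unfolding ex unfolding e_def using xc by simp
  qed
  have eM: "e \<in> M" unfolding e_def S.nat_pow_Suc using x xc by (intro M.I_l_closed) auto
  have eI: "e \<notin> I" using x ex I.I_r_closed[of e x] xc by auto
  let ?f = "\<one>\<^bsub>A\<^esub> \<ominus>\<^bsub>A\<^esub> e"
  have fc: "?f \<in> carrier A" using ec by simp
  have "?f \<notin> M"
  proof
    assume "?f \<in> M"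
    then have "?f \<oplus>\<^bsub>A\<^esub> e \<in> M" using eM by (rule M.a_closed)
    then show False using S.minus_add_cancel[OF S.one_closed ec] M.one_imp_carrier M.I_notcarr by simp
  qed
  then have fI: "?f \<notin> I" using M(2) by blast
  have ef: "e \<otimes>\<^bsub>A\<^esub> ?f = \<zero>\<^bsub>A\<^esub>"
    using S.m_minus_distr[OF ec S.one_closed ec] ec ee by (simp add: S.minus_eq S.r_neg)
  \<comment> \<open>Both colon ideals are strictly larger than \<open>I\<close>, the first because
    of \<open>e\<close> and the second because of \<open>1 - e\<close>;
    \<open>a = a (1 - e) + a e\<close> shows that they meet in \<open>I\<close>.\<close>
  let ?K1 = "{r \<in> carrier A. r \<otimes>\<^bsub>A\<^esub> ?f \<in> I}" and ?K2 = "{r \<in> carrier A. r \<otimes>\<^bsub>A\<^esub> e \<in> I}"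
  have K: "ideal ?K1 A" "ideal ?K2 A" using S.colon_ideal[OF I(1)] fc ec by auto
  have sub: "I \<subseteq> ?K1" "I \<subseteq> ?K2" using I.I_r_closed fc ec I.a_Hcarr by blast+
  have "e \<in> ?K1" using ec ef I.zero_closed by simp
  moreover have "?f \<in> ?K2" using fc ef S.m_comm[OF fc ec] I.zero_closed by simp
  ultimately have "?good ?K1" "?good ?K2" using good_larger[OF K(1) sub(1)] good_larger[OF K(2) sub(2)] eI fI by blast+
  then obtain N1 N2 where N: "finite N1" "\<forall>N\<in>N1. maximalideal N A" "{x \<in> carrier A. \<forall>N\<in>N1. x \<in> N} = ?K1"
    "finite N2" "\<forall>N\<in>N2. maximalideal N A" "{x \<in> carrier A. \<forall>N\<in>N2. x \<in> N} = ?K2"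
    by blast
  have "{x \<in> carrier A. \<forall>N\<in>N1 \<union> N2. x \<in> N} = {x \<in> carrier A. \<forall>N\<in>N1. x \<in> N} \<inter> {x \<in> carrier A. \<forall>N\<in>N2. x \<in> N}"
    by blast
  also have "\<dots> = ?K1 \<inter> ?K2" unfolding N(3,6) ..
  also have "\<dots> = I"
  proof (intro equalityI subsetI)
    fix a assume a: "a \<in> ?K1 \<inter> ?K2"
    then have ac: "a \<in> carrier A" by blast
    have "a \<otimes>\<^bsub>A\<^esub> ?f \<oplus>\<^bsub>A\<^esub> a \<otimes>\<^bsub>A\<^esub> e \<in> I" using a by (intro I.a_closed) auto
    also have "a \<otimes>\<^bsub>A\<^esub> ?f \<oplus>\<^bsub>A\<^esub> a \<otimes>\<^bsub>A\<^esub> e = a" using ac ec by algebra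
    finally show "a \<in> I" .
  qed (use sub in blast)
  finally have "{x \<in> carrier A. \<forall>N\<in>N1 \<union> N2. x \<in> N} = I" .
  then have "?good I" using N by (intro exI[of _ "N1 \<union> N2"]) auto
  then show False using I(2) by blast
qed

lemma semi_local_zero_Inter_maximals:
  assumes pc: "power_congruence D p A \<phi>" and J0: "J = {\<zero>\<^bsub>A\<^esub>}" and "semi_local A"
  shows "\<exists>\<N>. finite \<N> \<and> (\<forall>N\<in>\<N>. maximalideal N A) \<and> {x \<in> carrier A. \<forall>N\<in>\<N>. x \<in> N} = {\<zero>\<^bsub>A\<^esub>}"
proof (rule exI[of _ "{N. maximalideal N A}"], intro conjI)
  show "finite {N. maximalideal N A}" using assms(3) unfolding semi_local_def .
  have "\<zero>\<^bsub>A\<^esub> \<in> N" if "maximalideal N A" for N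
    using additive_subgroup.zero_closed[OF ideal.axioms(1)[OF maximalideal.axioms(1)[OF that]]] .
  then show "{x \<in> carrier A. \<forall>N\<in>{N. maximalideal N A}. x \<in> N} = {\<zero>\<^bsub>A\<^esub>}"
    using Inter_primes_if_power_congruence[OF pc] unfolding J0 by blast
qed simp

text \<open>The finiteness condition yields a finite family of maximal ideals of
  \<open>A / J\<close> with intersection zero. Contracted to \<open>A\<close> they remain maximal,
  by \<open>prime_imp_maximal\<close>, and their product is their intersection \<open>J\<close>.
  Conversely \<open>x^q - x\<close> lies in each factor, hence in the product.\<close>

lemma ideal_product_iff:
  assumes "semi_local (A Quot J) \<or> noetherian_ring (A Quot J)"
  shows "power_congruence D p A \<phi> \<longleftrightarrow>
    (\<exists>Ms. distinct Ms \<and>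
      (\<forall>M\<in>set Ms. maximalideal M A \<and> alg_isomorphic D (A Quot M) (quot_map A M \<circ> \<phi>) (D Quot p) (quot_map D p)) \<and>
      J = ideal_product A Ms)"
proof
  assume pc: "power_congruence D p A \<phi>"
  interpret C: finite_residue D "A Quot J" "reduction_map A \<phi> p" p by (rule reduction_finite_residue)
  interpret r: ring_hom_cring A "A Quot J" "\<lambda>a. J +>\<^bsub>A\<^esub> a" by (rule reduction_hom)
  have pcC: "power_congruence D p (A Quot J) (reduction_map A \<phi> p)"
    using pc power_congruence_iff_reduction C.power_congruence_iff_zero[OF reduction_extended_ideal] by blast
  have "\<exists>\<N>. finite \<N> \<and> (\<forall>N\<in>\<N>. maximalideal N (A Quot J)) \<and>
      {x \<in> carrier (A Quot J). \<forall>N\<in>\<N>. x \<in> N} = {\<zero>\<^bsub>A Quot J\<^esub>}"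
    using assms
  proof
    assume "noetherian_ring (A Quot J)"
    then show ?thesis by (rule C.noetherian_zero_Inter_maximals[OF pcC reduction_extended_ideal])
  next
    assume "semi_local (A Quot J)"
    then show ?thesis by (rule C.semi_local_zero_Inter_maximals[OF pcC reduction_extended_ideal])
  qed
  then obtain \<N> where N: "finite \<N>" "\<forall>N\<in>\<N>. maximalideal N (A Quot J)"
    "{x \<in> carrier (A Quot J). \<forall>N\<in>\<N>. x \<in> N} = {\<zero>\<^bsub>A Quot J\<^esub>}"
    by (elim exE conjE)
  let ?M = "\<lambda>N. {a \<in> carrier A. J +>\<^bsub>A\<^esub> a \<in> N}"
  obtain Ms where Ms: "set Ms = ?M ` \<N>" "distinct Ms"
    using finite_distinct_list[OF finite_imageI[OF N(1)]] by metis
  have M: "primeideal M A \<and> J \<subseteq> M" if MM: "M \<in> set Ms" for M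
  proof -
    obtain N where n: "N \<in> \<N>" "M = ?M N" using MM unfolding Ms(1) by (rule imageE)
    have NP: "primeideal N (A Quot J)" using C.S.maximalideal_prime N(2) n(1) by blast
    then have "primeideal M A" unfolding n(2) by (rule r.primeideal_vimage)
    moreover have "\<zero>\<^bsub>A Quot J\<^esub> \<in> N" using additive_subgroup.zero_closed[OF ideal.axioms(1)[OF primeideal.axioms(1)[OF NP]]] .
    then have "J \<in> N" unfolding Quot_zero .
    have "J \<subseteq> M"
    proof
      fix x assume x: "x \<in> J"
      then have "J +>\<^bsub>A\<^esub> x = J" using J.rcos_eq_self_iff J.a_Hcarr by blast
      then show "x \<in> M" unfolding n(2) using x J.a_Hcarr \<open>J \<in> N\<close> by simp
    qed
    ultimately show ?thesis by blast
  qed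
  have Mmax: "\<forall>M\<in>set Ms. maximalideal M A" using prime_imp_maximal[OF pc] M by blast
  have "{x \<in> carrier A. \<forall>M\<in>set Ms. x \<in> M} = J"
  proof (intro equalityI subsetI)
    fix x assume x: "x \<in> {x \<in> carrier A. \<forall>M\<in>set Ms. x \<in> M}"
    then have xc: "x \<in> carrier A" by blast
    have "J +>\<^bsub>A\<^esub> x \<in> N" if "N \<in> \<N>" for N
    proof -
      have "?M N \<in> set Ms" unfolding Ms(1) using that by (rule imageI)
      have *: "\<forall>M\<in>set Ms. x \<in> M" using x by simp
      from bspec[OF * \<open>?M N \<in> set Ms\<close>] have "x \<in> ?M N" .
      then show ?thesis by simp
    qed
    then have "J +>\<^bsub>A\<^esub> x \<in> {x \<in> carrier (A Quot J). \<forall>N\<in>\<N>. x \<in> N}"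
      using r.hom_closed[OF xc] by blast
    then have "J +>\<^bsub>A\<^esub> x = J" unfolding N(3) Quot_zero by blast
    then show "x \<in> J" using J.rcos_eq_self_iff x by blast
  next
    fix x assume "x \<in> J"
    then show "x \<in> {x \<in> carrier A. \<forall>M\<in>set Ms. x \<in> M}" using M J.a_Hcarr by blast
  qed
  then have "J = ideal_product A Ms" using S.ideal_product_distinct_maximals[OF Ms(2) Mmax] by simp
  moreover have "alg_isomorphic D (A Quot M) (quot_map A M \<circ> \<phi>) (D Quot p) (quot_map D p)" if "M \<in> set Ms" for M
  proof -
    have P: "primeideal M A" "J \<subseteq> M" using M[OF that] by auto
    show ?thesis
      using alg_isomorphic_Quot_prime_iff[OF primeideal.axioms(1)[OF P(1)] primeideal.I_notcarr[OF P(1), symmetric]]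
        residue_if_power_congruence[OF pc P] P(2) by blast
  qed
  ultimately show "\<exists>Ms. distinct Ms \<and>
      (\<forall>M\<in>set Ms. maximalideal M A \<and> alg_isomorphic D (A Quot M) (quot_map A M \<circ> \<phi>) (D Quot p) (quot_map D p)) \<and>
      J = ideal_product A Ms"
    using Ms(2) Mmax by blast
next
  assume "\<exists>Ms. distinct Ms \<and>
      (\<forall>M\<in>set Ms. maximalideal M A \<and> alg_isomorphic D (A Quot M) (quot_map A M \<circ> \<phi>) (D Quot p) (quot_map D p)) \<and>
      J = ideal_product A Ms"
  then obtain Ms where Ms: "distinct Ms" "\<forall>M\<in>set Ms. maximalideal M A"
    "\<forall>M\<in>set Ms. alg_isomorphic D (A Quot M) (quot_map A M \<circ> \<phi>) (D Quot p) (quot_map D p)"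
    "J = ideal_product A Ms" by blast
  show "power_congruence D p A \<phi>"
    unfolding power_congruence_def
  proof
    fix x assume x: "x \<in> carrier A"
    have "(x [^]\<^bsub>A\<^esub> q) \<ominus>\<^bsub>A\<^esub> x \<in> M" if "M \<in> set Ms" for M
    proof -
      interpret M: maximalideal M A using Ms(2) that by blast
      have *: "J \<subseteq> M" "\<forall>x\<in>carrier A. \<exists>d\<in>carrier D. x \<ominus>\<^bsub>A\<^esub> \<phi> d \<in> M"
        using alg_isomorphic_Quot_prime_iff[OF M.is_ideal M.I_notcarr[symmetric]] Ms(3) that by blast+
      then show ?thesis using frobenius_mem[OF M.is_ideal *(1) x] x by blast
    qed
    then show "(x [^]\<^bsub>A\<^esub> q) \<ominus>\<^bsub>A\<^esub> x \<in> J"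
      unfolding Ms(4) S.ideal_product_distinct_maximals[OF Ms(1,2)] using x by simp
  qed
qed

end

section \<open>\<open>t\<close>-ideals in terms of divisibility\<close>

text \<open>A fraction \<open>a / b\<close> belongs to the inverse of the ideal generated by
  \<open>S\<close> exactly if \<open>b\<close> divides every \<open>a s\<close>. This is therefore
  the \<open>v\<close>-closure, stated without the quotient field.\<close>

definition v_set :: "('a, 'm) ring_scheme \<Rightarrow> 'a set \<Rightarrow> 'a set"
  where "v_set R S = {x \<in> carrier R. \<forall>a\<in>carrier R. \<forall>b\<in>carrier R - {\<zero>\<^bsub>R\<^esub>}.
    (\<forall>s\<in>S. b divides\<^bsub>R\<^esub> (a \<otimes>\<^bsub>R\<^esub> s)) \<longrightarrow> b divides\<^bsub>R\<^esub> (a \<otimes>\<^bsub>R\<^esub> x)}"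

context domain
begin

abbreviation "K \<equiv> quot_field R"
abbreviation "\<iota> \<equiv> quot_field_map R"
abbreviation "N0 \<equiv> carrier R - {\<zero>}"

lemma K_eq: "K = loc R N0" "\<iota> = (\<lambda>a. loc_frac R N0 a \<one>)"
  unfolding quot_field_def loc_at_def quot_field_map_def loc_map_def by auto

lemma iota_hom: "ring_hom_cring R K \<iota>"
  unfolding K_eq by (rule localization.frac_hom[OF localization_nonzero])

lemma iota_inj: "inj_on \<iota> (carrier R)"
  unfolding K_eq by (rule loc_domain(2)[OF localization_nonzero]) simp

lemma K_cases:
  assumes "x \<in> carrier K"
  obtains a b where "a \<in> carrier R" "b \<in> N0" "x = loc_frac R N0 a b"
  using localization.loc_cases[OF localization_nonzero] assms unfolding K_eq by blast

lemma frac_in_iota_iff: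
  assumes "a \<in> carrier R" "b \<in> N0"
  shows "loc_frac R N0 a b \<in> \<iota> ` carrier R \<longleftrightarrow> b divides a"
proof -
  interpret L: localization R N0 by (rule localization_nonzero)
  have "loc_frac R N0 a b = loc_frac R N0 c \<one> \<longleftrightarrow> a = b \<otimes> c" if c: "c \<in> carrier R" for c
  proof -
    have "loc_frac R N0 a b = loc_frac R N0 c \<one> \<longleftrightarrow> (\<exists>u\<in>N0. u \<otimes> (\<one> \<otimes> a) = u \<otimes> (b \<otimes> c))"
      by (rule L.frac_eq_iff[OF assms c L.S_one])
    also have "\<dots> \<longleftrightarrow> (\<exists>u\<in>N0. a = b \<otimes> c)"
      using assms c by (intro bex_cong HOL.refl) (auto simp: m_lcancel)
    also have "\<dots> \<longleftrightarrow> a = b \<otimes> c" using L.S_one by blast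
    finally show ?thesis .
  qed
  then show ?thesis unfolding K_eq factor_def by blast
qed

lemma frac_iota_mult:
  assumes "a \<in> carrier R" "b \<in> N0" "s \<in> carrier R"
  shows "loc_frac R N0 a b \<otimes>\<^bsub>K\<^esub> \<iota> s = loc_frac R N0 (a \<otimes> s) b"
proof -
  interpret L: localization R N0 by (rule localization_nonzero)
  show ?thesis unfolding K_eq using assms by (simp add: L.frac_mult L.S_one)
qed

interpretation K: field K by (rule quot_field_field)
interpretation iota: ring_hom_cring R K \<iota> by (rule iota_hom)

text \<open>Lets the inverse of a span be tested on generators alone: whatever \<open>x\<close>
  sends into the ring is closed under linear combinations.\<close>

lemma frac_submodule_vimage:
  assumes x: "x \<in> carrier K"
  shows "frac_submodule R {y \<in> carrier K. x \<otimes>\<^bsub>K\<^esub> y \<in> \<iota> ` carrier R}"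
  unfolding frac_submodule_def
proof (intro conjI ballI)
  have im: "subgroup (\<iota> ` carrier R) (add_monoid K)"
    using iota.ring.img_is_add_subgroup[OF add.subgroup_self] by simp
  interpret I: additive_subgroup "\<iota> ` carrier R" K
    by (rule additive_subgroup.intro[OF im])
  show "additive_subgroup {y \<in> carrier K. x \<otimes>\<^bsub>K\<^esub> y \<in> \<iota> ` carrier R} K"
  proof (rule additive_subgroup.intro, rule K.add.subgroupI)
    have "x \<otimes>\<^bsub>K\<^esub> \<zero>\<^bsub>K\<^esub> \<in> \<iota> ` carrier R" using I.zero_closed x by simp
    then show "{y \<in> carrier K. x \<otimes>\<^bsub>K\<^esub> y \<in> \<iota> ` carrier R} \<noteq> {}" using K.zero_closed by blast
  next
    fix y assume "y \<in> {y \<in> carrier K. x \<otimes>\<^bsub>K\<^esub> y \<in> \<iota> ` carrier R}"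
    then show "\<ominus>\<^bsub>K\<^esub> y \<in> {y \<in> carrier K. x \<otimes>\<^bsub>K\<^esub> y \<in> \<iota> ` carrier R}"
      using x I.a_inv_closed[of "x \<otimes>\<^bsub>K\<^esub> y"] by (simp add: K.r_minus)
  next
    fix y z assume "y \<in> {y \<in> carrier K. x \<otimes>\<^bsub>K\<^esub> y \<in> \<iota> ` carrier R}" "z \<in> {y \<in> carrier K. x \<otimes>\<^bsub>K\<^esub> y \<in> \<iota> ` carrier R}"
    then show "y \<oplus>\<^bsub>K\<^esub> z \<in> {y \<in> carrier K. x \<otimes>\<^bsub>K\<^esub> y \<in> \<iota> ` carrier R}"
      using x I.a_closed[of "x \<otimes>\<^bsub>K\<^esub> y" "x \<otimes>\<^bsub>K\<^esub> z"] by (simp add: K.r_distr)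
  qed simp
  fix d y assume d: "d \<in> carrier R" and y: "y \<in> {y \<in> carrier K. x \<otimes>\<^bsub>K\<^esub> y \<in> \<iota> ` carrier R}"
  then obtain c where c: "c \<in> carrier R" "x \<otimes>\<^bsub>K\<^esub> y = \<iota> c" by blast
  have "x \<otimes>\<^bsub>K\<^esub> (\<iota> d \<otimes>\<^bsub>K\<^esub> y) = \<iota> (d \<otimes> c)"
    using x y d c(1) by (simp add: K.m_lcomm c(2)[symmetric])
  moreover have "\<iota> (d \<otimes> c) \<in> \<iota> ` carrier R" using m_closed[OF d c(1)] by (rule imageI)
  ultimately show "\<iota> d \<otimes>\<^bsub>K\<^esub> y \<in> {y \<in> carrier K. x \<otimes>\<^bsub>K\<^esub> y \<in> \<iota> ` carrier R}"
    using y iota.hom_closed[OF d] by simp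
qed

lemma frac_submodule_iota:
  assumes "ideal I R"
  shows "frac_submodule R (\<iota> ` I)"
proof -
  interpret I: ideal I R by fact
  have "subgroup (\<iota> ` I) (add_monoid K)"
    using iota.ring.img_is_add_subgroup[OF I.a_subgroup] .
  moreover have "\<iota> d \<otimes>\<^bsub>K\<^esub> x \<in> \<iota> ` I" if "d \<in> carrier R" "x \<in> \<iota> ` I" for d x
  proof -
    from that(2) obtain y where y: "y \<in> I" "x = \<iota> y" by blast
    have "\<iota> d \<otimes>\<^bsub>K\<^esub> x = \<iota> (d \<otimes> y)" unfolding y(2) using that(1) I.a_Hcarr[OF y(1)] by simp
    then show ?thesis using I.I_l_closed[OF y(1) that(1)] by blast
  qed
  ultimately show ?thesis unfolding frac_submodule_def using additive_subgroup.intro by blast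
qed

lemma frac_submodule_carrier: "frac_submodule R (carrier K)"
  unfolding frac_submodule_def
  using K.add.subgroup_self iota.hom_closed by (auto intro!: additive_subgroup.intro)

lemma frac_submodule_frac_span:
  assumes "T \<subseteq> carrier K"
  shows "frac_submodule R (frac_span R T)"
proof -
  let ?F = "{M. frac_submodule R M \<and> T \<subseteq> M}"
  have ne: "carrier K \<in> ?F" using frac_submodule_carrier assms by blast
  have sg: "subgroup M (add_monoid K)" if "M \<in> ?F" for M
    using that unfolding frac_submodule_def additive_subgroup_def by blast
  have "subgroup (\<Inter>?F) (add_monoid K)"
    by (rule K.add.subgroups_Inter) (use sg ne in blast)+
  then show ?thesis
    unfolding frac_span_def frac_submodule_def additive_subgroup_def by blast
qed

lemma frac_span_minimal: "frac_submodule R M \<Longrightarrow> T \<subseteq> M \<Longrightarrow> frac_span R T \<subseteq> M"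
  unfolding frac_span_def by blast

lemma frac_span_self: "T \<subseteq> frac_span R T"
  unfolding frac_span_def by blast

lemma frac_inverse_frac_span:
  assumes "T \<subseteq> carrier K"
  shows "frac_inverse R (frac_span R T) = {x \<in> carrier K. \<forall>t\<in>T. x \<otimes>\<^bsub>K\<^esub> t \<in> \<iota> ` carrier R}"
proof (intro equalityI subsetI)
  fix x assume x: "x \<in> {x \<in> carrier K. \<forall>t\<in>T. x \<otimes>\<^bsub>K\<^esub> t \<in> \<iota> ` carrier R}"
  then have "frac_span R T \<subseteq> {y \<in> carrier K. x \<otimes>\<^bsub>K\<^esub> y \<in> \<iota> ` carrier R}"
    using assms by (intro frac_span_minimal frac_submodule_vimage) auto
  then show "x \<in> frac_inverse R (frac_span R T)" using x unfolding frac_inverse_def by blast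
qed (use frac_span_self in \<open>auto simp: frac_inverse_def\<close>)

lemma v_closure_frac_span:
  assumes S: "S \<subseteq> carrier R"
  shows "v_closure R (frac_span R (\<iota> ` S)) = \<iota> ` v_set R S"
proof -
  have im: "\<iota> ` S \<subseteq> carrier K" using S iota.hom_closed by blast
  let ?V = "{x \<in> carrier K. \<forall>t\<in>\<iota> ` S. x \<otimes>\<^bsub>K\<^esub> t \<in> \<iota> ` carrier R}"
  have V: "loc_frac R N0 a b \<in> ?V \<longleftrightarrow> (\<forall>s\<in>S. b divides (a \<otimes> s))" if ab: "a \<in> carrier R" "b \<in> N0" for a b
  proof -
    have "loc_frac R N0 a b \<otimes>\<^bsub>K\<^esub> \<iota> s \<in> \<iota> ` carrier R \<longleftrightarrow> b divides (a \<otimes> s)" if "s \<in> S" for s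
    proof -
      have s: "s \<in> carrier R" using that S by blast
      show ?thesis unfolding frac_iota_mult[OF ab s] using ab s by (intro frac_in_iota_iff) auto
    qed
    moreover have "loc_frac R N0 a b \<in> carrier K"
      unfolding K_eq using localization.frac_closed[OF localization_nonzero ab] .
    ultimately show ?thesis by simp
  qed
  have vc: "v_closure R (frac_span R (\<iota> ` S)) = {y \<in> carrier K. \<forall>x\<in>?V. y \<otimes>\<^bsub>K\<^esub> x \<in> \<iota> ` carrier R}"
    unfolding v_closure_def frac_inverse_frac_span[OF im] unfolding frac_inverse_def ..
  have key: "(\<forall>x\<in>?V. \<iota> z \<otimes>\<^bsub>K\<^esub> x \<in> \<iota> ` carrier R) \<longleftrightarrow> z \<in> v_set R S" if z: "z \<in> carrier R" for z
  proof -
    have e: "\<iota> z \<otimes>\<^bsub>K\<^esub> loc_frac R N0 a b \<in> \<iota> ` carrier R \<longleftrightarrow> b divides (a \<otimes> z)"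
      if ab: "a \<in> carrier R" "b \<in> N0" for a b
    proof -
      have "loc_frac R N0 a b \<in> carrier K"
        unfolding K_eq using localization.frac_closed[OF localization_nonzero ab] .
      then have "\<iota> z \<otimes>\<^bsub>K\<^esub> loc_frac R N0 a b = loc_frac R N0 (a \<otimes> z) b"
        using frac_iota_mult[OF ab z] K.m_comm[OF iota.hom_closed[OF z]] by simp
      then show ?thesis using frac_in_iota_iff[of "a \<otimes> z" b] ab z by simp
    qed
    show ?thesis
    proof
      assume *: "\<forall>x\<in>?V. \<iota> z \<otimes>\<^bsub>K\<^esub> x \<in> \<iota> ` carrier R"
      show "z \<in> v_set R S"
        unfolding v_set_def
      proof (intro CollectI conjI z ballI impI)
        fix a b assume ab: "a \<in> carrier R" "b \<in> N0" "\<forall>s\<in>S. b divides (a \<otimes> s)"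
        then show "b divides (a \<otimes> z)" using * V[OF ab(1,2)] e[OF ab(1,2)] by blast
      qed
    next
      assume z: "z \<in> v_set R S"
      show "\<forall>x\<in>?V. \<iota> z \<otimes>\<^bsub>K\<^esub> x \<in> \<iota> ` carrier R"
      proof
        fix x assume x: "x \<in> ?V"
        then have "x \<in> carrier K" by blast
        then obtain a b where ab: "a \<in> carrier R" "b \<in> N0" "x = loc_frac R N0 a b" by (rule K_cases)
        have "\<forall>s\<in>S. b divides (a \<otimes> s)" using x V[OF ab(1,2)] unfolding ab(3) by blast
        then show "\<iota> z \<otimes>\<^bsub>K\<^esub> x \<in> \<iota> ` carrier R"
          using z ab(1,2) unfolding ab(3) e[OF ab(1,2)] v_set_def by blast
      qed
    qed
  qed
  \<comment> \<open>Since 1 belongs to the inverse, the \<open>v\<close>-closure stays inside the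
    ring.\<close>
  have oneV: "\<one>\<^bsub>K\<^esub> \<in> ?V" using im S by auto
  show ?thesis
  proof (intro equalityI subsetI)
    fix y assume "y \<in> v_closure R (frac_span R (\<iota> ` S))"
    then have y: "y \<in> carrier K" "\<forall>x\<in>?V. y \<otimes>\<^bsub>K\<^esub> x \<in> \<iota> ` carrier R" unfolding vc by blast+
    then have "y \<otimes>\<^bsub>K\<^esub> \<one>\<^bsub>K\<^esub> \<in> \<iota> ` carrier R" using oneV by blast
    then have "y \<in> \<iota> ` carrier R" using y(1) by simp
    then obtain z where z: "z \<in> carrier R" "y = \<iota> z" by blast
    then show "y \<in> \<iota> ` v_set R S" using key[OF z(1)] y(2) by blast
  next
    fix y assume "y \<in> \<iota> ` v_set R S"
    then obtain z where z: "z \<in> v_set R S" "y = \<iota> z" by blast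
    have zc: "z \<in> carrier R" using z(1) unfolding v_set_def by blast
    show "y \<in> v_closure R (frac_span R (\<iota> ` S))"
      unfolding vc using key[OF zc] z iota.hom_closed[OF zc] by blast
  qed
qed

lemma nonzero_fractional_frac_span:
  assumes S: "S \<subseteq> carrier R" "\<not> S \<subseteq> {\<zero>}"
  shows "nonzero_fractional_ideal R (frac_span R (\<iota> ` S))"
proof -
  have im: "\<iota> ` S \<subseteq> carrier K" using S iota.hom_closed by blast
  obtain s where s: "s \<in> S" "s \<noteq> \<zero>" using S(2) by blast
  have "\<iota> s \<noteq> \<zero>\<^bsub>K\<^esub>"
    using inj_onD[OF iota_inj, of s \<zero>] s S(1) iota.hom_zero by auto
  then have "frac_span R (\<iota> ` S) \<noteq> {\<zero>\<^bsub>K\<^esub>}" using frac_span_self[of "\<iota> ` S"] s(1) by blast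
  moreover have "frac_span R (\<iota> ` S) \<subseteq> \<iota> ` carrier R"
    by (rule frac_span_minimal[OF frac_submodule_iota[OF oneideal]]) (use S(1) in blast)
  then have "\<forall>x\<in>frac_span R (\<iota> ` S). \<iota> \<one> \<otimes>\<^bsub>K\<^esub> x \<in> \<iota> ` carrier R"
    using iota.hom_closed by auto
  then have "\<exists>d\<in>N0. \<forall>x\<in>frac_span R (\<iota> ` S). \<iota> d \<otimes>\<^bsub>K\<^esub> x \<in> \<iota> ` carrier R"
    by (rule bexI) simp
  ultimately show ?thesis
    unfolding nonzero_fractional_ideal_def using frac_submodule_frac_span[OF im] by blast
qed

text \<open>A finitely generated submodule inside the image of \<open>I\<close> has finitely many
  generators that come from \<open>I\<close>, and it is nonzero exactly if these are not all
  zero.\<close>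

lemma t_closure_eq:
  assumes I: "ideal I R"
  shows "t_closure R (\<iota> ` I) = \<Union>{\<iota> ` v_set R S | S. finite S \<and> S \<subseteq> I \<and> \<not> S \<subseteq> {\<zero>}}"
proof -
  interpret I: ideal I R by fact
  have "(\<exists>J. U = v_closure R J \<and> nonzero_fractional_ideal R J \<and> fin_gen R J \<and> J \<subseteq> \<iota> ` I) \<longleftrightarrow>
      (\<exists>S. U = \<iota> ` v_set R S \<and> finite S \<and> S \<subseteq> I \<and> \<not> S \<subseteq> {\<zero>})" for U
  proof
    assume "\<exists>J. U = v_closure R J \<and> nonzero_fractional_ideal R J \<and> fin_gen R J \<and> J \<subseteq> \<iota> ` I"
    then obtain J where J: "U = v_closure R J" "nonzero_fractional_ideal R J" "fin_gen R J" "J \<subseteq> \<iota> ` I" by blast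
    then obtain T where T: "finite T" "T \<subseteq> carrier K" "J = frac_span R T" unfolding fin_gen_def by blast
    have "T \<subseteq> \<iota> ` I" using J(4) T(3) frac_span_self by blast
    then obtain S where S: "S \<subseteq> I" "finite S" "T = \<iota> ` S" using finite_subset_image[OF T(1)] by metis
    have "\<not> S \<subseteq> {\<zero>}"
    proof
      assume "S \<subseteq> {\<zero>}"
      then have "T \<subseteq> \<iota> ` {\<zero>}" unfolding S(3) by (rule image_mono)
      then have "J \<subseteq> \<iota> ` {\<zero>}" unfolding T(3) by (rule frac_span_minimal[OF frac_submodule_iota[OF zeroideal]])
      then have "J \<subseteq> {\<zero>\<^bsub>K\<^esub>}" using iota.hom_zero by simp
      moreover have "\<zero>\<^bsub>K\<^esub> \<in> J"
        using J(2) additive_subgroup.zero_closed unfolding nonzero_fractional_ideal_def frac_submodule_def by blast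
      ultimately have "J = {\<zero>\<^bsub>K\<^esub>}" by blast
      then show False using J(2) unfolding nonzero_fractional_ideal_def by blast
    qed
    moreover have "S \<subseteq> carrier R" using S(1) I.a_subset by blast
    ultimately show "\<exists>S. U = \<iota> ` v_set R S \<and> finite S \<and> S \<subseteq> I \<and> \<not> S \<subseteq> {\<zero>}"
      using S(1,2) v_closure_frac_span unfolding J(1) T(3) S(3) by blast
  next
    assume "\<exists>S. U = \<iota> ` v_set R S \<and> finite S \<and> S \<subseteq> I \<and> \<not> S \<subseteq> {\<zero>}"
    then obtain S where S: "U = \<iota> ` v_set R S" "finite S" "S \<subseteq> I" "\<not> S \<subseteq> {\<zero>}" by blast
    have Sc: "S \<subseteq> carrier R" using S(3) I.a_subset by blast
    have "fin_gen R (frac_span R (\<iota> ` S))"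
      unfolding fin_gen_def using S(2) Sc iota.hom_closed by (intro exI[of _ "\<iota> ` S"]) auto
    moreover have "frac_span R (\<iota> ` S) \<subseteq> \<iota> ` I"
      by (rule frac_span_minimal[OF frac_submodule_iota[OF I]]) (use S(3) in blast)
    ultimately show "\<exists>J. U = v_closure R J \<and> nonzero_fractional_ideal R J \<and> fin_gen R J \<and> J \<subseteq> \<iota> ` I"
      using nonzero_fractional_frac_span[OF Sc S(4)] v_closure_frac_span[OF Sc] S(1) by metis
  qed
  then show ?thesis unfolding t_closure_def by presburger
qed

lemma proper_t_ideal_iff:
  "proper_t_ideal R I \<longleftrightarrow> ideal I R \<and> I \<noteq> {\<zero>} \<and> I \<noteq> carrier R \<and>
    (\<forall>S. finite S \<and> S \<subseteq> I \<and> \<not> S \<subseteq> {\<zero>} \<longrightarrow> v_set R S \<subseteq> I)"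
proof -
  have "t_closure R (\<iota> ` I) = \<iota> ` I \<longleftrightarrow> (\<forall>S. finite S \<and> S \<subseteq> I \<and> \<not> S \<subseteq> {\<zero>} \<longrightarrow> v_set R S \<subseteq> I)"
    if I: "ideal I R" and nz: "I \<noteq> {\<zero>}"
  proof -
    interpret I: ideal I R by fact
    obtain y where y: "y \<in> I" "y \<noteq> \<zero>" using nz I.zero_closed by blast
    have self: "x \<in> v_set R {x}" if "x \<in> carrier R" for x
      using that unfolding v_set_def by simp
    \<comment> \<open>The zero element needs a generating set other than \<open>{0}\<close>, which
      is excluded; any nonzero \<open>y\<close> of \<open>I\<close> serves.\<close>
    have zero: "\<zero> \<in> v_set R {y}"
      unfolding v_set_def by (auto simp: factor_def intro!: bexI[of _ \<zero>])
    have "\<iota> ` I \<subseteq> t_closure R (\<iota> ` I)"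
      unfolding t_closure_eq[OF I]
    proof
      fix w assume "w \<in> \<iota> ` I"
      then obtain x where x: "x \<in> I" "w = \<iota> x" by blast
      have "\<exists>S. finite S \<and> S \<subseteq> I \<and> \<not> S \<subseteq> {\<zero>} \<and> x \<in> v_set R S"
      proof (cases "x = \<zero>")
        case True
        then show ?thesis using y zero by (intro exI[of _ "{y}"]) simp
      next
        case False
        then show ?thesis using x self[OF I.a_Hcarr[OF x(1)]] by (intro exI[of _ "{x}"]) simp
      qed
      then show "w \<in> \<Union>{\<iota> ` v_set R S | S. finite S \<and> S \<subseteq> I \<and> \<not> S \<subseteq> {\<zero>}}"
        unfolding x(2) by blast
    qed
    then have "t_closure R (\<iota> ` I) = \<iota> ` I \<longleftrightarrow> t_closure R (\<iota> ` I) \<subseteq> \<iota> ` I" by blast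
    also have "\<dots> \<longleftrightarrow> (\<forall>S. finite S \<and> S \<subseteq> I \<and> \<not> S \<subseteq> {\<zero>} \<longrightarrow> \<iota> ` v_set R S \<subseteq> \<iota> ` I)"
      unfolding t_closure_eq[OF I] by blast
    finally have 1: "t_closure R (\<iota> ` I) = \<iota> ` I \<longleftrightarrow>
      (\<forall>S. finite S \<and> S \<subseteq> I \<and> \<not> S \<subseteq> {\<zero>} \<longrightarrow> \<iota> ` v_set R S \<subseteq> \<iota> ` I)" .
    have "\<iota> ` v_set R S \<subseteq> \<iota> ` I \<longleftrightarrow> v_set R S \<subseteq> I" for S
      proof -
      have "v_set R S \<subseteq> carrier R" unfolding v_set_def by blast
      then show ?thesis using inj_on_image_mem_iff[OF iota_inj _ I.a_subset] by blast
    qed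
    then show ?thesis unfolding 1 by simp
  qed
  then show ?thesis unfolding proper_t_ideal_def by metis
qed

text \<open>For \<open>a\<close> outside \<open>p\<close> the ideal \<open>(p : a)\<close> is again
  a proper \<open>t\<close>-ideal above \<open>p\<close>. Maximality gives
  \<open>(p : a) = p\<close>, so that \<open>a b \<in> p\<close> forces
  \<open>b \<in> p\<close>.\<close>

lemma t_maximal_prime:
  assumes "t_maximal R p"
  shows "primeideal p R"
proof -
  have pt: "proper_t_ideal R p" and max: "\<And>I. proper_t_ideal R I \<Longrightarrow> p \<subseteq> I \<Longrightarrow> I = p"
    using assms unfolding t_maximal_def by blast+
  then interpret p: ideal p R unfolding proper_t_ideal_def by blast
  have p1: "\<one> \<notin> p" using pt p.one_imp_carrier unfolding proper_t_ideal_def by blast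
  show ?thesis
  proof (rule primeidealI[OF p.is_ideal is_cring])
    show "carrier R \<noteq> p" using pt unfolding proper_t_ideal_def by blast
    fix a b assume ab: "a \<in> carrier R" "b \<in> carrier R" "a \<otimes> b \<in> p"
    show "a \<in> p \<or> b \<in> p"
    proof (cases "a \<in> p")
      case False
      then have a0: "a \<noteq> \<zero>" using p.zero_closed by blast
      let ?I = "{r \<in> carrier R. r \<otimes> a \<in> p}"
      have pI: "p \<subseteq> ?I" using p.I_r_closed p.a_Hcarr ab(1) by blast
      have "proper_t_ideal R ?I"
        unfolding proper_t_ideal_iff
      proof (intro conjI allI impI)
        show "ideal ?I R" by (rule colon_ideal[OF p.is_ideal ab(1)])
        show "?I \<noteq> {\<zero>}" using pI pt p.zero_closed unfolding proper_t_ideal_def by blast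
        have "\<one> \<notin> ?I" using False ab(1) by simp
        then show "?I \<noteq> carrier R" by blast
        fix S assume S: "finite S \<and> S \<subseteq> ?I \<and> \<not> S \<subseteq> {\<zero>}"
        then have Sc: "\<And>s. s \<in> S \<Longrightarrow> s \<in> carrier R" by blast
        have "v_set R ((\<lambda>s. s \<otimes> a) ` S) \<subseteq> p"
        proof -
          obtain s where "s \<in> S" "s \<noteq> \<zero>" using S by blast
          then have "s \<otimes> a \<noteq> \<zero>" using a0 ab(1) Sc integral_iff by blast
          then have "\<not> (\<lambda>s. s \<otimes> a) ` S \<subseteq> {\<zero>}" using \<open>s \<in> S\<close> by blast
          moreover have "(\<lambda>s. s \<otimes> a) ` S \<subseteq> p" "finite ((\<lambda>s. s \<otimes> a) ` S)" using S by blast+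
          ultimately show ?thesis using pt unfolding proper_t_ideal_iff by blast
        qed
        \<comment> \<open>Multiplication by \<open>a\<close> carries the \<open>v\<close>-closure of
          \<open>S\<close> into that of \<open>a S\<close>: a fraction \<open>c / b\<close> tested
          on \<open>a S\<close> is the fraction \<open>c a / b\<close> tested on
          \<open>S\<close>.\<close>
        moreover have "x \<otimes> a \<in> v_set R ((\<lambda>s. s \<otimes> a) ` S)" if x: "x \<in> v_set R S" for x
          unfolding v_set_def
        proof (intro CollectI conjI ballI impI)
          have xc: "x \<in> carrier R" using x unfolding v_set_def by blast
          then show "x \<otimes> a \<in> carrier R" using ab(1) by simp
          fix c b assume cb: "c \<in> carrier R" "b \<in> N0" "\<forall>s\<in>(\<lambda>s. s \<otimes> a) ` S. b divides (c \<otimes> s)"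
          have "c \<otimes> a \<otimes> s = c \<otimes> (s \<otimes> a)" if "s \<in> carrier R" for s
            using that cb(1) ab(1) by (simp add: m_ac)
          then have "\<forall>s\<in>S. b divides (c \<otimes> a \<otimes> s)" using cb(3) Sc by simp
          moreover have "c \<otimes> a \<in> carrier R" using cb(1) ab(1) by simp
          ultimately have "b divides (c \<otimes> a \<otimes> x)" using x cb(2) unfolding v_set_def by blast
          then show "b divides (c \<otimes> (x \<otimes> a))" using xc cb(1) ab(1) by (simp add: m_ac)
        qed
        ultimately show "v_set R S \<subseteq> ?I" unfolding v_set_def by blast
      qed
      then have Ip: "?I = p" using max pI by blast
      have "b \<otimes> a \<in> p" using ab(3) m_comm[OF ab(1,2)] by simp
      then have "b \<in> ?I" using ab(2) by blast
      then show ?thesis unfolding Ip by blast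
    qed simp
  qed
qed

end

text \<open>Multiplication by a nonzero element of the finite domain \<open>R / p\<close> is
  injective, hence surjective.\<close>

lemma (in cring) finite_prime_imp_maximal:
  assumes P: "primeideal p R" and fin: "finite_norm R p"
  shows "maximalideal p R"
proof -
  interpret p: primeideal p R by fact
  interpret Q: domain "R Quot p" by (rule p.quotient_is_domain)
  interpret h: ring_hom_cring R "R Quot p" "(+>) p" by (rule p.rcos_ring_hom_cring)
  show ?thesis
  proof (rule maximalidealI[OF p.is_ideal p.I_notcarr])
    fix I assume I: "ideal I R" "p \<subseteq> I" "I \<subseteq> carrier R"
    interpret I: ideal I R by fact
    show "I = p \<or> I = carrier R"
    proof (cases "I = p")
      case False
      then obtain x where x: "x \<in> I" "x \<notin> p" using I(2) by blast
      have xc: "x \<in> carrier R" using x I(3) by blast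
      have px: "p +> x \<in> carrier (R Quot p)" "p +> x \<noteq> \<zero>\<^bsub>R Quot p\<^esub>"
        using h.hom_closed[OF xc] p.rcos_eq_self_iff[OF xc] x(2) unfolding Quot_zero by blast+
      have "inj_on (\<lambda>y. (p +> x) \<otimes>\<^bsub>R Quot p\<^esub> y) (carrier (R Quot p))"
        using px Q.m_lcancel by (intro inj_onI) blast
      then have "(\<lambda>y. (p +> x) \<otimes>\<^bsub>R Quot p\<^esub> y) ` carrier (R Quot p) = carrier (R Quot p)"
        using fin px(1) unfolding finite_norm_def by (intro endo_inj_surj) auto
      then have "\<one>\<^bsub>R Quot p\<^esub> \<in> (\<lambda>y. (p +> x) \<otimes>\<^bsub>R Quot p\<^esub> y) ` carrier (R Quot p)" using Q.one_closed by simp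
      then obtain z where z: "z \<in> carrier (R Quot p)" "\<one>\<^bsub>R Quot p\<^esub> = (p +> x) \<otimes>\<^bsub>R Quot p\<^esub> z" by (rule imageE)
      obtain y where y: "y \<in> carrier R" "z = p +> y" using z(1) by (rule p.Quot_cases)
      have "p +> \<one> = p +> (x \<otimes> y)" using z(2) h.hom_mult[OF xc y(1)] h.hom_one unfolding y(2) by simp
      then have "\<one> \<ominus> x \<otimes> y \<in> p"
        using p.rcos_eq_iff[OF one_closed m_closed[OF xc y(1)]] by blast
      then have "(\<one> \<ominus> x \<otimes> y) \<oplus> x \<otimes> y \<in> I" using I(2) I.I_r_closed[OF x(1) y(1)] by (intro I.a_closed) auto
      then have "\<one> \<in> I" using minus_add_cancel[of \<one> "x \<otimes> y"] xc y(1) by simp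
      then show ?thesis using I.one_imp_carrier by blast
    qed simp
  qed
qed

section \<open>A criterion for \<open>t\<close>-maximality\<close>

context domain
begin

text \<open>By \<open>nd\<close> the fraction \<open>a / b\<close> lies outside the localization at
  \<open>p\<close>, and by \<open>kill\<close> powers of each element of \<open>p\<close> bring it
  in. For finite \<open>S\<close> in \<open>p\<close> a multiple \<open>w a / b\<close> is found
  that is still outside while every \<open>s\<close> in \<open>S\<close> brings it in, with one
  common \<open>t\<close>. Then \<open>t w a / b\<close> is in the inverse of \<open>S\<close>, and
  an element of the \<open>v\<close>-closure outside \<open>p\<close> would bring
  \<open>w a / b\<close> in as well.\<close>

lemma t_maximal_if_locally_killed:
  assumes P: "primeideal p R" and nz: "p \<noteq> {\<zero>}" and fin: "finite_norm R p"
    and a: "a \<in> carrier R" and b: "b \<in> N0"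
    and nd: "\<And>t. t \<in> carrier R - p \<Longrightarrow> \<not> b divides (t \<otimes> a)"
    and kill: "\<And>s. s \<in> p \<Longrightarrow> \<exists>N::nat. \<exists>t\<in>carrier R - p. b divides (t \<otimes> (s [^] N \<otimes> a))"
  shows "t_maximal R p"
proof -
  interpret p: primeideal p R by fact
  interpret L: localization R "carrier R - p" by (rule localization_primeI[OF P])
  interpret m: maximalideal p R by (rule finite_prime_imp_maximal[OF P fin])
  have bc: "b \<in> carrier R" using b by blast
  have dm: "b divides (w \<otimes> y)" if "b divides y" "y \<in> carrier R" "w \<in> carrier R" for w y
    by (rule divides_prod_l[OF bc that(2,3,1)])
  have ex: "\<exists>w\<in>carrier R. (\<forall>t\<in>carrier R - p. \<not> b divides (t \<otimes> (w \<otimes> a))) \<and>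
      (\<exists>t\<in>carrier R - p. \<forall>s\<in>S. b divides (t \<otimes> (s \<otimes> (w \<otimes> a))))" if S: "finite S" "S \<subseteq> p" for S
    using S
  proof (induction S)
    case empty
    then show ?case using nd a L.S_one by (intro bexI[of _ \<one>]) auto
  next
    case (insert s S)
    then obtain w t where w: "w \<in> carrier R" "\<forall>t\<in>carrier R - p. \<not> b divides (t \<otimes> (w \<otimes> a))"
      and t: "t \<in> carrier R - p" "\<forall>s\<in>S. b divides (t \<otimes> (s \<otimes> (w \<otimes> a)))" by blast
    have s: "s \<in> p" "s \<in> carrier R" using insert p.a_Hcarr by auto
    have Sc: "\<And>s. s \<in> S \<Longrightarrow> s \<in> carrier R" using insert p.a_Hcarr by blast
    let ?Q = "\<lambda>N::nat. \<exists>t\<in>carrier R - p. b divides (t \<otimes> (s [^] N \<otimes> (w \<otimes> a)))"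
    have "\<exists>N. ?Q N"
    proof -
      obtain N :: nat and t where t: "t \<in> carrier R - p" "b divides (t \<otimes> (s [^] N \<otimes> a))" using kill s by blast
      then have "b divides (w \<otimes> (t \<otimes> (s [^] N \<otimes> a)))" using w(1) a s t(1) by (intro dm[OF t(2)]) auto
      also have "w \<otimes> (t \<otimes> (s [^] N \<otimes> a)) = t \<otimes> (s [^] N \<otimes> (w \<otimes> a))"
        using w(1) a s t(1) by (simp add: m_ac)
      finally show ?thesis using t(1) by blast
    qed
    \<comment> \<open>The least exponent is positive. One power less gives the new multiplier
      \<open>s^M w\<close>: the fraction is still outside, and \<open>s\<close> brings it in. The
      earlier members of \<open>S\<close> keep doing so, as divisibility survives
      multiplication.\<close>
    then have Q: "?Q (LEAST N. ?Q N)" by (rule LeastI_ex)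
    have "\<not> ?Q 0" using w a by auto
    have "(LEAST N. ?Q N) \<noteq> 0"
    proof
      assume z: "(LEAST N. ?Q N) = 0"
      show False using Q unfolding z using \<open>\<not> ?Q 0\<close> by contradiction
    qed
    then obtain M where M: "(LEAST N. ?Q N) = Suc M" by (rule not0_implies_Suc[THEN exE])
    have nQ: "\<not> ?Q M" using not_less_Least[of M ?Q] M by simp
    obtain t' where t': "t' \<in> carrier R - p" "b divides (t' \<otimes> (s [^] Suc M \<otimes> (w \<otimes> a)))"
      using Q unfolding M by (rule bexE)
    let ?w = "s [^] M \<otimes> w"
    have c: "?w \<in> carrier R" "s [^] M \<in> carrier R" using w(1) s by auto
    have "\<forall>t\<in>carrier R - p. \<not> b divides (t \<otimes> (?w \<otimes> a))"
      using nQ c w(1) a by (simp add: m_assoc)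
    moreover have "b divides (t \<otimes> t' \<otimes> (r \<otimes> (?w \<otimes> a)))" if r: "r \<in> insert s S" for r
    proof (cases "r = s")
      case True
      have "b divides (t \<otimes> (t' \<otimes> (s [^] Suc M \<otimes> (w \<otimes> a))))" by (rule dm[OF t'(2)]) (use t'(1) t(1) w(1) a s in simp_all)
      also have "t \<otimes> (t' \<otimes> (s [^] Suc M \<otimes> (w \<otimes> a))) = t \<otimes> t' \<otimes> (s \<otimes> (s [^] M \<otimes> (w \<otimes> a)))"
        unfolding nat_pow_Suc using t(1) t'(1) c(2) w(1) a s(2) by (simp add: m_ac)
      also have "s [^] M \<otimes> (w \<otimes> a) = ?w \<otimes> a" using m_assoc[OF c(2) w(1) a] by simp
      finally show ?thesis using True by simp
    next
      case False
      then have r: "r \<in> S" "r \<in> carrier R" using r Sc by auto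
      have "b divides ((t' \<otimes> s [^] M) \<otimes> (t \<otimes> (r \<otimes> (w \<otimes> a))))"
        by (rule dm[OF bspec[OF t(2) r(1)]]) (use t(1) r(2) t'(1) c(2) w(1) a in simp_all)
      also have "(t' \<otimes> s [^] M) \<otimes> (t \<otimes> (r \<otimes> (w \<otimes> a))) = t \<otimes> t' \<otimes> (r \<otimes> (?w \<otimes> a))"
        using DiffD1[OF t(1)] DiffD1[OF t'(1)] c(2) w(1) a r(2) by algebra
      finally show ?thesis .
    qed
    ultimately show ?case using c(1) L.S_mult[OF t(1) t'(1)] by blast
  qed
  have "proper_t_ideal R p"
    unfolding proper_t_ideal_iff
  proof (intro conjI allI impI p.is_ideal nz p.I_notcarr[symmetric] subsetI, rule ccontr)
    fix S x assume S': "finite S \<and> S \<subseteq> p \<and> \<not> S \<subseteq> {\<zero>}" and x: "x \<in> v_set R S" "x \<notin> p"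
    then have S: "finite S" "S \<subseteq> p" by blast+
    have xc: "x \<in> carrier R" using x(1) unfolding v_set_def by blast
    have Sc: "\<And>s. s \<in> S \<Longrightarrow> s \<in> carrier R" using S p.a_Hcarr by blast
    obtain w t where w: "w \<in> carrier R" "\<forall>t\<in>carrier R - p. \<not> b divides (t \<otimes> (w \<otimes> a))"
      and t: "t \<in> carrier R - p" "\<forall>s\<in>S. b divides (t \<otimes> (s \<otimes> (w \<otimes> a)))"
      using ex[OF S(1,2)] by (elim bexE conjE)
    let ?a = "t \<otimes> (w \<otimes> a)"
    have ac: "?a \<in> carrier R" using t(1) w(1) a by simp
    have "\<forall>s\<in>S. b divides (?a \<otimes> s)"
    proof
      fix s assume s: "s \<in> S"
      have "t \<otimes> (s \<otimes> (w \<otimes> a)) = ?a \<otimes> s" using t(1) w(1) a Sc[OF s] by (simp add: m_ac)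
      then show "b divides (?a \<otimes> s)" using t(2) s by metis
    qed
    then have "b divides (?a \<otimes> x)" using x(1) ac b unfolding v_set_def by blast
    moreover have "?a \<otimes> x = (x \<otimes> t) \<otimes> (w \<otimes> a)" using t(1) w(1) a xc by (simp add: m_ac)
    moreover have "x \<otimes> t \<in> carrier R - p" using L.S_mult t(1) xc x(2) by blast
    ultimately show False using w(2) by metis
  qed
  \<comment> \<open>By finite norm \<open>p\<close> is a maximal ideal, so it is maximal among all
    proper ideals and in particular among the \<open>t\<close>-ideals.\<close>
  moreover have "I = p" if "proper_t_ideal R I" "p \<subseteq> I" for I
  proof -
    have "ideal I R" "I \<noteq> carrier R" using that(1) unfolding proper_t_ideal_def by blast+
    then show ?thesis using m.I_maximal that(2) additive_subgroup.a_subset[OF ideal.axioms(1)] by blast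
  qed
  ultimately show ?thesis unfolding t_maximal_def by blast
qed

end

section \<open>Localization as a tensor product\<close>

lemma WPC_transport:
  assumes W: "WPC R C \<gamma>" and t: "t \<in> ring_iso C C'" and t\<gamma>: "\<And>r. r \<in> carrier R \<Longrightarrow> t (\<gamma> r) = \<gamma>' r"
  shows "WPC R C' \<gamma>'"
  unfolding WPC_def
proof
  fix a' assume a': "a' \<in> carrier C'"
  have th: "t \<in> ring_hom C C'" and tc: "t ` carrier C = carrier C'"
    using t unfolding ring_iso_def bij_betw_def by auto
  obtain a where a: "a \<in> carrier C" "t a = a'" using a' unfolding tc[symmetric] by blast
  obtain h where h: "h \<in> alg_hom R (int_poly R) (int_poly_const R) C \<gamma>" "h (int_poly_X R) = a"
    using W a(1) unfolding WPC_def by blast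
  have "t \<circ> h \<in> alg_hom R (int_poly R) (int_poly_const R) C' \<gamma>'"
    using h(1) ring_hom_trans[of h "int_poly R" C t C'] th t\<gamma> unfolding alg_hom_def by auto
  then show "\<exists>h\<in>alg_hom R (int_poly R) (int_poly_const R) C' \<gamma>'. h (int_poly_X R) = a'"
    using h(2) a(2) by (intro bexI[of _ "t \<circ> h"]) auto
qed

lemma WPC_iso:
  assumes "ring B" and \<theta>: "\<theta> \<in> ring_iso B B'" and \<beta>: "\<And>r. r \<in> carrier R \<Longrightarrow> \<beta> r \<in> carrier B"
    and \<theta>\<beta>: "\<And>r. r \<in> carrier R \<Longrightarrow> \<theta> (\<beta> r) = \<beta>' r"
  shows "WPC R B \<beta> \<longleftrightarrow> WPC R B' \<beta>'"
proof
  assume "WPC R B \<beta>"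
  then show "WPC R B' \<beta>'" by (rule WPC_transport[OF _ \<theta> \<theta>\<beta>])
next
  assume W: "WPC R B' \<beta>'"
  have inj: "inj_on \<theta> (carrier B)" using \<theta> unfolding ring_iso_def bij_betw_def by auto
  have "inv_into (carrier B) \<theta> (\<beta>' r) = \<beta> r" if "r \<in> carrier R" for r
    using inv_into_f_f[OF inj \<beta>[OF that]] \<theta>\<beta>[OF that] by simp
  then show "WPC R B \<beta>" by (rule WPC_transport[OF W ring_iso_set_sym[OF assms(1) \<theta>]])
qed

locale localized_algebra = ring_hom_cring D A \<phi> + L: localization D S
  for D (structure) and A (structure) and \<phi> S
begin

abbreviation "T \<equiv> \<phi> ` S"
abbreviation "D\<^sub>S \<equiv> loc D S"
abbreviation "A\<^sub>S \<equiv> loc A T"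
abbreviation "\<iota> d \<equiv> loc_frac D S d \<one>"
abbreviation "\<beta> \<equiv> loc_lift D S A T \<phi>"
abbreviation "teq \<equiv> tensor_eq D A \<phi> D\<^sub>S \<iota>"
abbreviation "mcarrier \<equiv> {M. set_mset M \<subseteq> carrier A \<times> carrier D\<^sub>S}"

lemma T_localization: "localization A T"
proof (intro localization.intro[OF S.is_cring] localization_axioms.intro)
  show "T \<subseteq> carrier A" using L.S_closed by blast
  show "\<one>\<^bsub>A\<^esub> \<in> T" using L.S_one hom_one by force
  fix s t assume "s \<in> T" "t \<in> T"
  then obtain u v where uv: "u \<in> S" "s = \<phi> u" "v \<in> S" "t = \<phi> v" by blast
  then have "s \<otimes>\<^bsub>A\<^esub> t = \<phi> (u \<otimes> v)" using L.S_closed by simp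
  then show "s \<otimes>\<^bsub>A\<^esub> t \<in> T" using L.S_mult[OF uv(1,3)] by blast
qed

interpretation M: localization A T by (rule T_localization)
interpretation AS: cring A\<^sub>S by (rule M.loc_cring)
interpretation DS: cring D\<^sub>S by (rule L.loc_cring)
interpretation b: ring_hom_cring D\<^sub>S A\<^sub>S \<beta>
  by (rule loc_lift_hom) (use L.localization_axioms T_localization ring_hom_cring_axioms in auto)
interpretation a: ring_hom_cring A A\<^sub>S "\<lambda>x. loc_frac A T x \<one>\<^bsub>A\<^esub>" by (rule M.frac_hom)
interpretation d: ring_hom_cring D D\<^sub>S \<iota> by (rule L.frac_hom)

lemma beta_frac: "d \<in> carrier D \<Longrightarrow> s \<in> S \<Longrightarrow> \<beta> (loc_frac D S d s) = loc_frac A T (\<phi> d) (\<phi> s)"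
  by (rule loc_lift_frac) (use L.localization_axioms T_localization ring_hom_cring_axioms in auto)

text \<open>The balanced bilinear map that sends the symbol \<open>a \<otimes> r\<close> to the
  product of \<open>a\<close> and \<open>r\<close> in the localization of \<open>A\<close>.\<close>

definition tval :: "'c \<times> ('a \<times> 'a) set \<Rightarrow> ('c \<times> 'c) set"
  where "tval x = loc_frac A T (fst x) \<one>\<^bsub>A\<^esub> \<otimes>\<^bsub>A\<^sub>S\<^esub> \<beta> (snd x)"

text \<open>Summands and accumulators outside the carriers are ignored, which makes the fold commutative on
  all of its type.\<close>
definition tstep :: "'c \<times> ('a \<times> 'a) set \<Rightarrow> ('c \<times> 'c) set \<Rightarrow> ('c \<times> 'c) set"
  where "tstep x y = (if x \<in> carrier A \<times> carrier D\<^sub>S \<and> y \<in> carrier A\<^sub>S then tval x \<oplus>\<^bsub>A\<^sub>S\<^esub> y else y)"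

definition val :: "('c \<times> ('a \<times> 'a) set) multiset \<Rightarrow> ('c \<times> 'c) set"
  where "val = fold_mset tstep \<zero>\<^bsub>A\<^sub>S\<^esub>"

lemma tval_closed: "x \<in> carrier A \<times> carrier D\<^sub>S \<Longrightarrow> tval x \<in> carrier A\<^sub>S"
  unfolding tval_def by auto

lemma val_empty: "val {#} = \<zero>\<^bsub>A\<^sub>S\<^esub>"
  unfolding val_def by simp

lemma comp_fun_commute_tstep: "comp_fun_commute tstep"
proof
  fix x y
  have "tval y \<oplus>\<^bsub>A\<^sub>S\<^esub> (tval x \<oplus>\<^bsub>A\<^sub>S\<^esub> z) = tval x \<oplus>\<^bsub>A\<^sub>S\<^esub> (tval y \<oplus>\<^bsub>A\<^sub>S\<^esub> z)"
    if "x \<in> carrier A \<times> carrier D\<^sub>S" "y \<in> carrier A \<times> carrier D\<^sub>S" "z \<in> carrier A\<^sub>S" for z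
    by (rule AS.add.m_lcomm) (use that tval_closed in blast)+
  then show "tstep y \<circ> tstep x = tstep x \<circ> tstep y"
    by (intro ext) (auto simp add: tstep_def tval_closed)
qed

lemma val_add_mset':
  "val (add_mset x M) = tstep x (val M)"
  unfolding val_def using comp_fun_commute.fold_mset_add_mset[OF comp_fun_commute_tstep] by metis

lemma val_closed: "val M \<in> carrier A\<^sub>S"
  by (induction M) (auto simp: val_empty val_add_mset' tstep_def tval_closed)

lemma val_add_mset:
  "x \<in> carrier A \<times> carrier D\<^sub>S \<Longrightarrow> val (add_mset x M) = tval x \<oplus>\<^bsub>A\<^sub>S\<^esub> val M"
  using val_closed[of M] by (simp add: val_add_mset' tstep_def)

lemma val_plus: "M \<in> mcarrier \<Longrightarrow> val (M + N) = val M \<oplus>\<^bsub>A\<^sub>S\<^esub> val N"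
  by (induction M) (simp_all add: val_empty val_add_mset val_closed AS.a_assoc tval_closed)

lemma val_single: "x \<in> carrier A \<times> carrier D\<^sub>S \<Longrightarrow> val {#x#} = tval x"
  using val_add_mset[of x "{#}"] by (simp add: val_empty tval_closed)

lemma val_formal_mult:
  assumes "M \<in> mcarrier" "N \<in> mcarrier"
  shows "formal_mult A D\<^sub>S M N \<in> mcarrier \<and> val (formal_mult A D\<^sub>S M N) = val M \<otimes>\<^bsub>A\<^sub>S\<^esub> val N"
  using assms(1)
proof (induction M)
  case empty
  then show ?case by (simp add: formal_mult_def val_empty val_closed)
next
  case (add x M)
  obtain u v where x: "x = (u, v)" by (cases x)
  have uv: "u \<in> carrier A" "v \<in> carrier D\<^sub>S" using add.prems x by auto
  let ?f = "\<lambda>y. (u \<otimes>\<^bsub>A\<^esub> fst y, v \<otimes>\<^bsub>D\<^sub>S\<^esub> snd y)"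
  have "image_mset ?f N \<in> mcarrier \<and> val (image_mset ?f N) = tval x \<otimes>\<^bsub>A\<^sub>S\<^esub> val N"
    using assms(2)
  proof (induction N)
    case empty
    then show ?case using tval_closed x uv by (simp add: val_empty)
  next
    case (add y N)
    obtain c e where y: "y = (c, e)" by (cases y)
    have ce: "c \<in> carrier A" "e \<in> carrier D\<^sub>S" using add.prems y by auto
    have IH: "image_mset ?f N \<in> mcarrier" "val (image_mset ?f N) = tval x \<otimes>\<^bsub>A\<^sub>S\<^esub> val N" using add by auto
    have yc: "y \<in> carrier A \<times> carrier D\<^sub>S" and fc: "?f y \<in> carrier A \<times> carrier D\<^sub>S"
      and xc: "x \<in> carrier A \<times> carrier D\<^sub>S" using x y uv ce by auto
    have t: "tval (?f y) = tval x \<otimes>\<^bsub>A\<^sub>S\<^esub> tval y"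
      unfolding tval_def x y using uv ce by (simp add: AS.m_ac)
    have "val (image_mset ?f (add_mset y N)) = tval (?f y) \<oplus>\<^bsub>A\<^sub>S\<^esub> val (image_mset ?f N)"
      using val_add_mset[OF fc] by simp
    also have "\<dots> = tval x \<otimes>\<^bsub>A\<^sub>S\<^esub> val (add_mset y N)"
      unfolding val_add_mset[OF yc] IH(2) t
      using tval_closed[OF xc] tval_closed[OF yc] val_closed by (simp add: AS.r_distr)
    finally show ?case using IH(1) fc by simp
  qed
  then have f: "image_mset ?f N \<in> mcarrier" "val (image_mset ?f N) = tval x \<otimes>\<^bsub>A\<^sub>S\<^esub> val N" by blast+
  have IH: "formal_mult A D\<^sub>S M N \<in> mcarrier" "val (formal_mult A D\<^sub>S M N) = val M \<otimes>\<^bsub>A\<^sub>S\<^esub> val N" using add by auto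
  have xc: "x \<in> carrier A \<times> carrier D\<^sub>S" using x uv by auto
  have e: "formal_mult A D\<^sub>S (add_mset x M) N = image_mset ?f N + formal_mult A D\<^sub>S M N"
    unfolding formal_mult_def x by simp
  show ?case
    unfolding e val_plus[OF f(1)] val_add_mset[OF xc] f(2) IH(2)
    using f(1) IH(1) tval_closed[OF xc] val_closed by (simp add: AS.l_distr)
qed

text \<open>Soundness: every generating relation of the tensor congruence becomes an identity under
  \<open>val\<close>, by bilinearity and, for \<open>balanced\<close>, because
  \<open>\<beta>\<close> extends \<open>\<phi>\<close>.\<close>

lemma val_tensor_eq:
  "teq M N \<Longrightarrow> M \<in> mcarrier \<and> N \<in> mcarrier \<and> val M = val N"
proof (induction rule: tensor_eq.induct)
  case (plus M M' N N')
  then show ?case using val_plus by auto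
next
  case (zero b)
  then show ?case by (simp add: val_single val_empty tval_def)
next
  case (add_left a a' b)
  then have "(a, b) \<in> carrier A \<times> carrier D\<^sub>S" "(a', b) \<in> carrier A \<times> carrier D\<^sub>S" by auto
  note tval_closed[OF this(1)] tval_closed[OF this(2)]
  then show ?case using add_left
    by (simp add: val_single val_add_mset val_empty) (simp add: tval_def AS.l_distr)
next
  case (add_right a b b')
  then have "(a, b) \<in> carrier A \<times> carrier D\<^sub>S" "(a, b') \<in> carrier A \<times> carrier D\<^sub>S" by auto
  note tval_closed[OF this(1)] tval_closed[OF this(2)]
  then show ?case using add_right
    by (simp add: val_single val_add_mset val_empty) (simp add: tval_def AS.r_distr)
next
  case (balanced r a b)
  have "\<beta> (\<iota> r) = loc_frac A T (\<phi> r) \<one>\<^bsub>A\<^esub>" using beta_frac[OF balanced(1) L.S_one] by simp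
  then show ?case using balanced
    by (simp add: val_single) (simp add: tval_def AS.m_ac)
qed auto

text \<open>As \<open>1 / s = t / (s t)\<close>, the factor \<open>t\<close> can cross to the left;
  this is how denominators are matched.\<close>

lemma teq_expand:
  assumes "c \<in> carrier A" "s \<in> S" "t \<in> S"
  shows "teq {#(c, loc_frac D S \<one> s)#} {#(\<phi> t \<otimes>\<^bsub>A\<^esub> c, loc_frac D S \<one> (s \<otimes> t))#}"
proof -
  have tc: "t \<in> carrier D" "s \<in> carrier D" using assms L.S_closed by auto
  have st: "s \<otimes> t \<in> S" using assms L.S_mult by blast
  have "loc_frac D S t (s \<otimes> t) = loc_frac D S \<one> s"
    using L.frac_eqI[of t "s \<otimes> t" \<one> s] assms tc st by simp
  then have "\<iota> t \<otimes>\<^bsub>D\<^sub>S\<^esub> loc_frac D S \<one> (s \<otimes> t) = loc_frac D S \<one> s"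
    using L.frac_mult[OF tc(1) L.S_one R.one_closed st] tc by simp
  then show ?thesis
    using tensor_eq.sym[OF tensor_eq.balanced[of t D c A "loc_frac D S \<one> (s \<otimes> t)" D\<^sub>S \<phi> \<iota>]] tc assms st by simp
qed

text \<open>Numerators cross to the left factor and denominators are made equal, after which two
  symbols with the same right entry add up to one.\<close>

lemma teq_single:
  assumes "M \<in> mcarrier"
  shows "\<exists>a\<in>carrier A. \<exists>s\<in>S. teq M {#(a, loc_frac D S \<one> s)#}"
  using assms
proof (induction M)
  case empty
  have "teq {#(\<zero>\<^bsub>A\<^esub>, loc_frac D S \<one> \<one>)#} {#}" by (rule tensor_eq.zero) (use L.S_one in simp)
  then show ?case using tensor_eq.sym L.S_one S.zero_closed by blast
next
  case (add x M)
  then obtain b t where b: "b \<in> carrier A" "t \<in> S" "teq M {#(b, loc_frac D S \<one> t)#}" by auto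
  obtain a r where x: "x = (a, r)" by (cases x)
  have a: "a \<in> carrier A" "r \<in> carrier D\<^sub>S" using add.prems x by auto
  obtain d s where d: "d \<in> carrier D" "s \<in> S" "r = loc_frac D S d s" using a(2) by (rule L.loc_cases)
  have r: "r = \<iota> d \<otimes>\<^bsub>D\<^sub>S\<^esub> loc_frac D S \<one> s" using L.frac_mult[OF d(1) L.S_one R.one_closed d(2)] d L.S_closed by simp
  have "teq {#(\<phi> d \<otimes>\<^bsub>A\<^esub> a, loc_frac D S \<one> s)#} {#x#}"
    unfolding x r by (rule tensor_eq.balanced) (use d a in simp_all)
  then have 1: "teq {#x#} {#(\<phi> d \<otimes>\<^bsub>A\<^esub> a, loc_frac D S \<one> s)#}" by (rule tensor_eq.sym)
  have 2: "teq {#(\<phi> d \<otimes>\<^bsub>A\<^esub> a, loc_frac D S \<one> s)#} {#(\<phi> t \<otimes>\<^bsub>A\<^esub> (\<phi> d \<otimes>\<^bsub>A\<^esub> a), loc_frac D S \<one> (s \<otimes> t))#}"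
    by (rule teq_expand) (use d a b in simp_all)
  have 3: "teq {#(b, loc_frac D S \<one> t)#} {#(\<phi> s \<otimes>\<^bsub>A\<^esub> b, loc_frac D S \<one> (s \<otimes> t))#}"
    using teq_expand[OF b(1,2) d(2)] R.m_comm L.S_closed b(2) d(2) by simp
  let ?u = "\<phi> t \<otimes>\<^bsub>A\<^esub> (\<phi> d \<otimes>\<^bsub>A\<^esub> a)" and ?v = "\<phi> s \<otimes>\<^bsub>A\<^esub> b"
  have c: "?u \<in> carrier A" "?v \<in> carrier A" using a b d L.S_closed by auto
  have 5: "teq {#(?u \<oplus>\<^bsub>A\<^esub> ?v, loc_frac D S \<one> (s \<otimes> t))#} {#(?u, loc_frac D S \<one> (s \<otimes> t)), (?v, loc_frac D S \<one> (s \<otimes> t))#}"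
    by (rule tensor_eq.add_left) (use c b d L.S_mult in simp_all)
  have 4: "teq ({#(?u, loc_frac D S \<one> (s \<otimes> t))#} + {#(?v, loc_frac D S \<one> (s \<otimes> t))#})
      {#(?u \<oplus>\<^bsub>A\<^esub> ?v, loc_frac D S \<one> (s \<otimes> t))#}"
    using tensor_eq.sym[OF 5] by (simp add: add_mset_commute)
  have "teq ({#x#} + M) ({#(?u, loc_frac D S \<one> (s \<otimes> t))#} + {#(?v, loc_frac D S \<one> (s \<otimes> t))#})"
    by (rule tensor_eq.plus[OF tensor_eq.trans[OF 1 2] tensor_eq.trans[OF b(3) 3]])
  from tensor_eq.trans[OF this 4] show ?case using c L.S_mult[OF d(2) b(2)] by auto
qed

lemma tval_single:
  "a \<in> carrier A \<Longrightarrow> s \<in> S \<Longrightarrow> tval (a, loc_frac D S \<one> s) = loc_frac A T a (\<phi> s)"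
  unfolding tval_def using beta_frac[OF R.one_closed] M.frac_mult[OF _ M.S_one S.one_closed]
  by (simp add: M.S_closed)

text \<open>Completeness: both sides are reduced to single symbols. Equality of \<open>a / s\<close>
  and \<open>b / t\<close> in the localization comes with a multiplier \<open>u\<close>, and
  expanding the symbols by \<open>t u\<close> and \<open>s u\<close> makes them literally
  equal.\<close>

lemma teq_iff: "M \<in> mcarrier \<Longrightarrow> N \<in> mcarrier \<Longrightarrow> teq M N \<longleftrightarrow> val M = val N"
proof
  assume MN: "M \<in> mcarrier" "N \<in> mcarrier" and v: "val M = val N"
  obtain a s where a: "a \<in> carrier A" "s \<in> S" "teq M {#(a, loc_frac D S \<one> s)#}" using teq_single[OF MN(1)] by blast
  obtain b t where b: "b \<in> carrier A" "t \<in> S" "teq N {#(b, loc_frac D S \<one> t)#}" using teq_single[OF MN(2)] by blast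
  have "val M = loc_frac A T a (\<phi> s)"
    using val_tensor_eq[OF a(3)] tval_single[OF a(1,2)] val_single[of "(a, loc_frac D S \<one> s)"] a by simp
  moreover have "val N = loc_frac A T b (\<phi> t)"
    using val_tensor_eq[OF b(3)] tval_single[OF b(1,2)] val_single[of "(b, loc_frac D S \<one> t)"] b by simp
  ultimately have "loc_frac A T a (\<phi> s) = loc_frac A T b (\<phi> t)" using v by simp
  then obtain u where u: "u \<in> S" "\<phi> u \<otimes>\<^bsub>A\<^esub> (\<phi> t \<otimes>\<^bsub>A\<^esub> a) = \<phi> u \<otimes>\<^bsub>A\<^esub> (\<phi> s \<otimes>\<^bsub>A\<^esub> b)"
    using M.frac_eq_iff[of a "\<phi> s" b "\<phi> t"] a b by blast
  have c: "u \<in> carrier D" "s \<in> carrier D" "t \<in> carrier D" using u a b L.S_closed by auto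
  have 1: "\<phi> (t \<otimes> u) \<otimes>\<^bsub>A\<^esub> a = \<phi> (s \<otimes> u) \<otimes>\<^bsub>A\<^esub> b"
    using u(2) c a(1) b(1) by (simp add: S.m_ac)
  have 2: "s \<otimes> (t \<otimes> u) = t \<otimes> (s \<otimes> u)" using c by (simp add: R.m_lcomm)
  have "teq M {#(\<phi> (t \<otimes> u) \<otimes>\<^bsub>A\<^esub> a, loc_frac D S \<one> (s \<otimes> (t \<otimes> u)))#}"
    by (rule tensor_eq.trans[OF a(3) teq_expand[OF a(1,2) L.S_mult[OF b(2) u(1)]]])
  moreover have "teq N {#(\<phi> (s \<otimes> u) \<otimes>\<^bsub>A\<^esub> b, loc_frac D S \<one> (t \<otimes> (s \<otimes> u)))#}"
    by (rule tensor_eq.trans[OF b(3) teq_expand[OF b(1,2) L.S_mult[OF a(2) u(1)]]])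
  ultimately show "teq M N" unfolding 1 2 by (rule tensor_eq.trans[OF _ tensor_eq.sym])
qed (use val_tensor_eq in blast)

text \<open>The fibre of \<open>val\<close> over \<open>b\<close>. By \<open>teq_iff\<close> the
  fibres over the localization are exactly the tensor classes, so this inverts the map induced by
  \<open>val\<close>.\<close>

definition theta :: "('c \<times> 'c) set \<Rightarrow> ('c \<times> ('a \<times> 'a) set) multiset set"
  where "theta b = {M \<in> mcarrier. val M = b}"

lemma tensor_class_eq: "M \<in> mcarrier \<Longrightarrow> tensor_class D A \<phi> D\<^sub>S \<iota> M = theta (val M)"
proof -
  assume M: "M \<in> mcarrier"
  have "teq M N \<longleftrightarrow> N \<in> mcarrier \<and> val N = val M" for N
    using teq_iff[OF M, of N] val_tensor_eq[of M N] by metis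
  then show ?thesis unfolding tensor_class_def theta_def by (intro Collect_cong) simp
qed

lemma val_surj: "b \<in> carrier A\<^sub>S \<Longrightarrow> \<exists>M\<in>mcarrier. val M = b"
proof -
  assume "b \<in> carrier A\<^sub>S"
  then obtain a t where at: "a \<in> carrier A" "t \<in> T" "b = loc_frac A T a t" by (rule M.loc_cases)
  then obtain s where s: "s \<in> S" "t = \<phi> s" by blast
  have "val {#(a, loc_frac D S \<one> s)#} = b"
    using val_single[of "(a, loc_frac D S \<one> s)"] tval_single[OF at(1) s(1)] at s by simp
  then show ?thesis using at(1) s(1) by (intro bexI[of _ "{#(a, loc_frac D S \<one> s)#}"]) simp_all
qed

lemma theta_iso: "theta \<in> ring_iso A\<^sub>S (tensor_alg D A \<phi> D\<^sub>S \<iota>)"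
proof -
  have carr: "theta ` carrier A\<^sub>S = carrier (tensor_alg D A \<phi> D\<^sub>S \<iota>)"
  proof -
    have "carrier (tensor_alg D A \<phi> D\<^sub>S \<iota>) = (\<lambda>M. theta (val M)) ` mcarrier"
      unfolding tensor_alg_def using tensor_class_eq by (simp cong: image_cong_simp)
    also have "\<dots> = theta ` (val ` mcarrier)" by (simp only: image_image)
    also have "val ` mcarrier = carrier A\<^sub>S" using val_surj val_closed by blast
    finally show ?thesis ..
  qed
  have "inj_on theta (carrier A\<^sub>S)"
  proof (rule inj_onI)
    fix x y assume "x \<in> carrier A\<^sub>S" "y \<in> carrier A\<^sub>S" and xy: "theta x = theta y"
    then obtain M where M: "M \<in> mcarrier" "val M = x" using val_surj by blast
    then have "M \<in> theta x" unfolding theta_def by blast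
    then have "M \<in> theta y" using xy by simp
    then show "x = y" using M unfolding theta_def by blast
  qed
  moreover have "theta \<in> ring_hom A\<^sub>S (tensor_alg D A \<phi> D\<^sub>S \<iota>)"
  proof (rule ring_hom_memI)
    fix x y assume xy: "x \<in> carrier A\<^sub>S" "y \<in> carrier A\<^sub>S"
    show "theta x \<in> carrier (tensor_alg D A \<phi> D\<^sub>S \<iota>)" using carr xy(1) by blast
    obtain M N where MN: "M \<in> theta x" "N \<in> theta y" using val_surj xy unfolding theta_def by blast
    have "tensor_class D A \<phi> D\<^sub>S \<iota> (formal_mult A D\<^sub>S M N) = theta (x \<otimes>\<^bsub>A\<^sub>S\<^esub> y)" if "M \<in> theta x" "N \<in> theta y" for M N
    proof -
      have "M \<in> mcarrier" "N \<in> mcarrier" "val M = x" "val N = y" using that unfolding theta_def by blast+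
      then show ?thesis using tensor_class_eq val_formal_mult by metis
    qed
    then have "(\<Union>M\<in>theta x. \<Union>N\<in>theta y. tensor_class D A \<phi> D\<^sub>S \<iota> (formal_mult A D\<^sub>S M N)) = theta (x \<otimes>\<^bsub>A\<^sub>S\<^esub> y)"
      using MN by (intro SUP_eq_const ballI) auto
    then show "theta (x \<otimes>\<^bsub>A\<^sub>S\<^esub> y) = theta x \<otimes>\<^bsub>tensor_alg D A \<phi> D\<^sub>S \<iota>\<^esub> theta y"
      unfolding tensor_alg_def by simp
    have "tensor_class D A \<phi> D\<^sub>S \<iota> (M + N) = theta (x \<oplus>\<^bsub>A\<^sub>S\<^esub> y)" if "M \<in> theta x" "N \<in> theta y" for M N
    proof -
      have *: "M \<in> mcarrier" "N \<in> mcarrier" "val M = x" "val N = y" using that unfolding theta_def by blast+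
      then have "M + N \<in> mcarrier" by simp
      then show ?thesis using tensor_class_eq[of "M + N"] val_plus[OF *(1), of N] *(3,4) by simp
    qed
    then have "(\<Union>M\<in>theta x. \<Union>N\<in>theta y. tensor_class D A \<phi> D\<^sub>S \<iota> (M + N)) = theta (x \<oplus>\<^bsub>A\<^sub>S\<^esub> y)"
      using MN by (intro SUP_eq_const ballI) auto
    then show "theta (x \<oplus>\<^bsub>A\<^sub>S\<^esub> y) = theta x \<oplus>\<^bsub>tensor_alg D A \<phi> D\<^sub>S \<iota>\<^esub> theta y"
      unfolding tensor_alg_def by simp
  next
    have c: "(\<one>\<^bsub>A\<^esub>, \<one>\<^bsub>D\<^sub>S\<^esub>) \<in> carrier A \<times> carrier D\<^sub>S" by simp
    have "val {#(\<one>\<^bsub>A\<^esub>, \<one>\<^bsub>D\<^sub>S\<^esub>)#} = \<one>\<^bsub>A\<^sub>S\<^esub>"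
      unfolding val_single[OF c] tval_def by simp
    then show "theta \<one>\<^bsub>A\<^sub>S\<^esub> = \<one>\<^bsub>tensor_alg D A \<phi> D\<^sub>S \<iota>\<^esub>"
      unfolding tensor_alg_def using tensor_class_eq[of "{#(\<one>\<^bsub>A\<^esub>, \<one>\<^bsub>D\<^sub>S\<^esub>)#}"] c by simp
  qed
  ultimately show ?thesis using carr unfolding ring_iso_def bij_betw_def by blast
qed

lemma theta_beta:
  assumes "r \<in> carrier D\<^sub>S"
  shows "theta (\<beta> r) = tensor_right D A \<phi> D\<^sub>S \<iota> r"
proof -
  have c: "(\<one>\<^bsub>A\<^esub>, r) \<in> carrier A \<times> carrier D\<^sub>S" using assms by simp
  have "val {#(\<one>\<^bsub>A\<^esub>, r)#} = \<beta> r" unfolding val_single[OF c] tval_def using assms by simp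
  then show ?thesis unfolding tensor_right_def using tensor_class_eq[of "{#(\<one>\<^bsub>A\<^esub>, r)#}"] c by simp
qed

lemma WPC_tensor_iff:
  "WPC D\<^sub>S (tensor_alg D A \<phi> D\<^sub>S \<iota>) (tensor_right D A \<phi> D\<^sub>S \<iota>) \<longleftrightarrow> WPC D\<^sub>S A\<^sub>S \<beta>"
  using WPC_iso[OF AS.ring_axioms theta_iso, of D\<^sub>S \<beta> "tensor_right D A \<phi> D\<^sub>S \<iota>"]
    theta_beta b.hom_closed by blast

end

text \<open>From here on the tensor product is replaced by the localization of the algebra at the
  image of the complement of \<open>p\<close>.\<close>

lemma (in ring_hom_cring) locally_WPC_iff:
  "locally_WPC R S h \<longleftrightarrow> (\<forall>p. primeideal p R \<longrightarrow>
     WPC (loc_at R p) (loc S (h ` (carrier R - p))) (loc_lift R (carrier R - p) S (h ` (carrier R - p)) h))"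
proof -
  have "WPC (loc_at R p) (tensor_alg R S h (loc_at R p) (loc_map R p)) (tensor_right R S h (loc_at R p) (loc_map R p))
      \<longleftrightarrow> WPC (loc_at R p) (loc S (h ` (carrier R - p))) (loc_lift R (carrier R - p) S (h ` (carrier R - p)) h)"
    if p: "primeideal p R" for p
  proof -
    interpret L: localized_algebra R S h "carrier R - p"
      using R.localization_primeI[OF p] ring_hom_cring_axioms by (simp add: localized_algebra_def)
    have lm: "loc_map R p = (\<lambda>d. loc_frac R (carrier R - p) d \<one>)" unfolding loc_map_def by auto
    show ?thesis unfolding loc_at_def lm by (rule L.WPC_tensor_iff)
  qed
  then show ?thesis unfolding locally_WPC_def by blast
qed

section \<open>Normal forms\<close>

text \<open>A coefficient family assigns an element of the base ring to every list of digits below \<open>q\<close>;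
  the digit list \<open>[i, j, \<dots>]\<close> belongs to the monomial \<open>e 0 ^ i * e 1 ^ j * \<dots>\<close>.\<close>
primrec nval ::
  "('c, 'm) ring_scheme \<Rightarrow> ('r \<Rightarrow> 'c) \<Rightarrow> nat \<Rightarrow> nat \<Rightarrow> (nat \<Rightarrow> 'c) \<Rightarrow> (nat list \<Rightarrow> 'r) \<Rightarrow> 'c"
  where
    "nval C \<psi> q 0 e c = \<psi> (c [])"
  | "nval C \<psi> q (Suc L) e c =
      horner C (map (\<lambda>i. nval C \<psi> q L (\<lambda>k. e (Suc k)) (\<lambda>l. c (i # l))) [0..<q]) (e 0)"

context cring
begin

lemma horner_map_add:
  assumes "x \<in> carrier R" "\<And>i. f i \<in> carrier R" "\<And>i. g i \<in> carrier R"
  shows "horner R (map (\<lambda>i. f i \<oplus> g i) is) x = horner R (map f is) x \<oplus> horner R (map g is) x"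
proof (induction "is")
  case (Cons i "is")
  have c: "f i \<in> carrier R" "g i \<in> carrier R" "horner R (map f is) x \<in> carrier R" "horner R (map g is) x \<in> carrier R"
    using assms by (auto intro!: horner_closed)
  show ?case unfolding list.map horner.simps Cons using c assms(1) by algebra
qed simp

lemma horner_map_mult:
  assumes "x \<in> carrier R" "\<And>i. i \<in> set is \<Longrightarrow> f i \<in> carrier R" "a \<in> carrier R"
  shows "horner R (map (\<lambda>i. a \<otimes> f i) is) x = a \<otimes> horner R (map f is) x"
  using assms(2)
proof (induction "is")
  case (Cons i "is")
  then have IH: "horner R (map (\<lambda>i. a \<otimes> f i) is) x = a \<otimes> horner R (map f is) x" by simp
  have c: "f i \<in> carrier R" "horner R (map f is) x \<in> carrier R"
    using Cons.prems assms(1) by (auto intro!: horner_closed)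
  show ?case unfolding list.map horner.simps IH using c assms(1,3) by algebra
qed (use assms in simp)

lemma horner_append_single:
  assumes "x \<in> carrier R" "set cs \<subseteq> carrier R" "c \<in> carrier R"
  shows "horner R (cs @ [c]) x = horner R cs x \<oplus> x [^] length cs \<otimes> c"
  using assms(2)
proof (induction cs)
  case (Cons d cs)
  then have IH: "horner R (cs @ [c]) x = horner R cs x \<oplus> x [^] length cs \<otimes> c" by simp
  have c: "d \<in> carrier R" "horner R cs x \<in> carrier R" "x [^] length cs \<in> carrier R"
    using Cons.prems assms(1) by auto
  show ?case unfolding append_Cons horner.simps IH list.size(4) using c assms(1,3)
    by (simp add: r_distr a_assoc m_ac)
qed (use assms in simp)

lemma horner_zeros: "x \<in> carrier R \<Longrightarrow> horner R (map (\<lambda>i. \<zero>) is) x = \<zero>"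
  by (induction "is") auto

lemma horner_cong_ideal:
  assumes "ideal I R" "x \<in> carrier R" "y \<in> carrier R" "x \<ominus> y \<in> I"
    and "\<And>i. i \<in> set is \<Longrightarrow> f i \<in> carrier R \<and> g i \<in> carrier R \<and> f i \<ominus> g i \<in> I"
  shows "horner R (map f is) x \<ominus> horner R (map g is) y \<in> I"
  using assms(5)
proof (induction "is")
  case Nil
  then show ?case using additive_subgroup.zero_closed[OF ideal.axioms(1)[OF assms(1)]] by (simp add: minus_eq)
next
  case (Cons i "is")
  interpret I: ideal I R by fact
  have IH: "horner R (map f is) x \<ominus> horner R (map g is) y \<in> I" using Cons by simp
  have c: "f i \<in> carrier R" "g i \<in> carrier R" "f i \<ominus> g i \<in> I" using Cons.prems by auto
  have h: "horner R (map f is) x \<in> carrier R" "horner R (map g is) y \<in> carrier R"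
    using Cons.prems assms(2,3) by (auto intro!: horner_closed)
  have "horner R (map f (i # is)) x \<ominus> horner R (map g (i # is)) y
      = (f i \<ominus> g i) \<oplus> (x \<otimes> (horner R (map f is) x \<ominus> horner R (map g is) y)
        \<oplus> horner R (map g is) y \<otimes> (x \<ominus> y))"
    unfolding list.map horner.simps using c h assms(2,3) by algebra
  also have "\<dots> \<in> I"
    using IH c(3) assms(2,4) h by (intro I.a_closed I.I_l_closed)
  finally show ?case .
qed

end

lemma (in ring_hom_cring) hom_horner:
  assumes "set cs \<subseteq> carrier R" "x \<in> carrier R"
  shows "h (horner R cs x) = horner S (map h cs) (h x)"
  using assms by (induction cs) auto

text \<open>Serves to evaluate a normal form at a point: the tower is evaluated while the
  coefficient family stays the same.\<close>

lemma nval_hom: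
  assumes "ring_hom_cring C C' h" "\<And>r. r \<in> carrier R \<Longrightarrow> \<psi> r \<in> carrier C"
    and "\<And>r. r \<in> carrier R \<Longrightarrow> h (\<psi> r) = \<psi>' r"
    and "\<And>k. e k \<in> carrier C" "\<And>l. c l \<in> carrier R"
  shows "nval C \<psi> q L e c \<in> carrier C \<and> h (nval C \<psi> q L e c) = nval C' \<psi>' q L (\<lambda>k. h (e k)) c"
  using assms(4,5)
proof (induction L arbitrary: e c)
  case (Suc L)
  interpret h: ring_hom_cring C C' h by fact
  have "nval C \<psi> q L (\<lambda>k. e (Suc k)) (\<lambda>l. c (i # l)) \<in> carrier C \<and>
     h (nval C \<psi> q L (\<lambda>k. e (Suc k)) (\<lambda>l. c (i # l))) = nval C' \<psi>' q L (\<lambda>k. h (e (Suc k))) (\<lambda>l. c (i # l))" for i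
    by (rule Suc.IH) (use Suc.prems in auto)
  then show ?case using Suc.prems by (simp add: h.hom_horner image_subset_iff h.R.horner_closed comp_def cong: map_cong)
qed (use assms(2,3) in auto)

lemma nval_cong:
  assumes "\<And>l. length l = L \<Longrightarrow> set l \<subseteq> {..<q} \<Longrightarrow> c l = c' l"
  shows "nval C \<psi> q L e c = nval C \<psi> q L e c'"
  using assms
proof (induction L arbitrary: e c c')
  case (Suc L)
  have "map (\<lambda>i. nval C \<psi> q L (\<lambda>k. e (Suc k)) (\<lambda>l. c (i # l))) [0..<q]
      = map (\<lambda>i. nval C \<psi> q L (\<lambda>k. e (Suc k)) (\<lambda>l. c' (i # l))) [0..<q]"
    by (intro map_cong HOL.refl Suc.IH) (use Suc.prems in auto)
  then show ?case by (simp only: nval.simps)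
qed simp

section \<open>Normal forms along a tower\<close>

locale normal_forms = ring_hom_cring R C \<psi> for R (structure) and C (structure) and \<psi> +
  fixes q :: nat and \<pi>
  assumes q2: "q \<ge> 2" and pi_closed: "\<pi> \<in> carrier R"
begin

text \<open>Only \<open>e 0\<close> to \<open>e (L - 1)\<close> occur, each with exponents below
  \<open>q\<close>.\<close>

definition NF :: "nat \<Rightarrow> (nat \<Rightarrow> 'c) \<Rightarrow> 'c set"
  where "NF L e = {nval C \<psi> q L e c | c. \<forall>l. c l \<in> carrier R}"

definition NFs :: "(nat \<Rightarrow> 'c) \<Rightarrow> 'c set"
  where "NFs e = (\<Union>L. NF L e)"

text \<open>A relation and not the recursion \<open>e (k+1) = (e k ^ q - e k) / \<pi>\<close>,
  because the image of \<open>\<pi>\<close> may be a zero divisor in \<open>C\<close>.\<close>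

definition tower :: "(nat \<Rightarrow> 'c) \<Rightarrow> bool"
  where "tower e \<longleftrightarrow> (\<forall>k. e k \<in> carrier C \<and>
    e k [^]\<^bsub>C\<^esub> q = e k \<oplus>\<^bsub>C\<^esub> \<psi> \<pi> \<otimes>\<^bsub>C\<^esub> e (Suc k))"

lemma tower_shift: "tower e \<Longrightarrow> tower (\<lambda>k. e (Suc k))"
  unfolding tower_def by blast

lemma tower_closed: "tower e \<Longrightarrow> e k \<in> carrier C"
  unfolding tower_def by blast

lemma NF_0: "NF 0 e = \<psi> ` carrier R"
proof (intro equalityI subsetI)
  fix x assume "x \<in> \<psi> ` carrier R"
  then obtain r where "r \<in> carrier R" "x = \<psi> r" by blast
  then show "x \<in> NF 0 e" unfolding NF_def by (auto intro!: exI[of _ "\<lambda>l. r"])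
qed (auto simp: NF_def)

lemma NF_Suc:
  "NF (Suc L) e = {horner C (map s [0..<q]) (e 0) | s. \<forall>i. s i \<in> NF L (\<lambda>k. e (Suc k))}"
proof (intro equalityI subsetI)
  fix x assume "x \<in> NF (Suc L) e"
  then obtain c where c: "\<And>l. c l \<in> carrier R" "x = nval C \<psi> q (Suc L) e c" unfolding NF_def by blast
  then show "x \<in> {horner C (map s [0..<q]) (e 0) | s. \<forall>i. s i \<in> NF L (\<lambda>k. e (Suc k))}"
    by (intro CollectI exI[of _ "\<lambda>i. nval C \<psi> q L (\<lambda>k. e (Suc k)) (\<lambda>l. c (i # l))"]) (auto simp: NF_def)
next
  fix x assume "x \<in> {horner C (map s [0..<q]) (e 0) | s. \<forall>i. s i \<in> NF L (\<lambda>k. e (Suc k))}"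
  then obtain s where s: "x = horner C (map s [0..<q]) (e 0)" "\<forall>i. s i \<in> NF L (\<lambda>k. e (Suc k))" by blast
  then have "\<forall>i. \<exists>c. (\<forall>l. c l \<in> carrier R) \<and> s i = nval C \<psi> q L (\<lambda>k. e (Suc k)) c"
    unfolding NF_def by blast
  from choice[OF this] obtain c where c: "\<forall>i. (\<forall>l. c i l \<in> carrier R) \<and> s i = nval C \<psi> q L (\<lambda>k. e (Suc k)) (c i)" ..
  have "s = (\<lambda>i. nval C \<psi> q L (\<lambda>k. e (Suc k)) (c i))" using c by (intro ext) blast
  \<comment> \<open>The families chosen for the separate digits of \<open>e 0\<close> are glued: the
    head of a digit list selects the family and the tail is its argument.\<close>
  then have "x = nval C \<psi> q (Suc L) e (\<lambda>l. c (hd l) (tl l))"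
    unfolding s(1) by simp
  then show "x \<in> NF (Suc L) e" unfolding NF_def using c by blast
qed

lemma NF_closed: "(\<And>k. e k \<in> carrier C) \<Longrightarrow> NF L e \<subseteq> carrier C"
proof (induction L arbitrary: e)
  case 0
  then show ?case unfolding NF_0 by auto
next
  case (Suc L)
  have "NF L (\<lambda>k. e (Suc k)) \<subseteq> carrier C" by (intro Suc.IH Suc.prems)
  then have "set (map s [0..<q]) \<subseteq> carrier C" if "\<forall>i. s i \<in> NF L (\<lambda>k. e (Suc k))" for s
    using that by auto
  then show ?case unfolding NF_Suc using S.horner_closed[OF _ Suc.prems] by blast
qed

lemma NF_zero: "(\<And>k. e k \<in> carrier C) \<Longrightarrow> \<zero>\<^bsub>C\<^esub> \<in> NF L e"
proof (induction L arbitrary: e)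
  case 0
  then show ?case unfolding NF_0 using hom_zero R.zero_closed by (metis imageI)
next
  case (Suc L)
  then show ?case unfolding NF_Suc
    using S.horner_zeros[of "e 0" "[0..<q]"] by (intro CollectI exI[of _ "\<lambda>i. \<zero>\<^bsub>C\<^esub>"]) auto
qed

lemma NF_add:
  "(\<And>k. e k \<in> carrier C) \<Longrightarrow> x \<in> NF L e \<Longrightarrow> y \<in> NF L e \<Longrightarrow> x \<oplus>\<^bsub>C\<^esub> y \<in> NF L e"
proof (induction L arbitrary: e x y)
  case 0
  then obtain a b where "a \<in> carrier R" "x = \<psi> a" "b \<in> carrier R" "y = \<psi> b" unfolding NF_0 by blast
  then show ?case unfolding NF_0 using hom_add[of a b] R.a_closed[of a b] by (metis imageI)
next
  case (Suc L)
  obtain s t where s: "x = horner C (map s [0..<q]) (e 0)" "\<forall>i. s i \<in> NF L (\<lambda>k. e (Suc k))"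
    and t: "y = horner C (map t [0..<q]) (e 0)" "\<forall>i. t i \<in> NF L (\<lambda>k. e (Suc k))"
    using Suc.prems unfolding NF_Suc by blast
  have sub: "NF L (\<lambda>k. e (Suc k)) \<subseteq> carrier C" by (rule NF_closed) (rule Suc.prems)
  have "x \<oplus>\<^bsub>C\<^esub> y = horner C (map (\<lambda>i. s i \<oplus>\<^bsub>C\<^esub> t i) [0..<q]) (e 0)"
    unfolding s t using s t sub Suc.prems by (intro S.horner_map_add[symmetric]) auto
  moreover have "\<forall>i. s i \<oplus>\<^bsub>C\<^esub> t i \<in> NF L (\<lambda>k. e (Suc k))"
    using s(2) t(2) Suc.prems(1) by (intro allI Suc.IH) auto
  ultimately show ?case unfolding NF_Suc by blast
qed

lemma NF_smult:
  "(\<And>k. e k \<in> carrier C) \<Longrightarrow> x \<in> NF L e \<Longrightarrow> r \<in> carrier R \<Longrightarrow> \<psi> r \<otimes>\<^bsub>C\<^esub> x \<in> NF L e"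
proof (induction L arbitrary: e x)
  case 0
  then obtain a where "a \<in> carrier R" "x = \<psi> a" unfolding NF_0 by blast
  then show ?case unfolding NF_0 using hom_mult[of r a] R.m_closed[of r a] 0(3) by (metis imageI)
next
  case (Suc L)
  obtain s where s: "x = horner C (map s [0..<q]) (e 0)" "\<forall>i. s i \<in> NF L (\<lambda>k. e (Suc k))"
    using Suc.prems unfolding NF_Suc by blast
  have sub: "NF L (\<lambda>k. e (Suc k)) \<subseteq> carrier C" by (rule NF_closed) (rule Suc.prems)
  have "\<psi> r \<otimes>\<^bsub>C\<^esub> x = horner C (map (\<lambda>i. \<psi> r \<otimes>\<^bsub>C\<^esub> s i) [0..<q]) (e 0)"
    unfolding s using s sub Suc.prems by (intro S.horner_map_mult[symmetric]) auto
  moreover have "\<forall>i. \<psi> r \<otimes>\<^bsub>C\<^esub> s i \<in> NF L (\<lambda>k. e (Suc k))"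
    using s(2) Suc.prems by (intro allI Suc.IH) auto
  ultimately show ?case unfolding NF_Suc by blast
qed

text \<open>Only the digits 0 and 1 of \<open>e 0\<close> are occupied; both exist because
  \<open>q \<ge> 2\<close>.\<close>

lemma NF_linear:
  assumes e: "\<And>k. e k \<in> carrier C" and y: "y \<in> NF L (\<lambda>k. e (Suc k))" and z: "z \<in> NF L (\<lambda>k. e (Suc k))"
  shows "y \<oplus>\<^bsub>C\<^esub> e 0 \<otimes>\<^bsub>C\<^esub> z \<in> NF (Suc L) e"
proof -
  obtain m where m: "q = Suc (Suc m)" using q2 that[of "q - 2"] by simp
  have sub: "NF L (\<lambda>k. e (Suc k)) \<subseteq> carrier C" by (rule NF_closed) (rule e)
  have c: "y \<in> carrier C" "z \<in> carrier C" using y z sub by auto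
  let ?s = "\<lambda>i. if i = 0 then y else if i = 1 then z else \<zero>\<^bsub>C\<^esub>"
  have "[0..<q] = 0 # 1 # [2..<q]"
    using upt_conv_Cons[of 0 q] upt_conv_Cons[of 1 q] unfolding m by (simp del: upt_Suc add: numeral_2_eq_2)
  then have "horner C (map ?s [0..<q]) (e 0) = y \<oplus>\<^bsub>C\<^esub> e 0 \<otimes>\<^bsub>C\<^esub> (z \<oplus>\<^bsub>C\<^esub> e 0 \<otimes>\<^bsub>C\<^esub> horner C (map ?s [2..<q]) (e 0))"
    by simp
  also have "map ?s [2..<q] = map (\<lambda>i. \<zero>\<^bsub>C\<^esub>) [2..<q]" by (intro map_cong) auto
  also have "horner C (map (\<lambda>i. \<zero>\<^bsub>C\<^esub>) [2..<q]) (e 0) = \<zero>\<^bsub>C\<^esub>" by (rule S.horner_zeros[OF e])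
  also have "y \<oplus>\<^bsub>C\<^esub> e 0 \<otimes>\<^bsub>C\<^esub> (z \<oplus>\<^bsub>C\<^esub> e 0 \<otimes>\<^bsub>C\<^esub> \<zero>\<^bsub>C\<^esub>) = y \<oplus>\<^bsub>C\<^esub> e 0 \<otimes>\<^bsub>C\<^esub> z"
    using c e by simp
  finally have "y \<oplus>\<^bsub>C\<^esub> e 0 \<otimes>\<^bsub>C\<^esub> z = horner C (map ?s [0..<q]) (e 0)" ..
  moreover have "\<forall>i. ?s i \<in> NF L (\<lambda>k. e (Suc k))" using y z NF_zero e by simp
  ultimately show ?thesis unfolding NF_Suc by blast
qed

text \<open>The new variable \<open>e L\<close> enters at the innermost level, where only its digit
  0 is occupied.\<close>

lemma NF_Suc_mono: "(\<And>k. e k \<in> carrier C) \<Longrightarrow> NF L e \<subseteq> NF (Suc L) e"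
proof (induction L arbitrary: e)
  case 0
  show ?case
  proof
    fix x assume x: "x \<in> NF 0 e"
    then have "x \<in> NF 0 (\<lambda>k. e (Suc k))" "x \<in> carrier C" unfolding NF_0 by auto
    then have "x \<oplus>\<^bsub>C\<^esub> e 0 \<otimes>\<^bsub>C\<^esub> \<zero>\<^bsub>C\<^esub> \<in> NF (Suc 0) e" using 0 NF_zero by (intro NF_linear) auto
    then show "x \<in> NF (Suc 0) e" using 0 \<open>x \<in> carrier C\<close> by simp
  qed
next
  case (Suc L)
  have "NF L (\<lambda>k. e (Suc k)) \<subseteq> NF (Suc L) (\<lambda>k. e (Suc k))" by (intro Suc.IH Suc.prems)
  then show ?case unfolding NF_Suc[of L e] NF_Suc[of "Suc L" e] by blast
qed

lemma NF_mono:
  assumes "\<And>k. e k \<in> carrier C" "L \<le> M"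
  shows "NF L e \<subseteq> NF M e"
proof -
  have "NF L e \<subseteq> NF (Suc L) e" for L by (rule NF_Suc_mono) (rule assms(1))
  then show ?thesis by (rule lift_Suc_mono_le[OF _ assms(2)])
qed

text \<open>Multiplication by \<open>e 0\<close> shifts the digits, and the top digit
  \<open>s\<close> overflows: \<open>s e_0^q = s e_0 + \<pi> s e_1\<close>. The last term is a carry
  into the shifted tower, where the induction hypothesis applies at the cost of one more
  level.\<close>

lemma NF_mult_tower_0:
  "tower e \<Longrightarrow> x \<in> NF L e \<Longrightarrow> e 0 \<otimes>\<^bsub>C\<^esub> x \<in> NF (Suc L) e"
proof (induction L arbitrary: e x)
  case 0
  note e = tower_closed[OF 0(1)]
  have x: "x \<in> carrier C" "x \<in> NF 0 (\<lambda>k. e (Suc k))" using 0(2) unfolding NF_0 by auto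
  have "\<zero>\<^bsub>C\<^esub> \<oplus>\<^bsub>C\<^esub> e 0 \<otimes>\<^bsub>C\<^esub> x \<in> NF (Suc 0) e" by (rule NF_linear[OF e NF_zero[OF e] x(2)])
  then show ?case using x e by simp
next
  case (Suc L)
  note e = tower_closed[OF Suc.prems(1)]
  let ?e = "\<lambda>k. e (Suc k)"
  have te: "tower ?e" by (rule tower_shift[OF Suc.prems(1)])
  have sub: "NF L ?e \<subseteq> carrier C" by (rule NF_closed) (rule e)
  obtain s where s: "x = horner C (map s [0..<q]) (e 0)" "\<And>i. s i \<in> NF L ?e"
    using Suc.prems(2) unfolding NF_Suc by blast
  have sc: "\<And>i. s i \<in> carrier C" using s(2) sub by blast
  obtain m where m: "q = Suc m" using q2 that[of "q - 1"] by simp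
  let ?h = "horner C (map s [0..<m]) (e 0)"
  have hc: "?h \<in> carrier C" using sc e by (intro S.horner_closed) auto
  have x: "x = ?h \<oplus>\<^bsub>C\<^esub> e 0 [^]\<^bsub>C\<^esub> m \<otimes>\<^bsub>C\<^esub> s m"
    unfolding s(1) m using S.horner_append_single[OF e, of "map s [0..<m]" "s m"] sc by auto
  have pw: "e 0 \<otimes>\<^bsub>C\<^esub> e 0 [^]\<^bsub>C\<^esub> m = e 0 \<oplus>\<^bsub>C\<^esub> \<psi> \<pi> \<otimes>\<^bsub>C\<^esub> e 1"
  proof -
    have "e 0 [^]\<^bsub>C\<^esub> q = e 0 \<oplus>\<^bsub>C\<^esub> \<psi> \<pi> \<otimes>\<^bsub>C\<^esub> e 1" using Suc.prems(1) unfolding tower_def by simp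
    then show ?thesis by (simp only: m S.nat_pow_Suc2[OF e])
  qed
  have pc: "e 0 [^]\<^bsub>C\<^esub> m \<in> carrier C" "\<psi> \<pi> \<in> carrier C" using e pi_closed by auto
  have "e 0 \<otimes>\<^bsub>C\<^esub> x = (\<zero>\<^bsub>C\<^esub> \<oplus>\<^bsub>C\<^esub> e 0 \<otimes>\<^bsub>C\<^esub> ?h) \<oplus>\<^bsub>C\<^esub> (e 0 \<otimes>\<^bsub>C\<^esub> e 0 [^]\<^bsub>C\<^esub> m) \<otimes>\<^bsub>C\<^esub> s m"
    unfolding x using hc pc e[of 0] sc[of m] by algebra
  also have "\<dots> = (\<zero>\<^bsub>C\<^esub> \<oplus>\<^bsub>C\<^esub> e 0 \<otimes>\<^bsub>C\<^esub> ?h) \<oplus>\<^bsub>C\<^esub> (\<psi> \<pi> \<otimes>\<^bsub>C\<^esub> (e 1 \<otimes>\<^bsub>C\<^esub> s m) \<oplus>\<^bsub>C\<^esub> e 0 \<otimes>\<^bsub>C\<^esub> s m)"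
    unfolding pw using hc pc(2) e[of 0] e[of 1] sc[of m] by algebra
  finally have split: "e 0 \<otimes>\<^bsub>C\<^esub> x = (\<zero>\<^bsub>C\<^esub> \<oplus>\<^bsub>C\<^esub> e 0 \<otimes>\<^bsub>C\<^esub> ?h) \<oplus>\<^bsub>C\<^esub> (\<psi> \<pi> \<otimes>\<^bsub>C\<^esub> (e 1 \<otimes>\<^bsub>C\<^esub> s m) \<oplus>\<^bsub>C\<^esub> e 0 \<otimes>\<^bsub>C\<^esub> s m)" .
  \<comment> \<open>All digits but the top one move up by one place, and 0 fills the lowest
    place.\<close>
  have "\<zero>\<^bsub>C\<^esub> \<oplus>\<^bsub>C\<^esub> e 0 \<otimes>\<^bsub>C\<^esub> ?h = horner C (map (\<lambda>i. case i of 0 \<Rightarrow> \<zero>\<^bsub>C\<^esub> | Suc j \<Rightarrow> s j) [0..<q]) (e 0)"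
    unfolding m map_upt_Suc horner.simps by simp
  moreover have "\<forall>i. (case i of 0 \<Rightarrow> \<zero>\<^bsub>C\<^esub> | Suc j \<Rightarrow> s j) \<in> NF L ?e"
    using s(2) NF_zero[of ?e L] e by (simp split: nat.split)
  ultimately have 1: "\<zero>\<^bsub>C\<^esub> \<oplus>\<^bsub>C\<^esub> e 0 \<otimes>\<^bsub>C\<^esub> ?h \<in> NF (Suc L) e"
    unfolding NF_Suc by blast
  have "e 1 \<otimes>\<^bsub>C\<^esub> s m \<in> NF (Suc L) ?e"
    using Suc.IH[OF te s(2)[of m]] by simp
  then have "\<psi> \<pi> \<otimes>\<^bsub>C\<^esub> (e 1 \<otimes>\<^bsub>C\<^esub> s m) \<in> NF (Suc L) ?e" using e pi_closed by (intro NF_smult) auto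
  moreover have "s m \<in> NF (Suc L) ?e" using NF_Suc_mono[of ?e L] e s(2) by blast
  ultimately have 2: "\<psi> \<pi> \<otimes>\<^bsub>C\<^esub> (e 1 \<otimes>\<^bsub>C\<^esub> s m) \<oplus>\<^bsub>C\<^esub> e 0 \<otimes>\<^bsub>C\<^esub> s m \<in> NF (Suc (Suc L)) e"
    by (intro NF_linear[OF e])
  have 3: "\<zero>\<^bsub>C\<^esub> \<oplus>\<^bsub>C\<^esub> e 0 \<otimes>\<^bsub>C\<^esub> ?h \<in> NF (Suc (Suc L)) e" using 1 NF_Suc_mono[of e "Suc L"] e by blast
  show ?case unfolding split by (rule NF_add[OF e 3 2])
qed

lemma NFs_I: "x \<in> NF L e \<Longrightarrow> x \<in> NFs e"
  unfolding NFs_def by blast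

lemma NFs_closed: "(\<And>k. e k \<in> carrier C) \<Longrightarrow> NFs e \<subseteq> carrier C"
  unfolding NFs_def using NF_closed by blast

lemma NFs_add:
  assumes "\<And>k. e k \<in> carrier C" "x \<in> NFs e" "y \<in> NFs e"
  shows "x \<oplus>\<^bsub>C\<^esub> y \<in> NFs e"
proof -
  obtain L M where "x \<in> NF L e" "y \<in> NF M e" using assms unfolding NFs_def by blast
  then have "x \<in> NF (max L M) e" "y \<in> NF (max L M) e" using NF_mono[of e] assms(1) by (meson max.cobounded1 max.cobounded2 subsetD)+
  then have "x \<oplus>\<^bsub>C\<^esub> y \<in> NF (max L M) e" by (intro NF_add assms(1))
  then show ?thesis by (rule NFs_I)
qed

lemma NFs_smult: "(\<And>k. e k \<in> carrier C) \<Longrightarrow> x \<in> NFs e \<Longrightarrow> r \<in> carrier R \<Longrightarrow> \<psi> r \<otimes>\<^bsub>C\<^esub> x \<in> NFs e"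
  using NF_smult unfolding NFs_def by blast

lemma NFs_base: "r \<in> carrier R \<Longrightarrow> \<psi> r \<in> NFs e"
  by (rule NFs_I[of _ 0]) (simp add: NF_0)

text \<open>For positive \<open>k\<close> the factor acts on each digit of \<open>e 0\<close> inside
  the shifted tower. The digits may end at different levels, which is why the union
  \<open>NFs\<close> is used.\<close>

lemma NFs_mult_tower: "tower e \<Longrightarrow> x \<in> NFs e \<Longrightarrow> e k \<otimes>\<^bsub>C\<^esub> x \<in> NFs e"
proof (induction k arbitrary: e x)
  case 0
  then show ?case using NF_mult_tower_0 unfolding NFs_def by blast
next
  case (Suc k)
  note e = tower_closed[OF Suc.prems(1)]
  let ?e = "\<lambda>k. e (Suc k)"
  obtain L where "x \<in> NF L e" using Suc.prems(2) unfolding NFs_def by blast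
  then have "x \<in> NF (Suc L) e" using NF_Suc_mono[of e L] e by blast
  then obtain s where s: "x = horner C (map s [0..<q]) (e 0)" "\<And>i. s i \<in> NF L ?e"
    unfolding NF_Suc by blast
  have sc: "\<And>i. s i \<in> carrier C" using s(2) NF_closed[of ?e L] e by blast
  have "\<forall>i. \<exists>M. e (Suc k) \<otimes>\<^bsub>C\<^esub> s i \<in> NF M ?e"
    using Suc.IH[OF tower_shift[OF Suc.prems(1)] NFs_I[OF s(2)]] unfolding NFs_def by blast
  from choice[OF this] obtain M where M: "\<And>i. e (Suc k) \<otimes>\<^bsub>C\<^esub> s i \<in> NF (M i) ?e" by blast
  define N where "N = Max (M ` {..<q})"
  \<comment> \<open>Beyond the \<open>q\<close> digits the family is set to zero, because
    \<open>N\<close> bounds the levels \<open>M i\<close> only for \<open>i < q\<close>.\<close>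
  let ?s = "\<lambda>i. if i < q then e (Suc k) \<otimes>\<^bsub>C\<^esub> s i else \<zero>\<^bsub>C\<^esub>"
  have "e (Suc k) \<otimes>\<^bsub>C\<^esub> x = horner C (map (\<lambda>i. e (Suc k) \<otimes>\<^bsub>C\<^esub> s i) [0..<q]) (e 0)"
    unfolding s(1) using sc e by (intro S.horner_map_mult[symmetric])
  also have "map (\<lambda>i. e (Suc k) \<otimes>\<^bsub>C\<^esub> s i) [0..<q] = map ?s [0..<q]" by (intro map_cong) auto
  finally have x: "e (Suc k) \<otimes>\<^bsub>C\<^esub> x = horner C (map ?s [0..<q]) (e 0)" .
  have "?s i \<in> NF N ?e" for i
  proof (cases "i < q")
    case True
    then have "M i \<le> N" unfolding N_def by (intro Max_ge) auto
    then show ?thesis using NF_mono[of ?e "M i" N] M[of i] e True by auto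
  next
    case False
    then show ?thesis using NF_zero[of ?e N] e by simp
  qed
  then have "e (Suc k) \<otimes>\<^bsub>C\<^esub> x \<in> NF (Suc N) e" unfolding x NF_Suc by blast
  then show ?case by (rule NFs_I)
qed

text \<open>Horner's scheme for \<open>x\<close> reduces the product to multiplications by scalars
  and single tower elements. \<open>x\<close> comes from a shifted tower while \<open>y\<close>
  belongs to the whole one, so that the induction can descend into the digits of
  \<open>x\<close>.\<close>

lemma NFs_mult_shift:
  "tower e \<Longrightarrow> x \<in> NF L (\<lambda>i. e (i + k)) \<Longrightarrow> y \<in> NFs e \<Longrightarrow> x \<otimes>\<^bsub>C\<^esub> y \<in> NFs e"
proof (induction L arbitrary: x k)
  case 0
  then obtain r where "r \<in> carrier R" "x = \<psi> r" unfolding NF_0 by blast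
  then show ?case using NFs_smult[OF tower_closed[OF 0(1)] 0(3)] by simp
next
  case (Suc L)
  note e = tower_closed[OF Suc.prems(1)]
  have yc: "y \<in> carrier C" using Suc.prems(3) NFs_closed[of e] e by blast
  obtain s where s: "x = horner C (map s [0..<q]) (e k)" "\<And>i. s i \<in> NF L (\<lambda>j. e (j + Suc k))"
    using Suc.prems(2) unfolding NF_Suc by auto
  have sc: "\<And>i. s i \<in> carrier C" using s(2) NF_closed[of "\<lambda>j. e (j + Suc k)" L] e by blast
  have sy: "s i \<otimes>\<^bsub>C\<^esub> y \<in> NFs e" for i using Suc.IH[OF Suc.prems(1) s(2) Suc.prems(3)] .
  have "horner C (map s is) (e k) \<otimes>\<^bsub>C\<^esub> y \<in> NFs e" for "is"
  proof (induction "is")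
    case Nil
    then show ?case using yc NFs_I[OF NF_zero[OF e]] by simp
  next
    case (Cons i "is")
    have hc: "horner C (map s is) (e k) \<in> carrier C" using sc e by (intro S.horner_closed) auto
    have "horner C (map s (i # is)) (e k) \<otimes>\<^bsub>C\<^esub> y = s i \<otimes>\<^bsub>C\<^esub> y \<oplus>\<^bsub>C\<^esub> e k \<otimes>\<^bsub>C\<^esub> (horner C (map s is) (e k) \<otimes>\<^bsub>C\<^esub> y)"
      unfolding list.map horner.simps using sc[of i] hc e[of k] yc by algebra
    also have "\<dots> \<in> NFs e"
      by (intro NFs_add[OF e] sy NFs_mult_tower[OF Suc.prems(1)] Cons)
    finally show ?case .
  qed
  then show ?case unfolding s(1) .
qed

lemma NFs_mult:
  assumes "tower e" "x \<in> NFs e" "y \<in> NFs e"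
  shows "x \<otimes>\<^bsub>C\<^esub> y \<in> NFs e"
proof -
  obtain L where "x \<in> NF L e" using assms(2) unfolding NFs_def by blast
  then show ?thesis using NFs_mult_shift[OF assms(1), of x L 0] assms(3) by simp
qed

lemma NFs_tower: "tower e \<Longrightarrow> e k \<in> NFs e"
  using NFs_mult_tower[of e "\<psi> \<one>" k] NFs_base[OF R.one_closed, of e] tower_closed[of e k] by simp

end

section \<open>Normal forms divisible by a uniformizer\<close>

lemma (in cring) mem_PIdl_iff: "x \<in> PIdl a \<longleftrightarrow> (\<exists>r\<in>carrier R. x = r \<otimes> a)"
  unfolding cgenideal_def by blast

lemma (in cring) minus_minus_cancel:
  "a \<in> carrier R \<Longrightarrow> b \<in> carrier R \<Longrightarrow> a \<ominus> (a \<ominus> b) = b"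
  by algebra

text \<open>The second equation identifies the cofactor \<open>s\<close> modulo \<open>a - b\<close>
  with \<open>(n + 1) a^n\<close>, the derivative of the power. It is divisible by
  \<open>\<pi>\<close> as soon as \<open>n + 1\<close> and \<open>a - b\<close> are.\<close>

lemma (in cring) pow_minus_pow:
  assumes a: "a \<in> carrier R" and b: "b \<in> carrier R"
  shows "\<exists>s\<in>carrier R. \<exists>v\<in>carrier R. a [^] Suc n \<ominus> b [^] Suc n = (a \<ominus> b) \<otimes> s \<and>
    s = add_pow R (Suc n) \<one> \<otimes> a [^] n \<oplus> (a \<ominus> b) \<otimes> v"
proof (induction n)
  case 0
  then show ?case using a b by (intro bexI[of _ \<one>] bexI[of _ \<zero>]) auto
next
  case (Suc n)
  then obtain s v where s: "s \<in> carrier R" "v \<in> carrier R" "a [^] Suc n \<ominus> b [^] Suc n = (a \<ominus> b) \<otimes> s"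
    "s = add_pow R (Suc n) \<one> \<otimes> a [^] n \<oplus> (a \<ominus> b) \<otimes> v" by blast
  define A where "A = a [^] n"
  define B where "B = b [^] n"
  define N where "N = add_pow R (Suc n) \<one>"
  have c: "A \<in> carrier R" "B \<in> carrier R" "N \<in> carrier R" using a b unfolding A_def B_def N_def by auto
  have N: "add_pow R (Suc (Suc n)) \<one> = N \<oplus> \<one>" unfolding N_def by simp
  have h1: "A \<otimes> a \<ominus> B \<otimes> b = (a \<ominus> b) \<otimes> s" using s(3) unfolding A_def B_def by simp
  have h2: "s = N \<otimes> A \<oplus> (a \<ominus> b) \<otimes> v" using s(4) unfolding A_def N_def .
  have p: "a [^] Suc (Suc n) = A \<otimes> a \<otimes> a" "b [^] Suc (Suc n) = B \<otimes> b \<otimes> b" "a [^] Suc n = A \<otimes> a"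
    unfolding A_def B_def by simp_all
  have Bb: "B \<otimes> b = A \<otimes> a \<ominus> (a \<ominus> b) \<otimes> s"
  proof -
    have "B \<otimes> b = A \<otimes> a \<ominus> (A \<otimes> a \<ominus> B \<otimes> b)" using a b c by algebra
    then show ?thesis unfolding h1 .
  qed
  have "A \<otimes> a \<otimes> a \<ominus> B \<otimes> b \<otimes> b = a \<otimes> (A \<otimes> a \<ominus> B \<otimes> b) \<oplus> (a \<ominus> b) \<otimes> (B \<otimes> b)"
    using a b c by algebra
  also have "\<dots> = (a \<ominus> b) \<otimes> (a \<otimes> s \<oplus> B \<otimes> b)"
    unfolding h1 using a b c s(1) by algebra
  finally have 1: "a [^] Suc (Suc n) \<ominus> b [^] Suc (Suc n) = (a \<ominus> b) \<otimes> (a \<otimes> s \<oplus> B \<otimes> b)" unfolding p .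
  have "a \<otimes> s \<oplus> B \<otimes> b = a \<otimes> (N \<otimes> A \<oplus> (a \<ominus> b) \<otimes> v) \<oplus> (A \<otimes> a \<ominus> (a \<ominus> b) \<otimes> s)"
    unfolding Bb using h2 by simp
  also have "\<dots> = (N \<oplus> \<one>) \<otimes> (A \<otimes> a) \<oplus> (a \<ominus> b) \<otimes> (a \<otimes> v \<ominus> s)"
    using a b c s(1,2) by algebra
  finally have 2: "a \<otimes> s \<oplus> B \<otimes> b = add_pow R (Suc (Suc n)) \<one> \<otimes> a [^] Suc n \<oplus> (a \<ominus> b) \<otimes> (a \<otimes> v \<ominus> s)"
    unfolding N p .
  have "a \<otimes> s \<oplus> B \<otimes> b \<in> carrier R" "a \<otimes> v \<ominus> s \<in> carrier R" using a b c s(1,2) by auto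
  then show ?case using 1 2 by blast
qed

text \<open>In the application the residue ring modulo \<open>\<pi>\<close> is the field with
  \<open>q\<close> elements, which gives \<open>q_mem\<close> and \<open>frobenius\<close>. The list
  \<open>xs\<close> is a system of representatives, whose unit differences are needed for the
  elimination.\<close>

locale uniformizer = domain R for R (structure) +
  fixes \<pi> and q :: nat and xs
  assumes pi_closed [simp]: "\<pi> \<in> carrier R" and pi_nonzero: "\<pi> \<noteq> \<zero>"
    and q2: "q \<ge> 2" and q_mem: "add_pow R q \<one> \<in> PIdl \<pi>"
    and frobenius: "\<And>x. x \<in> carrier R \<Longrightarrow> x [^] q \<ominus> x \<in> PIdl \<pi>"
    and xs: "length xs = q" "set xs \<subseteq> carrier R" "sorted_wrt (\<lambda>x y. y \<ominus> x \<in> Units R) xs"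
begin

abbreviation "I n \<equiv> PIdl (\<pi> [^] (n::nat))"

lemma pow_pi: "\<pi> [^] (n::nat) \<in> carrier R"
  using pi_closed by simp

lemma I_ideal: "ideal (I n) R"
  by (rule cgenideal_ideal[OF pow_pi])

lemma I_1: "I 1 = PIdl \<pi>"
  using pi_closed by simp

lemma I_mono: "n \<le> m \<Longrightarrow> I m \<subseteq> I n"
proof
  fix x assume nm: "n \<le> m" and "x \<in> I m"
  then obtain r where r: "r \<in> carrier R" "x = r \<otimes> \<pi> [^] m" unfolding mem_PIdl_iff by blast
  have "x = (r \<otimes> \<pi> [^] (m - n)) \<otimes> \<pi> [^] n"
    unfolding r(2) using r(1) pi_closed nm by (simp add: m_assoc nat_pow_mult)
  then show "x \<in> I n" unfolding mem_PIdl_iff using r(1) pow_pi by blast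
qed

lemma I_cancel:
  assumes "x \<in> carrier R" "\<pi> \<otimes> x \<in> I (Suc n)"
  shows "x \<in> I n"
proof -
  obtain r where r: "r \<in> carrier R" "\<pi> \<otimes> x = r \<otimes> \<pi> [^] Suc n" using assms(2) unfolding mem_PIdl_iff by blast
  then have "\<pi> \<otimes> x = \<pi> \<otimes> (r \<otimes> \<pi> [^] n)" using pi_closed pow_pi[of n] by (simp add: m_ac)
  then have "x = r \<otimes> \<pi> [^] n" using m_lcancel[OF pi_nonzero pi_closed assms(1), of "r \<otimes> \<pi> [^] n"] r(1) pow_pi by simp
  then show ?thesis unfolding mem_PIdl_iff using r(1) by blast
qed

text \<open>The cofactor of \<open>a - b\<close> is divisible by \<open>\<pi>\<close>, so taking
  \<open>q\<close>-th powers gains one power of \<open>\<pi>\<close>.\<close>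

lemma pow_q_cong:
  assumes a: "a \<in> carrier R" and b: "b \<in> carrier R" and ab: "a \<ominus> b \<in> I (Suc n)"
  shows "a [^] q \<ominus> b [^] q \<in> I (Suc (Suc n))"
proof -
  obtain m where m: "q = Suc m" using q2 that[of "q - 1"] by simp
  interpret I1: ideal "PIdl \<pi>" R by (rule cgenideal_ideal[OF pi_closed])
  obtain s v where s: "s \<in> carrier R" "v \<in> carrier R" "a [^] q \<ominus> b [^] q = (a \<ominus> b) \<otimes> s"
    "s = add_pow R q \<one> \<otimes> a [^] m \<oplus> (a \<ominus> b) \<otimes> v" using pow_minus_pow[OF a b, of m] unfolding m by blast
  have "a \<ominus> b \<in> PIdl \<pi>" using ab I_mono[of 1 "Suc n"] unfolding I_1 by auto
  then have "s \<in> PIdl \<pi>"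
    unfolding s(4) using q_mem a s(2) by (intro I1.a_closed I1.I_r_closed) auto
  then obtain t where t: "t \<in> carrier R" "s = t \<otimes> \<pi>" unfolding mem_PIdl_iff by blast
  obtain r where r: "r \<in> carrier R" "a \<ominus> b = r \<otimes> \<pi> [^] Suc n" using ab unfolding mem_PIdl_iff by blast
  have "a [^] q \<ominus> b [^] q = (r \<otimes> \<pi> [^] Suc n) \<otimes> (t \<otimes> \<pi>)"
    unfolding s(3) r(2)[symmetric] t(2)[symmetric] ..
  also have "\<dots> = (r \<otimes> t) \<otimes> (\<pi> [^] Suc n \<otimes> \<pi>)"
    using r(1) t(1) pow_pi[of "Suc n"] pi_closed by algebra
  finally have e: "a [^] q \<ominus> b [^] q = (r \<otimes> t) \<otimes> \<pi> [^] Suc (Suc n)" unfolding nat_pow_Suc[of \<pi> "Suc n"] .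
  have "r \<otimes> t \<in> carrier R" using r(1) t(1) by simp
  with e show ?thesis unfolding mem_PIdl_iff by blast
qed

text \<open>The quotient \<open>(x^q - x) / \<pi>\<close>; the choice is unique because
  \<open>\<pi>\<close> is nonzero in a domain.\<close>

definition \<phi> :: "'a \<Rightarrow> 'a"
  where "\<phi> x = (SOME y. y \<in> carrier R \<and> \<pi> \<otimes> y = x [^] q \<ominus> x)"

lemma phi:
  assumes "x \<in> carrier R"
  shows "\<phi> x \<in> carrier R \<and> \<pi> \<otimes> \<phi> x = x [^] q \<ominus> x"
proof -
  obtain r where "r \<in> carrier R" "x [^] q \<ominus> x = r \<otimes> \<pi>" using frobenius[OF assms] unfolding mem_PIdl_iff by blast
  then have "r \<in> carrier R \<and> \<pi> \<otimes> r = x [^] q \<ominus> x" using m_comm pi_closed by simp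
  then show ?thesis unfolding \<phi>_def by (rule someI)
qed

text \<open>The division by \<open>\<pi>\<close> costs one power; the linear term
  \<open>a - b\<close> prevents the gain from \<open>pow_q_cong\<close> from making up for
  it.\<close>

lemma phi_cong:
  assumes a: "a \<in> carrier R" and b: "b \<in> carrier R" and ab: "a \<ominus> b \<in> I (Suc n)"
  shows "\<phi> a \<ominus> \<phi> b \<in> I n"
proof (rule I_cancel)
  interpret I: ideal "I (Suc n)" R by (rule I_ideal)
  show "\<phi> a \<ominus> \<phi> b \<in> carrier R" using phi[OF a] phi[OF b] by simp
  have c: "a [^] q \<in> carrier R" "b [^] q \<in> carrier R" using a b by auto
  have "\<pi> \<otimes> (\<phi> a \<ominus> \<phi> b) = (a [^] q \<ominus> a) \<ominus> (b [^] q \<ominus> b)"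
    using phi[OF a] phi[OF b] m_minus_distr[OF pi_closed] by metis
  also have "\<dots> = (a [^] q \<ominus> b [^] q) \<ominus> (a \<ominus> b)" using a b c by algebra
  also have "\<dots> \<in> I (Suc n)"
    by (rule I.minus_mem[OF _ ab]) (use pow_q_cong[OF a b ab] I_mono[of "Suc n" "Suc (Suc n)"] in auto)
  finally show "\<pi> \<otimes> (\<phi> a \<ominus> \<phi> b) \<in> I (Suc n)" .
qed

definition orbit :: "'a \<Rightarrow> nat \<Rightarrow> 'a"
  where "orbit x k = (\<phi> ^^ k) x"

lemma orbit_closed: "x \<in> carrier R \<Longrightarrow> orbit x k \<in> carrier R"
  unfolding orbit_def by (induction k) (auto simp: phi)

lemma orbit_0: "orbit x 0 = x"
  unfolding orbit_def by simp

lemma orbit_Suc: "orbit x (Suc k) = orbit (\<phi> x) k"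
  unfolding orbit_def by (simp add: funpow_swap1)

abbreviation "rval \<equiv> nval R (\<lambda>r. r) q"

lemma rval_closed:
  assumes "\<And>k. e k \<in> carrier R" "\<And>l. c l \<in> carrier R"
  shows "rval L e c \<in> carrier R"
  using nval_hom[of R R "\<lambda>r. r" R "\<lambda>r. r" "\<lambda>r. r" e c] assms cring_axioms
  by (simp add: ring_hom_cring_def ring_hom_cring_axioms_def ring_hom_def)

lemma rval_orbit_Suc:
  "rval (Suc L) (orbit x) c = horner R (map (\<lambda>i. rval L (orbit (\<phi> x)) (\<lambda>l. c (i # l))) [0..<q]) x"
  unfolding nval.simps orbit_0 orbit_Suc ..

text \<open>Each iterate costs one power by \<open>phi_cong\<close>. Level \<open>L\<close> sees the
  orbit entries 0 to \<open>L - 1\<close>, so agreement modulo \<open>\<pi>^L\<close> leaves one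
  power for the last of them.\<close>

lemma rval_cong:
  assumes "a \<in> carrier R" "b \<in> carrier R" "a \<ominus> b \<in> I L" "\<And>l. c l \<in> carrier R"
  shows "rval L (orbit a) c \<ominus> rval L (orbit b) c \<in> I 1"
  using assms
proof (induction L arbitrary: a b c)
  case 0
  interpret I: ideal "I 1" R by (rule I_ideal)
  show ?case using 0(4) I.zero_closed by (simp add: minus_eq r_neg)
next
  case (Suc L)
  have ab: "a \<ominus> b \<in> I 1" using Suc.prems(3) I_mono[of 1 "Suc L"] by auto
  have ph: "\<phi> a \<in> carrier R" "\<phi> b \<in> carrier R" "\<phi> a \<ominus> \<phi> b \<in> I L"
    using phi Suc.prems(1,2) phi_cong[OF Suc.prems(1-3)] by blast+
  have rc: "rval L (orbit z) (\<lambda>l. c (i # l)) \<in> carrier R" if "z \<in> carrier R" for z i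
    by (intro rval_closed orbit_closed that Suc.prems(4))
  show ?case
    unfolding rval_orbit_Suc
    by (intro horner_cong_ideal[OF I_ideal Suc.prems(1,2) ab] conjI rc ph Suc.IH Suc.prems(4))
qed

text \<open>Solves \<open>x ^ q - x = \<pi> y\<close> to any precision by iterating \<open>x \<mapsto> x ^ q - \<pi> y\<close>.\<close>
lemma phi_approx:
  assumes c: "c \<in> carrier R" and y: "y \<in> carrier R"
  shows "\<exists>x\<in>carrier R. x \<ominus> c \<in> I 1 \<and> \<phi> x \<ominus> y \<in> I n"
proof -
  have "\<exists>x\<in>carrier R. x \<ominus> c \<in> I 1 \<and> (x [^] q \<ominus> \<pi> \<otimes> y) \<ominus> x \<in> I (Suc n)"
  proof (induction n)
    case 0
    interpret I: ideal "I 1" R by (rule I_ideal)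
    have cl: "c [^] q \<in> carrier R" "\<pi> \<otimes> y \<in> carrier R" using c y pi_closed by auto
    have py: "\<pi> \<otimes> y \<in> I 1" unfolding I_1 mem_PIdl_iff using y pi_closed m_comm by blast
    have "(c [^] q \<ominus> c) \<ominus> \<pi> \<otimes> y \<in> I 1" by (rule I.minus_mem[OF frobenius[OF c, folded I_1] py])
    moreover have "(c [^] q \<ominus> c) \<ominus> \<pi> \<otimes> y = (c [^] q \<ominus> \<pi> \<otimes> y) \<ominus> c" using c cl by algebra
    ultimately have 1: "(c [^] q \<ominus> \<pi> \<otimes> y) \<ominus> c \<in> I (Suc 0)" unfolding One_nat_def by (simp only:)
    have "c \<ominus> c \<in> I 1" using I.zero_closed c by (simp add: minus_eq r_neg)
    with c 1 show ?case by blast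
  next
    case (Suc n)
    then obtain x where x: "x \<in> carrier R" "x \<ominus> c \<in> I 1" "(x [^] q \<ominus> \<pi> \<otimes> y) \<ominus> x \<in> I (Suc n)" by blast
    interpret I: ideal "I 1" R by (rule I_ideal)
    define z where "z = x [^] q \<ominus> \<pi> \<otimes> y"
    have z: "z \<in> carrier R" unfolding z_def using x(1) y pi_closed by simp
    have zx: "z \<ominus> x \<in> I (Suc n)" using x(3) unfolding z_def .
    have cl: "x [^] q \<in> carrier R" "\<pi> \<otimes> y \<in> carrier R" "z [^] q \<in> carrier R" using x(1) y pi_closed z by auto
    have "z \<ominus> x \<in> I 1" using zx I_mono[of 1 "Suc n"] by auto
    then have "(z \<ominus> x) \<oplus> (x \<ominus> c) \<in> I 1" using x(2) by (rule I.a_closed)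
    moreover have "(z \<ominus> x) \<oplus> (x \<ominus> c) = z \<ominus> c" using z x(1) c by algebra
    ultimately have 1: "z \<ominus> c \<in> I 1" by (simp only:)
    \<comment> \<open>The error of the new iterate is a difference of \<open>q\<close>-th powers of
      two elements that agree modulo \<open>\<pi>^(n+1)\<close>, so it gains a power.\<close>
    have "(z [^] q \<ominus> \<pi> \<otimes> y) \<ominus> z = z [^] q \<ominus> x [^] q"
      unfolding z_def[symmetric]
    proof -
      have "(z [^] q \<ominus> \<pi> \<otimes> y) \<ominus> (x [^] q \<ominus> \<pi> \<otimes> y) = z [^] q \<ominus> x [^] q" using cl by algebra
      then show "(z [^] q \<ominus> \<pi> \<otimes> y) \<ominus> z = z [^] q \<ominus> x [^] q" unfolding z_def[symmetric] .
    qed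
    moreover have "z [^] q \<ominus> x [^] q \<in> I (Suc (Suc n))" by (rule pow_q_cong[OF z x(1) zx])
    ultimately have "(z [^] q \<ominus> \<pi> \<otimes> y) \<ominus> z \<in> I (Suc (Suc n))" by (simp only:)
    with z 1 show ?case by blast
  qed
  then obtain x where x: "x \<in> carrier R" "x \<ominus> c \<in> I 1" "(x [^] q \<ominus> \<pi> \<otimes> y) \<ominus> x \<in> I (Suc n)" by blast
  have cl: "x [^] q \<in> carrier R" "\<pi> \<otimes> y \<in> carrier R" using x(1) y pi_closed by auto
  have "(x [^] q \<ominus> \<pi> \<otimes> y) \<ominus> x = (x [^] q \<ominus> x) \<ominus> \<pi> \<otimes> y" using x(1) cl by algebra
  also have "x [^] q \<ominus> x = \<pi> \<otimes> \<phi> x" using phi[OF x(1)] by simp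
  also have "\<pi> \<otimes> \<phi> x \<ominus> \<pi> \<otimes> y = \<pi> \<otimes> (\<phi> x \<ominus> y)"
    using m_minus_distr[OF pi_closed _ y] phi[OF x(1)] by simp
  finally have e: "(x [^] q \<ominus> \<pi> \<otimes> y) \<ominus> x = \<pi> \<otimes> (\<phi> x \<ominus> y)" .
  have "\<phi> x \<ominus> y \<in> carrier R" using phi[OF x(1)] y by simp
  then have "\<phi> x \<ominus> y \<in> I n" using x(3) unfolding e by (rule I_cancel)
  then show ?thesis using x(1,2) by blast
qed

lemma Units_cancel:
  assumes "u \<in> Units R" "x \<in> carrier R" "ideal H R" "u \<otimes> x \<in> H"
  shows "x \<in> H"
proof -
  have "inv u \<otimes> (u \<otimes> x) \<in> H" by (rule ideal.I_l_closed[OF assms(3,4)]) (use assms(1) in simp)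
  then show ?thesis using assms(1,2) by (simp add: m_assoc[symmetric] Units_closed)
qed

text \<open>Keep the value \<open>y\<close> of \<open>\<phi> x\<close> fixed and let the residue of
  \<open>x\<close> vary: the outer Horner sum has values divisible by \<open>\<pi>\<close> at every
  \<open>r\<close>, and elimination at the \<open>q\<close> representatives makes each digit,
  evaluated at \<open>y\<close>, divisible. As \<open>y\<close> is arbitrary, the induction
  hypothesis applies to the digits.\<close>

lemma rval_coeffs_divisible:
  assumes "\<And>l. c l \<in> carrier R" "\<And>x. x \<in> carrier R \<Longrightarrow> rval L (orbit x) c \<in> I 1"
    and "length l = L" "set l \<subseteq> {..<q}"
  shows "c l \<in> I 1"
  using assms
proof (induction L arbitrary: c l)
  case 0
  then show ?case using one_closed by fastforce
next
  case (Suc L)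
  obtain i l' where l: "l = i # l'" "length l' = L" using Suc.prems(3) by (cases l) auto
  have i: "i < q" and l': "set l' \<subseteq> {..<q}" using Suc.prems(4) l by auto
  interpret I: ideal "I 1" R by (rule I_ideal)
  have "rval L (orbit y) (\<lambda>l. c (i # l)) \<in> I 1" if y: "y \<in> carrier R" for y
  proof -
    define cs where "cs = map (\<lambda>i. rval L (orbit y) (\<lambda>l. c (i # l))) [0..<q]"
    have rc: "rval L (orbit z) (\<lambda>l. c (j # l)) \<in> carrier R" if "z \<in> carrier R" for j z
      by (intro rval_closed orbit_closed that Suc.prems(1))
    have "horner R cs r \<in> I 1" if r: "r \<in> carrier R" for r
    proof -
      \<comment> \<open>Two prescriptions at once: \<open>x\<close> modulo \<open>\<pi>\<close>, and
        \<open>\<phi> x\<close> to the precision that \<open>rval_cong\<close> asks for at level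
        \<open>L\<close>.\<close>
      obtain x where x: "x \<in> carrier R" "x \<ominus> r \<in> I 1" "\<phi> x \<ominus> y \<in> I L" using phi_approx[OF r y] by blast
      have px: "\<phi> x \<in> carrier R" using phi[OF x(1)] by blast
      let ?h = "horner R (map (\<lambda>i. rval L (orbit (\<phi> x)) (\<lambda>l. c (i # l))) [0..<q]) x"
      have hr: "?h \<ominus> horner R cs r \<in> I 1"
        unfolding cs_def
        by (intro horner_cong_ideal[OF I_ideal x(1) r x(2)] conjI rc px y rval_cong x(3) Suc.prems(1))
      have h: "?h \<in> I 1" using Suc.prems(2)[OF x(1)] unfolding rval_orbit_Suc .
      have "?h \<ominus> (?h \<ominus> horner R cs r) \<in> I 1" by (rule I.minus_mem[OF h hr])
      moreover have "?h \<ominus> (?h \<ominus> horner R cs r) = horner R cs r"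
      proof -
        have "?h \<in> carrier R" using h I.a_Hcarr by blast
        moreover have "horner R cs r \<in> carrier R" using rc[OF y] r unfolding cs_def by (intro horner_closed) auto
        ultimately show ?thesis by (rule minus_minus_cancel)
      qed
      ultimately show ?thesis by simp
    qed
    then have "\<forall>r\<in>set xs. horner R cs r \<in> I 1" using xs(2) by blast
    moreover have "length cs = length xs" "set cs \<subseteq> carrier R" using xs(1) rc[OF y] unfolding cs_def by auto
    moreover have "t \<otimes> i \<in> I 1" if "t \<in> carrier R" "i \<in> I 1" for t i using I.I_l_closed[OF that(2,1)] .
    ultimately obtain t where t: "t \<in> Units R" "\<forall>g\<in>set cs. t \<otimes> g \<in> I 1"
      using vandermonde[of "I 1" "Units R" xs cs] xs(2,3) I.is_additive_subgroup Units_closed by blast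
    have "rval L (orbit y) (\<lambda>l. c (i # l)) \<in> set cs" unfolding cs_def using i by auto
    then show ?thesis using t Units_cancel[OF t(1) rc[OF y] I_ideal] by blast
  qed
  then show ?case unfolding l(1)
    using Suc.IH[of "\<lambda>l. c (i # l)" l'] Suc.prems(1) l(2) l' by blast
qed

end

section \<open>Homomorphisms out of the ring of integer-valued polynomials\<close>

lemma RDirProd_cring:
  assumes "cring A" "cring B"
  shows "cring (RDirProd A B)"
proof -
  interpret A: cring A by fact
  interpret B: cring B by fact
  interpret C: ring "RDirProd A B" by (rule RDirProd_ring[OF A.ring_axioms B.ring_axioms])
  show ?thesis
    by unfold_locales (auto simp: RDirProd_def DirProd_def monoid.defs A.m_comm B.m_comm)
qed

lemma RDirProd_simps:
  "x \<otimes>\<^bsub>RDirProd A B\<^esub> y = (fst x \<otimes>\<^bsub>A\<^esub> fst y, snd x \<otimes>\<^bsub>B\<^esub> snd y)"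
  "x \<oplus>\<^bsub>RDirProd A B\<^esub> y = (fst x \<oplus>\<^bsub>A\<^esub> fst y, snd x \<oplus>\<^bsub>B\<^esub> snd y)"
  "\<one>\<^bsub>RDirProd A B\<^esub> = (\<one>\<^bsub>A\<^esub>, \<one>\<^bsub>B\<^esub>)" "\<zero>\<^bsub>RDirProd A B\<^esub> = (\<zero>\<^bsub>A\<^esub>, \<zero>\<^bsub>B\<^esub>)"
  by (auto simp: RDirProd_def DirProd_def monoid.defs case_prod_unfold)

lemma (in cring) finsum_eq_horner:
  assumes "\<And>i. f i \<in> carrier R" "x \<in> carrier R"
  shows "(\<Oplus>i\<in>{..<n}. f i \<otimes> x [^] i) = horner R (map f [0..<n]) x"
proof (induction n)
  case (Suc n)
  have "(\<Oplus>i\<in>{..<Suc n}. f i \<otimes> x [^] i) = f n \<otimes> x [^] n \<oplus> (\<Oplus>i\<in>{..<n}. f i \<otimes> x [^] i)"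
    unfolding lessThan_Suc using assms by (subst finsum_insert) auto
  also have "\<dots> = horner R (map f [0..<n]) x \<oplus> x [^] length (map f [0..<n]) \<otimes> f n"
    unfolding Suc using assms by (simp add: a_comm m_comm horner_closed image_subset_iff)
  also have "\<dots> = horner R (map f [0..<n] @ [f n]) x"
    using assms by (intro horner_append_single[symmetric]) auto
  finally show ?case by simp
qed simp

section \<open>Degrees of Horner sums of polynomials\<close>

context UP_domain
begin

lemma add_distinct_deg:
  assumes p: "p \<in> carrier P" "q \<in> carrier P" and n: "deg R p < deg R q"
  shows "p \<oplus>\<^bsub>P\<^esub> q \<noteq> \<zero>\<^bsub>P\<^esub> \<and> deg R (p \<oplus>\<^bsub>P\<^esub> q) = deg R q"
proof -
  have q0: "q \<noteq> \<zero>\<^bsub>P\<^esub>" using n by auto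
  have "up_ring.coeff P (p \<oplus>\<^bsub>P\<^esub> q) (deg R q) = up_ring.coeff P q (deg R q)"
    using p deg_aboveD[OF n p(1)] by simp
  then have c: "up_ring.coeff P (p \<oplus>\<^bsub>P\<^esub> q) (deg R q) \<noteq> \<zero>" using lcoeff_nonzero[OF q0 p(2)] by simp
  have "deg R (p \<oplus>\<^bsub>P\<^esub> q) \<le> deg R q" using deg_add[OF p] n by simp
  moreover have "deg R q \<le> deg R (p \<oplus>\<^bsub>P\<^esub> q)" using c p by (intro deg_belowI) auto
  ultimately show ?thesis using c by auto
qed

lemma deg_pow:
  assumes "p \<in> carrier P" "p \<noteq> \<zero>\<^bsub>P\<^esub>"
  shows "p [^]\<^bsub>P\<^esub> (n::nat) \<noteq> \<zero>\<^bsub>P\<^esub> \<and> deg R (p [^]\<^bsub>P\<^esub> n) = n * deg R p"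
proof (induction n)
  case (Suc n)
  have "p [^]\<^bsub>P\<^esub> Suc n \<noteq> \<zero>\<^bsub>P\<^esub>"
    using UP_integral[of "p [^]\<^bsub>P\<^esub> n" p] assms Suc by auto
  moreover have "deg R (p [^]\<^bsub>P\<^esub> Suc n) = deg R (p [^]\<^bsub>P\<^esub> n) + deg R p"
    using deg_mult[of "p [^]\<^bsub>P\<^esub> n" p] Suc assms by simp
  ultimately show ?case using Suc by simp
qed simp

text \<open>If the coefficients have degrees divisible by \<open>q d\<close> where \<open>d = deg f\<close>, then the summands of
  \<open>\<Sum>\<^sub>i z\<^sub>i f\<^sup>i\<close> have pairwise distinct degrees.\<close>
lemma horner_deg:
  assumes f: "f \<in> carrier P" "f \<noteq> \<zero>\<^bsub>P\<^esub>" and d: "deg R f = d" "d > 0"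
    and "set zs \<subseteq> carrier P" "length zs \<le> q"
    and "\<forall>z\<in>set zs. z = \<zero>\<^bsub>P\<^esub> \<or> (\<exists>m. deg R z = m * (q * d))"
  shows "(\<forall>z\<in>set zs. z = \<zero>\<^bsub>P\<^esub>) \<or> (horner P zs f \<noteq> \<zero>\<^bsub>P\<^esub> \<and>
    (\<exists>i m. i < length zs \<and> deg R (horner P zs f) = i * d + m * (q * d)))"
  using assms(5-)
proof (induction zs)
  case (Cons z zs)
  have zc: "z \<in> carrier P" and hc: "horner P zs f \<in> carrier P"
    using Cons.prems f by (auto intro!: P.horner_closed)
  consider (0) "\<forall>z\<in>set zs. z = \<zero>\<^bsub>P\<^esub>"
    | (1) "horner P zs f \<noteq> \<zero>\<^bsub>P\<^esub>" "\<exists>i m. i < length zs \<and> deg R (horner P zs f) = i * d + m * (q * d)"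
    using Cons by auto
  then show ?case
  proof cases
    case 0
    have "horner P zs f = \<zero>\<^bsub>P\<^esub>" using 0 f(1) by (induction zs) auto
    then have h: "horner P (z # zs) f = z" using zc f by simp
    show ?thesis
    proof (cases "z = \<zero>\<^bsub>P\<^esub>")
      case True
      then show ?thesis using 0 by simp
    next
      case False
      then obtain m where "deg R z = m * (q * d)" using Cons.prems by auto
      then have "0 < length (z # zs) \<and> deg R (horner P (z # zs) f) = 0 * d + m * (q * d)" unfolding h by simp
      then show ?thesis using False unfolding h by blast
    qed
  next
    case 1
    then obtain i m where im: "i < length zs" "deg R (horner P zs f) = i * d + m * (q * d)" by blast
    let ?g = "f \<otimes>\<^bsub>P\<^esub> horner P zs f"
    have gc: "?g \<in> carrier P" using f hc by simp
    have g0: "?g \<noteq> \<zero>\<^bsub>P\<^esub>" using UP_integral[of f "horner P zs f"] f hc 1(1) by blast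
    have gd: "deg R ?g = (i + 1) * d + m * (q * d)"
      using deg_mult[OF f(2) 1(1) f(1) hc] d im by simp
    have iq: "i + 1 < q" "i + 1 < length (z # zs)" using im(1) Cons.prems(2) by auto
    show ?thesis
    proof (cases "z = \<zero>\<^bsub>P\<^esub>")
      case True
      then have "horner P (z # zs) f = ?g" using gc by simp
      then show ?thesis using g0 gd iq by metis
    next
      case False
      then obtain n where n: "deg R z = n * (q * d)" using Cons.prems by auto
      \<comment> \<open>Divided by \<open>d\<close> the two degrees are \<open>n q\<close> and
        \<open>(i + 1) + m q\<close> with \<open>0 < i + 1 < q\<close>, hence different modulo
        \<open>q\<close>.\<close>
      have "deg R z \<noteq> deg R ?g"
      proof
        assume "deg R z = deg R ?g"
        then have "d * (n * q) = d * ((i + 1) + m * q)" unfolding n gd by (simp add: algebra_simps)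
        then have "n * q = (i + 1) + m * q" using d(2) by (metis nat_mult_eq_cancel1)
        then have "(n * q) mod q = ((i + 1) + m * q) mod q" by simp
        then have "0 = (i + 1) mod q" by simp
        then show False using iq(1) by simp
      qed
      then consider "deg R z < deg R ?g" | "deg R ?g < deg R z" by linarith
      then show ?thesis
      proof cases
        case 1
        then have "horner P (z # zs) f \<noteq> \<zero>\<^bsub>P\<^esub> \<and> deg R (horner P (z # zs) f) = (i + 1) * d + m * (q * d)"
          using add_distinct_deg[OF zc gc] gd by simp
        then show ?thesis using iq by blast
      next
        case 2
        then have "horner P (z # zs) f \<noteq> \<zero>\<^bsub>P\<^esub> \<and> deg R (horner P (z # zs) f) = 0 * d + n * (q * d)"
          using add_distinct_deg[OF gc zc] n P.a_comm[OF zc gc] by simp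
        then show ?thesis by (metis length_greater_0_conv list.distinct(1))
      qed
    qed
  qed
qed simp

end

section \<open>Denominators of integer-valued polynomials and graphs of homomorphisms\<close>

locale int_poly_target = domain R + target: ring_hom_cring R B \<beta>
  for R (structure) and B and \<beta>
begin

abbreviation "P \<equiv> UP K"
abbreviation "ev \<equiv> UnivPoly.eval K K (\<lambda>x. x)"
abbreviation "X0 \<equiv> up_ring.monom P \<one>\<^bsub>K\<^esub> 1"
abbreviation "con r \<equiv> up_ring.monom P (\<iota> r) 0"
abbreviation "C \<equiv> RDirProd P B"
abbreviation "\<psi> r \<equiv> (con r, \<beta> r)"

interpretation K: field K by (rule quot_field_field)
interpretation iota: ring_hom_cring R K \<iota> by (rule iota_hom)
interpretation P: UP_domain K P by unfold_locales

text \<open>Not an interpretation: its rule \<open>x \<in> carrier K \<Longrightarrow> x \<in> carrier K\<close> would make the simplifier loop.\<close>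
lemma E_pre: "UP_pre_univ_prop K K (\<lambda>x. x)"
proof (intro UP_pre_univ_prop.intro UP_cring.intro K.is_cring)
  show "ring_hom_cring K K (\<lambda>x. x)"
    by (rule ring_hom_cringI[OF K.is_cring K.is_cring]) (rule ring_hom_memI; simp)
qed

lemma C_cring: "cring C"
  by (rule RDirProd_cring) (use P.P.is_cring target.S.is_cring in auto)

interpretation C: cring C by (rule C_cring)

lemma C_carrier: "x \<in> carrier C \<longleftrightarrow> fst x \<in> carrier P \<and> snd x \<in> carrier B"
  unfolding RDirProd_carrier by (cases x) auto

lemma con_hom: "ring_hom_cring R P con"
  using ring_hom_cringI[OF is_cring P.P.is_cring ring_hom_trans[OF iota.homh P.const_ring_hom]]
  unfolding comp_def .

interpretation con: ring_hom_cring R P con by (rule con_hom)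

lemma psi_hom: "ring_hom_cring R C \<psi>"
proof (rule ring_hom_cringI[OF is_cring C_cring], rule ring_hom_memI)
  fix r assume r: "r \<in> carrier R"
  then show "\<psi> r \<in> carrier C" by (simp add: RDirProd_carrier)
  fix s assume s: "s \<in> carrier R"
  show "\<psi> (r \<otimes> s) = \<psi> r \<otimes>\<^bsub>C\<^esub> \<psi> s"
    unfolding RDirProd_simps fst_conv snd_conv con.hom_mult[OF r s] target.hom_mult[OF r s] ..
  show "\<psi> (r \<oplus> s) = \<psi> r \<oplus>\<^bsub>C\<^esub> \<psi> s"
    unfolding RDirProd_simps fst_conv snd_conv con.hom_add[OF r s] target.hom_add[OF r s] ..
next
  show "\<psi> \<one> = \<one>\<^bsub>C\<^esub>" unfolding RDirProd_simps con.hom_one target.hom_one ..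
qed

lemma fst_hom: "ring_hom_cring C P fst"
  by (rule ring_hom_cringI[OF C_cring P.P.is_cring], rule ring_hom_memI)
    (simp_all only: C_carrier RDirProd_simps fst_conv)

lemma snd_hom: "ring_hom_cring C B snd"
  by (rule ring_hom_cringI[OF C_cring target.S.is_cring], rule ring_hom_memI)
    (simp_all only: C_carrier RDirProd_simps snd_conv)

interpretation psi: ring_hom_cring R C \<psi> by (rule psi_hom)

lemma iota_image_subgroup: "additive_subgroup (\<iota> ` carrier R) K"
proof -
  have "subgroup (\<iota> ` carrier R) (add_monoid K)"
    using iota.ring.img_is_add_subgroup[OF add.subgroup_self] by simp
  then show ?thesis by (rule additive_subgroup.intro)
qed

lemma ev_hom: "x \<in> carrier K \<Longrightarrow> ring_hom_cring P K (ev x)"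
  by (rule ring_hom_cringI[OF P.P.is_cring K.is_cring UP_pre_univ_prop.eval_ring_hom[OF E_pre]])

lemma int_poly_carrier:
  "f \<in> carrier (int_poly R) \<longleftrightarrow> f \<in> carrier P \<and> (\<forall>d\<in>carrier R. ev (\<iota> d) f \<in> \<iota> ` carrier R)"
  unfolding int_poly_def by simp

lemma int_poly_ops:
  "x \<otimes>\<^bsub>int_poly R\<^esub> y = x \<otimes>\<^bsub>P\<^esub> y" "x \<oplus>\<^bsub>int_poly R\<^esub> y = x \<oplus>\<^bsub>P\<^esub> y" "\<one>\<^bsub>int_poly R\<^esub> = \<one>\<^bsub>P\<^esub>"
  unfolding int_poly_def by simp_all

lemma ev_X0: "x \<in> carrier K \<Longrightarrow> ev x X0 = x"
  by (rule UP_pre_univ_prop.eval_monom1[OF E_pre])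

lemma ev_con: "x \<in> carrier K \<Longrightarrow> r \<in> carrier R \<Longrightarrow> ev x (con r) = \<iota> r"
  by (rule UP_pre_univ_prop.eval_const[OF E_pre]) auto

lemma con_int_poly: "r \<in> carrier R \<Longrightarrow> con r \<in> carrier (int_poly R)"
  unfolding int_poly_carrier using ev_con[OF iota.hom_closed] P.monom_closed[OF iota.hom_closed] imageI
  by metis

lemma X0_int_poly: "X0 \<in> carrier (int_poly R)"
  unfolding int_poly_carrier using ev_X0[OF iota.hom_closed] P.monom_closed[OF K.one_closed] imageI
  by metis

lemma int_poly_closed:
  assumes "f \<in> carrier (int_poly R)" "g \<in> carrier (int_poly R)"
  shows "f \<otimes>\<^bsub>P\<^esub> g \<in> carrier (int_poly R)" "f \<oplus>\<^bsub>P\<^esub> g \<in> carrier (int_poly R)"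
proof -
  have fg: "f \<in> carrier P" "g \<in> carrier P" using assms unfolding int_poly_carrier by auto
  have "ev (\<iota> d) (f \<otimes>\<^bsub>P\<^esub> g) \<in> \<iota> ` carrier R \<and> ev (\<iota> d) (f \<oplus>\<^bsub>P\<^esub> g) \<in> \<iota> ` carrier R" if d: "d \<in> carrier R" for d
  proof -
    interpret e: ring_hom_cring P K "ev (\<iota> d)" by (rule ev_hom) (use d in simp)
    obtain a b where ab: "a \<in> carrier R" "ev (\<iota> d) f = \<iota> a" "b \<in> carrier R" "ev (\<iota> d) g = \<iota> b"
      using assms d unfolding int_poly_carrier by blast
    have "ev (\<iota> d) (f \<otimes>\<^bsub>P\<^esub> g) = \<iota> (a \<otimes> b)"
      unfolding e.hom_mult[OF fg] ab(2,4) iota.hom_mult[OF ab(1,3)] ..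
    moreover have "ev (\<iota> d) (f \<oplus>\<^bsub>P\<^esub> g) = \<iota> (a \<oplus> b)"
      unfolding e.hom_add[OF fg] ab(2,4) iota.hom_add[OF ab(1,3)] ..
    ultimately show ?thesis using m_closed[OF ab(1,3)] a_closed[OF ab(1,3)] by simp
  qed
  then show "f \<otimes>\<^bsub>P\<^esub> g \<in> carrier (int_poly R)" "f \<oplus>\<^bsub>P\<^esub> g \<in> carrier (int_poly R)"
    unfolding int_poly_carrier using fg by auto
qed

lemma ev_eq_horner:
  assumes "f \<in> carrier P" "x \<in> carrier K"
  shows "ev x f = horner K (map (up_ring.coeff P f) [0..<Suc (deg K f)]) x"
proof -
  have "ev x f = (\<Oplus>\<^bsub>K\<^esub>i\<in>{..<Suc (deg K f)}. up_ring.coeff P f i \<otimes>\<^bsub>K\<^esub> x [^]\<^bsub>K\<^esub> i)"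
    unfolding P.eval_on_carrier[OF assms(1)] lessThan_Suc_atMost ..
  also have "\<dots> = horner K (map (up_ring.coeff P f) [0..<Suc (deg K f)]) x"
    by (rule K.finsum_eq_horner) (use assms in auto)
  finally show ?thesis .
qed

text \<open>Vandermonde elimination in the quotient field, with the ring as additive subgroup: since
  the values at \<open>deg f + 1\<close> nodes lie in the ring, an element of \<open>T\<close>
  clears all coefficients.\<close>

lemma int_poly_denominator:
  assumes f: "f \<in> carrier (int_poly R)" and T: "T \<subseteq> carrier R" "\<one> \<in> T" "\<And>s t. s \<in> T \<Longrightarrow> t \<in> T \<Longrightarrow> s \<otimes> t \<in> T"
    and xs: "set xs \<subseteq> carrier R" "sorted_wrt (\<lambda>x y. y \<ominus> x \<in> T) xs" "length xs = Suc (deg K f)"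
  shows "\<exists>t\<in>T. \<forall>i. \<iota> t \<otimes>\<^bsub>K\<^esub> up_ring.coeff P f i \<in> \<iota> ` carrier R"
proof -
  have fP: "f \<in> carrier P" using f unfolding int_poly_carrier by blast
  note sg = iota_image_subgroup
  let ?cs = "map (up_ring.coeff P f) [0..<Suc (deg K f)]"
  have mc: "\<iota> a \<otimes>\<^bsub>K\<^esub> y \<in> \<iota> ` carrier R" if "a \<in> carrier R" "y \<in> \<iota> ` carrier R" for a y
  proof -
    from that(2) obtain b where b: "b \<in> carrier R" "y = \<iota> b" by blast
    show ?thesis unfolding b(2) iota.hom_mult[OF that(1) b(1), symmetric] using that(1) b(1) by (intro imageI) simp
  qed
  have "\<exists>t\<in>\<iota> ` T. \<forall>c\<in>set ?cs. t \<otimes>\<^bsub>K\<^esub> c \<in> \<iota> ` carrier R"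
  proof (rule K.vandermonde[OF sg, where xs = "map \<iota> xs"])
    show "\<iota> ` T \<subseteq> carrier K" using T(1) iota.hom_closed by blast
    show "\<one>\<^bsub>K\<^esub> \<in> \<iota> ` T" using T(2) iota.hom_one by force
    show "s \<otimes>\<^bsub>K\<^esub> t \<in> \<iota> ` T" if st: "s \<in> \<iota> ` T" "t \<in> \<iota> ` T" for s t
    proof -
      obtain u v where uv: "u \<in> T" "v \<in> T" "s = \<iota> u" "t = \<iota> v" using st by blast
      have "s \<otimes>\<^bsub>K\<^esub> t = \<iota> (u \<otimes> v)" using uv T(1) by (auto simp: subset_eq)
      then show ?thesis using T(3) uv by blast
    qed
    show "t \<otimes>\<^bsub>K\<^esub> i \<in> \<iota> ` carrier R" if "t \<in> \<iota> ` T" "i \<in> \<iota> ` carrier R" for t i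
      using that mc T(1) by blast
    show "x \<otimes>\<^bsub>K\<^esub> i \<in> \<iota> ` carrier R" if "x \<in> set (map \<iota> xs)" "i \<in> \<iota> ` carrier R" for x i
      using that mc xs(1) by auto
    show "set (map \<iota> xs) \<subseteq> carrier K" using xs(1) iota.hom_closed by auto
    show "sorted_wrt (\<lambda>x y. y \<ominus>\<^bsub>K\<^esub> x \<in> \<iota> ` T) (map \<iota> xs)"
      unfolding sorted_wrt_map
    proof (rule sorted_wrt_mono_rel[OF _ xs(2)])
      fix x y assume "x \<in> set xs" "y \<in> set xs" "y \<ominus> x \<in> T"
      moreover have "\<iota> y \<ominus>\<^bsub>K\<^esub> \<iota> x = \<iota> (y \<ominus> x)" using calculation xs(1) by (auto simp: minus_eq K.minus_eq subset_eq)
      ultimately show "\<iota> y \<ominus>\<^bsub>K\<^esub> \<iota> x \<in> \<iota> ` T" by (metis imageI)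
    qed
    show "set ?cs \<subseteq> carrier K" using fP by auto
    show "length ?cs = length (map \<iota> xs)" using xs(3) by simp
    show "\<forall>x\<in>set (map \<iota> xs). horner K ?cs x \<in> \<iota> ` carrier R"
    proof
      fix x assume "x \<in> set (map \<iota> xs)"
      then obtain d where d: "d \<in> carrier R" "x = \<iota> d" using xs(1) by auto
      have "horner K ?cs x = ev x f" by (rule ev_eq_horner[OF fP, symmetric]) (use d in simp)
      then show "horner K ?cs x \<in> \<iota> ` carrier R"
        using f d unfolding int_poly_carrier by (simp only:)
    qed
  qed
  then obtain t where t: "t \<in> T" "\<And>c. c \<in> set ?cs \<Longrightarrow> \<iota> t \<otimes>\<^bsub>K\<^esub> c \<in> \<iota> ` carrier R" by blast
  have "\<iota> t \<otimes>\<^bsub>K\<^esub> up_ring.coeff P f i \<in> \<iota> ` carrier R" for i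
  proof (cases "i \<le> deg K f")
    case True
    then show ?thesis by (intro t(2)) (auto simp del: upt_Suc)
  next
    case False
    then have "up_ring.coeff P f i = \<zero>\<^bsub>K\<^esub>" using P.deg_aboveD[of f i] fP by simp
    then have "\<iota> t \<otimes>\<^bsub>K\<^esub> up_ring.coeff P f i = \<iota> \<zero>" using t(1) T(1) by auto
    then show ?thesis by (metis imageI zero_closed)
  qed
  then show ?thesis using t(1) by blast
qed

text \<open>The graph of the homomorphism to be constructed is a subring of \<open>K[X] \<times> B\<close>.\<close>
lemma hom_from_graph:
  assumes W: "W \<subseteq> carrier C"
    and add: "\<And>x y. x \<in> W \<Longrightarrow> y \<in> W \<Longrightarrow> x \<oplus>\<^bsub>C\<^esub> y \<in> W"
    and mult: "\<And>x y. x \<in> W \<Longrightarrow> y \<in> W \<Longrightarrow> x \<otimes>\<^bsub>C\<^esub> y \<in> W"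
    and base: "\<And>r. r \<in> carrier R \<Longrightarrow> \<psi> r \<in> W"
    and X0: "(X0, a) \<in> W"
    and single: "\<And>x. x \<in> W \<Longrightarrow> fst x = \<zero>\<^bsub>P\<^esub> \<Longrightarrow> x = \<zero>\<^bsub>C\<^esub>"
    and total: "\<And>f. f \<in> carrier (int_poly R) \<Longrightarrow> \<exists>b. (f, b) \<in> W"
  shows "\<exists>h \<in> alg_hom R (int_poly R) (int_poly_const R) B \<beta>. h (int_poly_X R) = a"
proof -
  have uniq: "b = b'" if fb: "(f, b) \<in> W" "(f, b') \<in> W" for f b b'
  proof -
    have c: "f \<in> carrier P" "b \<in> carrier B" "b' \<in> carrier B" using subsetD[OF W fb(1)] subsetD[OF W fb(2)] unfolding C_carrier by simp_all
    \<comment> \<open>The difference of the two pairs, written with the scalar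
      \<open>\<psi> (- 1)\<close>, because \<open>W\<close> is only known to contain scalars, sums
      and products.\<close>
    let ?z = "(f, b) \<oplus>\<^bsub>C\<^esub> \<psi> (\<ominus> \<one>) \<otimes>\<^bsub>C\<^esub> (f, b')"
    have zW: "?z \<in> W" by (intro add mult fb base a_inv_closed one_closed)
    have "con (\<ominus> \<one>) = \<ominus>\<^bsub>P\<^esub> \<one>\<^bsub>P\<^esub>" using con.hom_a_inv[OF one_closed] con.hom_one by simp
    then have z: "?z = (f \<oplus>\<^bsub>P\<^esub> \<ominus>\<^bsub>P\<^esub> f, b \<oplus>\<^bsub>B\<^esub> \<ominus>\<^bsub>B\<^esub> b')"
      using c by (simp add: RDirProd_simps P.P.l_minus target.S.l_minus del: con.hom_a_inv)
    then have "fst ?z = \<zero>\<^bsub>P\<^esub>" using c by (simp add: P.P.r_neg)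
    then have "?z = \<zero>\<^bsub>C\<^esub>" by (rule single[OF zW])
    then have "b \<ominus>\<^bsub>B\<^esub> b' = \<zero>\<^bsub>B\<^esub>" unfolding z by (simp add: RDirProd_simps target.S.minus_eq)
    then show "b = b'" using c by simp
  qed
  define h where "h f = (THE b. (f, b) \<in> W)" for f
  have hW: "h f = b" if "(f, b) \<in> W" for f b
    unfolding h_def using that uniq[OF _ that] by (intro the_equality[where P = "\<lambda>b. (f, b) \<in> W" and a = b])
  have hI: "(f, h f) \<in> W" if "f \<in> carrier (int_poly R)" for f
    using total[OF that] hW by blast
  have "h \<in> ring_hom (int_poly R) B"
  proof (rule ring_hom_memI)
    fix f assume "f \<in> carrier (int_poly R)"
    from subsetD[OF W hI[OF this]] show "h f \<in> carrier B" unfolding C_carrier by simp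
  next
    fix f g assume fg: "f \<in> carrier (int_poly R)" "g \<in> carrier (int_poly R)"
    show "h (f \<otimes>\<^bsub>int_poly R\<^esub> g) = h f \<otimes>\<^bsub>B\<^esub> h g" "h (f \<oplus>\<^bsub>int_poly R\<^esub> g) = h f \<oplus>\<^bsub>B\<^esub> h g"
      using mult[OF hI[OF fg(1)] hI[OF fg(2)]] add[OF hI[OF fg(1)] hI[OF fg(2)]]
      unfolding int_poly_ops RDirProd_simps fst_conv snd_conv by (auto dest!: hW)
  next
    have "(\<one>\<^bsub>P\<^esub>, \<one>\<^bsub>B\<^esub>) \<in> W" using base[OF one_closed] con.hom_one target.hom_one by metis
    then show "h \<one>\<^bsub>int_poly R\<^esub> = \<one>\<^bsub>B\<^esub>" unfolding int_poly_ops by (rule hW)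
  qed
  moreover have "h (int_poly_const R r) = \<beta> r" if "r \<in> carrier R" for r
    unfolding int_poly_const_def by (rule hW[OF base[OF that]])
  moreover have "h (int_poly_X R) = a"
    unfolding int_poly_X_def by (rule hW[OF X0])
  ultimately show ?thesis unfolding alg_hom_def by blast
qed

abbreviation "Ev a \<equiv> UnivPoly.eval R C \<psi> (X0, a)"

lemma Ev_pre: "UP_pre_univ_prop R C \<psi>"
  by (intro UP_pre_univ_prop.intro psi_hom UP_cring.intro is_cring)

lemma X0_closed: "a \<in> carrier B \<Longrightarrow> (X0, a) \<in> carrier C"
  by (simp add: RDirProd_carrier)

lemma Ev_hom: "a \<in> carrier B \<Longrightarrow> ring_hom_cring (UP R) C (Ev a)"
  by (rule ring_hom_cringI[OF UP_cring.UP_cring C_cring UP_pre_univ_prop.eval_ring_hom[OF Ev_pre X0_closed]])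
    (auto intro: UP_cring.intro is_cring)

text \<open>Evaluation at the pair \<open>(X, a)\<close> leaves the polynomial unchanged in the
  first component, up to the embedding of coefficients. The pairs \<open>Ev a g\<close> therefore
  form the graph of evaluation at \<open>a\<close>.\<close>

lemma coeff_Ev:
  assumes a: "a \<in> carrier B" and g: "g \<in> carrier (UP R)"
  shows "up_ring.coeff P (fst (Ev a g)) k = \<iota> (up_ring.coeff (UP R) g k)"
proof -
  interpret U: UP_cring R "UP R" by (intro UP_cring.intro is_cring)
  have gc: "\<And>i. up_ring.coeff (UP R) g i \<in> carrier R" using g by simp
  interpret fst: ring_hom_cring C P fst by (rule fst_hom)
  note Xc = X0_closed[OF a]
  have t: "fst (\<psi> (up_ring.coeff (UP R) g i) \<otimes>\<^bsub>C\<^esub> (X0, a) [^]\<^bsub>C\<^esub> i) = up_ring.monom P (\<iota> (up_ring.coeff (UP R) g i)) i" for i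
  proof -
    have "fst (\<psi> (up_ring.coeff (UP R) g i) \<otimes>\<^bsub>C\<^esub> (X0, a) [^]\<^bsub>C\<^esub> i)
        = con (up_ring.coeff (UP R) g i) \<otimes>\<^bsub>P\<^esub> X0 [^]\<^bsub>P\<^esub> i"
      unfolding fst.hom_mult[OF psi.hom_closed[OF gc] C.nat_pow_closed[OF Xc]] fst.hom_pow[OF Xc] fst_conv ..
    also have "X0 [^]\<^bsub>P\<^esub> i = up_ring.monom P \<one>\<^bsub>K\<^esub> i"
      using P.monom_pow[OF K.one_closed, of 1 i] unfolding K.nat_pow_one mult_1 .
    also have "con (up_ring.coeff (UP R) g i) \<otimes>\<^bsub>P\<^esub> up_ring.monom P \<one>\<^bsub>K\<^esub> i = up_ring.monom P (\<iota> (up_ring.coeff (UP R) g i)) i"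
      using P.monom_mult[OF iota.hom_closed[OF gc] K.one_closed, of i 0 i]
      unfolding K.r_one[OF iota.hom_closed[OF gc]] add_0 by (rule HOL.sym)
    finally show ?thesis .
  qed
  have tc: "\<psi> (up_ring.coeff (UP R) g i) \<otimes>\<^bsub>C\<^esub> (X0, a) [^]\<^bsub>C\<^esub> i \<in> carrier C" for i
    by (rule C.m_closed[OF psi.hom_closed[OF gc] C.nat_pow_closed[OF Xc]])
  have "fst (Ev a g) = (\<Oplus>\<^bsub>P\<^esub>i\<in>{..deg R g}. up_ring.monom P (\<iota> (up_ring.coeff (UP R) g i)) i)"
    unfolding U.eval_on_carrier[OF g]
    using fst.ring.hom_finsum[of "\<lambda>i. \<psi> (up_ring.coeff (UP R) g i) \<otimes>\<^bsub>C\<^esub> (X0, a) [^]\<^bsub>C\<^esub> i" "{..deg R g}"] tc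
    unfolding comp_def t by blast
  then have "up_ring.coeff P (fst (Ev a g)) k = (\<Oplus>\<^bsub>K\<^esub>i\<in>{..deg R g}. up_ring.coeff P (up_ring.monom P (\<iota> (up_ring.coeff (UP R) g i)) i) k)"
    using P.coeff_finsum[of _ "\<lambda>i. up_ring.monom P (\<iota> (up_ring.coeff (UP R) g i)) i" k] gc by simp
  also have "\<dots> = (\<Oplus>\<^bsub>K\<^esub>i\<in>{..deg R g}. if k = i then \<iota> (up_ring.coeff (UP R) g i) else \<zero>\<^bsub>K\<^esub>)"
    by (intro K.finsum_cong' HOL.refl) (use gc in auto)
  also have "\<dots> = \<iota> (up_ring.coeff (UP R) g k)"
  proof (cases "k \<le> deg R g")
    case True
    then show ?thesis using K.finsum_singleton[of k "{..deg R g}" "\<lambda>i. \<iota> (up_ring.coeff (UP R) g i)"] gc by simp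
  next
    case False
    then have "up_ring.coeff (UP R) g k = \<zero>" using U.deg_aboveD[of g k] g by simp
    moreover have "(\<Oplus>\<^bsub>K\<^esub>i\<in>{..deg R g}. if k = i then \<iota> (up_ring.coeff (UP R) g i) else \<zero>\<^bsub>K\<^esub>) = (\<Oplus>\<^bsub>K\<^esub>i\<in>{..deg R g}. \<zero>\<^bsub>K\<^esub>)"
      using False gc by (intro K.finsum_cong') auto
    ultimately show ?thesis by simp
  qed
  finally show ?thesis .
qed

lemma poly_lift:
  assumes a: "a \<in> carrier B" and f: "f \<in> carrier P" and c: "\<And>i. up_ring.coeff P f i \<in> \<iota> ` carrier R"
  shows "\<exists>g\<in>carrier (UP R). fst (Ev a g) = f"
proof -
  interpret U: UP_cring R "UP R" by (intro UP_cring.intro is_cring)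
  define g where "g i = inv_into (carrier R) \<iota> (up_ring.coeff P f i)" for i
  have gc: "g i \<in> carrier R" and gi: "\<iota> (g i) = up_ring.coeff P f i" for i
    unfolding g_def using inv_into_into[OF c] f_inv_into_f[OF c] by auto
  have "g i = \<zero>" if "deg K f < i" for i
  proof -
    have "\<iota> (g i) = \<iota> \<zero>" unfolding gi P.deg_aboveD[OF that f] iota.hom_zero ..
    then show ?thesis using inj_onD[OF iota_inj] gc by blast
  qed
  then have "g \<in> up R" using gc by (intro mem_upI) (auto intro!: exI[of _ "deg K f"] simp: bound_def)
  then have g: "g \<in> carrier (UP R)" "up_ring.coeff (UP R) g = g" unfolding UP_def by auto
  interpret V: ring_hom_cring "UP R" C "Ev a" by (rule Ev_hom[OF a])
  have "fst (Ev a g) = f"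
  proof (rule P.up_eqI)
    show "fst (Ev a g) \<in> carrier P" using V.hom_closed[OF g(1)] by (simp add: C_carrier)
    show "up_ring.coeff P (fst (Ev a g)) n = up_ring.coeff P f n" for n unfolding coeff_Ev[OF a g(1)] g(2) gi ..
  qed (rule f)
  then show ?thesis using g(1) by blast
qed

text \<open>The graph is the image of \<open>Ev a\<close>. By hypothesis every integer-valued
  polynomial has a preimage there, and a vanishing first component forces
  \<open>g = 0\<close>.\<close>

lemma hom_if_int_poly_coeffs:
  assumes a: "a \<in> carrier B"
    and c: "\<And>f i. f \<in> carrier (int_poly R) \<Longrightarrow> up_ring.coeff P f i \<in> \<iota> ` carrier R"
  shows "\<exists>h \<in> alg_hom R (int_poly R) (int_poly_const R) B \<beta>. h (int_poly_X R) = a"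
proof -
  interpret U: UP_cring R "UP R" by (intro UP_cring.intro is_cring)
  interpret V: ring_hom_cring "UP R" C "Ev a" by (rule Ev_hom[OF a])
  show ?thesis
  proof (rule hom_from_graph[of "Ev a ` carrier (UP R)"])
    show "Ev a ` carrier (UP R) \<subseteq> carrier C" using V.hom_closed by blast
    fix x y assume "x \<in> Ev a ` carrier (UP R)" "y \<in> Ev a ` carrier (UP R)"
    then obtain g g' where g: "g \<in> carrier (UP R)" "x = Ev a g" "g' \<in> carrier (UP R)" "y = Ev a g'" by blast
    show "x \<oplus>\<^bsub>C\<^esub> y \<in> Ev a ` carrier (UP R)"
      unfolding g V.hom_add[OF g(1,3), symmetric] using g by (intro imageI) simp
    show "x \<otimes>\<^bsub>C\<^esub> y \<in> Ev a ` carrier (UP R)"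
      unfolding g V.hom_mult[OF g(1,3), symmetric] using g by (intro imageI) simp
  next
    fix r assume r: "r \<in> carrier R"
    have *: "Ev a (up_ring.monom (UP R) r 0) = \<psi> r" by (rule UP_pre_univ_prop.eval_const[OF Ev_pre X0_closed[OF a] r])
    from imageI[OF U.monom_closed[OF r, of 0], of "Ev a"] show "\<psi> r \<in> Ev a ` carrier (UP R)" unfolding * .
  next
    have *: "Ev a (up_ring.monom (UP R) \<one> 1) = (X0, a)" by (rule UP_pre_univ_prop.eval_monom1[OF Ev_pre X0_closed[OF a]])
    from imageI[OF U.monom_closed[OF one_closed, of 1], of "Ev a"] show "(X0, a) \<in> Ev a ` carrier (UP R)" unfolding * .
  next
    fix x assume "x \<in> Ev a ` carrier (UP R)" and x0: "fst x = \<zero>\<^bsub>P\<^esub>"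
    then obtain g where g: "g \<in> carrier (UP R)" "x = Ev a g" by blast
    have "up_ring.coeff (UP R) g k = \<zero>" for k
    proof -
      have "\<iota> (up_ring.coeff (UP R) g k) = \<iota> \<zero>" using coeff_Ev[OF a g(1), of k] x0 unfolding g(2) by simp
      then show ?thesis using inj_onD[OF iota_inj] g(1) by (simp add: U.coeff_closed)
    qed
    then have "g = \<zero>\<^bsub>UP R\<^esub>" using g(1) by (intro U.up_eqI) auto
    then show "x = \<zero>\<^bsub>C\<^esub>" unfolding g(2) using V.hom_zero by (simp only:)
  next
    fix f assume f: "f \<in> carrier (int_poly R)"
    then have "f \<in> carrier P" unfolding int_poly_carrier by blast
    then obtain g where g: "g \<in> carrier (UP R)" "fst (Ev a g) = f" using poly_lift[OF a _ c[OF f]] by blast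
    have "(f, snd (Ev a g)) = Ev a g" using prod.collapse[of "Ev a g"] unfolding g(2) .
    then have "(f, snd (Ev a g)) \<in> Ev a ` carrier (UP R)" using imageI[OF g(1), of "Ev a"] by (simp only:)
    then show "\<exists>b. (f, b) \<in> Ev a ` carrier (UP R)" ..
  qed
qed

text \<open>The nodes are the powers of \<open>x\<close>: the difference
  \<open>x^j - x^i = (x^(j-i) - 1) x^i\<close> is a unit times a power of \<open>x\<close>, and such
  products form a multiplicative set.\<close>

lemma int_poly_power_denominator:
  assumes f: "f \<in> carrier (int_poly R)" and x: "x \<in> carrier R"
    and unit: "\<And>k::nat. k \<ge> 1 \<Longrightarrow> x [^] k \<ominus> \<one> \<in> Units R"
  shows "\<exists>u\<in>Units R. \<exists>N::nat. \<forall>i. \<iota> (u \<otimes> x [^] N) \<otimes>\<^bsub>K\<^esub> up_ring.coeff P f i \<in> \<iota> ` carrier R"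
proof -
  let ?T = "{u \<otimes> x [^] (N::nat) | u N. u \<in> Units R}"
  have "\<exists>t\<in>?T. \<forall>i. \<iota> t \<otimes>\<^bsub>K\<^esub> up_ring.coeff P f i \<in> \<iota> ` carrier R"
  proof (rule int_poly_denominator[OF f, where xs = "map (\<lambda>i. x [^] i) [0..<Suc (deg K f)]"])
    show "?T \<subseteq> carrier R" using x by auto
    have "\<one> = \<one> \<otimes> x [^] (0::nat)" by simp
    then show "\<one> \<in> ?T" by blast
    fix s t assume "s \<in> ?T" "t \<in> ?T"
    then obtain u v N M where *: "u \<in> Units R" "v \<in> Units R" "s = u \<otimes> x [^] (N::nat)" "t = v \<otimes> x [^] (M::nat)" by blast
    have "s \<otimes> t = (u \<otimes> v) \<otimes> x [^] (N + M)"
      unfolding *(3,4) nat_pow_mult[OF x, symmetric] using *(1,2)[THEN Units_closed] x by (simp add: m_ac)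
    moreover have "u \<otimes> v \<in> Units R" using *(1,2) by (rule Units_m_closed)
    ultimately show "s \<otimes> t \<in> ?T" by blast
  next
    show "set (map (\<lambda>i. x [^] i) [0..<Suc (deg K f)]) \<subseteq> carrier R" using x by auto
    show "sorted_wrt (\<lambda>a b. b \<ominus> a \<in> ?T) (map (\<lambda>i. x [^] i) [0..<Suc (deg K f)])"
      unfolding sorted_wrt_map
    proof (rule sorted_wrt_mono_rel[OF _ sorted_wrt_upt])
      fix i j :: nat assume ij: "i < j"
      have "x [^] j = x [^] (j - i) \<otimes> x [^] i" using ij x by (simp add: nat_pow_mult)
      then have "x [^] j \<ominus> x [^] i = (x [^] (j - i) \<ominus> \<one>) \<otimes> x [^] i"
        using x m_minus_distr[of "x [^] i" "x [^] (j - i)" \<one>] by (simp add: m_comm)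
      moreover have "x [^] (j - i) \<ominus> \<one> \<in> Units R" using ij by (intro unit) simp
      ultimately show "x [^] j \<ominus> x [^] i \<in> ?T" by blast
    qed
  qed simp
  then show ?thesis by blast
qed

text \<open>The witness is \<open>(X^q - X) / \<pi>\<close>, with \<open>1 / \<pi>\<close> as the
  constant polynomial \<open>\<kappa>\<close>; its value at \<open>x\<close> is the cofactor of
  \<open>\<pi>\<close> in \<open>x^q - x\<close>.\<close>

lemma int_poly_frobenius_quotient:
  assumes pi: "\<pi> \<in> carrier R" "\<pi> \<noteq> \<zero>" and fr: "\<And>x. x \<in> carrier R \<Longrightarrow> x [^] q \<ominus> x \<in> PIdl \<pi>"
  shows "\<exists>g\<in>carrier (int_poly R). X0 [^]\<^bsub>P\<^esub> (q::nat) = X0 \<oplus>\<^bsub>P\<^esub> con \<pi> \<otimes>\<^bsub>P\<^esub> g"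
proof -
  have "\<iota> \<pi> \<noteq> \<zero>\<^bsub>K\<^esub>" using inj_onD[OF iota_inj, of \<pi> \<zero>] pi iota.hom_zero by auto
  then have u: "\<iota> \<pi> \<in> Units K" using K.field_Units pi by simp
  define \<kappa> where "\<kappa> = up_ring.monom P (inv\<^bsub>K\<^esub> (\<iota> \<pi>)) 0"
  have kc: "\<kappa> \<in> carrier P" unfolding \<kappa>_def using u by simp
  have cp: "con \<pi> \<in> carrier P" by (rule con.hom_closed[OF pi(1)])
  have X: "X0 \<in> carrier P" "X0 [^]\<^bsub>P\<^esub> q \<in> carrier P" by simp_all
  have "con \<pi> \<otimes>\<^bsub>P\<^esub> \<kappa> = up_ring.monom P (\<iota> \<pi> \<otimes>\<^bsub>K\<^esub> inv\<^bsub>K\<^esub> (\<iota> \<pi>)) (0 + 0)"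
    unfolding \<kappa>_def using u pi by (intro P.monom_mult[symmetric]) auto
  then have ck: "con \<pi> \<otimes>\<^bsub>P\<^esub> \<kappa> = \<one>\<^bsub>P\<^esub>" using u by simp
  define f where "f = X0 [^]\<^bsub>P\<^esub> q \<ominus>\<^bsub>P\<^esub> X0"
  have fc: "f \<in> carrier P" unfolding f_def using X by simp
  have "\<kappa> \<otimes>\<^bsub>P\<^esub> f \<in> carrier (int_poly R)"
    unfolding int_poly_carrier
  proof (intro conjI ballI)
    show "\<kappa> \<otimes>\<^bsub>P\<^esub> f \<in> carrier P" using kc fc by simp
    fix x assume x: "x \<in> carrier R"
    interpret e: ring_hom_cring P K "ev (\<iota> x)" by (rule ev_hom) (use x in simp)
    obtain y where y: "y \<in> carrier R" "x [^] q \<ominus> x = y \<otimes> \<pi>" using fr[OF x] unfolding mem_PIdl_iff by blast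
    have "ev (\<iota> x) (con \<pi>) \<otimes>\<^bsub>K\<^esub> ev (\<iota> x) \<kappa> = \<one>\<^bsub>K\<^esub>"
      using e.hom_mult[OF cp kc] unfolding ck e.hom_one by (rule HOL.sym)
    then have ek: "\<iota> \<pi> \<otimes>\<^bsub>K\<^esub> ev (\<iota> x) \<kappa> = \<one>\<^bsub>K\<^esub>" unfolding ev_con[OF iota.hom_closed[OF x] pi(1)] .
    have ec: "ev (\<iota> x) \<kappa> \<in> carrier K" by (rule e.hom_closed[OF kc])
    have "ev (\<iota> x) X0 = \<iota> x" by (rule ev_X0[OF iota.hom_closed[OF x]])
    then have "ev (\<iota> x) f = \<iota> (x [^] q \<ominus> x)"
      unfolding f_def P.P.minus_eq minus_eq using X x by simp
    also have "\<dots> = \<iota> y \<otimes>\<^bsub>K\<^esub> \<iota> \<pi>" unfolding y(2) by (rule iota.hom_mult[OF y(1) pi(1)])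
    finally have "ev (\<iota> x) (\<kappa> \<otimes>\<^bsub>P\<^esub> f) = ev (\<iota> x) \<kappa> \<otimes>\<^bsub>K\<^esub> (\<iota> y \<otimes>\<^bsub>K\<^esub> \<iota> \<pi>)"
      using e.hom_mult[OF kc fc] by simp
    also have "\<dots> = \<iota> y \<otimes>\<^bsub>K\<^esub> (\<iota> \<pi> \<otimes>\<^bsub>K\<^esub> ev (\<iota> x) \<kappa>)"
      using ec iota.hom_closed[OF y(1)] iota.hom_closed[OF pi(1)] by (simp add: K.m_ac)
    finally have "ev (\<iota> x) (\<kappa> \<otimes>\<^bsub>P\<^esub> f) = \<iota> y" unfolding ek using y(1) by simp
    then show "ev (\<iota> x) (\<kappa> \<otimes>\<^bsub>P\<^esub> f) \<in> \<iota> ` carrier R" using y(1) by simp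
  qed
  moreover have "X0 [^]\<^bsub>P\<^esub> q = X0 \<oplus>\<^bsub>P\<^esub> con \<pi> \<otimes>\<^bsub>P\<^esub> (\<kappa> \<otimes>\<^bsub>P\<^esub> f)"
  proof -
    have "con \<pi> \<otimes>\<^bsub>P\<^esub> (\<kappa> \<otimes>\<^bsub>P\<^esub> f) = f"
      using P.P.m_assoc[OF cp kc fc] fc unfolding ck by simp
    moreover have "f \<oplus>\<^bsub>P\<^esub> X0 = X0 [^]\<^bsub>P\<^esub> q" unfolding f_def by (rule P.P.minus_add_cancel[OF X(2,1)])
    ultimately show ?thesis using P.P.a_comm[OF fc X(1)] by simp
  qed
  ultimately show ?thesis by blast
qed

text \<open>The homomorphism carries the relation for \<open>X\<close> to one for \<open>a\<close>;
  its value at \<open>(X^q - X) / \<pi>\<close> is the required \<open>b\<close>.\<close>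

lemma WPC_frobenius:
  assumes W: "WPC R B \<beta>" and pi: "\<pi> \<in> carrier R" "\<pi> \<noteq> \<zero>"
    and fr: "\<And>x. x \<in> carrier R \<Longrightarrow> x [^] (q::nat) \<ominus> x \<in> PIdl \<pi>" and a: "a \<in> carrier B"
  shows "\<exists>b\<in>carrier B. a [^]\<^bsub>B\<^esub> q = a \<oplus>\<^bsub>B\<^esub> \<beta> \<pi> \<otimes>\<^bsub>B\<^esub> b"
proof -
  obtain h where h: "h \<in> ring_hom (int_poly R) B" "\<And>r. r \<in> carrier R \<Longrightarrow> h (con r) = \<beta> r" "h X0 = a"
    using W a unfolding WPC_def alg_hom_def int_poly_const_def int_poly_X_def by auto
  obtain g where g: "g \<in> carrier (int_poly R)" "X0 [^]\<^bsub>P\<^esub> q = X0 \<oplus>\<^bsub>P\<^esub> con \<pi> \<otimes>\<^bsub>P\<^esub> g"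
    using int_poly_frobenius_quotient[OF pi fr] by blast
  note hm = ring_hom_mult[OF h(1), unfolded int_poly_ops] and ha = ring_hom_add[OF h(1), unfolded int_poly_ops]
    and h1 = ring_hom_one[OF h(1), unfolded int_poly_ops]
  have pw: "X0 [^]\<^bsub>P\<^esub> n \<in> carrier (int_poly R) \<and> h (X0 [^]\<^bsub>P\<^esub> n) = a [^]\<^bsub>B\<^esub> n" for n :: nat
  proof (induction n)
    case 0
    have "\<one>\<^bsub>P\<^esub> \<in> carrier (int_poly R)" using con_int_poly[OF one_closed] unfolding con.hom_one .
    then show ?case using h1 by simp
  next
    case (Suc n)
    then show ?case unfolding P.P.nat_pow_Suc target.S.nat_pow_Suc
      using int_poly_closed(1)[of "X0 [^]\<^bsub>P\<^esub> n" X0] X0_int_poly hm[of "X0 [^]\<^bsub>P\<^esub> n" X0] h(3) by simp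
  qed
  have cg: "con \<pi> \<otimes>\<^bsub>P\<^esub> g \<in> carrier (int_poly R)" by (rule int_poly_closed(1)[OF con_int_poly[OF pi(1)] g(1)])
  have "a [^]\<^bsub>B\<^esub> q = h (X0 \<oplus>\<^bsub>P\<^esub> con \<pi> \<otimes>\<^bsub>P\<^esub> g)" using pw[of q] unfolding g(2) by simp
  also have "\<dots> = a \<oplus>\<^bsub>B\<^esub> \<beta> \<pi> \<otimes>\<^bsub>B\<^esub> h g"
    unfolding ha[OF X0_int_poly cg] hm[OF con_int_poly[OF pi(1)] g(1)] h(3) h(2)[OF pi(1)] ..
  finally show ?thesis using ring_hom_closed[OF h(1) g(1)] by blast
qed

end

section \<open>The Frobenius tower\<close>

lemma (in normal_forms) nval_smult:
  "(\<And>k. e k \<in> carrier C) \<Longrightarrow> (\<And>l. c l \<in> carrier R) \<Longrightarrow> r \<in> carrier R \<Longrightarrow>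
    nval C \<psi> q L e c \<in> carrier C \<and> nval C \<psi> q L e (\<lambda>l. r \<otimes> c l) = \<psi> r \<otimes>\<^bsub>C\<^esub> nval C \<psi> q L e c"
proof (induction L arbitrary: e c)
  case (Suc L)
  have IH: "nval C \<psi> q L (\<lambda>k. e (Suc k)) (\<lambda>l. c (i # l)) \<in> carrier C"
    "nval C \<psi> q L (\<lambda>k. e (Suc k)) (\<lambda>l. r \<otimes> c (i # l)) = \<psi> r \<otimes>\<^bsub>C\<^esub> nval C \<psi> q L (\<lambda>k. e (Suc k)) (\<lambda>l. c (i # l))" for i
    using Suc.IH[of "\<lambda>k. e (Suc k)" "\<lambda>l. c (i # l)"] Suc.prems by blast+
  have "nval C \<psi> q (Suc L) e (\<lambda>l. r \<otimes> c l) = \<psi> r \<otimes>\<^bsub>C\<^esub> nval C \<psi> q (Suc L) e c"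
    unfolding nval.simps IH(2) by (rule S.horner_map_mult) (use Suc.prems IH(1) in auto)
  moreover have "nval C \<psi> q (Suc L) e c \<in> carrier C"
    unfolding nval.simps using Suc.prems(1) IH(1) by (intro S.horner_closed) auto
  ultimately show ?case by blast
qed simp

text \<open>\<open>pi_pow_unit\<close> reflects that \<open>\<pi>\<close> lies in the maximal ideal
  of a local ring; it makes the powers of \<open>\<pi>\<close> admissible nodes.
  \<open>B_frobenius\<close> provides the tower above each element of \<open>B\<close>.\<close>

locale uniformizer_target = int_poly_target R B \<beta> + uniformizer R \<pi> q xs
  for R (structure) and B and \<beta> and \<pi> and q and xs +
  assumes pi_pow_unit: "\<And>k::nat. k \<ge> 1 \<Longrightarrow> \<pi> [^] k \<ominus> \<one> \<in> Units R"
    and B_frobenius: "\<And>b. b \<in> carrier B \<Longrightarrow> \<exists>b'\<in>carrier B. b [^]\<^bsub>B\<^esub> q = b \<oplus>\<^bsub>B\<^esub> \<beta> \<pi> \<otimes>\<^bsub>B\<^esub> b'"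
begin

interpretation K: field K by (rule quot_field_field)
interpretation iota: ring_hom_cring R K \<iota> by (rule iota_hom)
interpretation P: UP_domain K P by unfold_locales
interpretation C: cring C by (rule C_cring)
interpretation con: ring_hom_cring R P con by (rule con_hom)
interpretation psi: ring_hom_cring R C \<psi> by (rule psi_hom)
interpretation N: normal_forms R C \<psi> q \<pi>
  by unfold_locales (use q2 in auto)

definition kappa where "kappa = up_ring.monom P (inv\<^bsub>K\<^esub> (\<iota> \<pi>)) 0"

lemma iota_pi_unit: "\<iota> \<pi> \<in> Units K"
proof -
  have "\<iota> \<pi> \<noteq> \<zero>\<^bsub>K\<^esub>" using inj_onD[OF iota_inj, of \<pi> \<zero>] pi_nonzero iota.hom_zero by auto
  then show ?thesis using K.field_Units by simp
qed

lemma kappa_closed: "kappa \<in> carrier P"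
  unfolding kappa_def using iota_pi_unit by simp

lemma con_pi_kappa: "con \<pi> \<otimes>\<^bsub>P\<^esub> kappa = \<one>\<^bsub>P\<^esub>"
proof -
  have "con \<pi> \<otimes>\<^bsub>P\<^esub> kappa = up_ring.monom P (\<iota> \<pi> \<otimes>\<^bsub>K\<^esub> inv\<^bsub>K\<^esub> (\<iota> \<pi>)) (0 + 0)"
    unfolding kappa_def using iota_pi_unit by (intro P.monom_mult[symmetric]) auto
  then show ?thesis using iota_pi_unit by simp
qed

lemma kappa_nonzero: "kappa \<noteq> \<zero>\<^bsub>P\<^esub>"
proof
  assume "kappa = \<zero>\<^bsub>P\<^esub>"
  then have "\<one>\<^bsub>P\<^esub> = \<zero>\<^bsub>P\<^esub>" using con_pi_kappa con.hom_closed[OF pi_closed] by simp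
  then show False using P.UP_one_not_zero by simp
qed

primrec fseq :: "nat \<Rightarrow> nat \<Rightarrow> ('a \<times> 'a) set" where
  "fseq 0 = X0"
| "fseq (Suc k) = kappa \<otimes>\<^bsub>P\<^esub> (fseq k [^]\<^bsub>P\<^esub> q \<ominus>\<^bsub>P\<^esub> fseq k)"

lemma fseq_closed: "fseq k \<in> carrier P"
  using kappa_closed by (induction k) auto

text \<open>The power \<open>f^q\<close> outweighs \<open>f\<close> because
  \<open>q \<ge> 2\<close>, and the constant factor \<open>1 / \<pi>\<close> keeps the
  degree.\<close>

lemma fseq_deg: "fseq k \<noteq> \<zero>\<^bsub>P\<^esub> \<and> deg K (fseq k) = q ^ k"
proof (induction k)
  case 0
  have "deg K X0 = 1" using P.deg_monom[of "\<one>\<^bsub>K\<^esub>" 1] by simp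
  then have "X0 \<noteq> \<zero>\<^bsub>P\<^esub>" using P.deg_zero by (metis zero_neq_one)
  then show ?case using \<open>deg K X0 = 1\<close> by simp
next
  case (Suc k)
  let ?f = "fseq k"
  have f: "?f \<in> carrier P" "?f \<noteq> \<zero>\<^bsub>P\<^esub>" "deg K ?f = q ^ k" using Suc fseq_closed by auto
  have p: "?f [^]\<^bsub>P\<^esub> q \<in> carrier P" "deg K (?f [^]\<^bsub>P\<^esub> q) = q * q ^ k"
    using P.deg_pow[OF f(1,2), of q] f by auto
  have "q ^ k < q * q ^ k" using q2 by simp
  then have "deg K (\<ominus>\<^bsub>P\<^esub> ?f) < deg K (?f [^]\<^bsub>P\<^esub> q)" using f p by simp
  from P.add_distinct_deg[OF _ p(1) this]
  have d: "\<ominus>\<^bsub>P\<^esub> ?f \<oplus>\<^bsub>P\<^esub> ?f [^]\<^bsub>P\<^esub> q \<noteq> \<zero>\<^bsub>P\<^esub>" "deg K (\<ominus>\<^bsub>P\<^esub> ?f \<oplus>\<^bsub>P\<^esub> ?f [^]\<^bsub>P\<^esub> q) = q * q ^ k"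
    using f p by simp_all
  have e: "?f [^]\<^bsub>P\<^esub> q \<ominus>\<^bsub>P\<^esub> ?f = \<ominus>\<^bsub>P\<^esub> ?f \<oplus>\<^bsub>P\<^esub> ?f [^]\<^bsub>P\<^esub> q"
    unfolding P.P.minus_eq using f p by (intro P.P.a_comm) auto
  have g: "?f [^]\<^bsub>P\<^esub> q \<ominus>\<^bsub>P\<^esub> ?f \<noteq> \<zero>\<^bsub>P\<^esub>" "deg K (?f [^]\<^bsub>P\<^esub> q \<ominus>\<^bsub>P\<^esub> ?f) = q * q ^ k"
    unfolding e by (rule d)+
  have gc: "?f [^]\<^bsub>P\<^esub> q \<ominus>\<^bsub>P\<^esub> ?f \<in> carrier P" using f p by simp
  have "deg K kappa = 0" unfolding kappa_def using iota_pi_unit by (intro P.deg_const) auto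
  then have "deg K (fseq (Suc k)) = q ^ Suc k"
    using P.deg_mult[OF kappa_nonzero g(1) kappa_closed gc] g(2) by simp
  moreover have "fseq (Suc k) \<noteq> \<zero>\<^bsub>P\<^esub>"
    using P.UP_integral[OF _ kappa_closed gc] kappa_nonzero g(1) by auto
  ultimately show ?case by simp
qed

text \<open>Any solution is taken. It need not be unique when \<open>\<beta> \<pi>\<close> is a zero
  divisor; the uniqueness required of the graph comes from the polynomial component.\<close>

primrec aseq :: "'c \<Rightarrow> nat \<Rightarrow> 'c" where
  "aseq a 0 = a"
| "aseq a (Suc k) = (SOME b'. b' \<in> carrier B \<and> aseq a k [^]\<^bsub>B\<^esub> q = aseq a k \<oplus>\<^bsub>B\<^esub> \<beta> \<pi> \<otimes>\<^bsub>B\<^esub> b')"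

lemma aseq:
  assumes a: "a \<in> carrier B"
  shows "aseq a k \<in> carrier B"
    and "aseq a k [^]\<^bsub>B\<^esub> q = aseq a k \<oplus>\<^bsub>B\<^esub> \<beta> \<pi> \<otimes>\<^bsub>B\<^esub> aseq a (Suc k)"
proof -
  have step: "aseq a (Suc k) \<in> carrier B \<and> aseq a k [^]\<^bsub>B\<^esub> q = aseq a k \<oplus>\<^bsub>B\<^esub> \<beta> \<pi> \<otimes>\<^bsub>B\<^esub> aseq a (Suc k)"
    if "aseq a k \<in> carrier B" for k
    unfolding aseq.simps(2) by (rule someI_ex) (use B_frobenius[OF that] in \<open>simp only: Bex_def\<close>)
  show 1: "aseq a k \<in> carrier B" for k
    by (induction k) (use a step in auto)
  show "aseq a k [^]\<^bsub>B\<^esub> q = aseq a k \<oplus>\<^bsub>B\<^esub> \<beta> \<pi> \<otimes>\<^bsub>B\<^esub> aseq a (Suc k)" using step[OF 1] by blast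
qed

definition eseq where "eseq a k = (fseq k, aseq a k)"

lemma eseq_closed: "a \<in> carrier B \<Longrightarrow> eseq a k \<in> carrier C"
  unfolding eseq_def RDirProd_carrier using fseq_closed aseq(1) by blast

lemma eseq_tower:
  assumes a: "a \<in> carrier B"
  shows "N.tower (eseq a)"
  unfolding N.tower_def
proof (intro allI conjI eseq_closed[OF a])
  fix k
  interpret fst: ring_hom_cring C P fst by (rule fst_hom)
  interpret snd: ring_hom_cring C B snd by (rule snd_hom)
  have f: "fseq k \<in> carrier P" "fseq k [^]\<^bsub>P\<^esub> q \<in> carrier P" using fseq_closed by auto
  define g where "g = fseq k [^]\<^bsub>P\<^esub> q \<ominus>\<^bsub>P\<^esub> fseq k"
  have g: "g \<in> carrier P" unfolding g_def using f by simp
  have "con \<pi> \<otimes>\<^bsub>P\<^esub> fseq (Suc k) = (con \<pi> \<otimes>\<^bsub>P\<^esub> kappa) \<otimes>\<^bsub>P\<^esub> g"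
    unfolding fseq.simps(2) g_def[symmetric]
    using P.P.m_assoc[OF con.hom_closed[OF pi_closed] kappa_closed g] by simp
  then have cg: "con \<pi> \<otimes>\<^bsub>P\<^esub> fseq (Suc k) = g" unfolding con_pi_kappa using g by simp
  have "fseq k \<oplus>\<^bsub>P\<^esub> g = fseq k [^]\<^bsub>P\<^esub> q"
    unfolding g_def using P.P.minus_add_cancel[OF f(2,1)] P.P.a_comm[of "fseq k" "fseq k [^]\<^bsub>P\<^esub> q \<ominus>\<^bsub>P\<^esub> fseq k"] f by simp
  then have "fseq k [^]\<^bsub>P\<^esub> q = fseq k \<oplus>\<^bsub>P\<^esub> con \<pi> \<otimes>\<^bsub>P\<^esub> fseq (Suc k)" unfolding cg ..
  moreover have "fst (eseq a k [^]\<^bsub>C\<^esub> q) = fseq k [^]\<^bsub>P\<^esub> q" "snd (eseq a k [^]\<^bsub>C\<^esub> q) = aseq a k [^]\<^bsub>B\<^esub> q"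
    using fst.hom_pow[OF eseq_closed[OF a]] snd.hom_pow[OF eseq_closed[OF a]] unfolding eseq_def by simp_all
  ultimately show "eseq a k [^]\<^bsub>C\<^esub> q = eseq a k \<oplus>\<^bsub>C\<^esub> \<psi> \<pi> \<otimes>\<^bsub>C\<^esub> eseq a (Suc k)"
    using aseq(2)[OF a, of k] unfolding RDirProd_simps eseq_def fst_conv snd_conv by (intro prod_eqI) (simp_all only: fst_conv snd_conv)
qed

text \<open>The digits at level \<open>k\<close> have degrees divisible by \<open>q^(k+1)\<close>,
  so \<open>horner_deg\<close> rules out cancellation. For \<open>k = 0\<close> this makes the
  normal forms a graph: if the polynomial vanishes, so does the component in
  \<open>B\<close>.\<close>

lemma NF_deg:
  assumes a: "a \<in> carrier B"
  shows "x \<in> N.NF L (\<lambda>i. eseq a (i + k)) \<Longrightarrow>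
    x = \<zero>\<^bsub>C\<^esub> \<or> (fst x \<noteq> \<zero>\<^bsub>P\<^esub> \<and> (\<exists>m. deg K (fst x) = m * q ^ k))"
proof (induction L arbitrary: x k)
  case 0
  then obtain r where r: "r \<in> carrier R" "x = \<psi> r" unfolding N.NF_0 by blast
  show ?case
  proof (cases "r = \<zero>")
    case True
    then show ?thesis unfolding r(2) using psi.hom_zero by simp
  next
    case False
    have "\<iota> r \<noteq> \<iota> \<zero>" using False inj_onD[OF iota_inj] r(1) by blast
    then have "con r \<noteq> \<zero>\<^bsub>P\<^esub>"
      using inj_onD[OF P.monom_inj, of "\<iota> r" 0 "\<zero>\<^bsub>K\<^esub>"] r(1) iota.hom_zero by auto
    moreover have "deg K (con r) = 0 * q ^ k" using P.deg_const[of "\<iota> r"] r(1) by simp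
    ultimately show ?thesis unfolding r(2) fst_conv by blast
  qed
next
  case (Suc L)
  interpret fst: ring_hom_cring C P fst by (rule fst_hom)
  let ?e = "\<lambda>i. eseq a (i + Suc k)"
  obtain s where s: "x = horner C (map s [0..<q]) (eseq a k)" "\<And>i. s i \<in> N.NF L ?e"
    using Suc.prems unfolding N.NF_Suc by auto
  have sc: "s i \<in> carrier C" for i using s(2) N.NF_closed[of ?e L] eseq_closed[OF a] by blast
  have fx: "fst x = horner P (map (\<lambda>i. fst (s i)) [0..<q]) (fseq k)"
    unfolding s(1) using fst.hom_horner[of "map s [0..<q]" "eseq a k"] sc eseq_closed[OF a]
    by (simp add: image_subset_iff comp_def eseq_def)
  have deg_s: "s i = \<zero>\<^bsub>C\<^esub> \<or> (fst (s i) \<noteq> \<zero>\<^bsub>P\<^esub> \<and> (\<exists>m. deg K (fst (s i)) = m * (q * q ^ k)))" for i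
    using Suc.IH[OF s(2)] by simp
  have "(\<forall>z\<in>set (map (\<lambda>i. fst (s i)) [0..<q]). z = \<zero>\<^bsub>P\<^esub>) \<or>
      (horner P (map (\<lambda>i. fst (s i)) [0..<q]) (fseq k) \<noteq> \<zero>\<^bsub>P\<^esub> \<and>
      (\<exists>i m. i < length (map (\<lambda>i. fst (s i)) [0..<q]) \<and>
        deg K (horner P (map (\<lambda>i. fst (s i)) [0..<q]) (fseq k)) = i * q ^ k + m * (q * q ^ k)))"
  proof (rule P.horner_deg)
    show "fseq k \<in> carrier P" "fseq k \<noteq> \<zero>\<^bsub>P\<^esub>" "deg K (fseq k) = q ^ k" using fseq_closed fseq_deg by auto
    show "0 < q ^ k" using q2 by simp
    show "set (map (\<lambda>i. fst (s i)) [0..<q]) \<subseteq> carrier P" using fst.hom_closed[OF sc] by auto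
    show "\<forall>z\<in>set (map (\<lambda>i. fst (s i)) [0..<q]). z = \<zero>\<^bsub>P\<^esub> \<or> (\<exists>m. deg K z = m * (q * q ^ k))"
    proof
      fix z assume "z \<in> set (map (\<lambda>i. fst (s i)) [0..<q])"
      then obtain i where i: "z = fst (s i)" by auto
      show "z = \<zero>\<^bsub>P\<^esub> \<or> (\<exists>m. deg K z = m * (q * q ^ k))"
        using deg_s[of i] fst.hom_zero unfolding i by metis
    qed
  qed simp
  then show ?case
  proof
    assume z: "\<forall>z\<in>set (map (\<lambda>i. fst (s i)) [0..<q]). z = \<zero>\<^bsub>P\<^esub>"
    \<comment> \<open>By the induction hypothesis a digit with vanishing polynomial vanishes as a
      pair; this is where the second component is controlled.\<close>
    have "s i = \<zero>\<^bsub>C\<^esub>" if "i < q" for i using deg_s[of i] z that by auto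
    then have "map s [0..<q] = map (\<lambda>i. \<zero>\<^bsub>C\<^esub>) [0..<q]" by (intro map_cong) auto
    then have "x = \<zero>\<^bsub>C\<^esub>" unfolding s(1) using C.horner_zeros[OF eseq_closed[OF a]] by (simp only:)
    then show ?thesis ..
  next
    assume *: "horner P (map (\<lambda>i. fst (s i)) [0..<q]) (fseq k) \<noteq> \<zero>\<^bsub>P\<^esub> \<and>
      (\<exists>i m. i < length (map (\<lambda>i. fst (s i)) [0..<q]) \<and>
        deg K (horner P (map (\<lambda>i. fst (s i)) [0..<q]) (fseq k)) = i * q ^ k + m * (q * q ^ k))"
    then obtain i m where "deg K (fst x) = i * q ^ k + m * (q * q ^ k)" unfolding fx by blast
    then have "deg K (fst x) = (i + m * q) * q ^ k" by (simp add: algebra_simps)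
    then show ?thesis using * unfolding fx by blast
  qed
qed

lemma Ev_point_hom: "x \<in> carrier R \<Longrightarrow> ring_hom_cring C K (\<lambda>y. ev (\<iota> x) (fst y))"
proof -
  assume x: "x \<in> carrier R"
  interpret fst: ring_hom_cring C P fst by (rule fst_hom)
  interpret e: ring_hom_cring P K "ev (\<iota> x)" by (rule ev_hom) (use x in simp)
  show ?thesis
    using ring_hom_cringI[OF C_cring K.is_cring ring_hom_trans[OF fst.homh e.homh]] unfolding comp_def .
qed

text \<open>The polynomials \<open>fseq\<close> are the orbit of the indeterminate, so evaluation
  turns them into the orbit of the point.\<close>

lemma ev_fseq:
  assumes x: "x \<in> carrier R"
  shows "ev (\<iota> x) (fseq k) = \<iota> (orbit x k)"
proof (induction k)
  case 0
  then show ?case using ev_X0[OF iota.hom_closed[OF x]] unfolding orbit_0 fseq.simps .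
next
  case (Suc k)
  interpret e: ring_hom_cring P K "ev (\<iota> x)" by (rule ev_hom) (use x in simp)
  have o: "orbit x k \<in> carrier R" using orbit_closed[OF x] .
  have f: "fseq k \<in> carrier P" "fseq k [^]\<^bsub>P\<^esub> q \<in> carrier P" using fseq_closed by auto
  have os: "orbit x (Suc k) = \<phi> (orbit x k)" unfolding orbit_def by simp
  have p: "\<phi> (orbit x k) \<in> carrier R" "\<pi> \<otimes> \<phi> (orbit x k) = orbit x k [^] q \<ominus> orbit x k" using phi[OF o] by auto
  have ek: "ev (\<iota> x) (con \<pi>) \<otimes>\<^bsub>K\<^esub> ev (\<iota> x) kappa = \<one>\<^bsub>K\<^esub>"
    using e.hom_mult[OF con.hom_closed[OF pi_closed] kappa_closed] unfolding con_pi_kappa e.hom_one by (rule HOL.sym)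
  have kc: "ev (\<iota> x) kappa \<in> carrier K" by (rule e.hom_closed[OF kappa_closed])
  have "ev (\<iota> x) (fseq k [^]\<^bsub>P\<^esub> q \<ominus>\<^bsub>P\<^esub> fseq k) = \<iota> (orbit x k [^] q \<ominus> orbit x k)"
    unfolding P.P.minus_eq minus_eq using f o by (simp add: Suc)
  also have "\<dots> = \<iota> \<pi> \<otimes>\<^bsub>K\<^esub> \<iota> (\<phi> (orbit x k))" unfolding p(2)[symmetric] using p(1) by simp
  finally have "ev (\<iota> x) (fseq (Suc k)) = ev (\<iota> x) kappa \<otimes>\<^bsub>K\<^esub> (\<iota> \<pi> \<otimes>\<^bsub>K\<^esub> \<iota> (\<phi> (orbit x k)))"
    unfolding fseq.simps using e.hom_mult[OF kappa_closed, of "fseq k [^]\<^bsub>P\<^esub> q \<ominus>\<^bsub>P\<^esub> fseq k"] f by simp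
  also have "\<dots> = (ev (\<iota> x) (con \<pi>) \<otimes>\<^bsub>K\<^esub> ev (\<iota> x) kappa) \<otimes>\<^bsub>K\<^esub> \<iota> (\<phi> (orbit x k))"
    unfolding ev_con[OF iota.hom_closed[OF x] pi_closed] using kc p(1) by (simp add: K.m_ac)
  finally show ?case unfolding ek os using p(1) by simp
qed

text \<open>By \<open>rval_coeffs_divisible\<close> the coefficients themselves are divisible by
  \<open>\<pi>\<close>. Dividing them divides the whole pair, including the component in
  \<open>B\<close>, where no division is available.\<close>

lemma NF_divisible:
  assumes a: "a \<in> carrier B" and y: "y \<in> N.NF L (eseq a)"
    and div: "\<And>x. x \<in> carrier R \<Longrightarrow> ev (\<iota> x) (fst y) \<in> \<iota> ` (PIdl \<pi>)"
  shows "\<exists>y'\<in>N.NF L (eseq a). y = \<psi> \<pi> \<otimes>\<^bsub>C\<^esub> y'"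
proof -
  obtain c where c: "\<And>l. c l \<in> carrier R" "y = nval C \<psi> q L (eseq a) c" using y unfolding N.NF_def by blast
  have rv: "rval L (orbit x) c \<in> I 1" if x: "x \<in> carrier R" for x
  proof -
    have "ev (\<iota> x) (fst y) = nval K \<iota> q L (\<lambda>k. ev (\<iota> x) (fst (eseq a k))) c"
      unfolding c(2) using nval_hom[where R = R, OF Ev_point_hom[OF x] psi.hom_closed _ eseq_closed[OF a] c(1)]
      ev_con[OF iota.hom_closed[OF x]] by (simp only: fst_conv)
    also have "\<dots> = nval K \<iota> q L (\<lambda>k. \<iota> (orbit x k)) c"
      unfolding eseq_def fst_conv ev_fseq[OF x] ..
    also have "\<dots> = \<iota> (rval L (orbit x) c)"
      using nval_hom[where R = R, OF iota_hom, of "\<lambda>r. r" \<iota> "orbit x" c] orbit_closed[OF x] c(1) by simp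
    finally have "\<iota> (rval L (orbit x) c) \<in> \<iota> ` (PIdl \<pi>)" using div[OF x] by simp
    moreover have "rval L (orbit x) c \<in> carrier R" by (intro rval_closed orbit_closed x c(1))
    moreover have "PIdl \<pi> \<subseteq> carrier R" using additive_subgroup.a_subset[OF ideal.axioms(1)[OF cgenideal_ideal[OF pi_closed]]] .
    ultimately show ?thesis unfolding I_1 using inj_on_image_mem_iff[OF iota_inj] by blast
  qed
  \<comment> \<open>Coefficients that are not divisible get the default zero; they occur only at
    lists that do not enter the value, namely those of another length or with entries outside the
    digits.\<close>
  define c' where "c' l = (if c l \<in> PIdl \<pi> then SOME r. r \<in> carrier R \<and> c l = r \<otimes> \<pi> else \<zero>)" for l
  have c'1: "c' l \<in> carrier R \<and> c l = c' l \<otimes> \<pi>" if "c l \<in> PIdl \<pi>" for l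
  proof -
    have "\<exists>r. r \<in> carrier R \<and> c l = r \<otimes> \<pi>" using that unfolding mem_PIdl_iff by blast
    from someI_ex[OF this] show ?thesis unfolding c'_def using that by simp
  qed
  have c'c: "c' l \<in> carrier R" for l using c'1[of l] by (cases "c l \<in> PIdl \<pi>") (auto simp: c'_def)
  have "c l = \<pi> \<otimes> c' l" if "length l = L" "set l \<subseteq> {..<q}" for l
  proof -
    have "c l \<in> PIdl \<pi>" using rval_coeffs_divisible[OF c(1) rv that] unfolding I_1 .
    then show ?thesis using c'1 m_comm[OF pi_closed c'c] by metis
  qed
  then have "y = nval C \<psi> q L (eseq a) (\<lambda>l. \<pi> \<otimes> c' l)" unfolding c(2) by (rule nval_cong)
  also have "\<dots> = \<psi> \<pi> \<otimes>\<^bsub>C\<^esub> nval C \<psi> q L (eseq a) c'"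
    by (rule conjunct2[OF N.nval_smult[OF eseq_closed[OF a] c'c pi_closed]])
  finally show ?thesis unfolding N.NF_def using c'c by blast
qed

text \<open>One factor \<open>\<pi>\<close> is removed at a time: the remaining cofactor is still
  integer-valued, so the values of the product are divisible by \<open>\<pi>\<close>. The second
  component changes with every step.\<close>

lemma NFs_divide_power:
  assumes a: "a \<in> carrier B" and f: "f \<in> carrier (int_poly R)"
  shows "(con (\<pi> [^] (n::nat)) \<otimes>\<^bsub>P\<^esub> f, b) \<in> N.NFs (eseq a) \<Longrightarrow> \<exists>b'. (f, b') \<in> N.NFs (eseq a)"
proof (induction n arbitrary: b)
  case 0
  have "f \<in> carrier P" using f unfolding int_poly_carrier by blast
  then have "con (\<pi> [^] (0::nat)) \<otimes>\<^bsub>P\<^esub> f = f" unfolding nat_pow_0 con.hom_one by simp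
  then show ?case using 0 by metis
next
  case (Suc n)
  have fP: "f \<in> carrier P" using f unfolding int_poly_carrier by blast
  have pn: "\<pi> [^] n \<in> carrier R" by (rule pow_pi)
  let ?g = "con (\<pi> [^] n) \<otimes>\<^bsub>P\<^esub> f"
  have gP: "?g \<in> carrier P" using con.hom_closed[OF pn] fP by (rule P.P.m_closed)
  have "con (\<pi> [^] Suc n) = con \<pi> \<otimes>\<^bsub>P\<^esub> con (\<pi> [^] n)"
    unfolding nat_pow_Suc2[OF pi_closed] con.hom_mult[OF pi_closed pn] ..
  then have e: "con (\<pi> [^] Suc n) \<otimes>\<^bsub>P\<^esub> f = con \<pi> \<otimes>\<^bsub>P\<^esub> ?g"
    using P.P.m_assoc[OF con.hom_closed[OF pi_closed] con.hom_closed[OF pn] fP] by (simp only:)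
  obtain L where L: "(con \<pi> \<otimes>\<^bsub>P\<^esub> ?g, b) \<in> N.NF L (eseq a)" using Suc.prems unfolding e N.NFs_def by blast
  have "ev (\<iota> x) (con \<pi> \<otimes>\<^bsub>P\<^esub> ?g) \<in> \<iota> ` (PIdl \<pi>)" if x: "x \<in> carrier R" for x
  proof -
    interpret e: ring_hom_cring P K "ev (\<iota> x)" by (rule ev_hom) (use x in simp)
    have "?g \<in> carrier (int_poly R)" by (rule int_poly_closed(1)[OF con_int_poly[OF pn] f])
    then obtain r where r: "r \<in> carrier R" "ev (\<iota> x) ?g = \<iota> r" using x unfolding int_poly_carrier by blast
    have "ev (\<iota> x) (con \<pi> \<otimes>\<^bsub>P\<^esub> ?g) = \<iota> (r \<otimes> \<pi>)"
      unfolding e.hom_mult[OF con.hom_closed[OF pi_closed] gP] r(2) ev_con[OF iota.hom_closed[OF x] pi_closed]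
        m_comm[OF r(1) pi_closed] iota.hom_mult[OF pi_closed r(1)] ..
    moreover have "r \<otimes> \<pi> \<in> PIdl \<pi>" unfolding mem_PIdl_iff using r(1) by blast
    ultimately show ?thesis by (simp only: imageI)
  qed
  then have "\<exists>y\<in>N.NF L (eseq a). (con \<pi> \<otimes>\<^bsub>P\<^esub> ?g, b) = \<psi> \<pi> \<otimes>\<^bsub>C\<^esub> y"
    by (intro NF_divisible[OF a L]) (simp only: fst_conv)
  then obtain y where y: "y \<in> N.NF L (eseq a)" "(con \<pi> \<otimes>\<^bsub>P\<^esub> ?g, b) = \<psi> \<pi> \<otimes>\<^bsub>C\<^esub> y"
    by (rule bexE)
  have yc: "y \<in> carrier C" using y(1) N.NF_closed[of "eseq a" L] eseq_closed[OF a] by blast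
  have yP: "fst y \<in> carrier P" using yc unfolding C_carrier by blast
  \<comment> \<open>Only first components are cancelled, with the help of \<open>1 / \<pi>\<close>;
    the second component is simply read off from \<open>y\<close>.\<close>
  have "con \<pi> \<otimes>\<^bsub>P\<^esub> ?g = con \<pi> \<otimes>\<^bsub>P\<^esub> fst y" using y(2) unfolding RDirProd_simps by simp
  moreover have "kappa \<otimes>\<^bsub>P\<^esub> (con \<pi> \<otimes>\<^bsub>P\<^esub> z) = z" if z: "z \<in> carrier P" for z
  proof -
    have "kappa \<otimes>\<^bsub>P\<^esub> (con \<pi> \<otimes>\<^bsub>P\<^esub> z) = (con \<pi> \<otimes>\<^bsub>P\<^esub> kappa) \<otimes>\<^bsub>P\<^esub> z"
      using P.P.m_assoc[OF kappa_closed con.hom_closed[OF pi_closed] z]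
        P.P.m_comm[OF kappa_closed con.hom_closed[OF pi_closed]] by (simp only:)
    then show ?thesis unfolding con_pi_kappa using z by simp
  qed
  ultimately have "?g = fst y" using gP yP by metis
  then have "(?g, snd y) \<in> N.NFs (eseq a)" using y(1) by (auto intro: N.NFs_I)
  then show ?case by (rule Suc.IH)
qed

text \<open>The pair \<open>(X, a)\<close> is the bottom of the tower, and \<open>NFs\<close> is
  closed under scalars, sums and products.\<close>

lemma Ev_in_NFs:
  assumes a: "a \<in> carrier B" and g: "g \<in> carrier (UP R)"
  shows "Ev a g \<in> N.NFs (eseq a)"
proof -
  interpret U: UP_cring R "UP R" by (intro UP_cring.intro is_cring)
  note t = eseq_tower[OF a]
  have X: "(X0, a) \<in> N.NFs (eseq a)" using N.NFs_tower[OF t, of 0] unfolding eseq_def by simp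
  have pow: "(X0, a) [^]\<^bsub>C\<^esub> (i::nat) \<in> N.NFs (eseq a)" for i
  proof (induction i)
    case 0
    then show ?case using N.NFs_base[OF one_closed, of "eseq a"] psi.hom_one unfolding C.nat_pow_0 by (simp only:)
  next
    case (Suc i)
    then show ?case unfolding C.nat_pow_Suc by (rule N.NFs_mult[OF t _ X])
  qed
  have sub: "N.NFs (eseq a) \<subseteq> carrier C" by (rule N.NFs_closed) (rule eseq_closed[OF a])
  let ?t = "\<lambda>i. \<psi> (up_ring.coeff (UP R) g i) \<otimes>\<^bsub>C\<^esub> (X0, a) [^]\<^bsub>C\<^esub> i"
  have tN: "?t i \<in> N.NFs (eseq a)" for i
    by (rule N.NFs_mult[OF t N.NFs_base pow]) (use g in simp)
  have "finsum C ?t {..n} \<in> N.NFs (eseq a)" for n :: nat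
  proof (induction n)
    case 0
    have "finsum C ?t {..0} = ?t 0" using C.finsum_0[of ?t] tN sub by blast
    then show ?case using tN by (simp only:)
  next
    case (Suc n)
    have "finsum C ?t {..Suc n} = ?t (Suc n) \<oplus>\<^bsub>C\<^esub> finsum C ?t {..n}"
      using C.finsum_Suc[of ?t n] tN sub by blast
    then show ?case using N.NFs_add[of "eseq a", OF eseq_closed[OF a] tN Suc] by (simp only:)
  qed
  then show ?thesis unfolding U.eval_on_carrier[OF g] .
qed

lemma int_poly_total:
  assumes a: "a \<in> carrier B" and f: "f \<in> carrier (int_poly R)"
  shows "\<exists>b. (f, b) \<in> N.NFs (eseq a)"
proof -
  have fP: "f \<in> carrier P" using f unfolding int_poly_carrier by blast
  obtain u N where u: "u \<in> Units R" and N: "\<And>i. \<iota> (u \<otimes> \<pi> [^] (N::nat)) \<otimes>\<^bsub>K\<^esub> up_ring.coeff P f i \<in> \<iota> ` carrier R"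
    using int_poly_power_denominator[OF f pi_closed pi_pow_unit] by blast
  have uc: "u \<in> carrier R" "inv u \<in> carrier R" and pn: "\<pi> [^] N \<in> carrier R" using u pow_pi by auto
  have upn: "u \<otimes> \<pi> [^] N \<in> carrier R" using uc pn by simp
  let ?g = "con (u \<otimes> \<pi> [^] N) \<otimes>\<^bsub>P\<^esub> f"
  have gP: "?g \<in> carrier P" using con.hom_closed[OF upn] fP by (rule P.P.m_closed)
  have "?g = \<iota> (u \<otimes> \<pi> [^] N) \<odot>\<^bsub>P\<^esub> f"
    by (rule P.monom_mult_is_smult[OF iota.hom_closed[OF upn] fP])
  then have "up_ring.coeff P ?g i \<in> \<iota> ` carrier R" for i
    using N[of i] P.coeff_smult[OF iota.hom_closed[OF upn] fP, of i] by (simp only:)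
  then obtain h where h: "h \<in> carrier (UP R)" "fst (Ev a h) = ?g" using poly_lift[OF a gP] by blast
  \<comment> \<open>The unit part of the denominator is divided out again, which leaves a power of
    \<open>\<pi>\<close> times \<open>f\<close>.\<close>
  have "\<psi> (inv u) \<otimes>\<^bsub>C\<^esub> Ev a h \<in> N.NFs (eseq a)"
    by (rule N.NFs_smult[OF eseq_closed[OF a] Ev_in_NFs[OF a h(1)] uc(2)])
  moreover have "con (inv u) \<otimes>\<^bsub>P\<^esub> ?g = con (\<pi> [^] N) \<otimes>\<^bsub>P\<^esub> f"
  proof -
    have "con (inv u) \<otimes>\<^bsub>P\<^esub> ?g = con (inv u \<otimes> (u \<otimes> \<pi> [^] N)) \<otimes>\<^bsub>P\<^esub> f"
      unfolding con.hom_mult[OF uc(2) upn]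
      using P.P.m_assoc[OF con.hom_closed[OF uc(2)] con.hom_closed[OF upn] fP] by (rule HOL.sym)
    also have "inv u \<otimes> (u \<otimes> \<pi> [^] N) = \<pi> [^] N" using u uc pn by (simp add: m_assoc[symmetric])
    finally show ?thesis .
  qed
  ultimately have "(con (\<pi> [^] N) \<otimes>\<^bsub>P\<^esub> f, \<beta> (inv u) \<otimes>\<^bsub>B\<^esub> snd (Ev a h)) \<in> N.NFs (eseq a)"
    unfolding RDirProd_simps fst_conv snd_conv h(2) by (simp only:)
  then show ?thesis by (rule NFs_divide_power[OF a f])
qed

lemma hom_exists:
  assumes a: "a \<in> carrier B"
  shows "\<exists>h \<in> alg_hom R (int_poly R) (int_poly_const R) B \<beta>. h (int_poly_X R) = a"
proof (rule hom_from_graph)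
  note t = eseq_tower[OF a]
  show "N.NFs (eseq a) \<subseteq> carrier C" by (rule N.NFs_closed) (rule eseq_closed[OF a])
  show "x \<oplus>\<^bsub>C\<^esub> y \<in> N.NFs (eseq a)" if "x \<in> N.NFs (eseq a)" "y \<in> N.NFs (eseq a)" for x y
    by (rule N.NFs_add[OF eseq_closed[OF a] that])
  show "x \<otimes>\<^bsub>C\<^esub> y \<in> N.NFs (eseq a)" if "x \<in> N.NFs (eseq a)" "y \<in> N.NFs (eseq a)" for x y
    by (rule N.NFs_mult[OF t that])
  show "\<psi> r \<in> N.NFs (eseq a)" if "r \<in> carrier R" for r by (rule N.NFs_base[OF that])
  show "(X0, a) \<in> N.NFs (eseq a)" using N.NFs_tower[OF t, of 0] unfolding eseq_def by simp
  show "x = \<zero>\<^bsub>C\<^esub>" if "x \<in> N.NFs (eseq a)" "fst x = \<zero>\<^bsub>P\<^esub>" for x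
    using that NF_deg[OF a, of x _ 0] unfolding N.NFs_def by auto
  show "\<exists>b. (f, b) \<in> N.NFs (eseq a)" if "f \<in> carrier (int_poly R)" for f
    by (rule int_poly_total[OF a that])
qed

end

section \<open>Localization at a prime ideal\<close>

text \<open>From \<open>s^q (x^q - x) = ((x s)^q - x s) - x (s^q - s)\<close> and invertibility of
  \<open>s^q\<close>: the congruence for a fraction follows from those for its numerator
  \<open>x s\<close> and its denominator \<open>s\<close>.\<close>

lemma (in cring) frobenius_mem_denominator:
  assumes I: "ideal I R" and x: "x \<in> carrier R" and s: "s \<in> carrier R" "s \<in> Units R"
    and 1: "s [^] q \<ominus> s \<in> I" and 2: "(x \<otimes> s) [^] (q::nat) \<ominus> x \<otimes> s \<in> I"
  shows "x [^] q \<ominus> x \<in> I"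
proof -
  interpret I: ideal I R by fact
  have c: "x [^] q \<in> carrier R" "s [^] q \<in> carrier R" using x s by auto
  have "s [^] q \<otimes> (x [^] q \<ominus> x) = (x [^] q \<otimes> s [^] q \<ominus> x \<otimes> s) \<ominus> x \<otimes> (s [^] q \<ominus> s)"
    using c x s(1) by algebra
  also have "\<dots> \<in> I"
    using 2 unfolding nat_pow_distrib[OF x s(1)] by (rule I.minus_mem) (rule I.I_l_closed[OF 1 x])
  finally have *: "s [^] q \<otimes> (x [^] q \<ominus> x) \<in> I" .
  have u: "s [^] q \<in> Units R" by (rule Units_pow_closed[OF s(2)])
  have "inv (s [^] q) \<otimes> (s [^] q \<otimes> (x [^] q \<ominus> x)) \<in> I" by (rule I.I_l_closed[OF *]) (use u in simp)
  moreover have "inv (s [^] q) \<otimes> (s [^] q \<otimes> (x [^] q \<ominus> x)) = x [^] q \<ominus> x"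
    using u c x by (simp add: m_assoc[symmetric])
  ultimately show ?thesis by simp
qed

locale prime_localization = ring_hom_cring D A \<phi> + dom: domain D + p: primeideal p D
  for D (structure) and A (structure) and \<phi> and p
begin

abbreviation "U \<equiv> carrier D - p"
abbreviation "Dp \<equiv> loc D U"
abbreviation "T \<equiv> \<phi> ` U"
abbreviation "Ap \<equiv> loc A T"
abbreviation "\<beta> \<equiv> loc_lift D U A T \<phi>"
abbreviation "fr \<equiv> loc_frac D U"
abbreviation "fa \<equiv> loc_frac A T"
abbreviation "E \<equiv> extended_ideal (loc_at D p) (loc_map D p) p"

lemma U_loc: "localization D U"
  by (rule R.localization_primeI[OF p.primeideal])

lemma localized: "localized_algebra D A \<phi> U"
  using U_loc ring_hom_cring_axioms by (simp add: localized_algebra_def)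

lemma zero_notin_U: "\<zero> \<notin> U"
  using p.zero_closed by simp

lemma Dp_domain: "domain Dp"
  by (rule dom.loc_domain(1)[OF U_loc zero_notin_U])

interpretation L: localization D U by (rule U_loc)
interpretation Dp: domain Dp by (rule Dp_domain)
interpretation d: ring_hom_cring D Dp "\<lambda>a. fr a \<one>" by (rule L.frac_hom)
interpretation M: localization A T by (rule localized_algebra.T_localization[OF localized])
interpretation Ap: cring Ap by (rule M.loc_cring)
interpretation a: ring_hom_cring A Ap "\<lambda>x. fa x \<one>\<^bsub>A\<^esub>" by (rule M.frac_hom)
interpretation b: ring_hom_cring Dp Ap \<beta>
  by (rule loc_lift_hom) (use U_loc localized_algebra.T_localization[OF localized] ring_hom_cring_axioms in auto)

lemma target: "int_poly_target Dp Ap \<beta>"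
  using Dp_domain b.ring_hom_cring_axioms by (simp add: int_poly_target_def)

interpretation Z: int_poly_target Dp Ap \<beta> by (rule target)

lemma beta_frac: "d \<in> carrier D \<Longrightarrow> s \<in> U \<Longrightarrow> \<beta> (fr d s) = fa (\<phi> d) (\<phi> s)"
  by (rule localized_algebra.beta_frac[OF localized])

lemma E_eq: "E = Idl\<^bsub>Dp\<^esub> ((\<lambda>a. fr a \<one>) ` p)"
  unfolding extended_ideal_def loc_at_def loc_map_def ..

lemma E_ideal: "ideal E Dp"
  unfolding E_eq by (rule Dp.genideal_ideal) (use p.a_subset d.hom_closed in blast)

interpretation E: ideal E Dp by (rule E_ideal)

text \<open>Saturation with respect to \<open>U\<close> adds nothing to \<open>p\<close>, because
  \<open>p\<close> is prime.\<close>

lemma fr_mem_E: "a \<in> carrier D \<Longrightarrow> s \<in> U \<Longrightarrow> fr a s \<in> E \<longleftrightarrow> a \<in> p"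
proof -
  assume a: "a \<in> carrier D" and s: "s \<in> U"
  have "Idl p = p" using R.genideal_minimal[OF p.is_ideal] R.genideal_self[of p] p.a_subset by blast
  then have "fr a s \<in> E \<longleftrightarrow> (\<exists>u\<in>U. u \<otimes> a \<in> p)"
    unfolding E_eq using L.frac_in_genideal_iff[OF p.a_subset a s] by simp
  also have "\<dots> \<longleftrightarrow> a \<in> p"
    using p.I_prime[OF _ a] p.I_l_closed[OF _ R.one_closed, of a] L.S_one by blast
  finally show ?thesis .
qed

lemma one_notin_E: "\<one>\<^bsub>Dp\<^esub> \<notin> E"
  unfolding L.loc_one using fr_mem_E[OF R.one_closed L.S_one] L.S_one by simp

lemma Units_Dp:
  assumes "y \<in> carrier Dp" "y \<notin> E"
  shows "y \<in> Units Dp"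
proof -
  obtain a s where as: "a \<in> carrier D" "s \<in> U" "y = fr a s" using assms(1) by (rule L.loc_cases)
  have a: "a \<in> U" using assms(2) fr_mem_E[OF as(1,2)] as by blast
  have sc: "s \<in> carrier D" using as(2) by simp
  have "fr (s \<otimes> a) (a \<otimes> s) = fr \<one> \<one>"
    by (rule L.frac_eqI) (use as(1) sc a L.S_mult[OF a as(2)] L.S_one in \<open>auto simp: R.m_comm\<close>)
  then have "fr s a \<otimes>\<^bsub>Dp\<^esub> y = \<one>\<^bsub>Dp\<^esub>"
    unfolding as(3) L.loc_one L.frac_mult[OF sc a as(1,2)] .
  moreover have "fr s a \<in> carrier Dp" using sc a by simp
  ultimately show ?thesis unfolding Units_def using assms(1) Dp.m_comm[OF assms(1)] by auto
qed

text \<open>A positive power of \<open>x\<close> stays in the maximal ideal \<open>E\<close>, so its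
  difference from 1 cannot lie there.\<close>

lemma power_minus_one_unit:
  assumes x: "x \<in> E" and k: "(k::nat) \<ge> 1"
  shows "x [^]\<^bsub>Dp\<^esub> k \<ominus>\<^bsub>Dp\<^esub> \<one>\<^bsub>Dp\<^esub> \<in> Units Dp"
proof (rule Units_Dp)
  have xc: "x \<in> carrier Dp" by (rule E.a_Hcarr[OF x])
  then show "x [^]\<^bsub>Dp\<^esub> k \<ominus>\<^bsub>Dp\<^esub> \<one>\<^bsub>Dp\<^esub> \<in> carrier Dp" by simp
  obtain m where m: "k = Suc m" using k that[of "k - 1"] by simp
  have pk: "x [^]\<^bsub>Dp\<^esub> k \<in> E" unfolding m Dp.nat_pow_Suc by (rule E.I_l_closed[OF x]) (use xc in simp)
  show "x [^]\<^bsub>Dp\<^esub> k \<ominus>\<^bsub>Dp\<^esub> \<one>\<^bsub>Dp\<^esub> \<notin> E"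
  proof
    assume "x [^]\<^bsub>Dp\<^esub> k \<ominus>\<^bsub>Dp\<^esub> \<one>\<^bsub>Dp\<^esub> \<in> E"
    with pk have "x [^]\<^bsub>Dp\<^esub> k \<ominus>\<^bsub>Dp\<^esub> (x [^]\<^bsub>Dp\<^esub> k \<ominus>\<^bsub>Dp\<^esub> \<one>\<^bsub>Dp\<^esub>) \<in> E" by (rule E.minus_mem)
    then show False using one_notin_E Dp.minus_minus_cancel[of "x [^]\<^bsub>Dp\<^esub> k" "\<one>\<^bsub>Dp\<^esub>"] xc by simp
  qed
qed

text \<open>Representatives of distinct residue classes differ by elements outside \<open>p\<close>,
  which become units in the localization.\<close>

lemma representatives:
  assumes "infinite (carrier (D Quot p)) \<or> n \<le> card (carrier (D Quot p))"
  shows "\<exists>xs. length xs = n \<and> set xs \<subseteq> carrier Dp \<and> sorted_wrt (\<lambda>x y. y \<ominus>\<^bsub>Dp\<^esub> x \<in> Units Dp) xs"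
proof -
  obtain F where F: "F \<subseteq> carrier (D Quot p)" "finite F" "card F = n"
    using assms infinite_arbitrarily_large obtain_subset_with_card_n by metis
  obtain Ks where Ks: "set Ks = F" "distinct Ks" using finite_distinct_list[OF F(2)] by metis
  define rep where "rep N = (SOME d. d \<in> carrier D \<and> N = p +> d)" for N
  have rep: "rep N \<in> carrier D \<and> N = p +> rep N" if N: "N \<in> F" for N
  proof -
    have "\<exists>d. d \<in> carrier D \<and> N = p +> d" using p.Quot_cases[OF subsetD[OF F(1) N]] by blast
    then show ?thesis unfolding rep_def by (rule someI_ex)
  qed
  have "fr (rep N) \<one> \<ominus>\<^bsub>Dp\<^esub> fr (rep M) \<one> \<in> Units Dp" if NM: "N \<in> F" "M \<in> F" "N \<noteq> M" for N M
  proof (rule Units_Dp)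
    have c: "rep N \<in> carrier D" "rep M \<in> carrier D" using rep NM by auto
    have e: "fr (rep N) \<one> \<ominus>\<^bsub>Dp\<^esub> fr (rep M) \<one> = fr (rep N \<ominus> rep M) \<one>"
      unfolding Dp.minus_eq R.minus_eq using c by simp
    show "fr (rep N) \<one> \<ominus>\<^bsub>Dp\<^esub> fr (rep M) \<one> \<in> carrier Dp" using c d.hom_closed by (intro Dp.minus_closed) auto
    have "rep N \<ominus> rep M \<notin> p" using p.rcos_eq_iff[OF c] rep[OF NM(1)] rep[OF NM(2)] NM(3) by metis
    then show "fr (rep N) \<one> \<ominus>\<^bsub>Dp\<^esub> fr (rep M) \<one> \<notin> E"
      unfolding e using fr_mem_E[OF _ L.S_one, of "rep N \<ominus> rep M"] c by simp
  qed
  note diff = this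
  have "sorted_wrt (\<lambda>x y. y \<ominus>\<^bsub>Dp\<^esub> x \<in> Units Dp) (map (\<lambda>N. fr (rep N) \<one>) Ks)"
    unfolding sorted_wrt_map
    unfolding sorted_wrt_iff_nth_less
  proof (intro allI impI)
    fix i j assume ij: "i < j" "j < length Ks"
    then have "Ks ! j \<in> F" "Ks ! i \<in> F" "Ks ! j \<noteq> Ks ! i"
      using nth_mem[of i Ks] nth_mem[of j Ks] nth_eq_iff_index_eq[OF Ks(2), of j i] unfolding Ks(1) by simp_all
    then show "fr (rep (Ks ! j)) \<one> \<ominus>\<^bsub>Dp\<^esub> fr (rep (Ks ! i)) \<one> \<in> Units Dp" by (rule diff)
  qed
  moreover have "length (map (\<lambda>N. fr (rep N) \<one>) Ks) = n" using distinct_card[OF Ks(2)] Ks(1) F(3) by simp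
  moreover have "set (map (\<lambda>N. fr (rep N) \<one>) Ks) \<subseteq> carrier Dp" using Ks(1) rep d.hom_closed by auto
  ultimately show ?thesis by blast
qed

text \<open>The denominators and the multiplier from equality of fractions all lie outside
  \<open>p\<close> and are collected in \<open>w\<close>; this brings divisibility back to
  \<open>D\<close>, where \<open>v_set\<close> is defined.\<close>

lemma divides_frac_iff:
  assumes "a \<in> carrier D" "s \<in> U" "b \<in> carrier D" "t \<in> U" "y \<in> carrier D"
  shows "fr b t divides\<^bsub>Dp\<^esub> (fr y \<one> \<otimes>\<^bsub>Dp\<^esub> fr a s) \<longleftrightarrow> (\<exists>w\<in>U. b divides (w \<otimes> (y \<otimes> a)))"
proof -
  have c: "s \<in> carrier D" "t \<in> carrier D" using assms by auto
  have ya: "fr y \<one> \<otimes>\<^bsub>Dp\<^esub> fr a s = fr (y \<otimes> a) s" using L.frac_mult[OF assms(5) L.S_one assms(1,2)] c by simp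
  show ?thesis unfolding ya
  proof
    assume "fr b t divides\<^bsub>Dp\<^esub> fr (y \<otimes> a) s"
    then obtain z where z: "z \<in> carrier Dp" "fr (y \<otimes> a) s = fr b t \<otimes>\<^bsub>Dp\<^esub> z" unfolding factor_def by blast
    obtain e v where e: "e \<in> carrier D" "v \<in> U" "z = fr e v" using z(1) by (rule L.loc_cases)
    have ev: "v \<in> carrier D" using e(2) by simp
    have "fr (y \<otimes> a) s = fr (b \<otimes> e) (t \<otimes> v)" using z(2) L.frac_mult[OF assms(3,4) e(1,2)] e(3) by simp
    then obtain u where u: "u \<in> U" "u \<otimes> ((t \<otimes> v) \<otimes> (y \<otimes> a)) = u \<otimes> (s \<otimes> (b \<otimes> e))"
      using L.frac_eq_iff[of "y \<otimes> a" s "b \<otimes> e" "t \<otimes> v"] assms e L.S_mult by auto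
    have uc: "u \<in> carrier D" using u(1) by simp
    have "(u \<otimes> (t \<otimes> v)) \<otimes> (y \<otimes> a) = b \<otimes> (u \<otimes> (s \<otimes> e))"
      using u(2) uc c assms(1,3,5) e(1) ev by (simp add: R.m_ac)
    then have "b divides ((u \<otimes> (t \<otimes> v)) \<otimes> (y \<otimes> a))" using uc c e(1) by (intro dividesI) auto
    moreover have "u \<otimes> (t \<otimes> v) \<in> U" by (intro L.S_mult u(1) assms(4) e(2))
    ultimately show "\<exists>w\<in>U. b divides (w \<otimes> (y \<otimes> a))" by blast
  next
    assume "\<exists>w\<in>U. b divides (w \<otimes> (y \<otimes> a))"
    then obtain w g where w: "w \<in> U" "g \<in> carrier D" "w \<otimes> (y \<otimes> a) = b \<otimes> g" unfolding factor_def by blast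
    have wc: "w \<in> carrier D" using w(1) by simp
    have "fr b t \<otimes>\<^bsub>Dp\<^esub> fr (t \<otimes> g) (w \<otimes> s) = fr (b \<otimes> (t \<otimes> g)) (t \<otimes> (w \<otimes> s))"
      using assms c w L.S_mult by (intro L.frac_mult) auto
    also have "\<dots> = fr (y \<otimes> a) s"
    proof (rule L.frac_eqI)
      have "s \<otimes> (b \<otimes> (t \<otimes> g)) = s \<otimes> (t \<otimes> (b \<otimes> g))" using c assms(3) w(2) by (simp add: R.m_ac)
      also have "\<dots> = t \<otimes> (w \<otimes> s) \<otimes> (y \<otimes> a)" unfolding w(3)[symmetric] using c wc assms(1,5) by (simp add: R.m_ac)
      finally show "s \<otimes> (b \<otimes> (t \<otimes> g)) = t \<otimes> (w \<otimes> s) \<otimes> (y \<otimes> a)" .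
      show "t \<otimes> (w \<otimes> s) \<in> U" by (intro L.S_mult assms(4,2) w(1))
    qed (use assms c w in auto)
    finally have "fr (y \<otimes> a) s = fr b t \<otimes>\<^bsub>Dp\<^esub> fr (t \<otimes> g) (w \<otimes> s)" ..
    moreover have "fr (t \<otimes> g) (w \<otimes> s) \<in> carrier Dp" using c w(2) L.S_mult[OF w(1) assms(2)] by simp
    ultimately show "fr b t divides\<^bsub>Dp\<^esub> fr (y \<otimes> a) s" by (intro dividesI)
  qed
qed

text \<open>A coefficient \<open>\<alpha> / \<gamma>\<close> outside \<open>D\<^sub>p\<close> is killed by a power of every element of \<open>p\<close>, because the
  powers of \<open>x \<in> p\<close> can be used as interpolation points; this forces \<open>p\<close> to be a \<open>t\<close>-ideal. If the residue
  field were infinite, interpolation points with invertible differences would exist.\<close>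
lemma t_maximal_if_not_polynomial:
  assumes f: "f \<in> carrier (int_poly Dp)" and nc: "up_ring.coeff (UP (quot_field Dp)) f i \<notin> quot_field_map Dp ` carrier Dp"
  shows "t_maximal D p \<and> finite_norm D p"
proof -
  interpret K: field "quot_field Dp" by (rule Dp.quot_field_field)
  interpret iota: ring_hom_cring Dp "quot_field Dp" "quot_field_map Dp" by (rule Dp.iota_hom)
  interpret P: UP_domain "quot_field Dp" "UP (quot_field Dp)" by unfold_locales
  let ?c = "up_ring.coeff (UP (quot_field Dp)) f i"
  let ?N = "carrier Dp - {\<zero>\<^bsub>Dp\<^esub>}"
  have fP: "f \<in> carrier (UP (quot_field Dp))" using f unfolding Z.int_poly_carrier by blast
  have cK: "?c \<in> carrier (quot_field Dp)" using fP by simp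
  obtain \<alpha> \<gamma> where \<alpha>: "\<alpha> \<in> carrier Dp" and \<gamma>: "\<gamma> \<in> ?N" and c: "?c = loc_frac Dp ?N \<alpha> \<gamma>"
    using cK by (rule Dp.K_cases)
  obtain a s where a: "a \<in> carrier D" "s \<in> U" "\<alpha> = fr a s" using \<alpha> by (rule L.loc_cases)
  have \<gamma>c: "\<gamma> \<in> carrier Dp" using \<gamma> by blast
  obtain b t where b: "b \<in> carrier D" "t \<in> U" "\<gamma> = fr b t" using \<gamma>c by (rule L.loc_cases)
  have b0: "b \<noteq> \<zero>" using \<gamma> L.frac_zero[OF b(2)] b(3) by blast
  \<comment> \<open>With the coefficient written as \<open>\<alpha> / \<gamma>\<close>, being
    cleared by \<open>r\<close> is a divisibility statement, the form that
    \<open>t_maximal_if_locally_killed\<close> expects.\<close>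
  have mult: "\<gamma> divides\<^bsub>Dp\<^esub> (\<alpha> \<otimes>\<^bsub>Dp\<^esub> r) \<longleftrightarrow> quot_field_map Dp r \<otimes>\<^bsub>quot_field Dp\<^esub> ?c \<in> quot_field_map Dp ` carrier Dp"
    if r: "r \<in> carrier Dp" for r
  proof -
    have "quot_field_map Dp r \<otimes>\<^bsub>quot_field Dp\<^esub> ?c = loc_frac Dp ?N (\<alpha> \<otimes>\<^bsub>Dp\<^esub> r) \<gamma>"
      using K.m_comm[OF iota.hom_closed[OF r] cK] Dp.frac_iota_mult[OF \<alpha> \<gamma> r] unfolding c by simp
    then show ?thesis using Dp.frac_in_iota_iff[OF Dp.m_closed[OF \<alpha> r] \<gamma>] by simp
  qed
  have nd: "\<not> \<gamma> divides\<^bsub>Dp\<^esub> \<alpha>"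
    using nc Dp.frac_in_iota_iff[OF \<alpha> \<gamma>] unfolding c by blast
  have ndt: "\<not> b divides (w \<otimes> a)" if w: "w \<in> U" for w
  proof
    assume "b divides (w \<otimes> a)"
    then have "b divides (w \<otimes> (\<one> \<otimes> a))" using a(1) by simp
    then have "fr b t divides\<^bsub>Dp\<^esub> (fr \<one> \<one> \<otimes>\<^bsub>Dp\<^esub> fr a s)"
      using divides_frac_iff[OF a(1,2) b(1,2) R.one_closed] w by blast
    then show False using nd \<alpha> unfolding L.loc_one[symmetric] a(3)[symmetric] b(3)[symmetric] by simp
  qed
  have unit_cancel: "\<gamma> divides\<^bsub>Dp\<^esub> y"
    if u: "u \<in> Units Dp" and y: "y \<in> carrier Dp" and uy: "\<gamma> divides\<^bsub>Dp\<^esub> (u \<otimes>\<^bsub>Dp\<^esub> y)" for u y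
  proof -
    have uc: "u \<in> carrier Dp" "inv\<^bsub>Dp\<^esub> u \<in> carrier Dp" using u by auto
    have "\<gamma> divides\<^bsub>Dp\<^esub> (inv\<^bsub>Dp\<^esub> u \<otimes>\<^bsub>Dp\<^esub> (u \<otimes>\<^bsub>Dp\<^esub> y))"
      by (rule Dp.divides_prod_l[OF \<gamma>c _ uc(2) uy]) (use uc y in simp)
    then show ?thesis using u uc y by (simp add: Dp.m_assoc[symmetric])
  qed
  have kill: "\<exists>n::nat. \<exists>w\<in>U. b divides (w \<otimes> (r [^] n \<otimes> a))" if r: "r \<in> p" for r
  proof -
    have rc: "r \<in> carrier D" by (rule p.a_Hcarr[OF r])
    let ?x = "fr r \<one>"
    have x: "?x \<in> carrier Dp" "?x \<in> E" using d.hom_closed[OF rc] fr_mem_E[OF rc L.S_one] r by blast+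
    obtain u n where u: "u \<in> Units Dp"
      and n: "\<And>i. quot_field_map Dp (u \<otimes>\<^bsub>Dp\<^esub> ?x [^]\<^bsub>Dp\<^esub> (n::nat)) \<otimes>\<^bsub>quot_field Dp\<^esub> up_ring.coeff (UP (quot_field Dp)) f i
        \<in> quot_field_map Dp ` carrier Dp"
      using Z.int_poly_power_denominator[OF f x(1) power_minus_one_unit[OF x(2)]] by blast
    have uc: "u \<in> carrier Dp" and xn: "?x [^]\<^bsub>Dp\<^esub> n \<in> carrier Dp" using u x(1) by auto
    have "\<gamma> divides\<^bsub>Dp\<^esub> (\<alpha> \<otimes>\<^bsub>Dp\<^esub> (u \<otimes>\<^bsub>Dp\<^esub> ?x [^]\<^bsub>Dp\<^esub> n))" using mult[OF Dp.m_closed[OF uc xn]] n by blast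
    then have "\<gamma> divides\<^bsub>Dp\<^esub> (u \<otimes>\<^bsub>Dp\<^esub> (?x [^]\<^bsub>Dp\<^esub> n \<otimes>\<^bsub>Dp\<^esub> \<alpha>))" using uc xn \<alpha> by (simp add: Dp.m_ac)
    then have "\<gamma> divides\<^bsub>Dp\<^esub> (?x [^]\<^bsub>Dp\<^esub> n \<otimes>\<^bsub>Dp\<^esub> \<alpha>)" by (rule unit_cancel[OF u Dp.m_closed[OF xn \<alpha>]])
    then have "fr b t divides\<^bsub>Dp\<^esub> (fr (r [^] n) \<one> \<otimes>\<^bsub>Dp\<^esub> fr a s)"
      unfolding a(3) b(3) d.hom_pow[OF rc] .
    then show ?thesis
      using divides_frac_iff[OF a(1,2) b(1,2), of "r [^] n"] rc by blast
  qed
  have "finite_norm D p"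
  proof (rule ccontr)
    assume "\<not> finite_norm D p"
    then have "infinite (carrier (D Quot p))" unfolding finite_norm_def .
    then obtain xs where xs: "length xs = Suc (deg (quot_field Dp) f)" "set xs \<subseteq> carrier Dp"
      "sorted_wrt (\<lambda>x y. y \<ominus>\<^bsub>Dp\<^esub> x \<in> Units Dp) xs"
      using representatives[of "Suc (deg (quot_field Dp) f)"] by blast
    have "\<exists>u\<in>Units Dp. \<forall>i. quot_field_map Dp u \<otimes>\<^bsub>quot_field Dp\<^esub> up_ring.coeff (UP (quot_field Dp)) f i
        \<in> quot_field_map Dp ` carrier Dp"
      by (rule Z.int_poly_denominator[OF f _ _ _ xs(2,3,1)]) (auto intro: Dp.Units_closed)
    then obtain u where u: "u \<in> Units Dp" "quot_field_map Dp u \<otimes>\<^bsub>quot_field Dp\<^esub> ?c \<in> quot_field_map Dp ` carrier Dp" by blast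
    then have "\<gamma> divides\<^bsub>Dp\<^esub> (\<alpha> \<otimes>\<^bsub>Dp\<^esub> u)" using mult by blast
    then have "\<gamma> divides\<^bsub>Dp\<^esub> \<alpha>" using unit_cancel[OF u(1) \<alpha>] Dp.m_comm[OF \<alpha>, of u] u(1) by auto
    then show False using nd by blast
  qed
  \<comment> \<open>If \<open>p\<close> were zero, \<open>b\<close> itself would lie outside
    \<open>p\<close> and clear the fraction, against \<open>ndt\<close>.\<close>
  moreover have "p \<noteq> {\<zero>}"
  proof
    assume "p = {\<zero>}"
    then have "b \<in> U" using b(1) b0 by blast
    moreover have "b divides (b \<otimes> a)" using a(1) by (intro dividesI) auto
    ultimately show False using ndt by blast
  qed
  moreover have "b \<in> carrier D - {\<zero>}" using b(1) b0 by blast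
  ultimately show ?thesis
    using dom.t_maximal_if_locally_killed[OF p.primeideal _ _ a(1) _ ndt kill] by blast
qed

text \<open>The generator is nonzero because \<open>p\<close> contains a nonzero element and the map
  to the localization is injective.\<close>

lemma E_generator:
  assumes "p \<noteq> {\<zero>}" "principalideal E (loc_at D p)"
  shows "\<exists>\<pi>\<in>carrier Dp. \<pi> \<noteq> \<zero>\<^bsub>Dp\<^esub> \<and> E = PIdl\<^bsub>Dp\<^esub> \<pi>"
proof -
  obtain \<pi> where pi: "\<pi> \<in> carrier Dp" "E = Idl\<^bsub>Dp\<^esub> {\<pi>}"
    using principalideal.generate[OF assms(2)] unfolding loc_at_def by blast
  have e: "E = PIdl\<^bsub>Dp\<^esub> \<pi>" using pi(2) Dp.cgenideal_eq_genideal[OF pi(1)] by simp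
  obtain x where x: "x \<in> p" "x \<noteq> \<zero>" using assms(1) p.zero_closed by blast
  have xc: "x \<in> carrier D" by (rule p.a_Hcarr[OF x(1)])
  have "fr x \<one> \<in> PIdl\<^bsub>Dp\<^esub> \<pi>" using fr_mem_E[OF xc L.S_one] x(1) e by simp
  then obtain r where r: "r \<in> carrier Dp" "fr x \<one> = r \<otimes>\<^bsub>Dp\<^esub> \<pi>" unfolding Dp.mem_PIdl_iff by blast
  have "fr x \<one> \<noteq> fr \<zero> \<one>"
  proof
    assume "fr x \<one> = fr \<zero> \<one>"
    then have "x = \<zero>" by (rule inj_onD[OF dom.loc_domain(2)[OF U_loc zero_notin_U] _ xc R.zero_closed])
    then show False using x(2) by simp
  qed
  then have "r \<otimes>\<^bsub>Dp\<^esub> \<pi> \<noteq> \<zero>\<^bsub>Dp\<^esub>" unfolding r(2) L.frac_zero[OF L.S_one] .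
  then have "\<pi> \<noteq> \<zero>\<^bsub>Dp\<^esub>" using Dp.r_null[OF r(1)] by metis
  then show ?thesis using pi(1) e by blast
qed

lemma finite_residueI: "finite_norm D p \<Longrightarrow> finite_residue D A \<phi> p"
  by (intro finite_residue.intro finite_residue_axioms.intro ring_hom_cring_axioms
      R.finite_prime_imp_maximal[OF p.primeideal])

lemma exists_uniformizer:
  assumes fin: "finite_norm D p" and pi: "\<pi> \<in> carrier Dp" "\<pi> \<noteq> \<zero>\<^bsub>Dp\<^esub>" "E = PIdl\<^bsub>Dp\<^esub> \<pi>"
  shows "\<exists>xs. uniformizer Dp \<pi> (ideal_norm D p) xs"
proof -
  interpret f: finite_residue D A \<phi> p by (rule finite_residueI[OF fin])
  interpret h: ring_hom_ring D "D Quot p" "(+>) p" by (rule p.rcos_ring_hom_ring)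
  let ?q = "ideal_norm D p"
  have "p +> add_pow D n \<one> = add_pow (D Quot p) n \<one>\<^bsub>D Quot p\<^esub>" for n :: nat
  proof (induction n)
    case (Suc n)
    have "add_pow D n \<one> \<in> carrier D" by simp
    then show ?case using Suc h.hom_add[of "add_pow D n \<one>" \<one>] by simp
  qed simp
  \<comment> \<open>The additive group of \<open>D / p\<close> has order \<open>q\<close>, so
    \<open>q\<close> times 1 vanishes in it.\<close>
  also have "add_pow (D Quot p) ?q \<one>\<^bsub>D Quot p\<^esub> = \<zero>\<^bsub>D Quot p\<^esub>"
    using group.pow_order_eq_1[OF f.k.a_group, of "\<one>\<^bsub>D Quot p\<^esub>"]
    unfolding add_pow_def order_def f.fin_k(2)[symmetric] by simp
  finally have "add_pow D ?q \<one> \<in> p" by (simp add: Quot_zero p.rcos_eq_self_iff)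
  moreover have "add_pow Dp n \<one>\<^bsub>Dp\<^esub> = fr (add_pow D n \<one>) \<one>" for n :: nat
  proof (induction n)
    case (Suc n)
    have "add_pow D n \<one> \<in> carrier D" by simp
    then show ?case using Suc d.hom_add[of "add_pow D n \<one>" \<one>] by simp
  qed simp
  ultimately have q_mem: "add_pow Dp ?q \<one>\<^bsub>Dp\<^esub> \<in> E"
    using fr_mem_E[OF _ L.S_one, of "add_pow D ?q \<one>"] by simp
  have fr1: "fr y \<one> [^]\<^bsub>Dp\<^esub> ?q \<ominus>\<^bsub>Dp\<^esub> fr y \<one> \<in> E" if y: "y \<in> carrier D" for y
  proof -
    have "fr y \<one> [^]\<^bsub>Dp\<^esub> ?q \<ominus>\<^bsub>Dp\<^esub> fr y \<one> = fr (y [^] ?q \<ominus> y) \<one>"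
      unfolding Dp.minus_eq R.minus_eq using y by simp
    then show ?thesis using fr_mem_E[OF _ L.S_one, of "y [^] ?q \<ominus> y"] f.frobenius_D[OF y] y by simp
  qed
  \<comment> \<open>For numerator and denominator the congruence comes from the finite field
    \<open>D / p\<close>; \<open>frobenius_mem_denominator\<close> passes to the fraction.\<close>
  have frob: "x [^]\<^bsub>Dp\<^esub> ?q \<ominus>\<^bsub>Dp\<^esub> x \<in> E" if x: "x \<in> carrier Dp" for x
  proof -
    obtain y s where y: "y \<in> carrier D" "s \<in> U" "x = fr y s" using x by (rule L.loc_cases)
    have s: "s \<in> carrier D" using y(2) by blast
    have "x \<otimes>\<^bsub>Dp\<^esub> fr s \<one> = fr (s \<otimes> y) (s \<otimes> \<one>)"
      unfolding y(3) L.frac_mult[OF y(1,2) s L.S_one] using y(1) s by (simp add: R.m_comm)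
    also have "\<dots> = fr y \<one>" by (rule L.frac_cancel[OF y(1) L.S_one y(2)])
    finally have "x \<otimes>\<^bsub>Dp\<^esub> fr s \<one> = fr y \<one>" .
    then show ?thesis
      using Dp.frobenius_mem_denominator[OF E_ideal x d.hom_closed[OF s] L.frac_Units[OF y(2)] fr1[OF s]] fr1[OF y(1)]
      by simp
  qed
  obtain xs where "length xs = ?q" "set xs \<subseteq> carrier Dp" "sorted_wrt (\<lambda>x y. y \<ominus>\<^bsub>Dp\<^esub> x \<in> Units Dp) xs"
    using representatives[of ?q] f.fin_k(2) by auto
  then have "uniformizer Dp \<pi> ?q xs"
    using pi f.q_ge_2 q_mem frob Dp_domain unfolding uniformizer_def uniformizer_axioms_def by simp
  then show ?thesis by blast
qed

text \<open>In \<open>Ap\<close> each \<open>\<phi> d\<close> with \<open>d\<close> in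
  \<open>p\<close> becomes a multiple of \<open>\<beta> \<pi>\<close>, so \<open>J\<close> lands in
  a principal ideal \<open>I\<close>. The congruence then holds modulo \<open>I\<close> for elements
  of \<open>A\<close>, and \<open>frobenius_mem_denominator\<close> extends it to fractions.\<close>

lemma frobenius_if_power_congruence:
  assumes fin: "finite_norm D p" and pc: "power_congruence D p A \<phi>"
    and pi: "\<pi> \<in> carrier Dp" "E = PIdl\<^bsub>Dp\<^esub> \<pi>" and x: "x \<in> carrier Ap"
  shows "\<exists>y\<in>carrier Ap. x [^]\<^bsub>Ap\<^esub> ideal_norm D p = x \<oplus>\<^bsub>Ap\<^esub> \<beta> \<pi> \<otimes>\<^bsub>Ap\<^esub> y"
proof -
  interpret f: finite_residue D A \<phi> p by (rule finite_residueI[OF fin])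
  let ?q = "ideal_norm D p"
  define I where "I = PIdl\<^bsub>Ap\<^esub> (\<beta> \<pi>)"
  have bp: "\<beta> \<pi> \<in> carrier Ap" by (rule b.hom_closed[OF pi(1)])
  have I: "ideal I Ap" unfolding I_def by (rule Ap.cgenideal_ideal[OF bp])
  have V: "ideal {r \<in> carrier A. fa r \<one>\<^bsub>A\<^esub> \<in> I} A" by (rule a.ring.ideal_vimage[OF I])
  have "\<phi> ` p \<subseteq> {r \<in> carrier A. fa r \<one>\<^bsub>A\<^esub> \<in> I}"
  proof (rule image_subsetI)
    fix y assume y: "y \<in> p"
    have yc: "y \<in> carrier D" by (rule p.a_Hcarr[OF y])
    have "fr y \<one> \<in> PIdl\<^bsub>Dp\<^esub> \<pi>" using fr_mem_E[OF yc L.S_one] y pi(2) by simp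
    then obtain r where r: "r \<in> carrier Dp" "fr y \<one> = r \<otimes>\<^bsub>Dp\<^esub> \<pi>" unfolding Dp.mem_PIdl_iff by blast
    have "fa (\<phi> y) \<one>\<^bsub>A\<^esub> = \<beta> (fr y \<one>)" using beta_frac[OF yc L.S_one] by simp
    also have "\<dots> = \<beta> r \<otimes>\<^bsub>Ap\<^esub> \<beta> \<pi>" unfolding r(2) by (rule b.hom_mult[OF r(1) pi(1)])
    finally show "\<phi> y \<in> {r \<in> carrier A. fa r \<one>\<^bsub>A\<^esub> \<in> I}"
      using b.hom_closed[OF r(1)] yc unfolding I_def Ap.mem_PIdl_iff by blast
  qed
  then have JV: "f.J \<subseteq> {r \<in> carrier A. fa r \<one>\<^bsub>A\<^esub> \<in> I}" using f.J_subset_iff[OF V] by blast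
  have fa1: "fa y \<one>\<^bsub>A\<^esub> [^]\<^bsub>Ap\<^esub> ?q \<ominus>\<^bsub>Ap\<^esub> fa y \<one>\<^bsub>A\<^esub> \<in> I" if y: "y \<in> carrier A" for y
  proof -
    have "fa y \<one>\<^bsub>A\<^esub> [^]\<^bsub>Ap\<^esub> ?q \<ominus>\<^bsub>Ap\<^esub> fa y \<one>\<^bsub>A\<^esub> = fa (y [^]\<^bsub>A\<^esub> ?q \<ominus>\<^bsub>A\<^esub> y) \<one>\<^bsub>A\<^esub>"
      unfolding Ap.minus_eq S.minus_eq using y by simp
    moreover have "y [^]\<^bsub>A\<^esub> ?q \<ominus>\<^bsub>A\<^esub> y \<in> f.J" using pc y unfolding power_congruence_def by blast
    ultimately show ?thesis using JV by auto
  qed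
  obtain y t where y: "y \<in> carrier A" "t \<in> T" "x = fa y t" using x by (rule M.loc_cases)
  have t: "t \<in> carrier A" using y(2) by auto
  have "x \<otimes>\<^bsub>Ap\<^esub> fa t \<one>\<^bsub>A\<^esub> = fa (t \<otimes>\<^bsub>A\<^esub> y) (t \<otimes>\<^bsub>A\<^esub> \<one>\<^bsub>A\<^esub>)"
    unfolding y(3) M.frac_mult[OF y(1,2) t M.S_one] using y(1) t by (simp add: S.m_comm)
  also have "\<dots> = fa y \<one>\<^bsub>A\<^esub>" by (rule M.frac_cancel[OF y(1) M.S_one y(2)])
  finally have "x \<otimes>\<^bsub>Ap\<^esub> fa t \<one>\<^bsub>A\<^esub> = fa y \<one>\<^bsub>A\<^esub>" .
  then have "x [^]\<^bsub>Ap\<^esub> ?q \<ominus>\<^bsub>Ap\<^esub> x \<in> I"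
    using Ap.frobenius_mem_denominator[OF I x a.hom_closed[OF t] M.frac_Units[OF y(2)] fa1[OF t]] fa1[OF y(1)]
    by simp
  then obtain r where r: "r \<in> carrier Ap" "x [^]\<^bsub>Ap\<^esub> ?q \<ominus>\<^bsub>Ap\<^esub> x = r \<otimes>\<^bsub>Ap\<^esub> \<beta> \<pi>"
    unfolding I_def Ap.mem_PIdl_iff by blast
  have "x [^]\<^bsub>Ap\<^esub> ?q = (x [^]\<^bsub>Ap\<^esub> ?q \<ominus>\<^bsub>Ap\<^esub> x) \<oplus>\<^bsub>Ap\<^esub> x"
    using Ap.minus_add_cancel[OF Ap.nat_pow_closed[OF x] x] by simp
  also have "\<dots> = x \<oplus>\<^bsub>Ap\<^esub> \<beta> \<pi> \<otimes>\<^bsub>Ap\<^esub> r"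
    unfolding r(2) using x r(1) bp by (simp add: Ap.a_comm Ap.m_comm)
  finally show ?thesis using r(1) by blast
qed

lemma WPC_localization:
  assumes "t_maximal D p \<Longrightarrow> finite_norm D p \<Longrightarrow>
    principalideal E (loc_at D p) \<and> power_congruence D p A \<phi>"
  shows "WPC (loc_at D p) Ap \<beta>"
proof (cases "\<exists>f\<in>carrier (int_poly Dp). \<exists>i. up_ring.coeff (UP (quot_field Dp)) f i \<notin> quot_field_map Dp ` carrier Dp")
  case False
  then have c: "up_ring.coeff (UP (quot_field Dp)) f i \<in> quot_field_map Dp ` carrier Dp"
    if "f \<in> carrier (int_poly Dp)" for f i using that by blast
  show ?thesis unfolding WPC_def loc_at_def by (intro ballI Z.hom_if_int_poly_coeffs c)
next
  case True
  then have tm: "t_maximal D p" "finite_norm D p" using t_maximal_if_not_polynomial by blast+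
  have "p \<noteq> {\<zero>}" using tm(1) unfolding t_maximal_def proper_t_ideal_def by blast
  then obtain \<pi> where pi: "\<pi> \<in> carrier Dp" "\<pi> \<noteq> \<zero>\<^bsub>Dp\<^esub>" "E = PIdl\<^bsub>Dp\<^esub> \<pi>"
    using E_generator assms[OF tm] by blast
  obtain xs where u: "uniformizer Dp \<pi> (ideal_norm D p) xs" using exists_uniformizer[OF tm(2) pi] by blast
  have "\<pi> \<in> E" unfolding pi(3) by (rule Dp.cgenideal_self[OF pi(1)])
  then have "uniformizer_target Dp Ap \<beta> \<pi> (ideal_norm D p) xs"
    using target u power_minus_one_unit frobenius_if_power_congruence[OF tm(2) _ pi(1,3)] assms[OF tm]
    unfolding uniformizer_target_def uniformizer_target_axioms_def by simp
  then show ?thesis unfolding WPC_def loc_at_def by (intro ballI uniformizer_target.hom_exists)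
qed

text \<open>All denominators and multipliers in the relation over \<open>Ap\<close> are images of
  elements outside \<open>p\<close>; their product is the image of a single \<open>w\<close> outside
  \<open>p\<close> with \<open>\<phi> w\<close> times \<open>x^q - x\<close> in
  \<open>J\<close>.\<close>

lemma power_congruence_if_WPC:
  assumes tm: "t_maximal D p" "finite_norm D p" and E: "principalideal E (loc_at D p)" and W: "WPC (loc_at D p) Ap \<beta>"
  shows "power_congruence D p A \<phi>"
  unfolding power_congruence_def
proof
  interpret f: finite_residue D A \<phi> p by (rule finite_residueI[OF tm(2)])
  let ?q = "ideal_norm D p"
  have "p \<noteq> {\<zero>}" using tm(1) unfolding t_maximal_def proper_t_ideal_def by blast
  then obtain \<pi> where pi: "\<pi> \<in> carrier Dp" "\<pi> \<noteq> \<zero>\<^bsub>Dp\<^esub>" "E = PIdl\<^bsub>Dp\<^esub> \<pi>"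
    using E_generator E by blast
  obtain xs where u: "uniformizer Dp \<pi> ?q xs" using exists_uniformizer[OF tm(2) pi] by blast
  obtain e s where e: "e \<in> carrier D" "s \<in> U" "\<pi> = fr e s" using pi(1) by (rule L.loc_cases)
  have "\<pi> \<in> E" unfolding pi(3) by (rule Dp.cgenideal_self[OF pi(1)])
  then have ep: "e \<in> p" using fr_mem_E[OF e(1,2)] e(3) by simp
  have sT: "\<phi> s \<in> T" and sc: "s \<in> carrier D" using e(2) by blast+
  fix x assume x: "x \<in> carrier A"
  define z where "z = x [^]\<^bsub>A\<^esub> ?q \<ominus>\<^bsub>A\<^esub> x"
  have zc: "z \<in> carrier A" unfolding z_def using x by simp
  have xc: "fa x \<one>\<^bsub>A\<^esub> \<in> carrier Ap" by (rule a.hom_closed[OF x])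
  obtain c where c: "c \<in> carrier Ap" "fa x \<one>\<^bsub>A\<^esub> [^]\<^bsub>Ap\<^esub> ?q = fa x \<one>\<^bsub>A\<^esub> \<oplus>\<^bsub>Ap\<^esub> \<beta> \<pi> \<otimes>\<^bsub>Ap\<^esub> c"
    using Z.WPC_frobenius[OF W[unfolded loc_at_def] pi(1,2) uniformizer.frobenius[OF u] xc] by blast
  obtain y t where y: "y \<in> carrier A" "t \<in> T" "c = fa y t" using c(1) by (rule M.loc_cases)
  have tc: "t \<in> carrier A" using y(2) by auto
  have pc: "\<beta> \<pi> \<otimes>\<^bsub>Ap\<^esub> c \<in> carrier Ap" using b.hom_closed[OF pi(1)] c(1) by simp
  have ec: "\<phi> e \<in> carrier A" "\<phi> s \<in> carrier A" using e(1) sc by simp_all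
  have "fa z \<one>\<^bsub>A\<^esub> = fa x \<one>\<^bsub>A\<^esub> [^]\<^bsub>Ap\<^esub> ?q \<ominus>\<^bsub>Ap\<^esub> fa x \<one>\<^bsub>A\<^esub>"
    unfolding z_def Ap.minus_eq S.minus_eq using x by simp
  also have "\<dots> = (\<beta> \<pi> \<otimes>\<^bsub>Ap\<^esub> c \<oplus>\<^bsub>Ap\<^esub> fa x \<one>\<^bsub>A\<^esub>) \<ominus>\<^bsub>Ap\<^esub> fa x \<one>\<^bsub>A\<^esub>"
    unfolding c(2) Ap.a_comm[OF xc pc] ..
  also have "\<dots> = \<beta> \<pi> \<otimes>\<^bsub>Ap\<^esub> c" by (rule Ap.add_minus_cancel[OF pc xc])
  also have "\<dots> = fa (\<phi> e \<otimes>\<^bsub>A\<^esub> y) (\<phi> s \<otimes>\<^bsub>A\<^esub> t)"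
    unfolding e(3) beta_frac[OF e(1,2)] y(3) by (rule M.frac_mult[OF ec(1) sT y(1,2)])
  finally obtain v where v: "v \<in> T"
    "v \<otimes>\<^bsub>A\<^esub> ((\<phi> s \<otimes>\<^bsub>A\<^esub> t) \<otimes>\<^bsub>A\<^esub> z) = v \<otimes>\<^bsub>A\<^esub> (\<one>\<^bsub>A\<^esub> \<otimes>\<^bsub>A\<^esub> (\<phi> e \<otimes>\<^bsub>A\<^esub> y))"
    using M.frac_eq_iff[OF zc M.S_one S.m_closed[OF ec(1) y(1)] M.S_mult[OF sT y(2)]] by blast
  have vc: "v \<in> carrier A" using v(1) by auto
  obtain w where w: "w \<in> U" "\<phi> w = v \<otimes>\<^bsub>A\<^esub> (\<phi> s \<otimes>\<^bsub>A\<^esub> t)"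
    using M.S_mult[OF v(1) M.S_mult[OF sT y(2)]] by auto
  have wc: "w \<in> carrier D" using w(1) by blast
  have "\<phi> w \<otimes>\<^bsub>A\<^esub> z = (v \<otimes>\<^bsub>A\<^esub> y) \<otimes>\<^bsub>A\<^esub> \<phi> e"
    unfolding w(2) using v(2) vc ec tc y(1) zc by (simp add: S.m_ac)
  then have wz: "\<phi> w \<otimes>\<^bsub>A\<^esub> z \<in> f.J" using f.J.I_l_closed[OF f.phi_mem_J[OF ep] S.m_closed[OF vc y(1)]] by simp
  obtain g where g: "g \<in> carrier D" "g \<otimes> w \<ominus> \<one> \<in> p" using f.inverse_mod_p[OF wc] w(1) by blast
  have "\<phi> (g \<otimes> w \<ominus> \<one>) = \<phi> g \<otimes>\<^bsub>A\<^esub> \<phi> w \<ominus>\<^bsub>A\<^esub> \<one>\<^bsub>A\<^esub>"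
    unfolding R.minus_eq S.minus_eq using g(1) wc by simp
  \<comment> \<open>With \<open>g\<close> inverse to \<open>w\<close> modulo \<open>p\<close>, both
    terms of \<open>z = g (w z) - z (g w - 1)\<close> lie in \<open>J\<close>.\<close>
  then have "z = \<phi> g \<otimes>\<^bsub>A\<^esub> (\<phi> w \<otimes>\<^bsub>A\<^esub> z) \<ominus>\<^bsub>A\<^esub> z \<otimes>\<^bsub>A\<^esub> \<phi> (g \<otimes> w \<ominus> \<one>)"
    using hom_closed[OF g(1)] hom_closed[OF wc] zc by (simp del: hom_closed) algebra
  also have "\<dots> \<in> f.J"
    by (rule f.J.minus_mem[OF f.J.I_l_closed[OF wz hom_closed[OF g(1)]] f.J.I_l_closed[OF f.phi_mem_J[OF g(2)] zc]])
  finally show "x [^]\<^bsub>A\<^esub> ?q \<ominus>\<^bsub>A\<^esub> x \<in> f.J" unfolding z_def .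
qed

end

section \<open>Passage to all primes and assembly of the equivalences\<close>

lemma (in finite_residue) power_congruence_iff_reduction_congruence:
  "power_congruence D p A \<phi> \<longleftrightarrow> power_congruence D p (A Quot J) (reduction_map A \<phi> p)"
  using power_congruence_iff_reduction
    finite_residue.power_congruence_iff_zero[OF reduction_finite_residue reduction_extended_ideal] by simp

lemma (in ring_hom_cring) locally_WPC_iff_power_congruence:
  assumes "domain R"
    and princ: "\<And>p. t_maximal R p \<Longrightarrow> finite_norm R p \<Longrightarrow>
      principalideal (extended_ideal (loc_at R p) (loc_map R p) p) (loc_at R p)"
  shows "locally_WPC R S h \<longleftrightarrow> (\<forall>p. t_maximal R p \<and> finite_norm R p \<longrightarrow> power_congruence R p S h)"
proof -
  have loc: "prime_localization R S h p" if "primeideal p R" for p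
    by (intro prime_localization.intro ring_hom_cring_axioms assms(1) that)
  show ?thesis unfolding locally_WPC_iff
  proof (intro iffI allI impI)
    fix p assume W: "\<forall>p. primeideal p R \<longrightarrow>
        WPC (loc_at R p) (loc S (h ` (carrier R - p))) (loc_lift R (carrier R - p) S (h ` (carrier R - p)) h)"
      and tm: "t_maximal R p \<and> finite_norm R p"
    have p: "primeideal p R" using domain.t_maximal_prime[OF assms(1)] tm by blast
    show "power_congruence R p S h"
      using prime_localization.power_congruence_if_WPC[OF loc[OF p] _ _ princ] tm W[rule_format, OF p] by blast
  next
    fix p assume pc: "\<forall>p. t_maximal R p \<and> finite_norm R p \<longrightarrow> power_congruence R p S h" and p: "primeideal p R"
    show "WPC (loc_at R p) (loc S (h ` (carrier R - p))) (loc_lift R (carrier R - p) S (h ` (carrier R - p)) h)"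
      by (rule prime_localization.WPC_localization[OF loc[OF p]]) (intro conjI princ pc[rule_format])
  qed
qed

theorem theorem7p5:
  fixes D :: "'a ring" and A :: "'b ring" and \<phi> :: "'a \<Rightarrow> 'b"
  assumes "domain D"
    and "ring_hom_cring D A \<phi>"
    and "\<And>p. t_maximal D p \<Longrightarrow> finite_norm D p \<Longrightarrow>
           principalideal (extended_ideal (loc_at D p) (loc_map D p) p) (loc_at D p) \<and>
           height (loc_at D p) (extended_ideal (loc_at D p) (loc_map D p) p) < \<infinity>"
  shows
    "(locally_WPC D A \<phi> \<longleftrightarrow>
       (\<forall>p. t_maximal D p \<and> finite_norm D p \<longrightarrow>
          power_congruence D p A \<phi>))
     \<and>
     (\<forall>p. t_maximal D p \<and> finite_norm D p \<longrightarrow>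
        (power_congruence D p A \<phi> \<longleftrightarrow> (\<forall>x\<in>carrier (reduction A \<phi> p). x [^]\<^bsub>reduction A \<phi> p\<^esub> ideal_norm D p = x))
      \<and> (power_congruence D p A \<phi> \<longleftrightarrow> locally_isomorphic_to_residue D p (reduction A \<phi> p) (reduction_map A \<phi> p))
      \<and> (power_congruence D p A \<phi> \<longleftrightarrow>
           reduced_ring (reduction A \<phi> p) \<and>
           (\<forall>P. primeideal P (reduction A \<phi> p) \<longrightarrow>
              alg_isomorphic D
                (residue_field (reduction A \<phi> p) P)
                (residue_map (reduction A \<phi> p) P \<circ> reduction_map A \<phi> p)
                (D Quot p) (quot_map D p)))
      \<and> (power_congruence D p A \<phi> \<longleftrightarrow>
           (\<exists>(F :: 'a set ring) (Y :: 'b set set).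
              subring_of_Fq_power (ideal_norm D p) (reduction A \<phi> p) F Y))
      \<and> (\<forall>(F :: 'f ring) (Y :: 'y set).
           subring_of_Fq_power (ideal_norm D p) (reduction A \<phi> p) F Y \<longrightarrow> power_congruence D p A \<phi>)
      \<and> (power_congruence D p A \<phi> \<longleftrightarrow>
           (\<forall>M. maximalideal M A \<and> lies_over D \<phi> M p \<longrightarrow> unramified_with_residue D p A \<phi> M))
      \<and> (power_congruence D p A \<phi> \<longleftrightarrow>
           (\<forall>P. primeideal P A \<and> lies_over D \<phi> P p \<longrightarrow> unramified_with_residue D p A \<phi> P))
      \<and> (semi_local (reduction A \<phi> p) \<or> noetherian_ring (reduction A \<phi> p) \<longrightarrow>
          (power_congruence D p A \<phi> \<longleftrightarrow>
             (\<exists>Ms. distinct Ms \<and>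
                (\<forall>M\<in>set Ms. maximalideal M A \<and>
                   alg_isomorphic D (A Quot M) (quot_map A M \<circ> \<phi>) (D Quot p) (quot_map D p)) \<and>
                extended_ideal A \<phi> p = ideal_product A Ms))))"
proof (intro conjI allI impI)
  interpret h: ring_hom_cring D A \<phi> by fact
  show "locally_WPC D A \<phi> \<longleftrightarrow> (\<forall>p. t_maximal D p \<and> finite_norm D p \<longrightarrow> power_congruence D p A \<phi>)"
    by (rule h.locally_WPC_iff_power_congruence[OF assms(1)]) (use assms(3) in blast)
next
  fix p assume tm: "t_maximal D p \<and> finite_norm D p"
  interpret D: domain D by fact
  have P: "primeideal p D" using D.t_maximal_prime tm by blast
  interpret finite_residue D A \<phi> p
    by (intro finite_residue.intro finite_residue_axioms.intro assms(2) D.finite_prime_imp_maximal[OF P] conjunct2[OF tm])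
  interpret r: finite_residue D "reduction A \<phi> p" "reduction_map A \<phi> p" p by (rule reduction_finite_residue)
  show "power_congruence D p A \<phi> \<longleftrightarrow> (\<forall>x\<in>carrier (reduction A \<phi> p). x [^]\<^bsub>reduction A \<phi> p\<^esub> ideal_norm D p = x)"
    by (rule power_congruence_iff_reduction)
  \<comment> \<open>The condition speaks only of the reduction, so the congruence is first moved
    there, where the extended ideal is zero.\<close>
  show "power_congruence D p A \<phi> \<longleftrightarrow> locally_isomorphic_to_residue D p (reduction A \<phi> p) (reduction_map A \<phi> p)"
    unfolding power_congruence_iff_reduction_congruence by (rule r.locally_isomorphic_iff[OF reduction_extended_ideal])
  show "power_congruence D p A \<phi> \<longleftrightarrow> reduced_ring (reduction A \<phi> p) \<and>
      (\<forall>P. primeideal P (reduction A \<phi> p) \<longrightarrow>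
        alg_isomorphic D (residue_field (reduction A \<phi> p) P)
          (residue_map (reduction A \<phi> p) P \<circ> reduction_map A \<phi> p) (D Quot p) (quot_map D p))"
    unfolding power_congruence_iff_reduction_congruence by (rule r.reduced_residue_iff[OF reduction_extended_ideal])
  show "power_congruence D p A \<phi> \<longleftrightarrow> (\<exists>(F :: 'a set ring) (Y :: 'b set set).
      subring_of_Fq_power (ideal_norm D p) (reduction A \<phi> p) F Y)"
    using subring_of_Fq_power_if_power_congruence
      power_congruence_if_subring_of_Fq_power[OF r.S.ring_axioms] power_congruence_iff_reduction by blast
  show "power_congruence D p A \<phi>" if "subring_of_Fq_power (ideal_norm D p) (reduction A \<phi> p) F Y"
    for F :: "'f ring" and Y :: "'y set"
    using power_congruence_if_subring_of_Fq_power[OF r.S.ring_axioms that] power_congruence_iff_reduction by blast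
  \<comment> \<open>The congruence gives the condition at every prime, in particular at maximal
    ideals, and the maximal ideals suffice for the way back; the next equivalence uses the same two
    facts.\<close>
  show "power_congruence D p A \<phi> \<longleftrightarrow>
      (\<forall>M. maximalideal M A \<and> lies_over D \<phi> M p \<longrightarrow> unramified_with_residue D p A \<phi> M)"
    using power_congruence_if_unramified unramified_if_power_congruence S.maximalideal_prime by blast
  show "power_congruence D p A \<phi> \<longleftrightarrow>
      (\<forall>P. primeideal P A \<and> lies_over D \<phi> P p \<longrightarrow> unramified_with_residue D p A \<phi> P)"
    using power_congruence_if_unramified unramified_if_power_congruence S.maximalideal_prime by blast
  show "power_congruence D p A \<phi> \<longleftrightarrow> (\<exists>Ms. distinct Ms \<and>
      (\<forall>M\<in>set Ms. maximalideal M A \<and>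
        alg_isomorphic D (A Quot M) (quot_map A M \<circ> \<phi>) (D Quot p) (quot_map D p)) \<and>
      extended_ideal A \<phi> p = ideal_product A Ms)"
    if "semi_local (reduction A \<phi> p) \<or> noetherian_ring (reduction A \<phi> p)"
    by (rule ideal_product_iff[OF that])
qed

end
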